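(* Let $d\ge1$, $\alpha\in(0,2)$, let $\dot W^\alpha$ be a symmetric $\alpha$-stable Lévy white noise on $\mathbb{R}_+\times\mathbb{R}^d$, and consider the stochastic heat equation $$\frac{\partial u}{\partial t}-\sum_{i=1}^d\frac{\partial^2u}{\partial x_i^2}=\dot W^\alpha,\qquad u(0,\cdot)=0,$$ with the fundamental solution $$\rho_{\mathcal{H}}(t,x)=\frac{1}{(4\pi t)^{d/2}}\exp\left(-\frac{|x|^2}{4t}\right)\mathbf{1}_{t>0}.$$ The generalized solution $u_{\text{gen}}$, defined by $\langle u_{\text{gen}},\varphi\rangle:=\langle\dot W^\alpha,\varphi*\check\rho_{\mathcal{H}}\rangle$ for all $\varphi\in\mathcal{D}(\mathbb{R}^{d+1})$, always exists. The mild solution $u_{\text{mild}}$, defined by $u_{\text{mild}}(t,x):=\langle\dot W^\alpha,\rho_{\mathcal{H}}(t-\cdot,x-\cdot)\rangle$, exists if and only if $$\alpha<1+\frac2d.$$ Furthermore, a random field representation $Y$ of the generalized solution exists if and only if $\alpha<1+\frac2d$, and in this case, for almost all $(t,x)\in\mathbb{R}_+\times\mathbb{R}^d$, $$Y_{t,x}=\langle\dot W^\alpha,\rho_{\mathcal{H}}(t-\cdot,x-\cdot)\rangle=u_{\text{mild}}(t,x)\qquad\text{a.s.}$$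
   Context: Put $S=\mathbb{R}_+\times\mathbb{R}^d\subset\mathbb{R}^{d+1}$. $\mathcal{D}(\mathbb{R}^{d+1})$ is the space of (real-valued) $C^\infty$ compactly supported functions on $\mathbb{R}^{d+1}$. For a distribution $\rho$ on $\mathbb{R}^{d+1}$ and $\varphi\in\mathcal{D}(\mathbb{R}^{d+1})$, $(\varphi*\check\rho)(t,x)=\langle\rho,\varphi((t,x)+\cdot)\rangle$, a $C^\infty$ function; for $\rho=\rho_{\mathcal{H}}$ it equals $\int_t^{+\infty}\mathrm{d}s\int_{\mathbb{R}^d}\mathrm{d}y\,\rho_{\mathcal{H}}(s-t,y-x)\varphi(s,y)$. For $\alpha\in(0,2)$, $L^\alpha(S)$ is the set of measurable $f$ with $\int_S|f|^\alpha<\infty$. Symmetric $\alpha$-stable Lévy white noise on $S$: $\dot W^\alpha$ is an independently scattered symmetric $\alpha$-stable random measure on $S$ with $\mathbb{E}(e^{iu\dot W^\alpha(A)})=\exp(-\mathrm{Leb}(A)|u|^\alpha)$, $u\in\mathbb{R}$, for Borel $A\subset S$ of finite Lebesgue measure. A deterministic measurable function $f$ is integrable with respect to $\dot W^\alpha$ iff $f\in L^\alpha(S)$; the integral $\langle\dot W^\alpha,f\rangle$ is a.s. linear in $f$ with $\mathbb{E}(e^{i\langle\dot W^\alpha,f\rangle})=\exp(-\int_S|f|^\alpha)$. "The generalized solution exists" means that $\varphi*\check\rho_{\mathcal{H}}\in L^\alpha(S)$ for all $\varphi\in\mathcal{D}(\mathbb{R}^{d+1})$. "The mild solution exists" means that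 $\rho_{\mathcal{H}}(t-\cdot,x-\cdot)\in L^\alpha(S)$ for all $(t,x)$. A random field representation of a generalized stochastic process $u$ (a linear map $\mathcal{D}(\mathbb{R}^{d+1})\to L^0(\Omega)$) is a jointly measurable random field $(Y_{t,x})_{(t,x)\in\mathbb{R}^{d+1}}$ with almost surely locally integrable sample paths such that, for every $\varphi\in\mathcal{D}(\mathbb{R}^{d+1})$, $\langle u,\varphi\rangle=\int_{\mathbb{R}^{d+1}}Y_{t,x}\varphi(t,x)\,\mathrm{d}t\,\mathrm{d}x$ a.s. *)

theory Defs
  imports "HOL-Probability.Probability"
begin

section \<open>Space-time and test functions\<close>

text \<open>
  A point of space-time \<open>\<real>\<^sup>d\<^sup>+\<^sup>1 = \<real> \<times> \<real>\<^sup>d\<close> is a pair of type \<^typ>\<open>real \<times> (real ^ 'n)\<close>, with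
  \<open>d = CARD('n)\<close>.
\<close>

definition half_space :: "(real \<times> (real ^ 'n::finite)) set" where
  "half_space = {0..} \<times> UNIV"

abbreviation leb_half :: "(real \<times> (real ^ 'n::finite)) measure" where
  "leb_half \<equiv> restrict_space lborel half_space"

text \<open>
  \<open>C\<^sup>k\<close> regularity on the whole space: all partial derivatives along the standard basis exist up
  to order \<open>k\<close> and are continuous.
\<close>

primrec Ck :: "nat \<Rightarrow> ('a::euclidean_space \<Rightarrow> real) \<Rightarrow> bool" where
  "Ck 0 f \<longleftrightarrow> continuous_on UNIV f"
| "Ck (Suc k) f \<longleftrightarrow>
     f differentiable_on UNIV \<and> (\<forall>b\<in>Basis. Ck k (\<lambda>x. frechet_derivative f (at x) b))"

definition test_functions :: "('a::euclidean_space \<Rightarrow> real) set" where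
  "test_functions = {\<phi>. (\<forall>k. Ck k \<phi>) \<and> compact (closure {z. \<phi> z \<noteq> 0})}"

definition pairing :: "('a::euclidean_space \<Rightarrow> real) \<Rightarrow> ('a \<Rightarrow> real) \<Rightarrow> real" where
  "pairing \<rho> \<phi> = (LINT z|lborel. \<rho> z * \<phi> z)"

text \<open>
  \<open>conv_check \<phi> \<rho>\<close> is the convolution of \<open>\<phi>\<close> with the reflection of \<open>\<rho>\<close>, for \<open>\<rho>\<close> a locally
  integrable function identified with the distribution it defines.
\<close>

definition conv_check ::
  "('a::euclidean_space \<Rightarrow> real) \<Rightarrow> ('a \<Rightarrow> real) \<Rightarrow> 'a \<Rightarrow> real" where
  "conv_check \<phi> \<rho> z = pairing \<rho> (\<lambda>w. \<phi> (z + w))"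

definition heat_kernel :: "real \<times> (real ^ 'n::finite) \<Rightarrow> real" where
  "heat_kernel = (\<lambda>(t, x). if t > 0
     then 1 / (4 * pi * t) powr (real CARD('n) / 2) * exp (- (norm x)\<^sup>2 / (4 * t))
     else 0)"

section \<open>Stable white noise and its stochastic integral\<close>

text \<open>Functions live on the whole space-time; only their values on the half-space matter here.\<close>

definition L_space :: "real \<Rightarrow> (real \<times> (real ^ 'n::finite) \<Rightarrow> real) set" where
  "L_space \<alpha> = {f. f \<in> borel_measurable leb_half \<and>
     integrable leb_half (\<lambda>z. \<bar>f z\<bar> powr \<alpha>)}"

definition finite_sets :: "(real \<times> (real ^ 'n::finite)) set set" where
  "finite_sets = {A \<in> sets leb_half. emeasure leb_half A < \<infinity>}"

text \<open>
  Independently scattered symmetric stable random measure on the half-space with Lebesgue control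
  measure. Finite families of disjoint sets are covered by padding with empty sets.
\<close>

definition stable_white_noise ::
  "'w measure \<Rightarrow> real \<Rightarrow> ((real \<times> (real ^ 'n::finite)) set \<Rightarrow> 'w \<Rightarrow> real) \<Rightarrow> bool" where
  "stable_white_noise M \<alpha> W \<longleftrightarrow>
     prob_space M \<and>
     (\<forall>A\<in>finite_sets. W A \<in> borel_measurable M \<and>
        (\<forall>u. char (distr M borel (W A)) u
              = complex_of_real (exp (- measure leb_half A * \<bar>u\<bar> powr \<alpha>)))) \<and>
     (\<forall>A :: nat \<Rightarrow> (real \<times> (real ^ 'n)) set.
        range A \<subseteq> finite_sets \<longrightarrow> disjoint_family A \<longrightarrow>
          prob_space.indep_vars M (\<lambda>_. borel) (\<lambda>i. W (A i)) UNIV \<and>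
          ((\<Union>i. A i) \<in> finite_sets \<longrightarrow>
             (AE \<omega> in M. (\<lambda>i. W (A i) \<omega>) sums W (\<Union>i. A i) \<omega>)))"

text \<open>
  A list of pairs \<open>(c, A)\<close> encodes the simple function given by the sum of the \<open>c\<close>-multiples of the
  indicators of the sets \<open>A\<close>.
\<close>

definition simple_fun :: "(real \<times> 'a set) list \<Rightarrow> 'a \<Rightarrow> real" where
  "simple_fun cs z = (\<Sum>(c, A)\<leftarrow>cs. c * indicator A z)"

definition simple_integral ::
  "('a set \<Rightarrow> 'w \<Rightarrow> real) \<Rightarrow> (real \<times> 'a set) list \<Rightarrow> 'w \<Rightarrow> real" where
  "simple_integral W cs \<omega> = (\<Sum>(c, A)\<leftarrow>cs. c * W A \<omega>)"

text \<open>
  \<open>X\<close> is a version of the integral of \<open>f\<close>: a limit in probability of the integrals of simple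
  functions converging to \<open>f\<close> in \<open>L\<^sup>\<alpha>\<close> of the half-space.
\<close>

definition has_stable_integral ::
  "'w measure \<Rightarrow> real \<Rightarrow> ((real \<times> (real ^ 'n::finite)) set \<Rightarrow> 'w \<Rightarrow> real) \<Rightarrow>
    (real \<times> (real ^ 'n) \<Rightarrow> real) \<Rightarrow> ('w \<Rightarrow> real) \<Rightarrow> bool" where
  "has_stable_integral M \<alpha> W f X \<longleftrightarrow>
     f \<in> L_space \<alpha> \<and> X \<in> borel_measurable M \<and>
     (\<exists>F :: nat \<Rightarrow> (real \<times> (real \<times> (real ^ 'n)) set) list.
        (\<forall>n. snd ` set (F n) \<subseteq> finite_sets) \<and>
        (\<lambda>n. \<integral>\<^sup>+ z. ennreal (\<bar>simple_fun (F n) z - f z\<bar> powr \<alpha>) \<partial>leb_half) \<longlonglongrightarrow> 0 \<and>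
        (\<forall>\<epsilon>>0. (\<lambda>n. measure M {\<omega> \<in> space M. \<bar>simple_integral W (F n) \<omega> - X \<omega>\<bar> > \<epsilon>})
           \<longlonglongrightarrow> 0))"

text \<open>The integral is determined up to almost sure equality; we choose a version.\<close>

definition stable_integral ::
  "'w measure \<Rightarrow> real \<Rightarrow> ((real \<times> (real ^ 'n::finite)) set \<Rightarrow> 'w \<Rightarrow> real) \<Rightarrow>
    (real \<times> (real ^ 'n) \<Rightarrow> real) \<Rightarrow> 'w \<Rightarrow> real" where
  "stable_integral M \<alpha> W f = (SOME X. has_stable_integral M \<alpha> W f X)"

section \<open>Generalized and mild solutions\<close>

definition generalized_solution_exists ::
  "real \<Rightarrow> (real \<times> (real ^ 'n::finite) \<Rightarrow> real) \<Rightarrow> bool" where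
  "generalized_solution_exists \<alpha> \<rho> \<longleftrightarrow> (\<forall>\<phi>\<in>test_functions. conv_check \<phi> \<rho> \<in> L_space \<alpha>)"

definition generalized_solution ::
  "'w measure \<Rightarrow> real \<Rightarrow> ((real \<times> (real ^ 'n::finite)) set \<Rightarrow> 'w \<Rightarrow> real) \<Rightarrow>
    (real \<times> (real ^ 'n) \<Rightarrow> real) \<Rightarrow> (real \<times> (real ^ 'n) \<Rightarrow> real) \<Rightarrow> 'w \<Rightarrow> real" where
  "generalized_solution M \<alpha> W \<rho> \<phi> = stable_integral M \<alpha> W (conv_check \<phi> \<rho>)"

definition mild_solution_exists ::
  "real \<Rightarrow> (real \<times> (real ^ 'n::finite) \<Rightarrow> real) \<Rightarrow> bool" where
  "mild_solution_exists \<alpha> \<rho> \<longleftrightarrow> (\<forall>t x. (\<lambda>(s, y). \<rho> (t - s, x - y)) \<in> L_space \<alpha>)"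

definition mild_solution ::
  "'w measure \<Rightarrow> real \<Rightarrow> ((real \<times> (real ^ 'n::finite)) set \<Rightarrow> 'w \<Rightarrow> real) \<Rightarrow>
    (real \<times> (real ^ 'n) \<Rightarrow> real) \<Rightarrow> real \<times> (real ^ 'n) \<Rightarrow> 'w \<Rightarrow> real" where
  "mild_solution M \<alpha> W \<rho> = (\<lambda>(t, x). stable_integral M \<alpha> W (\<lambda>(s, y). \<rho> (t - s, x - y)))"

text \<open>
  Random variables are functions rather than almost-sure classes, so linearity of a map from test
  functions to \<open>L\<^sup>0(\<Omega>)\<close> is required almost surely for each linear combination.
\<close>

definition generalized_process ::
  "'w measure \<Rightarrow> (('a::euclidean_space \<Rightarrow> real) \<Rightarrow> 'w \<Rightarrow> real) \<Rightarrow> bool" where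
  "generalized_process M u \<longleftrightarrow>
     (\<forall>\<phi>\<in>test_functions. u \<phi> \<in> borel_measurable M) \<and>
     (\<forall>\<phi>\<in>test_functions. \<forall>\<psi>\<in>test_functions. \<forall>a b.
        AE \<omega> in M. u (\<lambda>z. a * \<phi> z + b * \<psi> z) \<omega> = a * u \<phi> \<omega> + b * u \<psi> \<omega>)"

definition random_field_representation ::
  "'w measure \<Rightarrow> (('a::euclidean_space \<Rightarrow> real) \<Rightarrow> 'w \<Rightarrow> real) \<Rightarrow> ('a \<Rightarrow> 'w \<Rightarrow> real) \<Rightarrow> bool" where
  "random_field_representation M u Y \<longleftrightarrow>
     generalized_process M u \<and>
     (\<lambda>(z, \<omega>). Y z \<omega>) \<in> borel_measurable (borel \<Otimes>\<^sub>M M) \<and>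
     (AE \<omega> in M. \<forall>K. compact K \<longrightarrow> set_integrable lborel K (\<lambda>z. Y z \<omega>)) \<and>
     (\<forall>\<phi>\<in>test_functions. AE \<omega> in M. u \<phi> \<omega> = (LINT z|lborel. Y z \<omega> * \<phi> z))"

end

theory Submission
  imports Defs "HOL-Computational_Algebra.Polynomial"
begin

text \<open>
  The identity \<open>1 - exp (- x\<^sup>2 / 2) = E (1 - cos (x N))\<close> for a standard normal \<open>N\<close> turns the
  characteristic function of a stable variable into tail and truncated moment bounds. Together with
  the characteristic function itself they show that stable integrals converge in probability exactly
  when their integrands converge in \<open>L\<^sup>\<alpha>\<close>; so the integral extends from simple functions to all of
  \<open>L\<^sup>\<alpha>\<close>, and the shifted heat kernel lies in \<open>L\<^sup>\<alpha>\<close> exactly when \<open>\<alpha> < 1 + 2 / d\<close> by a Gaussian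
  computation.

  Test a random field representation \<open>Y\<close> against mollifiers at \<open>z\<close>. For almost every \<open>z\<close> the
  resulting integrals converge to \<open>Y z\<close>, hence their integrands are Cauchy in \<open>L\<^sup>\<alpha>\<close>; by Fatou's
  lemma their limit is the kernel shifted to \<open>z\<close>. This forces \<open>\<alpha> < 1 + 2 / d\<close> and identifies \<open>Y z\<close>
  with the mild solution.

  Conversely, choose \<open>q\<close> with \<open>max 1 \<alpha> < q < min 2 (1 + 2 / d)\<close>. After truncation, a bound of von
  Bahr--Esseen type for \<open>q\<close>-th moments controls random fields locally in \<open>L\<^sup>1\<close> by the mixed norm of
  their kernels, \<open>L\<^sup>\<alpha>\<close> in the noise variable with values in local \<open>L\<^sup>q\<close>. The shifted heat kernel has
  finite mixed norm, and the fields of fast approximations by elementary kernels converge almost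
  surely in local \<open>L\<^sup>1\<close> to a representation.
\<close>

lemma abs_powr_mult: "\<bar>a * b\<bar> powr p = \<bar>a\<bar> powr p * \<bar>b\<bar> powr p" for a b p :: real
  by (simp add: abs_mult powr_mult)

lemma powr_add_le:
  fixes a b p :: real
  assumes "0 \<le> a" "0 \<le> b" "0 < p"
  shows "(a + b) powr p \<le> 2 powr p * (a powr p + b powr p)"
proof -
  have "(a + b) powr p \<le> (2 * max a b) powr p"
    using assms by (intro powr_mono2) auto
  also have "\<dots> = 2 powr p * (max a b) powr p"
    using assms by (simp add: powr_mult)
  also have "(max a b) powr p \<le> a powr p + b powr p"
    by (auto simp: max_def)
  finally show ?thesis by simp
qed

lemma abs_add_powr_le:
  fixes a b p :: real
  assumes "0 < p"
  shows "\<bar>a + b\<bar> powr p \<le> 2 powr p * (\<bar>a\<bar> powr p + \<bar>b\<bar> powr p)"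
proof -
  have "\<bar>a + b\<bar> powr p \<le> (\<bar>a\<bar> + \<bar>b\<bar>) powr p"
    using assms by (intro powr_mono2) auto
  with powr_add_le[of "\<bar>a\<bar>" "\<bar>b\<bar>" p] assms show ?thesis by simp
qed

lemma powr_le_one_plus_square:
  fixes x p :: real
  assumes "0 < p" "p \<le> 2"
  shows "\<bar>x\<bar> powr p \<le> 1 + x\<^sup>2"
proof (cases "\<bar>x\<bar> \<le> 1")
  case True
  then have "\<bar>x\<bar> powr p \<le> 1" using assms by (intro powr_le1) auto
  then show ?thesis by (smt (verit) zero_le_power2)
next
  case False
  then have "\<bar>x\<bar> powr p \<le> \<bar>x\<bar> powr 2" using assms by (intro powr_mono) auto
  then show ?thesis using False by (simp add: powr_numeral)
qed

text \<open>This replaces Hoelder's inequality: a bound on the \<open>q\<close>-th power controls the first power up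
  to an arbitrarily small error \<open>\<delta>\<close>.\<close>

lemma abs_le_delta_powr:
  fixes x q \<delta> :: real
  assumes "1 \<le> q" "0 < \<delta>"
  shows "\<bar>x\<bar> \<le> \<delta> + \<delta> powr (1 - q) * \<bar>x\<bar> powr q"
proof (cases "\<bar>x\<bar> \<le> \<delta>")
  case True
  then show ?thesis using assms by (smt (verit) mult_nonneg_nonneg powr_ge_zero)
next
  case False
  have "\<bar>x\<bar> = \<bar>x\<bar> powr q * \<bar>x\<bar> powr (1 - q)"
    using False assms by (simp flip: powr_add)
  also have "\<dots> \<le> \<bar>x\<bar> powr q * \<delta> powr (1 - q)"
    using False assms by (intro mult_left_mono powr_mono2') auto
  finally show ?thesis using assms by (simp add: mult.commute)
qed

lemma exp_half_bounds: "exp (- 1/2 :: real) \<le> 2/3"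
proof -
  have "3/2 \<le> exp (1/2::real)" using exp_ge_add_one_self[of "1/2::real"] by simp
  then have "inverse (exp (1/2::real)) \<le> inverse (3/2)" by (intro le_imp_inverse_le) auto
  then show ?thesis by (simp add: exp_minus)
qed

lemma Re_char_distr:
  assumes "prob_space M" and [measurable]: "X \<in> borel_measurable M"
  shows "Re (char (distr M borel X) t) = (LINT \<omega>|M. cos (t * X \<omega>))"
proof -
  interpret prob_space M by fact
  have "integrable M (\<lambda>\<omega>. iexp (t * X \<omega>))"
    by (rule integrable_iexp) auto
  then have "Re (LINT \<omega>|M. iexp (t * X \<omega>)) = (LINT \<omega>|M. Re (iexp (t * X \<omega>)))"
    by simp
  then show ?thesis by (simp add: char_def integral_distr Re_exp)
qed

lemma integral_cos_normal:
  "(LINT n|std_normal_distribution. cos (x * n)) = exp (- x\<^sup>2 / 2)"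
proof -
  interpret real_distribution std_normal_distribution by (rule real_dist_normal_dist)
  have "(LINT n|std_normal_distribution. cos (x * n))
      = Re (char (distr std_normal_distribution borel (\<lambda>n. n)) x)"
    by (subst Re_char_distr) (auto intro: prob_space_axioms)
  also have "distr std_normal_distribution borel (\<lambda>n. n) = std_normal_distribution"
    by (rule distr_id2) simp
  finally show ?thesis by (simp add: char_std_normal_distribution)
qed

lemma integrable_normal_bounded:
  "(f :: real \<Rightarrow> real) \<in> borel_measurable borel \<Longrightarrow> (\<And>x. \<bar>f x\<bar> \<le> B) \<Longrightarrow>
    integrable std_normal_distribution f"
proof -
  interpret real_distribution std_normal_distribution by (rule real_dist_normal_dist)
  show "f \<in> borel_measurable borel \<Longrightarrow> (\<And>x. \<bar>f x\<bar> \<le> B) \<Longrightarrow> ?thesis"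
    by (intro integrable_const_bound[where B=B]) auto
qed

text \<open>Randomise the argument of the characteristic function by an independent standard normal
  variable, using \<open>1 - exp (- x\<^sup>2 / 2) = E (1 - cos (x N))\<close>.\<close>

lemma stable_gauss_bound:
  fixes X :: "'w \<Rightarrow> real"
  assumes M: "prob_space M" and X[measurable]: "X \<in> borel_measurable M"
    and ch: "\<And>u. char (distr M borel X) u = complex_of_real (exp (- a * \<bar>u\<bar> powr \<alpha>))"
    and a: "0 \<le> a" and \<alpha>: "0 < \<alpha>" "\<alpha> \<le> 2"
  shows "(LINT \<omega>|M. 1 - exp (- (u * X \<omega>)\<^sup>2 / 2)) \<le> 2 * a * \<bar>u\<bar> powr \<alpha>"
proof -
  let ?N = "std_normal_distribution"
  interpret prob_space M by fact
  interpret N: real_distribution ?N by (rule real_dist_normal_dist)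
  interpret P: pair_prob_space M ?N ..
  have N1: "measure ?N UNIV = 1" using N.prob_space by simp
  have meas: "(\<lambda>(\<omega>, n). 1 - cos (u * X \<omega> * n)) \<in> borel_measurable (M \<Otimes>\<^sub>M ?N)"
    by measurable
  have int: "integrable (M \<Otimes>\<^sub>M ?N) (\<lambda>(\<omega>, n). 1 - cos (u * X \<omega> * n))"
    using meas
    by (intro P.integrable_const_bound[where B=2])
       (auto simp: split_beta intro!: AE_I2 abs_leI intro: order.trans[OF _ cos_le_one])
  have "(LINT \<omega>|M. 1 - exp (- (u * X \<omega>)\<^sup>2 / 2)) = (LINT \<omega>|M. LINT n|?N. 1 - cos (u * X \<omega> * n))"
  proof (intro Bochner_Integration.integral_cong refl)
    fix \<omega>
    have "integrable ?N (\<lambda>n. cos (u * X \<omega> * n))"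
      by (rule integrable_normal_bounded[where B=1]) auto
    then have "(LINT n|?N. 1 - cos (u * X \<omega> * n)) = 1 - (LINT n|?N. cos (u * X \<omega> * n))"
      by (subst Bochner_Integration.integral_diff) (auto simp: N1)
    then show "1 - exp (- (u * X \<omega>)\<^sup>2 / 2) = (LINT n|?N. 1 - cos (u * X \<omega> * n))"
      by (simp add: integral_cos_normal)
  qed
  also have "\<dots> = (LINT n|?N. LINT \<omega>|M. 1 - cos (u * X \<omega> * n))"
    using P.Fubini_integral[OF int] by simp
  also have "\<dots> = (LINT n|?N. 1 - exp (- a * \<bar>u * n\<bar> powr \<alpha>))"
  proof (intro Bochner_Integration.integral_cong refl)
    fix n :: real
    have i: "integrable M (\<lambda>\<omega>. cos (u * X \<omega> * n))"
      by (rule integrable_const_bound[where B=1]) auto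
    have "(LINT \<omega>|M. cos (u * X \<omega> * n)) = exp (- a * \<bar>u * n\<bar> powr \<alpha>)"
      using Re_char_distr[OF M X, of "u * n"] ch[of "u * n"]
      by (simp add: mult.assoc mult.commute mult.left_commute)
    then show "(LINT \<omega>|M. 1 - cos (u * X \<omega> * n)) = 1 - exp (- a * \<bar>u * n\<bar> powr \<alpha>)"
      by (subst Bochner_Integration.integral_diff) (use i in \<open>auto simp: prob_space\<close>)
  qed
  also have "\<dots> \<le> (LINT n|?N. a * \<bar>u\<bar> powr \<alpha> * (1 + n\<^sup>2))"
  proof (rule integral_mono)
    show "integrable ?N (\<lambda>n. 1 - exp (- a * \<bar>u * n\<bar> powr \<alpha>))"
      by (rule integrable_normal_bounded[where B=1]) (use a in \<open>auto simp: abs_le_iff\<close>)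
    show "integrable ?N (\<lambda>n. a * \<bar>u\<bar> powr \<alpha> * (1 + n\<^sup>2))"
      using integrable_std_normal_distribution_moment[of 2] by simp
    fix n :: real
    have "1 - exp (- (a * \<bar>u * n\<bar> powr \<alpha>)) \<le> a * \<bar>u * n\<bar> powr \<alpha>"
      using exp_ge_add_one_self[of "- (a * \<bar>u * n\<bar> powr \<alpha>)"] by simp
    also have "\<dots> = a * \<bar>u\<bar> powr \<alpha> * \<bar>n\<bar> powr \<alpha>"
      by (simp add: abs_powr_mult)
    also have "\<dots> \<le> a * \<bar>u\<bar> powr \<alpha> * (1 + n\<^sup>2)"
      using a powr_le_one_plus_square[of \<alpha> n] \<alpha> by (intro mult_left_mono) auto
    finally show "1 - exp (- a * \<bar>u * n\<bar> powr \<alpha>) \<le> a * \<bar>u\<bar> powr \<alpha> * (1 + n\<^sup>2)" by simp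
  qed
  also have "\<dots> = 2 * a * \<bar>u\<bar> powr \<alpha>"
  proof -
    have "(LINT n|?N. n\<^sup>2) = 1"
      using std_normal_distribution_even_moments(1)[of 1] by (simp add: fact_numeral)
    then show ?thesis using integrable_std_normal_distribution_moment[of 2]
      by (simp add: N1)
  qed
  finally show ?thesis .
qed

lemma min_powr_le_dyadic:
  fixes x q :: real
  assumes q: "0 < q" "q \<le> 2"
  shows "\<exists>k::nat. min 1 (\<bar>x\<bar> powr q) \<le> 12 * (2 powr (- q * k) * (1 - exp (- (2 ^ k * x)\<^sup>2 / 2)))"
proof -
  have large: "1/3 \<le> 1 - exp (- y\<^sup>2 / 2)" if "1 \<le> \<bar>y\<bar>" for y :: real
  proof -
    have "1 \<le> y\<^sup>2" using that by (metis one_le_power power2_abs)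
    then have "exp (- y\<^sup>2 / 2) \<le> exp (- 1/2)" by simp
    with exp_half_bounds show ?thesis by linarith
  qed
  consider "x = 0" | "1 \<le> \<bar>x\<bar>" | "x \<noteq> 0" "\<bar>x\<bar> < 1" by linarith
  then show ?thesis
  proof cases
    case 1
    then show ?thesis using q by (intro exI[of _ 0]) simp
  next
    case 2
    with large[of x] show ?thesis by (intro exI[of _ 0]) auto
  next
    case 3
    define k where "k = (LEAST k::nat. 1 \<le> 2 ^ k * \<bar>x\<bar>)"
    have ex: "\<exists>k::nat. 1 \<le> 2 ^ k * \<bar>x\<bar>"
    proof -
      obtain k :: nat where "1 / \<bar>x\<bar> < 2 ^ k" using real_arch_pow[of 2 "1 / \<bar>x\<bar>"] by auto
      then show ?thesis using 3 by (intro exI[of _ k]) (simp add: field_simps)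
    qed
    have k1: "1 \<le> 2 ^ k * \<bar>x\<bar>" unfolding k_def using ex by (rule LeastI_ex)
    then have "k \<noteq> 0" using 3 by (cases k) auto
    then obtain j where j: "k = Suc j" by (cases k) auto
    have "\<not> 1 \<le> 2 ^ j * \<bar>x\<bar>" using not_less_Least[of j "\<lambda>k. 1 \<le> 2 ^ k * \<bar>x\<bar>"] j
      by (simp add: k_def)
    then have "2 ^ k * \<bar>x\<bar> \<le> 2" by (simp add: j)
    then have "\<bar>x\<bar> \<le> 2 powr (1 - real k)"
      by (simp add: powr_diff powr_realpow field_simps)
    then have "\<bar>x\<bar> powr q \<le> (2 powr (1 - real k)) powr q" using q by (intro powr_mono2) auto
    also have "\<dots> = 2 powr q * 2 powr (- q * k)"
      by (simp add: powr_powr algebra_simps flip: powr_add)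
    also have "\<dots> \<le> 2 powr 2 * 2 powr (- q * k)"
      using q by (intro mult_right_mono powr_mono) auto
    also have "\<dots> = 12 * (2 powr (- q * k) * (1/3))" by simp
    also have "\<dots> \<le> 12 * (2 powr (- q * k) * (1 - exp (- (2 ^ k * x)\<^sup>2 / 2)))"
      using large[of "2 ^ k * x"] k1 by (intro mult_left_mono) (auto simp: abs_mult)
    finally show ?thesis by (intro exI[of _ k]) auto
  qed
qed

definition stable_tail_const :: "real \<Rightarrow> real \<Rightarrow> real" where
  "stable_tail_const \<alpha> q = 24 * (\<Sum>k. (2 powr (\<alpha> - q)) ^ k)"

lemma stable_tail_const_nonneg: "\<alpha> < q \<Longrightarrow> 0 \<le> stable_tail_const \<alpha> q"
  unfolding stable_tail_const_def by (intro mult_nonneg_nonneg suminf_nonneg summable_geometric)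
    (auto simp: powr_less_one)

lemma stable_tail:
  fixes X :: "'w \<Rightarrow> real"
  assumes M: "prob_space M" and X[measurable]: "X \<in> borel_measurable M"
    and ch: "\<And>u. char (distr M borel X) u = complex_of_real (exp (- a * \<bar>u\<bar> powr \<alpha>))"
    and a: "0 \<le> a" and \<alpha>: "0 < \<alpha>" "\<alpha> < q" "q \<le> 2"
  shows "(\<integral>\<^sup>+\<omega>. ennreal (min 1 (\<bar>b * X \<omega>\<bar> powr q)) \<partial>M)
    \<le> ennreal (stable_tail_const \<alpha> q * a * \<bar>b\<bar> powr \<alpha>)"
proof -
  interpret prob_space M by fact
  define g where "g k x = 12 * (2 powr (- q * real k) * (1 - exp (- (2 ^ k * x)\<^sup>2 / 2)))"
    for k :: nat and x :: real
  have [measurable]: "g k \<in> borel_measurable borel" for k unfolding g_def by measurable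
  have geo: "(\<lambda>k. (2 powr (\<alpha> - q)) ^ k) sums (\<Sum>k. (2 powr (\<alpha> - q)) ^ k)"
    using \<alpha> by (intro summable_sums summable_geometric) (auto simp: powr_less_one)
  have term_le: "(\<integral>\<^sup>+\<omega>. ennreal (g k (b * X \<omega>)) \<partial>M)
      \<le> ennreal (24 * a * \<bar>b\<bar> powr \<alpha> * (2 powr (\<alpha> - q)) ^ k)" for k
  proof -
    have int: "integrable M (\<lambda>\<omega>. 1 - exp (- (2 ^ k * b * X \<omega>)\<^sup>2 / 2))"
      by (rule integrable_const_bound[where B=1]) auto
    have "(\<integral>\<^sup>+\<omega>. ennreal (g k (b * X \<omega>)) \<partial>M)
      = ennreal (12 * 2 powr (- q * real k) * (LINT \<omega>|M. 1 - exp (- (2 ^ k * b * X \<omega>)\<^sup>2 / 2)))"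
      using int unfolding g_def
      by (subst nn_integral_eq_integral) (auto simp: mult.assoc)
    also have "\<dots> \<le> ennreal (12 * 2 powr (- q * real k) * (2 * a * \<bar>2 ^ k * b\<bar> powr \<alpha>))"
      using stable_gauss_bound[OF M X ch a, of "2 ^ k * b"] \<alpha>
      by (intro ennreal_leI mult_left_mono) auto
    also have "12 * 2 powr (- q * real k) * (2 * a * \<bar>2 ^ k * b\<bar> powr \<alpha>)
      = 24 * a * \<bar>b\<bar> powr \<alpha> * (2 powr (\<alpha> - q)) ^ k"
    proof -
      have "\<bar>2 ^ k * b\<bar> powr \<alpha> = 2 powr (\<alpha> * k) * \<bar>b\<bar> powr \<alpha>"
        by (simp add: abs_powr_mult powr_powr mult.commute flip: powr_realpow)
      moreover have "2 powr (- q * real k) * 2 powr (\<alpha> * k) = (2 powr (\<alpha> - q)) ^ k"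
        by (simp add: powr_power algebra_simps flip: powr_add)
      ultimately show ?thesis by (simp add: mult_ac)
    qed
    finally show ?thesis .
  qed
  have "(\<integral>\<^sup>+\<omega>. ennreal (min 1 (\<bar>b * X \<omega>\<bar> powr q)) \<partial>M)
      \<le> (\<integral>\<^sup>+\<omega>. (\<Sum>k. ennreal (g k (b * X \<omega>))) \<partial>M)"
  proof (rule nn_integral_mono)
    fix \<omega>
    obtain k :: nat where "min 1 (\<bar>b * X \<omega>\<bar> powr q) \<le> g k (b * X \<omega>)"
      using min_powr_le_dyadic[of q "b * X \<omega>"] \<alpha> unfolding g_def by auto
    then have "ennreal (min 1 (\<bar>b * X \<omega>\<bar> powr q)) \<le> (\<Sum>k\<in>{k}. ennreal (g k (b * X \<omega>)))"
      by (simp add: ennreal_leI)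
    also have "\<dots> \<le> (\<Sum>k. ennreal (g k (b * X \<omega>)))"
      by (rule sum_le_suminf) auto
    finally show "ennreal (min 1 (\<bar>b * X \<omega>\<bar> powr q)) \<le> (\<Sum>k. ennreal (g k (b * X \<omega>)))" .
  qed
  also have "\<dots> = (\<Sum>k. \<integral>\<^sup>+\<omega>. ennreal (g k (b * X \<omega>)) \<partial>M)"
    by (rule nn_integral_suminf) simp
  also have "\<dots> \<le> (\<Sum>k. ennreal (24 * a * \<bar>b\<bar> powr \<alpha> * (2 powr (\<alpha> - q)) ^ k))"
    by (intro suminf_le term_le) auto
  also have "\<dots> = ennreal (24 * a * \<bar>b\<bar> powr \<alpha> * (\<Sum>k. (2 powr (\<alpha> - q)) ^ k))"
    using a sums_mult[OF geo, of "24 * a * \<bar>b\<bar> powr \<alpha>"]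
    by (intro suminf_ennreal_eq) auto
  finally show ?thesis by (simp add: stable_tail_const_def mult_ac)
qed

section \<open>Convergence in probability\<close>

definition prob_dist :: "'w measure \<Rightarrow> ('w \<Rightarrow> real) \<Rightarrow> ennreal" where
  "prob_dist M X = (\<integral>\<^sup>+\<omega>. ennreal (min 1 \<bar>X \<omega>\<bar>) \<partial>M)"

lemma prob_dist_triangle:
  assumes [measurable]: "X \<in> borel_measurable M" "Y \<in> borel_measurable M"
  shows "prob_dist M (\<lambda>\<omega>. X \<omega> + Y \<omega>) \<le> prob_dist M X + prob_dist M Y"
proof -
  have "prob_dist M (\<lambda>\<omega>. X \<omega> + Y \<omega>)
      \<le> (\<integral>\<^sup>+\<omega>. ennreal (min 1 \<bar>X \<omega>\<bar>) + ennreal (min 1 \<bar>Y \<omega>\<bar>) \<partial>M)"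
    unfolding prob_dist_def
    by (intro nn_integral_mono) (auto simp flip: ennreal_plus intro!: ennreal_leI)
  also have "\<dots> = prob_dist M X + prob_dist M Y"
    unfolding prob_dist_def by (intro nn_integral_add) auto
  finally show ?thesis .
qed

lemma prob_dist_minus: "prob_dist M (\<lambda>\<omega>. - X \<omega>) = prob_dist M X"
  by (simp add: prob_dist_def)

lemma prob_dist_scale:
  assumes [measurable]: "X \<in> borel_measurable M"
  shows "prob_dist M (\<lambda>\<omega>. c * X \<omega>) \<le> ennreal (1 + \<bar>c\<bar>) * prob_dist M X"
proof -
  have "prob_dist M (\<lambda>\<omega>. c * X \<omega>) \<le> (\<integral>\<^sup>+\<omega>. ennreal (1 + \<bar>c\<bar>) * ennreal (min 1 \<bar>X \<omega>\<bar>) \<partial>M)"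
    unfolding prob_dist_def
  proof (intro nn_integral_mono)
    fix \<omega>
    have "min 1 \<bar>c * X \<omega>\<bar> \<le> (1 + \<bar>c\<bar>) * min 1 \<bar>X \<omega>\<bar>"
    proof (cases "1 \<le> \<bar>X \<omega>\<bar>")
      case False
      have "min 1 \<bar>c * X \<omega>\<bar> \<le> \<bar>c\<bar> * \<bar>X \<omega>\<bar>" by (simp add: abs_mult)
      also have "\<dots> \<le> (1 + \<bar>c\<bar>) * \<bar>X \<omega>\<bar>" by (intro mult_right_mono) auto
      finally show ?thesis using False by (simp add: min_def)
    qed auto
    then show "ennreal (min 1 \<bar>c * X \<omega>\<bar>) \<le> ennreal (1 + \<bar>c\<bar>) * ennreal (min 1 \<bar>X \<omega>\<bar>)"
      by (subst ennreal_mult[symmetric]) (auto intro: ennreal_leI)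
  qed
  also have "\<dots> = ennreal (1 + \<bar>c\<bar>) * prob_dist M X"
    unfolding prob_dist_def by (intro nn_integral_cmult) auto
  finally show ?thesis .
qed

lemma prob_dist_eq_0:
  assumes [measurable]: "X \<in> borel_measurable M" and "prob_dist M X = 0"
  shows "AE \<omega> in M. X \<omega> = 0"
proof -
  have "AE \<omega> in M. ennreal (min 1 \<bar>X \<omega>\<bar>) = 0"
    using assms(2) unfolding prob_dist_def by (subst (asm) nn_integral_0_iff_AE) auto
  then show ?thesis by eventually_elim (auto simp: min_def ennreal_eq_0_iff split: if_splits)
qed

lemma prob_dist_tendsto_iff:
  assumes "prob_space M" and [measurable]: "\<And>n. X n \<in> borel_measurable M"
  shows "(\<lambda>n. prob_dist M (X n)) \<longlonglongrightarrow> 0 \<longleftrightarrow>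
    (\<forall>\<epsilon>>0. (\<lambda>n. measure M {\<omega> \<in> space M. \<bar>X n \<omega>\<bar> > \<epsilon>}) \<longlonglongrightarrow> 0)"
proof -
  interpret prob_space M by fact
  have upper: "prob_dist M (X n) \<le> ennreal (\<epsilon> + measure M {\<omega> \<in> space M. \<bar>X n \<omega>\<bar> > \<epsilon>})"
    if "0 < \<epsilon>" for \<epsilon> n
  proof -
    let ?A = "{\<omega> \<in> space M. \<bar>X n \<omega>\<bar> > \<epsilon>}"
    have "prob_dist M (X n) \<le> (\<integral>\<^sup>+\<omega>. ennreal \<epsilon> + indicator ?A \<omega> \<partial>M)"
      unfolding prob_dist_def
    proof (intro nn_integral_mono)
      fix \<omega> assume "\<omega> \<in> space M"
      show "ennreal (min 1 \<bar>X n \<omega>\<bar>) \<le> ennreal \<epsilon> + indicator ?A \<omega>"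
      proof (cases "\<bar>X n \<omega>\<bar> > \<epsilon>")
        case True
        have "ennreal (min 1 \<bar>X n \<omega>\<bar>) \<le> 1" by (simp add: ennreal_le_1)
        also have "1 \<le> ennreal \<epsilon> + 1" by (rule add_increasing) auto
        finally show ?thesis using True \<open>\<omega> \<in> space M\<close> by simp
      qed (auto simp: min.coboundedI2 intro!: ennreal_leI)
    qed
    also have "\<dots> = ennreal \<epsilon> + emeasure M ?A"
      by (subst nn_integral_add) (auto simp: emeasure_space_1)
    also have "\<dots> = ennreal (\<epsilon> + measure M ?A)"
      using that by (simp add: emeasure_eq_measure)
    finally show ?thesis .
  qed
  have lower: "ennreal (min 1 \<epsilon> * measure M {\<omega> \<in> space M. \<bar>X n \<omega>\<bar> > \<epsilon>}) \<le> prob_dist M (X n)"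
    if "0 < \<epsilon>" for \<epsilon> n
  proof -
    let ?A = "{\<omega> \<in> space M. \<bar>X n \<omega>\<bar> > \<epsilon>}"
    have "ennreal (min 1 \<epsilon> * measure M ?A) = ennreal (min 1 \<epsilon>) * emeasure M ?A"
      using that by (simp add: emeasure_eq_measure ennreal_mult)
    also have "\<dots> = (\<integral>\<^sup>+\<omega>. ennreal (min 1 \<epsilon>) * indicator ?A \<omega> \<partial>M)"
      by (subst nn_integral_cmult_indicator) auto
    also have "\<dots> \<le> prob_dist M (X n)"
      unfolding prob_dist_def by (intro nn_integral_mono) (auto simp: indicator_def intro!: ennreal_leI)
    finally show ?thesis .
  qed
  show ?thesis
  proof (intro iffI allI impI)
    fix \<epsilon> :: real assume L: "(\<lambda>n. prob_dist M (X n)) \<longlonglongrightarrow> 0" and "0 < \<epsilon>"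
    have "(\<lambda>n. ennreal (min 1 \<epsilon> * measure M {\<omega> \<in> space M. \<bar>X n \<omega>\<bar> > \<epsilon>})) \<longlonglongrightarrow> 0"
      by (rule tendsto_sandwich[OF _ _ tendsto_const L]) (use lower[OF \<open>0 < \<epsilon>\<close>] in auto)
    then have "(\<lambda>n. min 1 \<epsilon> * measure M {\<omega> \<in> space M. \<bar>X n \<omega>\<bar> > \<epsilon>}) \<longlonglongrightarrow> 0"
      using \<open>0 < \<epsilon>\<close> by (subst (asm) tendsto_ennreal_iff[where x=0, simplified]) auto
    from tendsto_mult_left[OF this, of "1 / min 1 \<epsilon>"]
    show "(\<lambda>n. measure M {\<omega> \<in> space M. \<bar>X n \<omega>\<bar> > \<epsilon>}) \<longlonglongrightarrow> 0"
      using \<open>0 < \<epsilon>\<close> by (auto simp: min_def split: if_splits)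
  next
    assume R: "\<forall>\<epsilon>>0. (\<lambda>n. measure M {\<omega> \<in> space M. \<bar>X n \<omega>\<bar> > \<epsilon>}) \<longlonglongrightarrow> 0"
    show "(\<lambda>n. prob_dist M (X n)) \<longlonglongrightarrow> 0"
    proof (rule order_tendstoI)
      fix e :: ennreal assume "0 < e"
      obtain r where r: "0 < r" "ennreal r < e"
      proof (cases e)
        case (real e')
        with \<open>0 < e\<close> that[of "e' / 2"] show ?thesis by (auto simp: ennreal_less_iff)
      next
        case top
        with that[of 1] show ?thesis by auto
      qed
      have "eventually (\<lambda>n. measure M {\<omega> \<in> space M. \<bar>X n \<omega>\<bar> > r / 2} < r / 2) sequentially"
        using order_tendstoD(2)[OF R[rule_format, of "r / 2"], of "r / 2"] r(1) by simp
      then show "eventually (\<lambda>n. prob_dist M (X n) < e) sequentially"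
      proof eventually_elim
        case (elim n)
        have "prob_dist M (X n) \<le> ennreal (r / 2 + measure M {\<omega> \<in> space M. \<bar>X n \<omega>\<bar> > r / 2})"
          using upper[of "r / 2" n] r by simp
        also have "\<dots> \<le> ennreal r" using elim by (intro ennreal_leI) auto
        finally show ?case using r by simp
      qed
    qed auto
  qed
qed

lemma prob_dist_tendsto_AE:
  assumes "prob_space M" and [measurable]: "\<And>n. X n \<in> borel_measurable M"
    and "AE \<omega> in M. (\<lambda>n. X n \<omega>) \<longlonglongrightarrow> 0"
  shows "(\<lambda>n. prob_dist M (X n)) \<longlonglongrightarrow> 0"
proof -
  interpret prob_space M by fact
  have "(\<lambda>n. \<integral>\<^sup>+\<omega>. ennreal (min 1 \<bar>X n \<omega>\<bar>) \<partial>M) \<longlonglongrightarrow> (\<integral>\<^sup>+\<omega>. 0 \<partial>M)"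
  proof (rule nn_integral_dominated_convergence[where w="\<lambda>_. 1"])
    show "AE \<omega> in M. (\<lambda>n. ennreal (min 1 \<bar>X n \<omega>\<bar>)) \<longlonglongrightarrow> 0"
      using assms(3)
    proof eventually_elim
      case (elim \<omega>)
      have "(\<lambda>n. min 1 \<bar>X n \<omega>\<bar>) \<longlonglongrightarrow> min 1 \<bar>0\<bar>"
        by (intro tendsto_min tendsto_const tendsto_rabs elim)
      then show ?case by (simp add: tendsto_ennrealI[where x=0, simplified])
    qed
  qed (auto simp: emeasure_space_1)
  then show ?thesis by (simp add: prob_dist_def)
qed

lemma AE_summable_of_prob_dist:
  assumes [measurable]: "\<And>n::nat. X n \<in> borel_measurable M"
    and fin: "(\<Sum>n. prob_dist M (X n)) < \<infinity>"
  shows "AE \<omega> in M. summable (\<lambda>n. \<bar>X n \<omega>\<bar>)"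
proof -
  have "(\<integral>\<^sup>+\<omega>. (\<Sum>n. ennreal (min 1 \<bar>X n \<omega>\<bar>)) \<partial>M) \<noteq> \<infinity>"
    using fin by (subst nn_integral_suminf) (auto simp: prob_dist_def)
  then have "AE \<omega> in M. (\<Sum>n. ennreal (min 1 \<bar>X n \<omega>\<bar>)) \<noteq> \<infinity>"
    by (intro nn_integral_PInf_AE) auto
  then show ?thesis
  proof eventually_elim
    case (elim \<omega>)
    then have s: "summable (\<lambda>n. min 1 \<bar>X n \<omega>\<bar>)"
      by (intro summable_suminf_not_top) auto
    have "eventually (\<lambda>n. min 1 \<bar>X n \<omega>\<bar> < 1) sequentially"
      using summable_LIMSEQ_zero[OF s] by (rule order_tendstoD(2)) simp
    then have "eventually (\<lambda>n. norm \<bar>X n \<omega>\<bar> \<le> min 1 \<bar>X n \<omega>\<bar>) sequentially"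
      by eventually_elim (auto simp: min_def split: if_splits)
    then show ?case by (rule summable_comparison_test_ev) (rule s)
  qed
qed

section \<open>The stable stochastic integral\<close>

lemma sum_list_index_swap:
  fixes x :: "nat \<Rightarrow> real"
  assumes "\<forall>(c, A)\<in>set cs. I A \<subseteq> {..<n} \<and> y A = (\<Sum>i\<in>I A. x i)"
  shows "(\<Sum>(c, A)\<leftarrow>cs. c * y A)
    = (\<Sum>i<n. (\<Sum>(c, A)\<leftarrow>cs. if i \<in> I A then c else 0) * x i)"
  using assms
proof (induction cs)
  case Nil
  then show ?case by simp
next
  case (Cons p cs)
  obtain c A where p: "p = (c, A)" by (cases p)
  have "(\<Sum>i\<in>I A. x i) = (\<Sum>i<n. if i \<in> I A then x i else 0)"
    using Cons.prems p by (subst sum.inter_restrict[symmetric]) (auto intro!: sum.cong)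
  then have "c * y A = (\<Sum>i<n. (if i \<in> I A then c else 0) * x i)"
    using Cons.prems p by (auto simp: sum_distrib_left intro!: sum.cong)
  with Cons p show ?case by (simp add: sum.distrib ring_distribs)
qed

lemma disjoint_family_sum_indicator:
  fixes c :: "nat \<Rightarrow> real" and h :: "real \<Rightarrow> real"
  assumes B: "disjoint_family B" and h: "h 0 = 0"
  shows "h (\<Sum>i<n. c i * indicator (B i) z) = (\<Sum>i<n. h (c i) * indicator (B i) z)"
proof (cases "\<exists>i<n. z \<in> B i")
  case True
  then obtain i where i: "i < n" "z \<in> B i" by auto
  have *: "indicator (B j) z = (if j = i then 1 else 0 :: real)" for j
    using B i by (auto simp: disjoint_family_on_def indicator_def)
  show ?thesis using i by (simp add: * if_distrib sum.delta cong: if_cong)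
next
  case False
  then show ?thesis using h by (simp add: indicator_def)
qed

definition L_modular :: "real \<Rightarrow> (real \<times> (real ^ 'n::finite) \<Rightarrow> real) \<Rightarrow> ennreal" where
  "L_modular \<alpha> f = (\<integral>\<^sup>+z. ennreal (\<bar>f z\<bar> powr \<alpha>) \<partial>leb_half)"

lemma finite_sets_measurable: "A \<in> finite_sets \<Longrightarrow> A \<in> sets leb_half"
  by (simp add: finite_sets_def)

lemma sets_Collect_space: "A \<in> sets N \<Longrightarrow> {z \<in> space N. z \<in> A} \<in> sets N"
  using sets.Int[of "space N" N A] by (simp add: Int_def)

lemma finite_sets_emeasure: "A \<in> finite_sets \<Longrightarrow> emeasure leb_half A < \<infinity>"
  by (simp add: finite_sets_def)

lemma finite_sets_subset:
  "A \<in> finite_sets \<Longrightarrow> B \<subseteq> A \<Longrightarrow> B \<in> sets leb_half \<Longrightarrow> B \<in> finite_sets"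
  unfolding finite_sets_def by (auto intro: le_less_trans[OF emeasure_mono])

lemma finite_sets_empty: "{} \<in> finite_sets"
  by (simp add: finite_sets_def)

lemma finite_sets_UN:
  assumes "finite I" "\<And>i. i \<in> I \<Longrightarrow> A i \<in> finite_sets"
  shows "(\<Union>i\<in>I. A i) \<in> finite_sets"
  using assms
proof (induction I)
  case (insert i I)
  have "emeasure leb_half (A i \<union> (\<Union>i\<in>I. A i))
      \<le> emeasure leb_half (A i) + emeasure leb_half (\<Union>i\<in>I. A i)"
    using insert by (intro emeasure_subadditive) (auto simp: finite_sets_def)
  also have "\<dots> < \<infinity>" using insert by (auto simp: finite_sets_def)
  finally show ?case using insert by (auto simp: finite_sets_def)
qed (simp add: finite_sets_empty)

lemma L_modular_add:
  assumes [measurable]: "f \<in> borel_measurable leb_half" "g \<in> borel_measurable leb_half" and "0 < \<alpha>"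
  shows "L_modular \<alpha> (\<lambda>z. f z + g z) \<le> ennreal (2 powr \<alpha>) * (L_modular \<alpha> f + L_modular \<alpha> g)"
proof -
  have "L_modular \<alpha> (\<lambda>z. f z + g z)
      \<le> (\<integral>\<^sup>+z. ennreal (2 powr \<alpha>) * (ennreal (\<bar>f z\<bar> powr \<alpha>) + ennreal (\<bar>g z\<bar> powr \<alpha>)) \<partial>leb_half)"
    unfolding L_modular_def
  proof (intro nn_integral_mono)
    fix z
    have "ennreal (\<bar>f z + g z\<bar> powr \<alpha>) \<le> ennreal (2 powr \<alpha> * (\<bar>f z\<bar> powr \<alpha> + \<bar>g z\<bar> powr \<alpha>))"
      using abs_add_powr_le[OF \<open>0 < \<alpha>\<close>] by (rule ennreal_leI)
    then show "ennreal (\<bar>f z + g z\<bar> powr \<alpha>)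
        \<le> ennreal (2 powr \<alpha>) * (ennreal (\<bar>f z\<bar> powr \<alpha>) + ennreal (\<bar>g z\<bar> powr \<alpha>))"
      by (simp add: ennreal_mult)
  qed
  also have "\<dots> = ennreal (2 powr \<alpha>) * (L_modular \<alpha> f + L_modular \<alpha> g)"
    unfolding L_modular_def by (simp add: nn_integral_cmult nn_integral_add)
  finally show ?thesis .
qed

lemma L_modular_minus: "L_modular \<alpha> (\<lambda>z. - f z) = L_modular \<alpha> f"
  by (simp add: L_modular_def)

lemma L_modular_minus_commute: "L_modular \<alpha> (\<lambda>z. f z - g z) = L_modular \<alpha> (\<lambda>z. g z - f z)"
  by (simp add: L_modular_def abs_minus_commute)

lemma L_modular_diff_triangle:
  assumes [measurable]: "f \<in> borel_measurable leb_half" "g \<in> borel_measurable leb_half"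
    "h \<in> borel_measurable leb_half" and "0 < \<alpha>"
  shows "L_modular \<alpha> (\<lambda>z. f z - g z)
    \<le> ennreal (2 powr \<alpha>) * (L_modular \<alpha> (\<lambda>z. f z - h z) + L_modular \<alpha> (\<lambda>z. g z - h z))"
  using L_modular_add[of "\<lambda>z. f z - h z" "\<lambda>z. h z - g z" \<alpha>] \<open>0 < \<alpha>\<close>
  by (simp add: L_modular_minus_commute[of \<alpha> h])

lemma L_modular_scale:
  assumes [measurable]: "f \<in> borel_measurable leb_half"
  shows "L_modular \<alpha> (\<lambda>z. c * f z) = ennreal (\<bar>c\<bar> powr \<alpha>) * L_modular \<alpha> f"
  unfolding L_modular_def
  by (subst nn_integral_cmult[symmetric]) (auto simp: abs_powr_mult ennreal_mult)

lemma L_space_iff: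
  "f \<in> L_space \<alpha> \<longleftrightarrow> f \<in> borel_measurable leb_half \<and> L_modular \<alpha> f < \<infinity>"
  unfolding L_space_def L_modular_def by (auto simp: integrable_iff_bounded)

lemma simple_fun_measurable:
  assumes "snd ` set cs \<subseteq> finite_sets"
  shows "simple_fun cs \<in> borel_measurable leb_half"
  using assms
proof (induction cs)
  case Nil
  then show ?case by (simp add: simple_fun_def)
next
  case (Cons p cs)
  obtain c A where p: "p = (c, A)" by (cases p)
  have [measurable]: "A \<in> sets leb_half" "(\<lambda>z. simple_fun cs z) \<in> borel_measurable leb_half"
    using Cons p by (auto simp: finite_sets_measurable)
  have "simple_fun (p # cs) = (\<lambda>z. c * indicator A z + simple_fun cs z)"
    by (auto simp: simple_fun_def p)
  then show ?case by simp
qed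

lemma simple_fun_append: "simple_fun (cs @ ds) z = simple_fun cs z + simple_fun ds z"
  by (simp add: simple_fun_def)

lemma simple_integral_append:
  "simple_integral W (cs @ ds) \<omega> = simple_integral W cs \<omega> + simple_integral W ds \<omega>"
  by (simp add: simple_integral_def)

definition scale_list :: "real \<Rightarrow> (real \<times> 'a) list \<Rightarrow> (real \<times> 'a) list" where
  "scale_list a cs = map (\<lambda>(c, A). (a * c, A)) cs"

lemma scale_list_sets: "snd ` set (scale_list a cs) = snd ` set cs"
  by (force simp: scale_list_def)

lemma simple_fun_scale: "simple_fun (scale_list a cs) z = a * simple_fun cs z"
  by (induction cs) (auto simp: simple_fun_def scale_list_def algebra_simps)

lemma simple_integral_scale: "simple_integral W (scale_list a cs) \<omega> = a * simple_integral W cs \<omega>"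
  by (induction cs) (auto simp: simple_integral_def scale_list_def algebra_simps)

locale stable_noise =
  fixes M :: "'w measure" and \<alpha> :: real and W :: "(real \<times> (real ^ 'n::finite)) set \<Rightarrow> 'w \<Rightarrow> real"
  assumes \<alpha>_pos: "0 < \<alpha>" and \<alpha>_less: "\<alpha> < 2" and noise: "stable_white_noise M \<alpha> W"
begin

sublocale prob_space M
  using noise by (simp add: stable_white_noise_def)

lemma W_measurable: "A \<in> finite_sets \<Longrightarrow> W A \<in> borel_measurable M"
  using noise by (simp add: stable_white_noise_def)

lemma W_char: "A \<in> finite_sets \<Longrightarrow>
    char (distr M borel (W A)) u = complex_of_real (exp (- measure leb_half A * \<bar>u\<bar> powr \<alpha>))"
  using noise by (simp add: stable_white_noise_def)

lemma W_indep:
  "range A \<subseteq> finite_sets \<Longrightarrow> disjoint_family A \<Longrightarrow> indep_vars (\<lambda>_. borel) (\<lambda>i::nat. W (A i)) UNIV"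
  using noise by (simp add: stable_white_noise_def)

lemma W_sums:
  "range A \<subseteq> finite_sets \<Longrightarrow> disjoint_family A \<Longrightarrow> (\<Union>i::nat. A i) \<in> finite_sets \<Longrightarrow>
    AE \<omega> in M. (\<lambda>i. W (A i) \<omega>) sums W (\<Union>i. A i) \<omega>"
  using noise by (simp add: stable_white_noise_def)

lemma W_empty: "AE \<omega> in M. W {} \<omega> = 0"
proof -
  have "AE \<omega> in M. (\<lambda>i::nat. W {} \<omega>) sums W {} \<omega>"
    using W_sums[of "\<lambda>_. {}"] by (simp add: finite_sets_empty disjoint_family_on_def)
  then show ?thesis by eventually_elim (auto dest: sums_summable simp: summable_const_iff)
qed

lemma W_finite_additive:
  assumes B: "range B \<subseteq> finite_sets" "disjoint_family B" and I: "finite (I :: nat set)"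
  shows "AE \<omega> in M. W (\<Union>i\<in>I. B i) \<omega> = (\<Sum>i\<in>I. W (B i) \<omega>)"
proof -
  define C where "C i = (if i \<in> I then B i else {})" for i
  have "range C \<subseteq> finite_sets" "disjoint_family C" "(\<Union>i. C i) = (\<Union>i\<in>I. B i)"
    using B by (auto simp: C_def disjoint_family_on_def finite_sets_empty split: if_splits)
  moreover have "(\<Union>i\<in>I. B i) \<in> finite_sets"
    using B I by (intro finite_sets_UN) auto
  ultimately have "AE \<omega> in M. (\<lambda>i. W (C i) \<omega>) sums W (\<Union>i\<in>I. B i) \<omega>"
    using W_sums[of C] by simp
  with W_empty show ?thesis
  proof eventually_elim
    case (elim \<omega>)
    have "(\<lambda>i. W (C i) \<omega>) sums (\<Sum>i\<in>I. W (C i) \<omega>)"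
      using elim(1) by (intro sums_finite I) (auto simp: C_def)
    with elim(2) have "W (\<Union>i\<in>I. B i) \<omega> = (\<Sum>i\<in>I. W (C i) \<omega>)" by (rule sums_unique2)
    then show ?case by (simp add: C_def)
  qed
qed

lemma refinement:
  assumes "finite \<A>" "\<A> \<subseteq> finite_sets"
  obtains B :: "nat \<Rightarrow> _ set" and n and I :: "_ set \<Rightarrow> nat set" where
    "range B \<subseteq> finite_sets" "disjoint_family B"
    "\<forall>A\<in>\<A>. I A \<subseteq> {..<n} \<and> A = (\<Union>i\<in>I A. B i)"
    "AE \<omega> in M. \<forall>A\<in>\<A>. W A \<omega> = (\<Sum>i\<in>I A. W (B i) \<omega>)"
proof -
  define n where "n = card (Pow \<A>)"
  obtain e where e: "bij_betw e {0..<n} (Pow \<A>)"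
    unfolding n_def using ex_bij_betw_nat_finite[of "Pow \<A>"] assms by auto
  define atom where "atom J = {z \<in> \<Union>\<A>. \<forall>A\<in>\<A>. z \<in> A \<longleftrightarrow> A \<in> J}" for J
  define B where "B i = (if i < n then atom (e i) else {})" for i
  define I where "I A = {i\<in>{..<n}. A \<in> e i}" for A
  have U: "\<Union>\<A> \<in> finite_sets"
    using finite_sets_UN[of \<A> "\<lambda>A. A"] assms by auto
  have atom: "atom J \<in> finite_sets" for J
  proof (rule finite_sets_subset[OF U])
    have "\<Union>\<A> \<subseteq> space leb_half"
      using U finite_sets_measurable sets.sets_into_space by blast
    then have "atom J = {z \<in> space leb_half. z \<in> \<Union>\<A> \<and> (\<forall>A\<in>\<A>. z \<in> A \<longleftrightarrow> A \<in> J)}"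
      unfolding atom_def by blast
    also have "\<dots> \<in> sets leb_half"
    proof (intro sets.sets_Collect_conj sets.sets_Collect_finite_All assms(1))
      show "{z \<in> space leb_half. z \<in> \<Union>\<A>} \<in> sets leb_half"
        using finite_sets_measurable[OF U] by (rule sets_Collect_space)
      fix A assume "A \<in> \<A>"
      then have A: "{z \<in> space leb_half. z \<in> A} \<in> sets leb_half"
        using finite_sets_measurable assms(2) by (intro sets_Collect_space) auto
      show "{z \<in> space leb_half. z \<in> A \<longleftrightarrow> A \<in> J} \<in> sets leb_half"
        using A sets.sets_Collect_neg[OF A] by (cases "A \<in> J") auto
    qed
    finally show "atom J \<in> sets leb_half" .
  qed (auto simp: atom_def)
  have disj: "disjoint_family B"
  proof -
    have "i = j" if "i < n" "j < n" "z \<in> atom (e i)" "z \<in> atom (e j)" for i j z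
    proof -
      have "e i \<subseteq> \<A>" "e j \<subseteq> \<A>" using e that by (auto simp: bij_betw_def)
      then have "e i = e j" using that by (auto simp: atom_def)
      then show ?thesis using e that by (auto simp: bij_betw_def inj_on_def)
    qed
    then show ?thesis by (force simp: disjoint_family_on_def B_def)
  qed
  have range: "range B \<subseteq> finite_sets"
    using atom by (auto simp: B_def finite_sets_empty)
  have I: "I A \<subseteq> {..<n}" "finite (I A)" for A by (auto simp: I_def)
  have eq: "A = (\<Union>i\<in>I A. B i)" if A: "A \<in> \<A>" for A
  proof
    show "A \<subseteq> (\<Union>i\<in>I A. B i)"
    proof
      fix z assume z: "z \<in> A"
      have "{A \<in> \<A>. z \<in> A} \<in> Pow \<A>" by auto
      then have "{A \<in> \<A>. z \<in> A} \<in> e ` {0..<n}" using e by (simp add: bij_betw_def)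
      then obtain i where i: "{A \<in> \<A>. z \<in> A} = e i" "i \<in> {0..<n}"
        by (rule imageE)
      have "e i = {A \<in> \<A>. z \<in> A}" "i < n" using i by auto
      then have "i \<in> I A" "z \<in> B i" using A z by (auto simp: I_def B_def atom_def)
      then show "z \<in> (\<Union>i\<in>I A. B i)" by blast
    qed
    show "(\<Union>i\<in>I A. B i) \<subseteq> A" using A by (auto simp: I_def B_def atom_def)
  qed
  have "AE \<omega> in M. W A \<omega> = (\<Sum>i\<in>I A. W (B i) \<omega>)" if "A \<in> \<A>" for A
    using W_finite_additive[OF range disj I(2)[of A]] by (simp only: eq[OF that, symmetric])
  then have ae: "AE \<omega> in M. \<forall>A\<in>\<A>. W A \<omega> = (\<Sum>i\<in>I A. W (B i) \<omega>)"
    using assms(1) by (simp add: AE_finite_all)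
  have "\<forall>A\<in>\<A>. I A \<subseteq> {..<n} \<and> A = (\<Union>i\<in>I A. B i)"
    by (intro ballI conjI I(1) eq)
  then show thesis by (rule that[OF range disj _ ae])
qed

lemma simple_integral_measurable:
  assumes "snd ` set cs \<subseteq> finite_sets"
  shows "simple_integral W cs \<in> borel_measurable M"
  using assms
proof (induction cs)
  case Nil
  then show ?case by (simp add: simple_integral_def)
next
  case (Cons p cs)
  obtain c A where p: "p = (c, A)" by (cases p)
  have [measurable]: "W A \<in> borel_measurable M" "(\<lambda>\<omega>. simple_integral W cs \<omega>) \<in> borel_measurable M"
    using Cons p by (auto simp: W_measurable)
  have "simple_integral W (p # cs) = (\<lambda>\<omega>. c * W A \<omega> + simple_integral W cs \<omega>)"
    by (auto simp: simple_integral_def p)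
  then show ?case by simp
qed

lemma L_modular_disjoint_sum:
  fixes B :: "nat \<Rightarrow> _"
  assumes B: "range B \<subseteq> finite_sets" "disjoint_family B"
  shows "L_modular \<alpha> (\<lambda>z. \<Sum>i<n. c i * indicator (B i) z)
    = ennreal (\<Sum>i<n. measure leb_half (B i) * \<bar>c i\<bar> powr \<alpha>)"
proof -
  have [measurable]: "B i \<in> sets leb_half" for i using B finite_sets_measurable by blast
  have em: "emeasure leb_half (B i) = ennreal (measure leb_half (B i))" for i
  proof -
    have "B i \<in> finite_sets" using B by auto
    then show ?thesis
      using finite_sets_emeasure[of "B i"] by (intro emeasure_eq_ennreal_measure) auto
  qed
  have "L_modular \<alpha> (\<lambda>z. \<Sum>i<n. c i * indicator (B i) z)
    = (\<integral>\<^sup>+z. (\<Sum>i<n. ennreal (\<bar>c i\<bar> powr \<alpha>) * indicator (B i) z) \<partial>leb_half)"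
    unfolding L_modular_def
    by (subst disjoint_family_sum_indicator[OF B(2), of "\<lambda>x. \<bar>x\<bar> powr \<alpha>"])
       (auto simp: sum_ennreal[symmetric] ennreal_mult ennreal_indicator simp del: sum_ennreal
         intro!: nn_integral_cong)
  also have "\<dots> = (\<Sum>i<n. ennreal (\<bar>c i\<bar> powr \<alpha>) * emeasure leb_half (B i))"
    by (subst nn_integral_sum) (auto simp: nn_integral_cmult_indicator)
  also have "\<dots> = ennreal (\<Sum>i<n. measure leb_half (B i) * \<bar>c i\<bar> powr \<alpha>)"
    by (simp add: em sum_ennreal ennreal_mult[symmetric] mult.commute)
  finally show ?thesis .
qed

lemma char_simple_integral:
  assumes cs: "snd ` set cs \<subseteq> finite_sets"
  shows "L_modular \<alpha> (simple_fun cs) < \<infinity>"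
    and "char (distr M borel (simple_integral W cs)) u
      = complex_of_real (exp (- enn2real (L_modular \<alpha> (simple_fun cs)) * \<bar>u\<bar> powr \<alpha>))"
proof -
  obtain B :: "nat \<Rightarrow> _" and n I where B: "range B \<subseteq> finite_sets" "disjoint_family B"
    and IA: "\<forall>A\<in>snd ` set cs. I A \<subseteq> {..<n} \<and> A = (\<Union>i\<in>I A. B i)"
    and ae: "AE \<omega> in M. \<forall>A\<in>snd ` set cs. W A \<omega> = (\<Sum>i\<in>I A. W (B i) \<omega>)"
    by (rule refinement[OF finite_imageI[OF finite_set] cs]) (erule (3) that)
  have I: "I A \<subseteq> {..<n}" "A = (\<Union>i\<in>I A. B i)" if "A \<in> snd ` set cs" for A
    by (rule conjunct1[OF bspec[OF IA that]], rule conjunct2[OF bspec[OF IA that]])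
  define c where "c i = (\<Sum>(c, A)\<leftarrow>cs. if i \<in> I A then c else 0)" for i
  have [measurable]: "W (B i) \<in> borel_measurable M" for i using B by (intro W_measurable) auto
  have [measurable]: "simple_integral W cs \<in> borel_measurable M"
    by (rule simple_integral_measurable[OF cs])
  have sf: "simple_fun cs = (\<lambda>z. \<Sum>i<n. c i * indicator (B i) z)"
  proof
    fix z
    have "indicator A z = (\<Sum>i\<in>I A. indicator (B i) z :: real)" if A: "A \<in> snd ` set cs" for A
    proof -
      have "finite (I A)" using I(1)[OF A] finite_subset by blast
      moreover have "disjoint_family_on B (I A)" using B(2) by (auto simp: disjoint_family_on_def)
      ultimately have "indicator (\<Union>i\<in>I A. B i) z = (\<Sum>i\<in>I A. indicator (B i) z :: real)"
        by (rule indicator_UN_disjoint)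
      then show ?thesis by (simp only: I(2)[OF A, symmetric])
    qed
    then show "simple_fun cs z = (\<Sum>i<n. c i * indicator (B i) z)"
      unfolding simple_fun_def c_def using I(1)
      by (intro sum_list_index_swap) force
  qed
  have si: "AE \<omega> in M. simple_integral W cs \<omega> = (\<Sum>i<n. c i * W (B i) \<omega>)"
    using ae
  proof eventually_elim
    case (elim \<omega>)
    then show ?case unfolding simple_integral_def c_def using I(1)
      by (intro sum_list_index_swap) force
  qed
  have mod: "L_modular \<alpha> (simple_fun cs) = ennreal (\<Sum>i<n. measure leb_half (B i) * \<bar>c i\<bar> powr \<alpha>)"
    unfolding sf by (rule L_modular_disjoint_sum[OF B])
  then show "L_modular \<alpha> (simple_fun cs) < \<infinity>" by simp
  have "indep_vars (\<lambda>_. borel) (\<lambda>i \<omega>. c i * W (B i) \<omega>) {..<n}"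
    using indep_vars_compose2[OF indep_vars_subset[OF W_indep[OF B], of "{..<n}"], of "\<lambda>i x. c i * x" "\<lambda>_. borel"]
    by simp
  then have "char (distr M borel (\<lambda>\<omega>. \<Sum>i<n. c i * W (B i) \<omega>)) u
    = (\<Prod>i<n. char (distr M borel (\<lambda>\<omega>. c i * W (B i) \<omega>)) u)"
    by (rule char_distr_sum)
  also have "\<dots> = (\<Prod>i<n. complex_of_real (exp (- (measure leb_half (B i) * \<bar>c i\<bar> powr \<alpha> * \<bar>u\<bar> powr \<alpha>))))"
  proof (intro prod.cong refl)
    fix i
    have "char (distr M borel (\<lambda>\<omega>. c i * W (B i) \<omega>)) u = char (distr M borel (W (B i))) (c i * u)"
      by (simp add: char_def integral_distr mult_ac)
    also have "\<dots> = complex_of_real (exp (- (measure leb_half (B i) * \<bar>c i\<bar> powr \<alpha> * \<bar>u\<bar> powr \<alpha>)))"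
      using B by (subst W_char) (auto simp: abs_powr_mult mult_ac)
    finally show "char (distr M borel (\<lambda>\<omega>. c i * W (B i) \<omega>)) u
      = complex_of_real (exp (- (measure leb_half (B i) * \<bar>c i\<bar> powr \<alpha> * \<bar>u\<bar> powr \<alpha>)))" .
  qed
  also have "\<dots> = complex_of_real (exp (- (\<Sum>i<n. measure leb_half (B i) * \<bar>c i\<bar> powr \<alpha>) * \<bar>u\<bar> powr \<alpha>))"
    by (simp add: exp_sum sum_distrib_right sum_negf[symmetric] flip: of_real_prod del: of_real_exp)
  also have "(\<Sum>i<n. measure leb_half (B i) * \<bar>c i\<bar> powr \<alpha>) = enn2real (L_modular \<alpha> (simple_fun cs))"
    by (simp add: mod sum_nonneg)
  also have "char (distr M borel (\<lambda>\<omega>. \<Sum>i<n. c i * W (B i) \<omega>)) u = char (distr M borel (simple_integral W cs)) u"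
    using si by (auto simp: char_def integral_distr intro!: integral_cong_AE)
  finally show "char (distr M borel (simple_integral W cs)) u
      = complex_of_real (exp (- enn2real (L_modular \<alpha> (simple_fun cs)) * \<bar>u\<bar> powr \<alpha>))" .
qed

end

lemma min_le_delta_powr:
  fixes x q \<delta> :: real
  assumes "1 \<le> q" "0 < \<delta>" "\<delta> \<le> 1"
  shows "min 1 \<bar>x\<bar> \<le> \<delta> + \<delta> powr (1 - q) * min 1 (\<bar>x\<bar> powr q)"
proof (cases "\<bar>x\<bar> \<le> 1")
  case True
  then have "\<bar>x\<bar> powr q \<le> 1" using assms by (intro powr_le1) auto
  then show ?thesis using True abs_le_delta_powr[OF assms(1,2), of x] by (simp add: min_def)
next
  case False
  then have "1 \<le> \<bar>x\<bar> powr q" using assms by (intro ge_one_powr_ge_zero) auto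
  moreover have "1 \<le> \<delta> powr (1 - q)"
    using powr_mono2'[of "1 - q" \<delta> 1] assms by simp
  ultimately show ?thesis using False assms by (simp add: min_def)
qed

lemma tendsto_ennreal_0_iff:
  fixes f :: "nat \<Rightarrow> ennreal"
  shows "f \<longlonglongrightarrow> 0 \<longleftrightarrow> (\<forall>e>0. eventually (\<lambda>n. f n < ennreal e) sequentially)"
proof
  assume "f \<longlonglongrightarrow> 0"
  then show "\<forall>e>0. eventually (\<lambda>n. f n < ennreal e) sequentially"
    by (auto intro: order_tendstoD(2))
next
  assume *: "\<forall>e>0. eventually (\<lambda>n. f n < ennreal e) sequentially"
  show "f \<longlonglongrightarrow> 0"
  proof (rule order_tendstoI)
    fix a :: ennreal assume "0 < a"
    obtain r where r: "0 < r" "ennreal r \<le> a"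
    proof (cases a)
      case (real a')
      with \<open>0 < a\<close> that[of a'] show ?thesis by (auto simp: ennreal_less_iff)
    next
      case top
      with that[of 1] show ?thesis by auto
    qed
    from *[rule_format, OF r(1)] show "eventually (\<lambda>n. f n < a) sequentially"
      by eventually_elim (use r(2) in auto)
  qed auto
qed

lemma decreasing_null_sequence:
  fixes \<eta> :: "nat \<Rightarrow> real"
  assumes "\<And>n. 0 < \<eta> n"
  obtains \<epsilon> :: "nat \<Rightarrow> real" where "\<And>n. 0 < \<epsilon> n" "\<And>n. \<epsilon> n \<le> \<eta> n" "decseq \<epsilon>" "\<epsilon> \<longlonglongrightarrow> 0"
proof
  define \<epsilon> where "\<epsilon> n = Min ((\<lambda>k. min (\<eta> k) (1 / real (Suc k))) ` {..n})" for n
  show "0 < \<epsilon> n" for n unfolding \<epsilon>_def using assms by (subst Min_gr_iff) auto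
  show "\<epsilon> n \<le> \<eta> n" for n unfolding \<epsilon>_def by (rule Min.coboundedI[THEN order.trans, of _ "min (\<eta> n) (1 / real (Suc n))"]) auto
  have le: "\<epsilon> n \<le> 1 / real (Suc n)" for n
    unfolding \<epsilon>_def by (rule Min.coboundedI[THEN order.trans, of _ "min (\<eta> n) (1 / real (Suc n))"]) auto
  show "decseq \<epsilon>" unfolding \<epsilon>_def decseq_def
    by (intro allI impI Min_antimono image_mono) auto
  have "0 \<le> \<epsilon> n" for n unfolding \<epsilon>_def using assms by (subst Min_ge_iff) (auto intro: less_imp_le)
  then show "\<epsilon> \<longlonglongrightarrow> 0"
    using le by (intro tendsto_sandwich[OF _ _ tendsto_const LIMSEQ_inverse_real_of_nat])
      (auto simp: inverse_eq_divide)
qed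

lemma convergent_of_summable_increments:
  fixes x :: "nat \<Rightarrow> real"
  assumes "summable (\<lambda>n. \<bar>x (Suc n) - x n\<bar>)"
  shows "convergent x"
proof -
  have "summable (\<lambda>n. x (Suc n) - x n)" using assms by (rule summable_rabs_cancel)
  then have "convergent (\<lambda>n. \<Sum>i<n. x (Suc i) - x i)" by (simp add: summable_iff_convergent)
  then have "convergent (\<lambda>n. (x n - x 0) + x 0)"
    unfolding sum_lessThan_telescope by (intro convergent_add convergent_const)
  then show ?thesis by simp
qed

lemma one_minus_cos_le: "1 - cos x \<le> 2 * min 1 \<bar>x\<bar>" for x :: real
proof -
  have "\<bar>cos 0 - cos x\<bar> \<le> \<bar>0 - x\<bar>"
    using field_differentiable_bound[of UNIV cos "\<lambda>x. - sin x" 1 0 x]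
    by (auto intro!: derivative_eq_intros)
  moreover have "- 1 \<le> cos x" by simp
  ultimately show ?thesis by (auto simp: min_def)
qed

lemma cos_diff_le: "cos x - cos y \<le> 2 * min 1 \<bar>y - x\<bar>" for x y :: real
proof -
  have "\<bar>cos x - cos y\<bar> \<le> \<bar>x - y\<bar>"
    using field_differentiable_bound[of UNIV cos "\<lambda>x. - sin x" 1 y x]
    by (auto intro!: derivative_eq_intros)
  moreover have "- 1 \<le> cos y" "cos x \<le> 1" by simp_all
  ultimately have "cos x - cos y \<le> \<bar>y - x\<bar>" "cos x - cos y \<le> 2" by linarith+
  then show ?thesis
  proof (cases "1 \<le> \<bar>y - x\<bar>")
    case False
    have "cos x - cos y \<le> 2 * \<bar>y - x\<bar>"
      by (rule order.trans[OF \<open>cos x - cos y \<le> \<bar>y - x\<bar>\<close>]) simp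
    then show ?thesis using False by (simp add: min_def)
  qed simp
qed

lemma L_space_approx:
  fixes f :: "real \<times> (real ^ 'n::finite) \<Rightarrow> real"
  assumes f: "f \<in> L_space \<alpha>" and \<alpha>: "0 < \<alpha>" and e: "0 < e"
  shows "\<exists>cs. snd ` set cs \<subseteq> finite_sets \<and> L_modular \<alpha> (\<lambda>z. simple_fun cs z - f z) < ennreal e"
proof -
  have fm[measurable]: "f \<in> borel_measurable leb_half" and fin: "L_modular \<alpha> f < \<infinity>"
    using f by (auto simp: L_space_iff)
  obtain F where sF: "\<And>i::nat. simple_function leb_half (F i)"
    and lim: "\<And>z. z \<in> space leb_half \<Longrightarrow> (\<lambda>i. F i z) \<longlonglongrightarrow> f z"
    and bd: "\<And>i z. z \<in> space leb_half \<Longrightarrow> dist (F i z) 0 \<le> 2 * dist (f z) 0"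
    using borel_measurable_implies_sequence_metric[OF fm, of 0] by metis
  have [measurable]: "F i \<in> borel_measurable leb_half" for i
    using sF by (rule borel_measurable_simple_function)
  have "(\<lambda>i. \<integral>\<^sup>+z. ennreal (\<bar>F i z - f z\<bar> powr \<alpha>) \<partial>leb_half) \<longlonglongrightarrow> (\<integral>\<^sup>+z. 0 \<partial>(leb_half :: (real \<times> (real ^ 'n)) measure))"
  proof (rule nn_integral_dominated_convergence[where w="\<lambda>z. ennreal (3 powr \<alpha>) * ennreal (\<bar>f z\<bar> powr \<alpha>)"])
    show "(\<integral>\<^sup>+z. ennreal (3 powr \<alpha>) * ennreal (\<bar>f z\<bar> powr \<alpha>) \<partial>leb_half) < \<infinity>"
      using fin by (subst nn_integral_cmult) (auto simp: L_modular_def ennreal_mult_less_top)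
    show "AE z in leb_half. ennreal (\<bar>F i z - f z\<bar> powr \<alpha>) \<le> ennreal (3 powr \<alpha>) * ennreal (\<bar>f z\<bar> powr \<alpha>)" for i
    proof (rule AE_I2)
      fix z :: "real \<times> (real ^ 'n)" assume "z \<in> space leb_half"
      from bd[OF this, of i] have "\<bar>F i z - f z\<bar> \<le> \<bar>3 * f z\<bar>" by (simp add: dist_real_def)
      then have "\<bar>F i z - f z\<bar> powr \<alpha> \<le> \<bar>3 * f z\<bar> powr \<alpha>" using \<alpha> by (intro powr_mono2) auto
      also have "\<dots> = 3 powr \<alpha> * \<bar>f z\<bar> powr \<alpha>" by (simp add: abs_powr_mult)
      finally show "ennreal (\<bar>F i z - f z\<bar> powr \<alpha>) \<le> ennreal (3 powr \<alpha>) * ennreal (\<bar>f z\<bar> powr \<alpha>)"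
        by (subst ennreal_mult[symmetric]) (auto intro: ennreal_leI)
    qed
    show "AE z in leb_half. (\<lambda>i. ennreal (\<bar>F i z - f z\<bar> powr \<alpha>)) \<longlonglongrightarrow> 0"
    proof (rule AE_I2)
      fix z :: "real \<times> (real ^ 'n)" assume "z \<in> space leb_half"
      then have "(\<lambda>i. \<bar>F i z - f z\<bar>) \<longlonglongrightarrow> 0"
        using lim[THEN LIM_zero, of z] tendsto_rabs_zero by blast
      then have "(\<lambda>i. \<bar>F i z - f z\<bar> powr \<alpha>) \<longlonglongrightarrow> 0 powr \<alpha>"
        using \<alpha> by (intro tendsto_powr') auto
      then show "(\<lambda>i. ennreal (\<bar>F i z - f z\<bar> powr \<alpha>)) \<longlonglongrightarrow> 0"
        by (simp add: tendsto_ennrealI[where x=0, simplified])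
    qed
  qed auto
  then have "eventually (\<lambda>i. L_modular \<alpha> (\<lambda>z. F i z - f z) < ennreal e) sequentially"
    using e unfolding L_modular_def by (intro order_tendstoD(2)[of _ 0]) auto
  then obtain i where i: "L_modular \<alpha> (\<lambda>z. F i z - f z) < ennreal e"
    by (auto simp: eventually_sequentially)
  define V where "V = F i ` space leb_half - {0}"
  define A where "A v = F i -` {v} \<inter> space leb_half" for v
  define cs where "cs = map (\<lambda>v. (v, A v)) (sorted_list_of_set V)"
  have V: "finite V" unfolding V_def using sF[of i] by (auto dest: simple_functionD(1))
  have [measurable]: "A v \<in> sets leb_half" for v
    unfolding A_def using sF[of i] by (rule simple_functionD(2))
  have A: "A v \<in> finite_sets" if v: "v \<in> V" for v
  proof -
    have "v \<noteq> 0" using v by (simp add: V_def)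
    have "ennreal (\<bar>v\<bar> powr \<alpha>) * emeasure leb_half (A v)
        = (\<integral>\<^sup>+z. ennreal (\<bar>v\<bar> powr \<alpha>) * indicator (A v) z \<partial>leb_half)"
      by (subst nn_integral_cmult_indicator) auto
    also have "\<dots> \<le> (\<integral>\<^sup>+z. ennreal (2 powr \<alpha>) * ennreal (\<bar>f z\<bar> powr \<alpha>) \<partial>leb_half)"
    proof (rule nn_integral_mono)
      fix z :: "real \<times> (real ^ 'n)" assume z: "z \<in> space leb_half"
      show "ennreal (\<bar>v\<bar> powr \<alpha>) * indicator (A v) z \<le> ennreal (2 powr \<alpha>) * ennreal (\<bar>f z\<bar> powr \<alpha>)"
      proof (cases "z \<in> A v")
        case True
        then have "\<bar>v\<bar> \<le> \<bar>2 * f z\<bar>" using bd[OF z, of i] by (auto simp: A_def dist_real_def)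
        then have "\<bar>v\<bar> powr \<alpha> \<le> \<bar>2 * f z\<bar> powr \<alpha>" using \<alpha> by (intro powr_mono2) auto
        also have "\<dots> = 2 powr \<alpha> * \<bar>f z\<bar> powr \<alpha>" by (simp add: abs_powr_mult)
        finally show ?thesis using True
          by (subst ennreal_mult[symmetric]) (auto intro: ennreal_leI)
      qed auto
    qed
    also have "\<dots> < \<infinity>"
      using fin by (subst nn_integral_cmult) (auto simp: L_modular_def ennreal_mult_less_top)
    finally have "emeasure leb_half (A v) < \<infinity>"
      using \<open>v \<noteq> 0\<close> by (auto simp: ennreal_mult_less_top)
    then show ?thesis by (simp add: finite_sets_def)
  qed
  have sf: "simple_fun cs z = F i z" if z: "z \<in> space leb_half" for z
  proof -
    have "simple_fun cs z = (\<Sum>v\<in>V. v * indicator (A v) z)"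
      using V by (simp add: simple_fun_def cs_def comp_def sum_list_distinct_conv_sum_set)
    also have "\<dots> = (\<Sum>v\<in>V. if v = F i z then v else 0)"
      using z by (intro sum.cong) (auto simp: A_def indicator_def)
    also have "\<dots> = F i z" using V z by (auto simp: V_def sum.delta')
    finally show ?thesis .
  qed
  have "L_modular \<alpha> (\<lambda>z. simple_fun cs z - f z) = L_modular \<alpha> (\<lambda>z. F i z - f z)"
    unfolding L_modular_def by (intro nn_integral_cong) (simp add: sf)
  moreover have "snd ` set cs \<subseteq> finite_sets" using A V by (auto simp: cs_def)
  ultimately show ?thesis using i by (intro exI[of _ cs]) simp
qed

context stable_noise
begin

lemma prob_dist_simple_integral:
  assumes cs: "snd ` set cs \<subseteq> finite_sets" and \<delta>: "0 < \<delta>" "\<delta> \<le> 1"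
  shows "prob_dist M (simple_integral W cs)
    \<le> ennreal \<delta> + ennreal (stable_tail_const \<alpha> 2 / \<delta>) * L_modular \<alpha> (simple_fun cs)"
proof -
  let ?X = "simple_integral W cs" and ?a = "enn2real (L_modular \<alpha> (simple_fun cs))"
  have [measurable]: "?X \<in> borel_measurable M" by (rule simple_integral_measurable[OF cs])
  have C: "0 \<le> stable_tail_const \<alpha> 2" using \<alpha>_less by (rule stable_tail_const_nonneg)
  have "prob_dist M ?X \<le> (\<integral>\<^sup>+\<omega>. ennreal \<delta> + ennreal (1 / \<delta>) * ennreal (min 1 (\<bar>1 * ?X \<omega>\<bar> powr 2)) \<partial>M)"
    unfolding prob_dist_def
  proof (intro nn_integral_mono)
    fix \<omega>
    have "ennreal (min 1 \<bar>?X \<omega>\<bar>) \<le> ennreal (\<delta> + 1 / \<delta> * min 1 (\<bar>?X \<omega>\<bar> powr 2))"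
      using min_le_delta_powr[of 2 \<delta> "?X \<omega>"] \<delta> by (intro ennreal_leI) (simp add: powr_minus_divide)
    then show "ennreal (min 1 \<bar>?X \<omega>\<bar>)
        \<le> ennreal \<delta> + ennreal (1 / \<delta>) * ennreal (min 1 (\<bar>1 * ?X \<omega>\<bar> powr 2))"
      using \<delta> by (simp add: ennreal_plus ennreal_mult del: times_divide_eq_left)
  qed
  also have "\<dots> = ennreal \<delta> + ennreal (1 / \<delta>) * (\<integral>\<^sup>+\<omega>. ennreal (min 1 (\<bar>1 * ?X \<omega>\<bar> powr 2)) \<partial>M)"
    by (simp add: nn_integral_add nn_integral_cmult emeasure_space_1)
  also have "(\<integral>\<^sup>+\<omega>. ennreal (min 1 (\<bar>1 * ?X \<omega>\<bar> powr 2)) \<partial>M)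
      \<le> ennreal (stable_tail_const \<alpha> 2 * ?a * \<bar>1\<bar> powr \<alpha>)"
    using \<alpha>_pos \<alpha>_less by (intro stable_tail char_simple_integral(2) cs) (auto intro: prob_space_axioms)
  also have "ennreal (1 / \<delta>) * ennreal (stable_tail_const \<alpha> 2 * ?a * \<bar>1\<bar> powr \<alpha>)
      = ennreal (stable_tail_const \<alpha> 2 / \<delta>) * ennreal ?a"
    using \<delta> C by (simp add: ennreal_mult[symmetric])
  also have "ennreal ?a = L_modular \<alpha> (simple_fun cs)"
    using char_simple_integral(1)[OF cs] by simp
  finally show ?thesis by (simp add: add_left_mono mult_left_mono)
qed

lemma prob_dist_simple_integral_small:
  assumes "0 < e"
  shows "\<exists>\<eta>>0. \<forall>cs. snd ` set cs \<subseteq> finite_sets \<longrightarrow> L_modular \<alpha> (simple_fun cs) < ennreal \<eta> \<longrightarrow>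
    prob_dist M (simple_integral W cs) < ennreal e"
proof -
  define C where "C = stable_tail_const \<alpha> 2"
  have C: "0 \<le> C" unfolding C_def using \<alpha>_less by (rule stable_tail_const_nonneg)
  define \<delta> where "\<delta> = min 1 (e / 3)"
  define \<eta> where "\<eta> = e * \<delta> / (3 * (C + 1))"
  have \<delta>: "0 < \<delta>" "\<delta> \<le> 1" "\<delta> \<le> e / 3" using assms by (auto simp: \<delta>_def)
  have \<eta>: "0 < \<eta>" unfolding \<eta>_def using assms C \<delta> by auto
  show ?thesis
  proof (intro exI[of _ \<eta>] conjI allI impI \<eta>)
    fix cs :: "(real \<times> (real \<times> (real ^ 'n)) set) list"
    assume cs: "snd ` set cs \<subseteq> finite_sets" and L: "L_modular \<alpha> (simple_fun cs) < ennreal \<eta>"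
    have "prob_dist M (simple_integral W cs) \<le> ennreal \<delta> + ennreal (C / \<delta>) * ennreal \<eta>"
      unfolding C_def using L
      by (intro order.trans[OF prob_dist_simple_integral[OF cs \<delta>(1,2)]] add_left_mono mult_left_mono) auto
    also have "\<dots> = ennreal (\<delta> + C / \<delta> * \<eta>)"
      using C \<delta> \<eta> by (simp add: ennreal_mult[symmetric] ennreal_plus[symmetric] del: ennreal_plus)
    also have "\<dots> < ennreal e"
    proof -
      have "C / \<delta> * \<eta> = (C / (C + 1)) * (e / 3)" using \<delta> by (simp add: \<eta>_def)
      also have "\<dots> \<le> 1 * (e / 3)" using C assms by (intro mult_right_mono) auto
      finally have "\<delta> + C / \<delta> * \<eta> < e" using \<delta> assms by linarith
      then show ?thesis using assms by (intro ennreal_lessI)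
    qed
    finally show "prob_dist M (simple_integral W cs) < ennreal e" .
  qed
qed

lemma has_stable_integral_iff:
  "has_stable_integral M \<alpha> W f X \<longleftrightarrow> f \<in> L_space \<alpha> \<and> X \<in> borel_measurable M \<and>
    (\<exists>F. (\<forall>n. snd ` set (F n) \<subseteq> finite_sets) \<and>
      (\<lambda>n. L_modular \<alpha> (\<lambda>z. simple_fun (F n) z - f z)) \<longlonglongrightarrow> 0 \<and>
      (\<lambda>n. prob_dist M (\<lambda>\<omega>. simple_integral W (F n) \<omega> - X \<omega>)) \<longlonglongrightarrow> 0)"
proof -
  have "(\<lambda>n. prob_dist M (\<lambda>\<omega>. simple_integral W (F n) \<omega> - X \<omega>)) \<longlonglongrightarrow> 0 \<longleftrightarrow>
    (\<forall>\<epsilon>>0. (\<lambda>n. measure M {\<omega> \<in> space M. \<bar>simple_integral W (F n) \<omega> - X \<omega>\<bar> > \<epsilon>}) \<longlonglongrightarrow> 0)"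
    if [measurable]: "X \<in> borel_measurable M" and F: "\<forall>n. snd ` set (F n) \<subseteq> finite_sets" for F
  proof -
    have [measurable]: "simple_integral W (F n) \<in> borel_measurable M" for n
      using F by (intro simple_integral_measurable) auto
    show ?thesis
      by (rule prob_dist_tendsto_iff) (auto intro: prob_space_axioms)
  qed
  then show ?thesis unfolding has_stable_integral_def L_modular_def by blast
qed

lemma has_stable_integral_approx:
  "has_stable_integral M \<alpha> W f X \<longleftrightarrow> f \<in> L_space \<alpha> \<and> X \<in> borel_measurable M \<and>
    (\<forall>e>0. \<exists>cs. snd ` set cs \<subseteq> finite_sets \<and> L_modular \<alpha> (\<lambda>z. simple_fun cs z - f z) < ennreal e \<and>
      prob_dist M (\<lambda>\<omega>. simple_integral W cs \<omega> - X \<omega>) < ennreal e)" (is "_ \<longleftrightarrow> _ \<and> _ \<and> ?A")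
proof -
  have "(\<exists>F. (\<forall>n. snd ` set (F n) \<subseteq> finite_sets) \<and>
      (\<lambda>n. L_modular \<alpha> (\<lambda>z. simple_fun (F n) z - f z)) \<longlonglongrightarrow> 0 \<and>
      (\<lambda>n. prob_dist M (\<lambda>\<omega>. simple_integral W (F n) \<omega> - X \<omega>)) \<longlonglongrightarrow> 0) \<longleftrightarrow> ?A" (is "?B \<longleftrightarrow> _")
  proof
    assume ?B
    then obtain F where F: "\<And>n. snd ` set (F n) \<subseteq> finite_sets"
      "(\<lambda>n. L_modular \<alpha> (\<lambda>z. simple_fun (F n) z - f z)) \<longlonglongrightarrow> 0"
      "(\<lambda>n. prob_dist M (\<lambda>\<omega>. simple_integral W (F n) \<omega> - X \<omega>)) \<longlonglongrightarrow> 0" by blast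
    show ?A
    proof (intro allI impI)
      fix e :: real assume "0 < e"
      then have "eventually (\<lambda>n. L_modular \<alpha> (\<lambda>z. simple_fun (F n) z - f z) < ennreal e \<and>
          prob_dist M (\<lambda>\<omega>. simple_integral W (F n) \<omega> - X \<omega>) < ennreal e) sequentially"
        using F(2,3) unfolding tendsto_ennreal_0_iff by (intro eventually_conj) auto
      then show "\<exists>cs. snd ` set cs \<subseteq> finite_sets \<and> L_modular \<alpha> (\<lambda>z. simple_fun cs z - f z) < ennreal e \<and>
          prob_dist M (\<lambda>\<omega>. simple_integral W cs \<omega> - X \<omega>) < ennreal e"
        using F(1) unfolding eventually_sequentially by blast
    qed
  next
    assume A: ?A
    have "\<forall>n. \<exists>cs. snd ` set cs \<subseteq> finite_sets \<and>
        L_modular \<alpha> (\<lambda>z. simple_fun cs z - f z) < ennreal (1 / real (Suc n)) \<and>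
        prob_dist M (\<lambda>\<omega>. simple_integral W cs \<omega> - X \<omega>) < ennreal (1 / real (Suc n))"
      using A by auto
    then obtain F where "\<forall>n. snd ` set (F n) \<subseteq> finite_sets \<and>
        L_modular \<alpha> (\<lambda>z. simple_fun (F n) z - f z) < ennreal (1 / real (Suc n)) \<and>
        prob_dist M (\<lambda>\<omega>. simple_integral W (F n) \<omega> - X \<omega>) < ennreal (1 / real (Suc n))"
      unfolding choice_iff by blast
    then have F: "\<And>n. snd ` set (F n) \<subseteq> finite_sets"
      "\<And>n. L_modular \<alpha> (\<lambda>z. simple_fun (F n) z - f z) < ennreal (1 / real (Suc n))"
      "\<And>n. prob_dist M (\<lambda>\<omega>. simple_integral W (F n) \<omega> - X \<omega>) < ennreal (1 / real (Suc n))"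
      by simp_all
    have z: "(\<lambda>n. ennreal (1 / real (Suc n))) \<longlonglongrightarrow> 0"
      using LIMSEQ_inverse_real_of_nat by (simp add: tendsto_ennrealI[where x=0, simplified] inverse_eq_divide)
    have "(\<lambda>n. L_modular \<alpha> (\<lambda>z. simple_fun (F n) z - f z)) \<longlonglongrightarrow> 0"
      by (rule tendsto_sandwich[OF _ _ tendsto_const z]) (use less_imp_le[OF F(2)] in simp_all)
    moreover have "(\<lambda>n. prob_dist M (\<lambda>\<omega>. simple_integral W (F n) \<omega> - X \<omega>)) \<longlonglongrightarrow> 0"
      by (rule tendsto_sandwich[OF _ _ tendsto_const z]) (use less_imp_le[OF F(3)] in simp_all)
    ultimately show ?B using F(1) by blast
  qed
  then show ?thesis unfolding has_stable_integral_iff by simp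
qed

lemma has_stable_integral_unique:
  assumes X: "has_stable_integral M \<alpha> W f X" and Y: "has_stable_integral M \<alpha> W f Y"
  shows "AE \<omega> in M. X \<omega> = Y \<omega>"
proof -
  have [measurable]: "f \<in> borel_measurable leb_half" "X \<in> borel_measurable M" "Y \<in> borel_measurable M"
    using X Y by (auto simp: has_stable_integral_iff L_space_iff)
  have "prob_dist M (\<lambda>\<omega>. X \<omega> - Y \<omega>) < ennreal e" if e: "0 < e" for e
  proof -
    obtain \<eta> where \<eta>: "0 < \<eta>" "\<And>cs. snd ` set cs \<subseteq> finite_sets \<Longrightarrow>
        L_modular \<alpha> (simple_fun cs) < ennreal \<eta> \<Longrightarrow> prob_dist M (simple_integral W cs) < ennreal (e / 3)"
      using prob_dist_simple_integral_small[of "e / 3"] e by auto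
    define r where "r = min (e / 3) (\<eta> / (2 * 2 powr \<alpha>))"
    have r: "0 < r" "r \<le> e / 3" "2 powr \<alpha> * (r + r) \<le> \<eta>"
      using e \<eta>(1) by (auto simp: r_def min_def field_simps)
    obtain cs where cs: "snd ` set cs \<subseteq> finite_sets" "L_modular \<alpha> (\<lambda>z. simple_fun cs z - f z) < ennreal r"
      "prob_dist M (\<lambda>\<omega>. simple_integral W cs \<omega> - X \<omega>) < ennreal r"
      using X r(1) unfolding has_stable_integral_approx by blast
    obtain ds where ds: "snd ` set ds \<subseteq> finite_sets" "L_modular \<alpha> (\<lambda>z. simple_fun ds z - f z) < ennreal r"
      "prob_dist M (\<lambda>\<omega>. simple_integral W ds \<omega> - Y \<omega>) < ennreal r"
      using Y r(1) unfolding has_stable_integral_approx by blast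
    note [measurable] = cs(1)[THEN simple_fun_measurable] ds(1)[THEN simple_fun_measurable]
      cs(1)[THEN simple_integral_measurable] ds(1)[THEN simple_integral_measurable]
    let ?E = "cs @ scale_list (- 1) ds"
    have E: "snd ` set ?E \<subseteq> finite_sets" using cs(1) ds(1) by (simp add: image_Un scale_list_sets)
    have sE: "simple_fun ?E = (\<lambda>z. simple_fun cs z - simple_fun ds z)"
      "simple_integral W ?E = (\<lambda>\<omega>. simple_integral W cs \<omega> - simple_integral W ds \<omega>)"
      by (auto simp: simple_fun_append simple_integral_append simple_fun_scale simple_integral_scale)
    have "L_modular \<alpha> (simple_fun ?E) \<le> ennreal (2 powr \<alpha>) *
        (L_modular \<alpha> (\<lambda>z. simple_fun cs z - f z) + L_modular \<alpha> (\<lambda>z. simple_fun ds z - f z))"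
      unfolding sE by (rule L_modular_diff_triangle) (auto simp: \<alpha>_pos)
    also have "\<dots> < ennreal (2 powr \<alpha>) * (ennreal r + ennreal r)"
      using cs(2) ds(2) by (intro ennreal_mult_strict_left_mono add_strict_mono) auto
    also have "\<dots> \<le> ennreal \<eta>"
      using r by (simp add: ennreal_mult[symmetric] ennreal_plus[symmetric] ennreal_leI del: ennreal_plus)
    finally have p: "prob_dist M (simple_integral W ?E) < ennreal (e / 3)" by (rule \<eta>(2)[OF E])
    have "prob_dist M (\<lambda>\<omega>. X \<omega> - Y \<omega>) =
        prob_dist M (\<lambda>\<omega>. (- (simple_integral W cs \<omega> - X \<omega>) + (simple_integral W cs \<omega> - simple_integral W ds \<omega>))
          + (simple_integral W ds \<omega> - Y \<omega>))" by simp
    also have "\<dots> \<le> prob_dist M (\<lambda>\<omega>. - (simple_integral W cs \<omega> - X \<omega>) + (simple_integral W cs \<omega> - simple_integral W ds \<omega>))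
        + prob_dist M (\<lambda>\<omega>. simple_integral W ds \<omega> - Y \<omega>)"
      by (intro prob_dist_triangle) auto
    also have "\<dots> \<le> (prob_dist M (\<lambda>\<omega>. - (simple_integral W cs \<omega> - X \<omega>)) + prob_dist M (simple_integral W ?E))
        + prob_dist M (\<lambda>\<omega>. simple_integral W ds \<omega> - Y \<omega>)"
      unfolding sE by (intro add_right_mono prob_dist_triangle) auto
    also have "\<dots> < (ennreal r + ennreal (e / 3)) + ennreal r"
      unfolding prob_dist_minus using cs(3) ds(3) p by (intro add_strict_mono) auto
    also have "\<dots> \<le> ennreal e"
      using r e by (simp add: ennreal_plus[symmetric] ennreal_leI del: ennreal_plus)
    finally show ?thesis .
  qed
  then have "prob_dist M (\<lambda>\<omega>. X \<omega> - Y \<omega>) = 0"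
    using ennreal_le_epsilon[of 0 "prob_dist M (\<lambda>\<omega>. X \<omega> - Y \<omega>)"] less_imp_le by fastforce
  then have "AE \<omega> in M. X \<omega> - Y \<omega> = 0" by (intro prob_dist_eq_0) auto
  then show ?thesis by simp
qed

end

context stable_noise
begin

lemma has_stable_integral_linear:
  assumes X: "has_stable_integral M \<alpha> W f X" and Y: "has_stable_integral M \<alpha> W g Y"
  shows "has_stable_integral M \<alpha> W (\<lambda>z. a * f z + b * g z) (\<lambda>\<omega>. a * X \<omega> + b * Y \<omega>)"
proof -
  have [measurable]: "f \<in> borel_measurable leb_half" "g \<in> borel_measurable leb_half"
      "X \<in> borel_measurable M" "Y \<in> borel_measurable M"
    and fin: "L_modular \<alpha> f < \<infinity>" "L_modular \<alpha> g < \<infinity>"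
    using X Y by (auto simp: has_stable_integral_iff L_space_iff)
  obtain F where F: "\<And>n. snd ` set (F n) \<subseteq> finite_sets"
      "(\<lambda>n. L_modular \<alpha> (\<lambda>z. simple_fun (F n) z - f z)) \<longlonglongrightarrow> 0"
      "(\<lambda>n. prob_dist M (\<lambda>\<omega>. simple_integral W (F n) \<omega> - X \<omega>)) \<longlonglongrightarrow> 0"
    using X unfolding has_stable_integral_iff by blast
  obtain G where G: "\<And>n. snd ` set (G n) \<subseteq> finite_sets"
      "(\<lambda>n. L_modular \<alpha> (\<lambda>z. simple_fun (G n) z - g z)) \<longlonglongrightarrow> 0"
      "(\<lambda>n. prob_dist M (\<lambda>\<omega>. simple_integral W (G n) \<omega> - Y \<omega>)) \<longlonglongrightarrow> 0"
    using Y unfolding has_stable_integral_iff by blast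
  have [measurable]: "simple_fun (F n) \<in> borel_measurable leb_half" "simple_fun (G n) \<in> borel_measurable leb_half"
      "simple_integral W (F n) \<in> borel_measurable M" "simple_integral W (G n) \<in> borel_measurable M" for n
    by (rule simple_fun_measurable[OF F(1)] simple_fun_measurable[OF G(1)]
        simple_integral_measurable[OF F(1)] simple_integral_measurable[OF G(1)])+
  define E where "E n = scale_list a (F n) @ scale_list b (G n)" for n
  have "\<forall>n. snd ` set (E n) \<subseteq> finite_sets"
    using F(1) G(1) by (simp add: E_def image_Un scale_list_sets)
  moreover have "(\<lambda>n. L_modular \<alpha> (\<lambda>z. simple_fun (E n) z - (a * f z + b * g z))) \<longlonglongrightarrow> 0"
  proof (rule tendsto_sandwich[OF _ _ tendsto_const])
    show "eventually (\<lambda>n. L_modular \<alpha> (\<lambda>z. simple_fun (E n) z - (a * f z + b * g z))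
        \<le> ennreal (2 powr \<alpha>) * (ennreal (\<bar>a\<bar> powr \<alpha>) * L_modular \<alpha> (\<lambda>z. simple_fun (F n) z - f z) +
            ennreal (\<bar>b\<bar> powr \<alpha>) * L_modular \<alpha> (\<lambda>z. simple_fun (G n) z - g z))) sequentially"
    proof (intro always_eventually allI)
      fix n
      have "L_modular \<alpha> (\<lambda>z. simple_fun (E n) z - (a * f z + b * g z))
        = L_modular \<alpha> (\<lambda>z. a * (simple_fun (F n) z - f z) + b * (simple_fun (G n) z - g z))"
        by (simp add: E_def simple_fun_append simple_fun_scale algebra_simps)
      also have "\<dots> \<le> ennreal (2 powr \<alpha>) * (L_modular \<alpha> (\<lambda>z. a * (simple_fun (F n) z - f z)) +
          L_modular \<alpha> (\<lambda>z. b * (simple_fun (G n) z - g z)))"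
        by (rule L_modular_add) (auto simp: \<alpha>_pos)
      finally show "L_modular \<alpha> (\<lambda>z. simple_fun (E n) z - (a * f z + b * g z))
        \<le> ennreal (2 powr \<alpha>) * (ennreal (\<bar>a\<bar> powr \<alpha>) * L_modular \<alpha> (\<lambda>z. simple_fun (F n) z - f z) +
            ennreal (\<bar>b\<bar> powr \<alpha>) * L_modular \<alpha> (\<lambda>z. simple_fun (G n) z - g z))"
        by (simp add: L_modular_scale)
    qed
    have "(\<lambda>n. ennreal (2 powr \<alpha>) * (ennreal (\<bar>a\<bar> powr \<alpha>) * L_modular \<alpha> (\<lambda>z. simple_fun (F n) z - f z) +
            ennreal (\<bar>b\<bar> powr \<alpha>) * L_modular \<alpha> (\<lambda>z. simple_fun (G n) z - g z)))
          \<longlonglongrightarrow> ennreal (2 powr \<alpha>) * (ennreal (\<bar>a\<bar> powr \<alpha>) * 0 + ennreal (\<bar>b\<bar> powr \<alpha>) * 0)"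
      using F(2) G(2) by (intro tendsto_add ennreal_tendsto_cmult) auto
    then show "(\<lambda>n. ennreal (2 powr \<alpha>) * (ennreal (\<bar>a\<bar> powr \<alpha>) * L_modular \<alpha> (\<lambda>z. simple_fun (F n) z - f z) +
            ennreal (\<bar>b\<bar> powr \<alpha>) * L_modular \<alpha> (\<lambda>z. simple_fun (G n) z - g z))) \<longlonglongrightarrow> 0" by simp
  qed auto
  moreover have "(\<lambda>n. prob_dist M (\<lambda>\<omega>. simple_integral W (E n) \<omega> - (a * X \<omega> + b * Y \<omega>))) \<longlonglongrightarrow> 0"
  proof (rule tendsto_sandwich[OF _ _ tendsto_const])
    show "eventually (\<lambda>n. prob_dist M (\<lambda>\<omega>. simple_integral W (E n) \<omega> - (a * X \<omega> + b * Y \<omega>))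
        \<le> ennreal (1 + \<bar>a\<bar>) * prob_dist M (\<lambda>\<omega>. simple_integral W (F n) \<omega> - X \<omega>) +
          ennreal (1 + \<bar>b\<bar>) * prob_dist M (\<lambda>\<omega>. simple_integral W (G n) \<omega> - Y \<omega>)) sequentially"
    proof (intro always_eventually allI)
      fix n
      have "prob_dist M (\<lambda>\<omega>. simple_integral W (E n) \<omega> - (a * X \<omega> + b * Y \<omega>))
        = prob_dist M (\<lambda>\<omega>. a * (simple_integral W (F n) \<omega> - X \<omega>) + b * (simple_integral W (G n) \<omega> - Y \<omega>))"
        by (simp add: E_def simple_integral_append simple_integral_scale algebra_simps)
      also have "\<dots> \<le> prob_dist M (\<lambda>\<omega>. a * (simple_integral W (F n) \<omega> - X \<omega>)) +
          prob_dist M (\<lambda>\<omega>. b * (simple_integral W (G n) \<omega> - Y \<omega>))"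
        by (rule prob_dist_triangle) auto
      also have "\<dots> \<le> ennreal (1 + \<bar>a\<bar>) * prob_dist M (\<lambda>\<omega>. simple_integral W (F n) \<omega> - X \<omega>) +
          ennreal (1 + \<bar>b\<bar>) * prob_dist M (\<lambda>\<omega>. simple_integral W (G n) \<omega> - Y \<omega>)"
        by (intro add_mono prob_dist_scale) auto
      finally show "prob_dist M (\<lambda>\<omega>. simple_integral W (E n) \<omega> - (a * X \<omega> + b * Y \<omega>)) \<le> \<dots>" .
    qed
    have "(\<lambda>n. ennreal (1 + \<bar>a\<bar>) * prob_dist M (\<lambda>\<omega>. simple_integral W (F n) \<omega> - X \<omega>) +
          ennreal (1 + \<bar>b\<bar>) * prob_dist M (\<lambda>\<omega>. simple_integral W (G n) \<omega> - Y \<omega>))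
          \<longlonglongrightarrow> ennreal (1 + \<bar>a\<bar>) * 0 + ennreal (1 + \<bar>b\<bar>) * 0"
      using F(3) G(3) by (intro tendsto_add ennreal_tendsto_cmult) auto
    then show "(\<lambda>n. ennreal (1 + \<bar>a\<bar>) * prob_dist M (\<lambda>\<omega>. simple_integral W (F n) \<omega> - X \<omega>) +
          ennreal (1 + \<bar>b\<bar>) * prob_dist M (\<lambda>\<omega>. simple_integral W (G n) \<omega> - Y \<omega>)) \<longlonglongrightarrow> 0" by simp
  qed auto
  moreover have "(\<lambda>z. a * f z + b * g z) \<in> L_space \<alpha>"
  proof -
    have "L_modular \<alpha> (\<lambda>z. a * f z + b * g z)
        \<le> ennreal (2 powr \<alpha>) * (L_modular \<alpha> (\<lambda>z. a * f z) + L_modular \<alpha> (\<lambda>z. b * g z))"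
      by (rule L_modular_add) (auto simp: \<alpha>_pos)
    also have "\<dots> < \<infinity>" using fin by (simp add: L_modular_scale ennreal_mult_less_top)
    finally show ?thesis by (simp add: L_space_iff)
  qed
  ultimately show ?thesis unfolding has_stable_integral_iff by auto
qed

lemma has_stable_integral_exists:
  assumes f: "f \<in> L_space \<alpha>"
  shows "\<exists>X. has_stable_integral M \<alpha> W f X"
proof -
  have fm[measurable]: "f \<in> borel_measurable leb_half" using f by (simp add: L_space_iff)
  have "\<exists>\<eta>>0. \<forall>cs. snd ` set cs \<subseteq> finite_sets \<longrightarrow> L_modular \<alpha> (simple_fun cs) < ennreal \<eta> \<longrightarrow>
      prob_dist M (simple_integral W cs) < ennreal ((1/2) ^ n)" for n
    by (rule prob_dist_simple_integral_small) simp
  then obtain \<eta> where \<eta>: "\<And>n. 0 < \<eta> n" "\<And>n cs. snd ` set cs \<subseteq> finite_sets \<Longrightarrow>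
      L_modular \<alpha> (simple_fun cs) < ennreal (\<eta> n) \<Longrightarrow> prob_dist M (simple_integral W cs) < ennreal ((1/2) ^ n)"
    by metis
  obtain \<epsilon> where \<epsilon>: "\<And>n. 0 < \<epsilon> n" "\<And>n. \<epsilon> n \<le> \<eta> n / (2 * 2 powr \<alpha>)" "decseq \<epsilon>" "\<epsilon> \<longlonglongrightarrow> 0"
    using decreasing_null_sequence[of "\<lambda>n. \<eta> n / (2 * 2 powr \<alpha>)"] \<eta>(1) by auto
  have "\<exists>cs. snd ` set cs \<subseteq> finite_sets \<and> L_modular \<alpha> (\<lambda>z. simple_fun cs z - f z) < ennreal (\<epsilon> n)" for n
    using L_space_approx[OF f \<alpha>_pos \<epsilon>(1)] .
  then obtain F where F: "\<And>n. snd ` set (F n) \<subseteq> finite_sets"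
      "\<And>n. L_modular \<alpha> (\<lambda>z. simple_fun (F n) z - f z) < ennreal (\<epsilon> n)"
    by metis
  have [measurable]: "simple_fun (F n) \<in> borel_measurable leb_half"
      "simple_integral W (F n) \<in> borel_measurable M" for n
    using F(1) by (auto intro: simple_fun_measurable simple_integral_measurable)
  define D where "D n \<omega> = simple_integral W (F (Suc n)) \<omega> - simple_integral W (F n) \<omega>" for n \<omega>
  have [measurable]: "D n \<in> borel_measurable M" for n unfolding D_def by measurable
  have D: "prob_dist M (D n) \<le> ennreal ((1/2) ^ n)" for n
  proof -
    let ?E = "F (Suc n) @ scale_list (- 1) (F n)"
    have E: "snd ` set ?E \<subseteq> finite_sets" using F(1) by (simp add: image_Un scale_list_sets)
    have sE: "simple_fun ?E = (\<lambda>z. simple_fun (F (Suc n)) z - simple_fun (F n) z)"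
      "simple_integral W ?E = D n"
      by (auto simp: D_def simple_fun_append simple_integral_append simple_fun_scale simple_integral_scale)
    have "L_modular \<alpha> (simple_fun ?E) \<le> ennreal (2 powr \<alpha>) *
        (L_modular \<alpha> (\<lambda>z. simple_fun (F (Suc n)) z - f z) + L_modular \<alpha> (\<lambda>z. simple_fun (F n) z - f z))"
      unfolding sE by (rule L_modular_diff_triangle) (auto simp: \<alpha>_pos)
    also have "\<dots> < ennreal (2 powr \<alpha>) * (ennreal (\<epsilon> (Suc n)) + ennreal (\<epsilon> n))"
      using F(2) by (intro ennreal_mult_strict_left_mono add_strict_mono) auto
    also have "\<dots> = ennreal (2 powr \<alpha> * (\<epsilon> (Suc n) + \<epsilon> n))"
      using \<epsilon>(1) by (simp add: ennreal_mult[symmetric] ennreal_plus[symmetric] less_imp_le del: ennreal_plus)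
    also have "\<dots> \<le> ennreal (\<eta> n)"
    proof (rule ennreal_leI)
      have "\<epsilon> (Suc n) \<le> \<epsilon> n" using \<epsilon>(3) by (simp add: decseq_Suc_iff)
      then have "2 powr \<alpha> * (\<epsilon> (Suc n) + \<epsilon> n) \<le> 2 powr \<alpha> * (2 * (\<eta> n / (2 * 2 powr \<alpha>)))"
        using \<epsilon>(2)[of n] by (intro mult_left_mono) auto
      then show "2 powr \<alpha> * (\<epsilon> (Suc n) + \<epsilon> n) \<le> \<eta> n" by simp
    qed
    finally show ?thesis using \<eta>(2)[OF E, of n] by (simp add: sE(2))
  qed
  have "(\<Sum>n. prob_dist M (D n)) \<le> (\<Sum>n. ennreal ((1/2) ^ n))"
    by (intro suminf_le D) auto
  also have "\<dots> = ennreal 2"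
    using power_half_series geometric_sums[of "1/2 :: real"] by (intro suminf_ennreal_eq) auto
  also have "\<dots> < \<infinity>" by simp
  finally have "AE \<omega> in M. summable (\<lambda>n. \<bar>D n \<omega>\<bar>)"
    by (intro AE_summable_of_prob_dist) auto
  then have conv: "AE \<omega> in M. convergent (\<lambda>n. simple_integral W (F n) \<omega>)"
    by eventually_elim (auto simp: D_def intro: convergent_of_summable_increments)
  define X where "X \<omega> = lim (\<lambda>n. simple_integral W (F n) \<omega>)" for \<omega>
  have [measurable]: "X \<in> borel_measurable M"
    unfolding X_def by (rule borel_measurable_lim_metric) simp
  have "(\<lambda>n. prob_dist M (\<lambda>\<omega>. simple_integral W (F n) \<omega> - X \<omega>)) \<longlonglongrightarrow> 0"
  proof (rule prob_dist_tendsto_AE)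
    show "AE \<omega> in M. (\<lambda>n. simple_integral W (F n) \<omega> - X \<omega>) \<longlonglongrightarrow> 0"
      using conv
    proof eventually_elim
      case (elim \<omega>)
      then have "(\<lambda>n. simple_integral W (F n) \<omega>) \<longlonglongrightarrow> X \<omega>"
        unfolding X_def convergent_LIMSEQ_iff .
      then show ?case by (rule LIM_zero)
    qed
  qed (auto intro: prob_space_axioms)
  moreover have "(\<lambda>n. L_modular \<alpha> (\<lambda>z. simple_fun (F n) z - f z)) \<longlonglongrightarrow> 0"
  proof (rule tendsto_sandwich[OF _ _ tendsto_const])
    show "(\<lambda>n. ennreal (\<epsilon> n)) \<longlonglongrightarrow> 0" using tendsto_ennrealI[OF \<epsilon>(4)] by simp
  qed (use less_imp_le[OF F(2)] in auto)
  ultimately have "has_stable_integral M \<alpha> W f X"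
    unfolding has_stable_integral_iff using f F(1) by auto
  then show ?thesis by blast
qed

lemma stable_integral:
  "f \<in> L_space \<alpha> \<Longrightarrow> has_stable_integral M \<alpha> W f (stable_integral M \<alpha> W f)"
  unfolding stable_integral_def using has_stable_integral_exists by (rule someI_ex)

lemma expectation_cos_stable_integral:
  assumes X: "has_stable_integral M \<alpha> W f X"
  shows "(LINT \<omega>|M. cos (X \<omega>)) \<le> exp (- enn2real (L_modular \<alpha> f) / 2 powr \<alpha>)"
proof -
  have [measurable]: "f \<in> borel_measurable leb_half" "X \<in> borel_measurable M"
    using X by (auto simp: has_stable_integral_iff L_space_iff)
  have step: "(LINT \<omega>|M. cos (X \<omega>)) \<le> exp (e - enn2real (L_modular \<alpha> f) / 2 powr \<alpha>) + 2 * e" if e: "0 < e" for e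
  proof -
    obtain cs where cs: "snd ` set cs \<subseteq> finite_sets" "L_modular \<alpha> (\<lambda>z. simple_fun cs z - f z) < ennreal e"
      "prob_dist M (\<lambda>\<omega>. simple_integral W cs \<omega> - X \<omega>) < ennreal e"
      using X e unfolding has_stable_integral_approx by blast
    let ?S = "simple_integral W cs"
    note [measurable] = cs(1)[THEN simple_fun_measurable] cs(1)[THEN simple_integral_measurable]
    have fin': "L_modular \<alpha> (simple_fun cs) < \<infinity>" by (rule char_simple_integral(1)[OF cs(1)])
    have "L_modular \<alpha> f = L_modular \<alpha> (\<lambda>z. (f z - simple_fun cs z) + simple_fun cs z)" by simp
    also have "\<dots> \<le> ennreal (2 powr \<alpha>) * (L_modular \<alpha> (\<lambda>z. f z - simple_fun cs z) + L_modular \<alpha> (simple_fun cs))"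
      by (rule L_modular_add) (auto simp: \<alpha>_pos)
    also have "\<dots> \<le> ennreal (2 powr \<alpha>) * (ennreal e + L_modular \<alpha> (simple_fun cs))"
      using cs(2) by (intro mult_left_mono add_right_mono) (auto simp: L_modular_minus_commute[of \<alpha> f])
    finally have le: "L_modular \<alpha> f \<le> ennreal (2 powr \<alpha>) * (ennreal e + L_modular \<alpha> (simple_fun cs))" .
    have "enn2real (L_modular \<alpha> f) \<le> enn2real (ennreal (2 powr \<alpha>) * (ennreal e + L_modular \<alpha> (simple_fun cs)))"
      using fin' by (intro enn2real_mono[OF le]) (auto simp: ennreal_mult_less_top)
    also have "\<dots> = 2 powr \<alpha> * (e + enn2real (L_modular \<alpha> (simple_fun cs)))"
      using fin' e by (simp add: enn2real_mult enn2real_plus)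
    finally have mod: "enn2real (L_modular \<alpha> f) / 2 powr \<alpha> \<le> e + enn2real (L_modular \<alpha> (simple_fun cs))"
      by (simp add: field_simps)
    have icos: "integrable M (\<lambda>\<omega>. cos (Z \<omega>))" if [measurable]: "Z \<in> borel_measurable M" for Z :: "'w \<Rightarrow> real"
      by (rule integrable_const_bound[where B=1]) auto
    have imin: "integrable M (\<lambda>\<omega>. min 1 \<bar>?S \<omega> - X \<omega>\<bar>)"
      by (rule integrable_const_bound[where B=1]) auto
    have "(LINT \<omega>|M. cos (X \<omega>)) - (LINT \<omega>|M. cos (?S \<omega>)) = (LINT \<omega>|M. cos (X \<omega>) - cos (?S \<omega>))"
      by (rule Bochner_Integration.integral_diff[symmetric]) (auto intro: icos)
    also have "\<dots> \<le> (LINT \<omega>|M. 2 * min 1 \<bar>?S \<omega> - X \<omega>\<bar>)"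
      by (intro integral_mono integrable_mult_right imin Bochner_Integration.integrable_diff icos cos_diff_le) auto
    also have "\<dots> \<le> 2 * e"
    proof -
      have "ennreal (LINT \<omega>|M. min 1 \<bar>?S \<omega> - X \<omega>\<bar>) = prob_dist M (\<lambda>\<omega>. ?S \<omega> - X \<omega>)"
        unfolding prob_dist_def using imin by (intro nn_integral_eq_integral[symmetric]) auto
      then have "ennreal (LINT \<omega>|M. min 1 \<bar>?S \<omega> - X \<omega>\<bar>) < ennreal e" using cs(3) by simp
      then show ?thesis using e by (simp add: ennreal_less_iff)
    qed
    finally have "(LINT \<omega>|M. cos (X \<omega>)) \<le> (LINT \<omega>|M. cos (?S \<omega>)) + 2 * e" by simp
    also have "(LINT \<omega>|M. cos (?S \<omega>)) = exp (- enn2real (L_modular \<alpha> (simple_fun cs)))"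
      using Re_char_distr[of M ?S 1] char_simple_integral(2)[OF cs(1), of 1] prob_space_axioms by simp
    also have "\<dots> \<le> exp (e - enn2real (L_modular \<alpha> f) / 2 powr \<alpha>)" using mod by simp
    finally show ?thesis by simp
  qed
  let ?a = "enn2real (L_modular \<alpha> f) / 2 powr \<alpha>"
  have "(\<lambda>n. exp (inverse (real (Suc n)) - ?a) + 2 * inverse (real (Suc n))) \<longlonglongrightarrow> exp (0 - ?a) + 2 * 0"
    by (intro tendsto_intros LIMSEQ_inverse_real_of_nat)
  then have "(LINT \<omega>|M. cos (X \<omega>)) \<le> exp (0 - ?a) + 2 * 0"
    by (rule LIMSEQ_le_const) (use step in auto)
  then show ?thesis by simp
qed

lemma L_modular_small_of_prob_dist:
  assumes e: "0 < e"
  shows "\<exists>\<eta>>0. \<forall>f X. has_stable_integral M \<alpha> W f X \<longrightarrow> prob_dist M X < ennreal \<eta> \<longrightarrow> L_modular \<alpha> f < ennreal e"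
proof -
  define \<eta> where "\<eta> = (1 - exp (- e / 2 powr \<alpha>)) / 2"
  have \<eta>: "0 < \<eta>" unfolding \<eta>_def using e by simp
  show ?thesis
  proof (intro exI[of _ \<eta>] conjI \<eta> allI impI)
    fix f :: "real \<times> (real ^ 'n) \<Rightarrow> real" and X
    assume X: "has_stable_integral M \<alpha> W f X" and small: "prob_dist M X < ennreal \<eta>"
    have [measurable]: "X \<in> borel_measurable M" and fin: "L_modular \<alpha> f < \<infinity>"
      using X by (auto simp: has_stable_integral_iff L_space_iff)
    have imin: "integrable M (\<lambda>\<omega>. min 1 \<bar>X \<omega>\<bar>)"
      by (rule integrable_const_bound[where B=1]) auto
    have icos: "integrable M (\<lambda>\<omega>. cos (X \<omega>))"
      by (rule integrable_const_bound[where B=1]) auto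
    have "ennreal (LINT \<omega>|M. min 1 \<bar>X \<omega>\<bar>) = prob_dist M X"
      unfolding prob_dist_def using imin by (intro nn_integral_eq_integral[symmetric]) auto
    then have "ennreal (LINT \<omega>|M. min 1 \<bar>X \<omega>\<bar>) < ennreal \<eta>" using small by simp
    then have lt: "(LINT \<omega>|M. min 1 \<bar>X \<omega>\<bar>) < \<eta>" by (simp add: ennreal_less_iff)
    have "1 - (LINT \<omega>|M. cos (X \<omega>)) = (LINT \<omega>|M. 1 - cos (X \<omega>))"
      using icos by (simp add: prob_space)
    also have "\<dots> \<le> (LINT \<omega>|M. 2 * min 1 \<bar>X \<omega>\<bar>)"
      using imin icos by (intro integral_mono one_minus_cos_le) auto
    also have "\<dots> < 1 - exp (- e / 2 powr \<alpha>)" using lt by (simp add: \<eta>_def)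
    finally have "exp (- e / 2 powr \<alpha>) < exp (- enn2real (L_modular \<alpha> f) / 2 powr \<alpha>)"
      using expectation_cos_stable_integral[OF X] by linarith
    then have "enn2real (L_modular \<alpha> f) < e" by (simp add: divide_simps)
    then show "L_modular \<alpha> f < ennreal e" using fin e
      by (metis enn2real_nonneg ennreal_enn2real_if ennreal_less_iff infinity_ennreal_def less_irrefl)
  qed
qed

lemma has_stable_integral_limit:
  assumes X: "\<And>n. has_stable_integral M \<alpha> W (f n) (X n)"
    and f[measurable]: "f' \<in> borel_measurable leb_half" and X'[measurable]: "X' \<in> borel_measurable M"
    and fin: "f' \<in> L_space \<alpha>"
    and L: "(\<lambda>n. L_modular \<alpha> (\<lambda>z. f n z - f' z)) \<longlonglongrightarrow> 0"
    and P: "(\<lambda>n. prob_dist M (\<lambda>\<omega>. X n \<omega> - X' \<omega>)) \<longlonglongrightarrow> 0"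
  shows "has_stable_integral M \<alpha> W f' X'"
proof -
  have [measurable]: "f n \<in> borel_measurable leb_half" "X n \<in> borel_measurable M" for n
    using X[of n] by (auto simp: has_stable_integral_iff L_space_iff)
  have "\<exists>cs. snd ` set cs \<subseteq> finite_sets \<and> L_modular \<alpha> (\<lambda>z. simple_fun cs z - f' z) < ennreal e \<and>
      prob_dist M (\<lambda>\<omega>. simple_integral W cs \<omega> - X' \<omega>) < ennreal e" if e: "0 < e" for e
  proof -
    define r where "r = min (e / 2) (e / (2 * 2 powr \<alpha>))"
    have r: "0 < r" "r + r \<le> e" "2 powr \<alpha> * (r + r) \<le> e"
      using e by (auto simp: r_def min_def field_simps)
    have "eventually (\<lambda>n. L_modular \<alpha> (\<lambda>z. f n z - f' z) < ennreal r \<and>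
        prob_dist M (\<lambda>\<omega>. X n \<omega> - X' \<omega>) < ennreal r) sequentially"
      using L P r(1) unfolding tendsto_ennreal_0_iff by (intro eventually_conj) auto
    then obtain n where n: "L_modular \<alpha> (\<lambda>z. f n z - f' z) < ennreal r"
        "prob_dist M (\<lambda>\<omega>. X n \<omega> - X' \<omega>) < ennreal r"
      unfolding eventually_sequentially by blast
    obtain cs where cs: "snd ` set cs \<subseteq> finite_sets" "L_modular \<alpha> (\<lambda>z. simple_fun cs z - f n z) < ennreal r"
      "prob_dist M (\<lambda>\<omega>. simple_integral W cs \<omega> - X n \<omega>) < ennreal r"
      using X r(1) unfolding has_stable_integral_approx by blast
    note [measurable] = cs(1)[THEN simple_fun_measurable] cs(1)[THEN simple_integral_measurable]
    have "L_modular \<alpha> (\<lambda>z. simple_fun cs z - f' z)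
        \<le> ennreal (2 powr \<alpha>) * (L_modular \<alpha> (\<lambda>z. simple_fun cs z - f n z) + L_modular \<alpha> (\<lambda>z. f' z - f n z))"
      by (rule L_modular_diff_triangle) (auto simp: \<alpha>_pos)
    also have "\<dots> < ennreal (2 powr \<alpha>) * (ennreal r + ennreal r)"
      using cs(2) n(1)
      by (intro ennreal_mult_strict_left_mono add_strict_mono) (auto simp: L_modular_minus_commute[of \<alpha> f'])
    also have "\<dots> \<le> ennreal e"
      using r by (simp add: ennreal_mult[symmetric] ennreal_plus[symmetric] ennreal_leI del: ennreal_plus)
    finally have 1: "L_modular \<alpha> (\<lambda>z. simple_fun cs z - f' z) < ennreal e" .
    have "prob_dist M (\<lambda>\<omega>. simple_integral W cs \<omega> - X' \<omega>)
        = prob_dist M (\<lambda>\<omega>. (simple_integral W cs \<omega> - X n \<omega>) + (X n \<omega> - X' \<omega>))" by simp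
    also have "\<dots> \<le> prob_dist M (\<lambda>\<omega>. simple_integral W cs \<omega> - X n \<omega>) + prob_dist M (\<lambda>\<omega>. X n \<omega> - X' \<omega>)"
      by (rule prob_dist_triangle) auto
    also have "\<dots> < ennreal r + ennreal r" using cs(3) n(2) by (rule add_strict_mono)
    also have "\<dots> \<le> ennreal e"
      using r by (simp add: ennreal_plus[symmetric] ennreal_leI del: ennreal_plus)
    finally show ?thesis using cs(1) 1 by blast
  qed
  then show ?thesis unfolding has_stable_integral_approx using fin by simp
qed

text \<open>Convergence of the integrals makes the integrands Cauchy in \<open>L\<^sup>\<alpha>\<close>, and Fatou's lemma
  identifies their limit with the pointwise limit.\<close>

lemma has_stable_integral_pointwise_limit:
  assumes X: "\<And>n. has_stable_integral M \<alpha> W (f n) (X n)"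
    and f'[measurable]: "f' \<in> borel_measurable leb_half" and X'[measurable]: "X' \<in> borel_measurable M"
    and lim: "AE z in leb_half. (\<lambda>n. f n z) \<longlonglongrightarrow> f' z"
    and P: "(\<lambda>n. prob_dist M (\<lambda>\<omega>. X n \<omega> - X' \<omega>)) \<longlonglongrightarrow> 0"
  shows "has_stable_integral M \<alpha> W f' X'"
proof -
  have [measurable]: "f n \<in> borel_measurable leb_half" "X n \<in> borel_measurable M" for n
    using X[of n] by (auto simp: has_stable_integral_iff L_space_iff)
  have cauchy: "\<exists>N. \<forall>n\<ge>N. L_modular \<alpha> (\<lambda>z. f n z - f' z) \<le> ennreal e" if e: "0 < e" for e
  proof -
    obtain \<eta> where \<eta>: "0 < \<eta>" "\<And>f X. has_stable_integral M \<alpha> W f X \<Longrightarrow> prob_dist M X < ennreal \<eta> \<Longrightarrow>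
        L_modular \<alpha> f < ennreal e"
      using L_modular_small_of_prob_dist[OF e] by blast
    have "eventually (\<lambda>n. prob_dist M (\<lambda>\<omega>. X n \<omega> - X' \<omega>) < ennreal (\<eta> / 2)) sequentially"
      using P \<eta>(1) unfolding tendsto_ennreal_0_iff by simp
    then obtain N where N: "\<And>n. N \<le> n \<Longrightarrow> prob_dist M (\<lambda>\<omega>. X n \<omega> - X' \<omega>) < ennreal (\<eta> / 2)"
      unfolding eventually_sequentially by blast
    have nm: "L_modular \<alpha> (\<lambda>z. f n z - f m z) < ennreal e" if "N \<le> n" "N \<le> m" for n m
    proof -
      have "has_stable_integral M \<alpha> W (\<lambda>z. 1 * f n z + (- 1) * f m z) (\<lambda>\<omega>. 1 * X n \<omega> + (- 1) * X m \<omega>)"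
        by (rule has_stable_integral_linear) (rule X)+
      then have h: "has_stable_integral M \<alpha> W (\<lambda>z. f n z - f m z) (\<lambda>\<omega>. X n \<omega> - X m \<omega>)" by simp
      have "prob_dist M (\<lambda>\<omega>. X n \<omega> - X m \<omega>)
          = prob_dist M (\<lambda>\<omega>. (X n \<omega> - X' \<omega>) + - (X m \<omega> - X' \<omega>))" by simp
      also have "\<dots> \<le> prob_dist M (\<lambda>\<omega>. X n \<omega> - X' \<omega>) + prob_dist M (\<lambda>\<omega>. - (X m \<omega> - X' \<omega>))"
        by (rule prob_dist_triangle) auto
      also have "\<dots> < ennreal (\<eta> / 2) + ennreal (\<eta> / 2)"
        unfolding prob_dist_minus using that by (intro add_strict_mono N)
      also have "\<dots> = ennreal \<eta>"
        using \<eta>(1) by (simp add: ennreal_plus[symmetric] del: ennreal_plus)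
      finally show ?thesis using \<eta>(2)[OF h] by blast
    qed
    have "L_modular \<alpha> (\<lambda>z. f n z - f' z) \<le> ennreal e" if n: "N \<le> n" for n
    proof -
      have "L_modular \<alpha> (\<lambda>z. f n z - f' z)
          = (\<integral>\<^sup>+z. liminf (\<lambda>m. ennreal (\<bar>f n z - f m z\<bar> powr \<alpha>)) \<partial>leb_half)"
        unfolding L_modular_def
      proof (rule nn_integral_cong_AE)
        show "AE z in leb_half. ennreal (\<bar>f n z - f' z\<bar> powr \<alpha>) = liminf (\<lambda>m. ennreal (\<bar>f n z - f m z\<bar> powr \<alpha>))"
          using lim
        proof eventually_elim
          case (elim z)
          then have "(\<lambda>m. \<bar>f n z - f m z\<bar> powr \<alpha>) \<longlonglongrightarrow> \<bar>f n z - f' z\<bar> powr \<alpha>"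
            using \<alpha>_pos by (intro tendsto_powr' tendsto_rabs tendsto_diff tendsto_const) auto
          then have "(\<lambda>m. ennreal (\<bar>f n z - f m z\<bar> powr \<alpha>)) \<longlonglongrightarrow> ennreal (\<bar>f n z - f' z\<bar> powr \<alpha>)"
            by (rule tendsto_ennrealI)
          then show ?case by (intro lim_imp_Liminf[symmetric]) auto
        qed
      qed
      also have "\<dots> \<le> liminf (\<lambda>m. L_modular \<alpha> (\<lambda>z. f n z - f m z))"
        unfolding L_modular_def by (rule nn_integral_liminf) simp
      also have "\<dots> \<le> liminf (\<lambda>m. ennreal e)"
        using nm[OF n] by (intro Liminf_mono) (auto simp: eventually_sequentially intro!: exI[of _ N] less_imp_le)
      also have "\<dots> = ennreal e" by (simp add: Liminf_const)
      finally show ?thesis .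
    qed
    then show ?thesis by blast
  qed
  have L: "(\<lambda>n. L_modular \<alpha> (\<lambda>z. f n z - f' z)) \<longlonglongrightarrow> 0"
    unfolding tendsto_ennreal_0_iff
  proof (intro allI impI)
    fix e :: real assume "0 < e"
    then obtain N where N: "\<forall>n\<ge>N. L_modular \<alpha> (\<lambda>z. f n z - f' z) \<le> ennreal (e / 2)"
      using cauchy[of "e / 2"] by auto
    have "ennreal (e / 2) < ennreal e" using \<open>0 < e\<close> by (intro ennreal_lessI) auto
    then show "eventually (\<lambda>n. L_modular \<alpha> (\<lambda>z. f n z - f' z) < ennreal e) sequentially"
      unfolding eventually_sequentially using N by (intro exI[of _ N]) (auto intro: le_less_trans)
  qed
  have "f' \<in> L_space \<alpha>"
  proof -
    obtain N where N: "L_modular \<alpha> (\<lambda>z. f N z - f' z) \<le> ennreal 1" using cauchy[of 1] by auto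
    have fN: "L_modular \<alpha> (f N) < \<infinity>" using X[of N] by (auto simp: has_stable_integral_iff L_space_iff)
    have "L_modular \<alpha> f' = L_modular \<alpha> (\<lambda>z. - (f N z - f' z) + f N z)" by simp
    also have "\<dots> \<le> ennreal (2 powr \<alpha>) * (L_modular \<alpha> (\<lambda>z. - (f N z - f' z)) + L_modular \<alpha> (f N))"
      by (rule L_modular_add) (auto simp: \<alpha>_pos)
    also have "\<dots> < \<infinity>"
      unfolding L_modular_minus using fN N by (auto simp: ennreal_mult_less_top intro: le_less_trans)
    finally show ?thesis by (simp add: L_space_iff)
  qed
  from has_stable_integral_limit[OF X f' X' this L P] show ?thesis .
qed

end

section \<open>Smooth bump functions\<close>

lemma Ck_SucI:
  fixes f :: "'a::euclidean_space \<Rightarrow> real"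
  assumes "\<And>x. (f has_derivative f' x) (at x)" "\<And>b. b \<in> Basis \<Longrightarrow> Ck k (\<lambda>x. f' x b)"
  shows "Ck (Suc k) f"
proof -
  have "f' x = frechet_derivative f (at x)" for x
    using assms(1) by (rule frechet_derivative_at)
  moreover have "f differentiable_on UNIV"
    using assms(1) by (auto simp: differentiable_on_def differentiable_def)
  ultimately show ?thesis using assms(2) by simp
qed

lemma Ck_Suc_has_derivative:
  "Ck (Suc k) f \<Longrightarrow> (f has_derivative frechet_derivative f (at x)) (at x)"
  by (auto simp: differentiable_on_def frechet_derivative_works[symmetric])

lemma Ck_Suc_imp_Ck: "Ck (Suc k) f \<Longrightarrow> Ck k f"
proof (induction k arbitrary: f)
  case 0
  then show ?case by (auto intro: differentiable_imp_continuous_on)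
next
  case (Suc k)
  then show ?case by simp
qed

lemma Ck_const: "Ck k (\<lambda>x. c)"
proof (induction k arbitrary: c)
  case (Suc k)
  show ?case by (rule Ck_SucI[where f'="\<lambda>x h. 0"]) (use Suc in auto)
qed simp

lemma Ck_add: "Ck k f \<Longrightarrow> Ck k g \<Longrightarrow> Ck k (\<lambda>x. f x + g x)"
proof (induction k arbitrary: f g)
  case 0
  then show ?case by (simp add: continuous_on_add)
next
  case (Suc k)
  show ?case
    by (rule Ck_SucI, rule has_derivative_add, rule Ck_Suc_has_derivative[OF Suc.prems(1)],
        rule Ck_Suc_has_derivative[OF Suc.prems(2)]) (use Suc in simp)
qed

lemma Ck_mult: "Ck k f \<Longrightarrow> Ck k g \<Longrightarrow> Ck k (\<lambda>x. f x * g x)"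
proof (induction k arbitrary: f g)
  case 0
  then show ?case by (simp add: continuous_on_mult)
next
  case (Suc k)
  have fg: "Ck k f" "Ck k g" using Suc.prems by (auto intro: Ck_Suc_imp_Ck)
  show ?case
    by (rule Ck_SucI, rule has_derivative_mult, rule Ck_Suc_has_derivative[OF Suc.prems(1)],
        rule Ck_Suc_has_derivative[OF Suc.prems(2)])
       (use Suc fg in \<open>auto intro!: Ck_add Suc.IH\<close>)
qed

lemma Ck_sum: "(\<And>i. i \<in> I \<Longrightarrow> Ck k (f i)) \<Longrightarrow> Ck k (\<lambda>x. \<Sum>i\<in>I. f i x)"
  by (induction I rule: infinite_finite_induct) (auto intro: Ck_const Ck_add)

lemma Ck_prod: "(\<And>i. i \<in> I \<Longrightarrow> Ck k (f i)) \<Longrightarrow> Ck k (\<lambda>x. \<Prod>i\<in>I. f i x)"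
  by (induction I rule: infinite_finite_induct) (auto intro: Ck_const Ck_mult)

lemma Ck_compose_affine:
  fixes f :: "'b::euclidean_space \<Rightarrow> real" and L :: "'a::euclidean_space \<Rightarrow> 'b"
  assumes L: "bounded_linear L"
  shows "Ck k f \<Longrightarrow> Ck k (\<lambda>x. f (L x + c))"
proof (induction k arbitrary: f)
  case 0
  then have "continuous_on UNIV f" by simp
  then show ?case
    using bounded_linear.continuous_on[OF L continuous_on_id, of UNIV]
    by (auto intro!: continuous_on_compose2[of UNIV f] continuous_intros)
next
  case (Suc k)
  let ?D = "\<lambda>x. frechet_derivative f (at (L x + c))"
  have d: "((\<lambda>x. L x + c) has_derivative L) (at x)" for x
    using L by (auto intro!: derivative_eq_intros bounded_linear_imp_has_derivative)
  have lin: "linear (frechet_derivative f (at y))" for y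
    using Ck_Suc_has_derivative[OF Suc.prems] by (rule has_derivative_linear)
  have expand: "?D x (L b) = (\<Sum>b'\<in>Basis. (L b \<bullet> b') * ?D x b')" for x b
  proof -
    have "?D x (L b) = ?D x (\<Sum>b'\<in>Basis. (L b \<bullet> b') *\<^sub>R b')" by (simp add: euclidean_representation)
    also have "\<dots> = (\<Sum>b'\<in>Basis. (L b \<bullet> b') * ?D x b')"
      by (simp add: linear_sum[OF lin] linear_cmul[OF lin])
    finally show ?thesis .
  qed
  show ?case
  proof (rule Ck_SucI)
    show "((\<lambda>x. f (L x + c)) has_derivative (\<lambda>h. ?D x (L h))) (at x)" for x
      by (rule has_derivative_compose[OF d]) (rule Ck_Suc_has_derivative[OF Suc.prems])
    show "Ck k (\<lambda>x. ?D x (L b))" for b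
      unfolding expand using Suc by (intro Ck_sum Ck_mult Ck_const Suc.IH) auto
  qed
qed

text \<open>The derivatives of \<open>exp (- 1 / x)\<close> are of the form \<open>p (1 / x) * exp (- 1 / x)\<close>.\<close>

definition flat_fun :: "real poly \<Rightarrow> real \<Rightarrow> real" where
  "flat_fun p x = (if 0 < x then poly p (1 / x) * exp (- (1 / x)) else 0)"

definition flat_deriv :: "real poly \<Rightarrow> real poly" where
  "flat_deriv p = [:0, 0, 1:] * (p - pderiv p)"

lemma power_poly_exp_tendsto_0: "((\<lambda>y. y ^ k * poly p y * exp (- y :: real)) \<longlongrightarrow> 0) at_top"
proof (induction p arbitrary: k)
  case 0
  then show ?case by simp
next
  case (pCons a p)
  have "((\<lambda>y. a * (y ^ k / exp y) + y ^ Suc k * poly p y * exp (- y)) \<longlongrightarrow> a * 0 + 0) at_top"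
    by (intro tendsto_add tendsto_mult tendsto_const tendsto_power_div_exp_0 pCons.IH)
  then show ?case by (simp add: algebra_simps exp_minus divide_inverse)
qed

lemma flat_fun_quotient_tendsto: "((\<lambda>h. flat_fun p h / h) \<longlongrightarrow> 0) (at 0)"
proof -
  have "((\<lambda>h. flat_fun p h / h) \<longlongrightarrow> 0) (at_right 0)"
  proof (rule Lim_transform_eventually)
    show "((\<lambda>h. (inverse h) ^ 1 * poly p (inverse h) * exp (- inverse h)) \<longlongrightarrow> 0) (at_right 0)"
      using power_poly_exp_tendsto_0[of 1 p] filterlim_inverse_at_top_right
      by (rule filterlim_compose)
    show "\<forall>\<^sub>F h in at_right 0. (inverse h) ^ 1 * poly p (inverse h) * exp (- inverse h) = flat_fun p h / h"
      unfolding eventually_at_filter by (auto simp: flat_fun_def divide_inverse mult_ac)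
  qed
  moreover have "((\<lambda>h. flat_fun p h / h) \<longlongrightarrow> 0) (at_left 0)"
    by (rule Lim_transform_eventually[OF tendsto_const])
       (auto simp: flat_fun_def eventually_at_filter)
  ultimately show ?thesis by (simp add: filterlim_at_split)
qed

lemma flat_fun_deriv: "(flat_fun p has_real_derivative flat_fun (flat_deriv p) x) (at x)"
proof -
  consider "x < 0" | "x = 0" | "0 < x" by linarith
  then show ?thesis
  proof cases
    case 1
    have "((\<lambda>x. 0) has_real_derivative flat_fun (flat_deriv p) x) (at x)"
      using 1 by (simp add: flat_fun_def)
    then show ?thesis
      by (rule has_field_derivative_transform_within_open[of _ _ _ "{..<0}"])
         (use 1 in \<open>auto simp: flat_fun_def\<close>)
  next
    case 2
    then show ?thesis
      using flat_fun_quotient_tendsto[of p] by (simp add: has_field_derivative_iff flat_fun_def)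
  next
    case 3
    have "((\<lambda>x. poly p (1 / x) * exp (- (1 / x))) has_real_derivative
        (poly (pderiv p) (1 / x) * (- 1 / x\<^sup>2)) * exp (- (1 / x)) + poly p (1 / x) * (exp (- (1 / x)) * (1 / x\<^sup>2))) (at x)"
      using 3 by (auto intro!: derivative_eq_intros DERIV_chain2[OF poly_DERIV] simp: power2_eq_square)
    moreover have "(poly (pderiv p) (1 / x) * (- 1 / x\<^sup>2)) * exp (- (1 / x)) + poly p (1 / x) * (exp (- (1 / x)) * (1 / x\<^sup>2))
        = flat_fun (flat_deriv p) x"
      using 3 by (simp add: flat_fun_def flat_deriv_def field_simps power2_eq_square)
    ultimately have "((\<lambda>x. poly p (1 / x) * exp (- (1 / x))) has_real_derivative flat_fun (flat_deriv p) x) (at x)"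
      by simp
    then show ?thesis
      by (rule has_field_derivative_transform_within_open[of _ _ _ "{0<..}"])
         (use 3 in \<open>auto simp: flat_fun_def\<close>)
  qed
qed

lemma Ck_flat_fun: "Ck k (flat_fun p)"
proof (induction k arbitrary: p)
  case 0
  have "continuous_on UNIV (flat_fun p)"
    by (rule DERIV_continuous_on) (rule flat_fun_deriv)
  then show ?case by simp
next
  case (Suc k)
  show ?case
  proof (rule Ck_SucI)
    show "(flat_fun p has_derivative (\<lambda>h. flat_fun (flat_deriv p) x * h)) (at x)" for x
      using flat_fun_deriv[of p x] by (simp add: has_field_derivative_def)
  qed (use Suc in simp)
qed

definition bump :: "real \<Rightarrow> real" where
  "bump x = flat_fun 1 (1 + x) * flat_fun 1 (1 - x)"

lemma Ck_bump: "Ck k bump"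
proof -
  have "Ck k (\<lambda>x. flat_fun 1 (x + 1) * flat_fun 1 (- x + 1))"
    by (intro Ck_mult Ck_compose_affine Ck_flat_fun bounded_linear_ident bounded_linear_minus)
  then show ?thesis by (simp add: bump_def[abs_def] add.commute)
qed

lemma bump_nonneg: "0 \<le> bump x" and bump_pos: "0 < bump 0" and bump_eq_0: "1 \<le> \<bar>x\<bar> \<Longrightarrow> bump x = 0"
  by (auto simp: bump_def flat_fun_def)

lemma bump_fun_exists:
  "\<exists>\<psi>::'a::euclidean_space \<Rightarrow> real. (\<forall>k. Ck k \<psi>) \<and> (\<forall>z. 0 \<le> \<psi> z) \<and> (\<forall>z. 1 \<le> norm z \<longrightarrow> \<psi> z = 0) \<and>
    integrable lborel \<psi> \<and> (LINT z|lborel. \<psi> z) = 1"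
proof -
  define \<psi> where "\<psi> z = (\<Prod>b\<in>Basis. bump (real DIM('a) * (z \<bullet> b)))" for z :: 'a
  have Ck: "Ck k \<psi>" for k
  proof -
    have "Ck k (\<lambda>z::'a. bump (real DIM('a) * (z \<bullet> b) + 0))" for b
      by (rule Ck_compose_affine[OF _ Ck_bump])
         (intro bounded_linear_const_mult bounded_linear_inner_left)
    then have "Ck k (\<lambda>z::'a. \<Prod>b\<in>Basis. bump (real DIM('a) * (z \<bullet> b) + 0))"
      by (intro Ck_prod)
    then show ?thesis by (simp add: \<psi>_def[abs_def])
  qed
  have cont: "continuous_on UNIV \<psi>" using Ck[of 0] by simp
  have nonneg: "0 \<le> \<psi> z" for z unfolding \<psi>_def by (intro prod_nonneg bump_nonneg)
  have supp: "\<psi> z = 0" if "1 \<le> norm z" for z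
  proof (rule ccontr)
    assume "\<psi> z \<noteq> 0"
    then have "\<bar>real DIM('a) * (z \<bullet> b)\<bar> < 1" if "b \<in> Basis" for b
      using that bump_eq_0 unfolding \<psi>_def by (force simp: not_le[symmetric])
    then have "\<bar>z \<bullet> b\<bar> < 1 / real DIM('a)" if "b \<in> Basis" for b
      using that by (simp add: abs_mult field_simps)
    then have "(\<Sum>b\<in>Basis. \<bar>z \<bullet> b\<bar>) < (\<Sum>b\<in>(Basis::'a set). 1 / real DIM('a))"
      by (intro sum_strict_mono) auto
    then have "norm z < 1" using norm_le_l1[of z] by simp
    with that show False by simp
  qed
  have int: "integrable lborel \<psi>"
  proof -
    have "set_integrable lborel (cball 0 1) \<psi>"
      unfolding set_integrable_def
      by (intro borel_integrable_compact continuous_on_subset[OF cont]) auto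
    moreover have "(\<lambda>z. indicator (cball 0 1) z *\<^sub>R \<psi> z) = \<psi>"
      using supp by (auto simp: indicator_def fun_eq_iff)
    ultimately show ?thesis by (simp add: set_integrable_def)
  qed
  define c where "c = (LINT z|lborel. \<psi> z)"
  have "c \<noteq> 0"
  proof
    assume "c = 0"
    then have "AE z in lborel. \<psi> z = 0"
      using integral_nonneg_eq_0_iff_AE[OF int] nonneg by (auto simp: c_def)
    then have "AE z in lborel. z \<notin> {z. \<psi> z \<noteq> 0}" by simp
    moreover have op: "open {z. \<psi> z \<noteq> 0}"
      using cont by (intro open_Collect_neq) (auto intro: continuous_on_const)
    ultimately have "{z. \<psi> z \<noteq> 0} \<in> null_sets lborel"
      by (subst AE_iff_null_sets) auto
    then have "negligible {z. \<psi> z \<noteq> 0}"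
      by (simp add: negligible_iff_null_sets null_sets_completionI)
    moreover have "0 \<in> {z. \<psi> z \<noteq> 0}" using bump_pos by (simp add: \<psi>_def)
    ultimately show False using open_not_negligible[OF op] by blast
  qed
  moreover have "0 \<le> c" unfolding c_def using nonneg by simp
  ultimately have c: "0 < c" by simp
  show ?thesis
  proof (intro exI[of _ "\<lambda>z. (1 / c) * \<psi> z"] conjI allI)
    show "Ck k (\<lambda>z. 1 / c * \<psi> z)" for k by (intro Ck_mult Ck_const Ck)
  qed (use c nonneg supp int in \<open>auto simp: c_def[symmetric]\<close>)
qed

definition mollifier :: "(nat \<Rightarrow> 'a::euclidean_space \<Rightarrow> real) \<Rightarrow> bool" where
  "mollifier \<Psi> \<longleftrightarrow> (\<forall>n. (\<forall>k. Ck k (\<Psi> n)) \<and> (\<forall>z. 0 \<le> \<Psi> n z) \<and>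
    (\<forall>z. 1 / real (Suc n) \<le> norm z \<longrightarrow> \<Psi> n z = 0) \<and>
    integrable lborel (\<Psi> n) \<and> (LINT z|lborel. \<Psi> n z) = 1)"

lemma lborel_scale:
  fixes f :: "'a::euclidean_space \<Rightarrow> real"
  assumes f: "integrable lborel f" and c: "0 < c"
  shows "integrable lborel (\<lambda>z. f (c *\<^sub>R z))"
    and "(LINT z|lborel. f (c *\<^sub>R z)) = (1 / c) ^ DIM('a) * (LINT z|lborel. f z)"
proof -
  have eq: "lborel = density (distr lborel borel (\<lambda>x::'a. 0 + (1 / c) *\<^sub>R x)) (\<lambda>_. \<bar>1 / c\<bar> ^ DIM('a))"
    using c by (intro lborel_affine) auto
  have [measurable]: "f \<in> borel_measurable borel" using f by auto
  have i: "integrable (distr lborel borel (\<lambda>x::'a. 0 + (1 / c) *\<^sub>R x)) (\<lambda>z. f (c *\<^sub>R z))"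
    using f c by (subst integrable_distr_eq) auto
  show "integrable lborel (\<lambda>z. f (c *\<^sub>R z))"
    by (subst eq, subst integrable_density) (use i c in auto)
  show "(LINT z|lborel. f (c *\<^sub>R z)) = (1 / c) ^ DIM('a) * (LINT z|lborel. f z)"
    by (subst eq, subst integral_density) (use c in \<open>auto simp: integral_distr\<close>)
qed

lemma mollifier_exists: "\<exists>\<Psi> :: nat \<Rightarrow> 'a::euclidean_space \<Rightarrow> real. mollifier \<Psi>"
proof -
  obtain \<psi> :: "'a \<Rightarrow> real" where \<psi>: "\<And>k. Ck k \<psi>" "\<And>z. 0 \<le> \<psi> z" "\<And>z. 1 \<le> norm z \<Longrightarrow> \<psi> z = 0"
      "integrable lborel \<psi>" "(LINT z|lborel. \<psi> z) = 1"
    using bump_fun_exists by blast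
  define \<Psi> where "\<Psi> n z = real (Suc n) ^ DIM('a) * \<psi> (real (Suc n) *\<^sub>R z)" for n z
  have "Ck k (\<Psi> n)" for k n
  proof -
    have "Ck k (\<lambda>z. real (Suc n) ^ DIM('a) * \<psi> (real (Suc n) *\<^sub>R z + 0))"
      by (intro Ck_mult Ck_const Ck_compose_affine \<psi>(1) bounded_linear_scaleR_right)
    then show ?thesis by (simp add: \<Psi>_def[abs_def])
  qed
  moreover have "\<Psi> n z = 0" if "1 / real (Suc n) \<le> norm z" for n z
  proof -
    have "1 \<le> real (Suc n) * norm z" using that by (simp add: field_simps)
    then have "1 \<le> norm (real (Suc n) *\<^sub>R z)" by (simp only: norm_scaleR abs_of_nat)
    then show ?thesis by (simp only: \<Psi>_def \<psi>(3) mult_zero_right)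
  qed
  moreover have "integrable lborel (\<Psi> n)" for n
    unfolding \<Psi>_def by (intro integrable_mult_right lborel_scale(1) \<psi>(4)) simp
  moreover have "(LINT z|lborel. \<Psi> n z) = 1" for n
  proof -
    have "(LINT z|lborel. \<Psi> n z) = real (Suc n) ^ DIM('a) * (1 / real (Suc n)) ^ DIM('a)"
      unfolding \<Psi>_def using lborel_scale(2)[OF \<psi>(4), of "real (Suc n)"]
      by (simp add: \<psi>(5) del: of_nat_Suc)
    also have "\<dots> = 1" by (subst power_mult_distrib[symmetric]) simp
    finally show ?thesis .
  qed
  moreover have "0 \<le> \<Psi> n z" for n z by (simp add: \<Psi>_def \<psi>(2))
  ultimately show ?thesis unfolding mollifier_def by blast
qed

lemma mollifier_test_function:
  assumes "mollifier \<Psi>"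
  shows "(\<lambda>v. \<Psi> n (z - v)) \<in> test_functions"
proof -
  have "Ck k (\<lambda>v. \<Psi> n (- v + z))" for k
    using assms by (intro Ck_compose_affine bounded_linear_minus bounded_linear_ident)
      (auto simp: mollifier_def)
  moreover have "{v. \<Psi> n (z - v) \<noteq> 0} \<subseteq> cball z 1"
  proof
    fix v assume "v \<in> {v. \<Psi> n (z - v) \<noteq> 0}"
    then have "norm (z - v) < 1 / real (Suc n)" using assms unfolding mollifier_def by force
    also have "\<dots> \<le> 1" by simp
    finally show "v \<in> cball z 1" by (simp add: dist_norm)
  qed
  then have "compact (closure {v. \<Psi> n (z - v) \<noteq> 0})"
    using bounded_subset[OF bounded_cball] by (simp add: compact_closure)
  ultimately show ?thesis by (simp add: test_functions_def)
qed

section \<open>Mollification\<close>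

lemma lborel_translate:
  fixes f :: "'a::euclidean_space \<Rightarrow> real"
  assumes f: "integrable lborel f"
  shows "integrable lborel (\<lambda>z. f (z + h))" and "(LINT z|lborel. f (z + h)) = (LINT z|lborel. f z)"
proof -
  have [measurable]: "f \<in> borel_measurable borel" using f by auto
  have d: "distr lborel borel ((+) h) = lborel" by (rule lborel_distr_plus)
  show "integrable lborel (\<lambda>z. f (z + h))"
    using f by (subst (asm) d[symmetric]) (simp add: integrable_distr_eq add.commute)
  show "(LINT z|lborel. f (z + h)) = (LINT z|lborel. f z)"
    by (subst (2) d[symmetric]) (simp add: integral_distr add.commute)
qed

lemma lborel_reflect_eq: "lborel = distr lborel borel (\<lambda>u. z - u :: 'a::euclidean_space)"
proof -
  have "(lborel :: 'a measure) = density (distr lborel borel (\<lambda>x. z + (- 1) *\<^sub>R x)) (\<lambda>_. ennreal (\<bar>- 1 :: real\<bar> ^ DIM('a)))"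
    by (intro lborel_affine) auto
  then show ?thesis by (simp add: density_1)
qed

lemma lborel_reflect:
  fixes f :: "'a::euclidean_space \<Rightarrow> real"
  assumes [measurable]: "f \<in> borel_measurable borel"
  shows "(LINT z|lborel. f z) = (LINT u|lborel. f (z - u))"
    and "integrable lborel f \<longleftrightarrow> integrable lborel (\<lambda>u. f (z - u))"
proof -
  have m: "(\<lambda>u. z - u) \<in> measurable lborel (borel :: 'a measure)" by simp
  show "(LINT z|lborel. f z) = (LINT u|lborel. f (z - u))"
    using integral_distr[OF m assms] lborel_reflect_eq[of z] by simp
  show "integrable lborel f \<longleftrightarrow> integrable lborel (\<lambda>u. f (z - u))"
    using integrable_distr_eq[OF m assms] lborel_reflect_eq[of z] by simp
qed

definition translation_dist :: "('a::euclidean_space \<Rightarrow> real) \<Rightarrow> 'a \<Rightarrow> real" where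
  "translation_dist f h = (LINT z|lborel. \<bar>f (z + h) - f z\<bar>)"

lemma translation_dist_nonneg: "0 \<le> translation_dist f h"
  by (simp add: translation_dist_def)

lemma translation_dist_integrable:
  fixes f :: "'a::euclidean_space \<Rightarrow> real"
  assumes f: "integrable lborel f"
  shows "integrable lborel (\<lambda>z. \<bar>f (z + h) - f z\<bar>)"
  using Bochner_Integration.integrable_norm[OF Bochner_Integration.integrable_diff[OF lborel_translate(1)[OF f, of h] f]]
  by simp

lemma translation_dist_approx:
  assumes f: "integrable lborel f" and g: "integrable lborel g"
  shows "translation_dist f h \<le> translation_dist g h + 2 * (LINT z|lborel. \<bar>f z - g z\<bar>)"
proof -
  have i: "integrable lborel (\<lambda>z. \<bar>f z - g z\<bar>)" using f g by auto
  note i' = lborel_translate[OF i, of h]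
  have "translation_dist f h
      \<le> (LINT z|lborel. \<bar>g (z + h) - g z\<bar> + (\<bar>f (z + h) - g (z + h)\<bar> + \<bar>f z - g z\<bar>))"
    unfolding translation_dist_def
    by (intro integral_mono Bochner_Integration.integrable_add translation_dist_integrable f g i i'(1)) auto
  also have "\<dots> = translation_dist g h + 2 * (LINT z|lborel. \<bar>f z - g z\<bar>)"
    unfolding translation_dist_def using translation_dist_integrable[OF g, of h] i i' by simp
  finally show ?thesis .
qed

lemma translation_dist_tendsto_approx:
  assumes f: "integrable lborel f"
    and approx: "\<And>e. 0 < e \<Longrightarrow> \<exists>g. integrable lborel g \<and> (\<lambda>n::nat. translation_dist g (h n)) \<longlonglongrightarrow> 0 \<and>
      (LINT z|lborel. \<bar>f z - g z\<bar>) < e"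
  shows "(\<lambda>n. translation_dist f (h n)) \<longlonglongrightarrow> 0"
proof (rule order_tendstoI)
  fix a :: real assume "0 < a"
  then obtain g where g: "integrable lborel g" "(\<lambda>n. translation_dist g (h n)) \<longlonglongrightarrow> 0"
      "(LINT z|lborel. \<bar>f z - g z\<bar>) < a / 4"
    using approx[of "a / 4"] by auto
  have "eventually (\<lambda>n. translation_dist g (h n) < a / 2) sequentially"
    using g(2) \<open>0 < a\<close> by (intro order_tendstoD(2)) auto
  then show "eventually (\<lambda>n. translation_dist f (h n) < a) sequentially"
  proof eventually_elim
    case (elim n)
    then show ?case using translation_dist_approx[OF f g(1), of "h n"] g(3) by linarith
  qed
next
  fix a :: real assume "a < 0"
  then show "eventually (\<lambda>n. a < translation_dist f (h n)) sequentially"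
    by (simp add: less_le_trans[OF _ translation_dist_nonneg])
qed

lemma translation_dist_open:
  fixes U :: "'a::euclidean_space set"
  assumes U: "open U" "emeasure lborel U < \<infinity>" and h: "h \<longlonglongrightarrow> 0"
  shows "(\<lambda>n. translation_dist (indicator U) (h n)) \<longlonglongrightarrow> 0"
proof -
  let ?f = "indicator U :: 'a \<Rightarrow> real"
  have [measurable]: "U \<in> sets borel" using U by auto
  have i: "integrable lborel ?f" using U by (simp add: integrable_indicator_iff)
  have m: "integrable lborel (\<lambda>z. min (?f (z + h n)) (?f z))" for n
    by (rule Bochner_Integration.integrable_bound[OF i]) (auto simp: indicator_def)
  have "(\<lambda>n. LINT z|lborel. min (?f (z + h n)) (?f z)) \<longlonglongrightarrow> (LINT z|lborel. ?f z)"
  proof (rule integral_dominated_convergence[where w="?f"])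
    show "AE z in lborel. (\<lambda>n. min (?f (z + h n)) (?f z)) \<longlonglongrightarrow> ?f z"
    proof (rule AE_I2)
      fix z
      show "(\<lambda>n. min (?f (z + h n)) (?f z)) \<longlonglongrightarrow> ?f z"
      proof (cases "z \<in> U")
        case True
        have "(\<lambda>n. z + h n) \<longlonglongrightarrow> z + 0" by (intro tendsto_intros h)
        then have "eventually (\<lambda>n. z + h n \<in> U) sequentially"
          using U(1) True by (intro topological_tendstoD) auto
        then have "eventually (\<lambda>n. min (?f (z + h n)) (?f z) = ?f z) sequentially"
          by eventually_elim (simp add: True)
        then show ?thesis by (rule tendsto_eventually)
      next
        case False
        then have "min (?f (z + h n)) (?f z) = ?f z" for n by (auto simp: indicator_def)
        then show ?thesis by simp
      qed
    qed
  qed (use i in \<open>auto simp: indicator_def\<close>)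
  then have "(\<lambda>n. 2 * (LINT z|lborel. ?f z) - 2 * (LINT z|lborel. min (?f (z + h n)) (?f z)))
      \<longlonglongrightarrow> 2 * (LINT z|lborel. ?f z) - 2 * (LINT z|lborel. ?f z)"
    by (intro tendsto_intros)
  moreover have "translation_dist ?f (h n)
      = 2 * (LINT z|lborel. ?f z) - 2 * (LINT z|lborel. min (?f (z + h n)) (?f z))" for n
  proof -
    have "translation_dist ?f (h n) = (LINT z|lborel. (?f (z + h n) + ?f z) - 2 * min (?f (z + h n)) (?f z))"
      unfolding translation_dist_def by (intro Bochner_Integration.integral_cong) (auto simp: indicator_def)
    also have "\<dots> = 2 * (LINT z|lborel. ?f z) - 2 * (LINT z|lborel. min (?f (z + h n)) (?f z))"
      using m[of n] i lborel_translate[OF i, of "h n"] by simp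
    finally show ?thesis .
  qed
  ultimately show ?thesis by simp
qed

lemma translation_dist_indicator:
  fixes A :: "'a::euclidean_space set"
  assumes A[measurable]: "A \<in> sets borel" and fin: "emeasure lborel A < \<infinity>" and h: "h \<longlonglongrightarrow> 0"
  shows "(\<lambda>n. translation_dist (indicator A) (h n)) \<longlonglongrightarrow> 0"
proof (rule translation_dist_tendsto_approx)
  show iA: "integrable lborel (indicator A :: 'a \<Rightarrow> real)" using fin by (simp add: integrable_indicator_iff)
  fix e :: real assume "0 < e"
  obtain U where U: "open U" "A \<subseteq> U" "emeasure lborel (U - A) < ennreal e"
    using outer_regular_lborel[OF A \<open>0 < e\<close>] by auto
  have [measurable]: "U \<in> sets borel" using U by auto
  have "emeasure lborel U = emeasure lborel (U - A) + emeasure lborel A"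
    using U(2) by (subst plus_emeasure) (auto simp: Un_absorb2)
  also have "\<dots> < \<infinity>" using U(3) fin by (auto simp: less_top[symmetric])
  finally have finU: "emeasure lborel U < \<infinity>" .
  have "(LINT z|lborel. \<bar>indicator A z - indicator U z :: real\<bar>) = (LINT z|lborel. indicator (U - A) z)"
    using U(2) by (intro Bochner_Integration.integral_cong) (auto simp: indicator_def)
  also have "\<dots> = measure lborel (U - A)" by simp
  also have "\<dots> < e"
  proof -
    have "emeasure lborel (U - A) = ennreal (measure lborel (U - A))"
      using U(3) by (intro emeasure_eq_ennreal_measure) auto
    then have "ennreal (measure lborel (U - A)) < ennreal e" using U(3) by simp
    then show ?thesis by (simp add: ennreal_less_iff)
  qed
  finally show "\<exists>g. integrable lborel g \<and> (\<lambda>n. translation_dist g (h n)) \<longlonglongrightarrow> 0 \<and>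
      (LINT z|lborel. \<bar>indicator A z - g z\<bar>) < e"
    using translation_dist_open[OF U(1) finU h] finU
    by (intro exI[of _ "indicator U"]) (auto simp: integrable_indicator_iff)
qed

lemma translation_dist_tendsto:
  fixes f :: "'a::euclidean_space \<Rightarrow> real"
  assumes "integrable lborel f" and h: "h \<longlonglongrightarrow> 0"
  shows "(\<lambda>n. translation_dist f (h n)) \<longlonglongrightarrow> 0"
  using assms(1)
proof (induction rule: integrable_induct)
  case (base A c)
  have "translation_dist (\<lambda>x. indicator A x *\<^sub>R c) k = \<bar>c\<bar> * translation_dist (indicator A) k" for k
  proof -
    have "translation_dist (\<lambda>x. indicator A x *\<^sub>R c) k
        = (LINT z|lborel. \<bar>c\<bar> * \<bar>indicator A (z + k) - indicator A z\<bar>)"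
      unfolding translation_dist_def
    proof (intro Bochner_Integration.integral_cong refl)
      fix z
      have "indicator A (z + k) *\<^sub>R c - indicator A z *\<^sub>R c = c * (indicator A (z + k) - indicator A z)"
        by (simp add: algebra_simps)
      then show "\<bar>indicator A (z + k) *\<^sub>R c - indicator A z *\<^sub>R c\<bar>
          = \<bar>c\<bar> * \<bar>indicator A (z + k) - indicator A z\<bar>"
        by (simp only: abs_mult)
    qed
    then show ?thesis by (simp add: translation_dist_def)
  qed
  moreover have "(\<lambda>n. \<bar>c\<bar> * translation_dist (indicator A) (h n)) \<longlonglongrightarrow> \<bar>c\<bar> * 0"
    using base by (intro tendsto_mult tendsto_const translation_dist_indicator h) auto
  ultimately show ?case by simp
next
  case (add f g)
  show ?case
  proof (rule tendsto_sandwich[OF _ _ tendsto_const])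
    show "eventually (\<lambda>n. translation_dist (\<lambda>x. f x + g x) (h n)
        \<le> translation_dist f (h n) + translation_dist g (h n)) sequentially"
    proof (intro always_eventually allI)
      fix n
      show "translation_dist (\<lambda>x. f x + g x) (h n) \<le> translation_dist f (h n) + translation_dist g (h n)"
      proof -
        note if_ig = translation_dist_integrable[OF add.hyps(1), of "h n"] translation_dist_integrable[OF add.hyps(2), of "h n"]
        have "translation_dist (\<lambda>x. f x + g x) (h n)
            \<le> (LINT z|lborel. \<bar>f (z + h n) - f z\<bar> + \<bar>g (z + h n) - g z\<bar>)"
          unfolding translation_dist_def
          by (intro integral_mono translation_dist_integrable Bochner_Integration.integrable_add add.hyps) auto
        also have "\<dots> = translation_dist f (h n) + translation_dist g (h n)"
          unfolding translation_dist_def using if_ig by (rule Bochner_Integration.integral_add)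
        finally show ?thesis .
      qed
    qed
    show "(\<lambda>n. translation_dist f (h n) + translation_dist g (h n)) \<longlonglongrightarrow> 0"
      using tendsto_add[OF add.IH(1) add.IH(2)] by simp
  qed (simp_all add: translation_dist_nonneg)
next
  case (lim f s)
  show ?case
  proof (rule translation_dist_tendsto_approx[OF lim.hyps(4)])
    fix e :: real assume "0 < e"
    note [measurable] = borel_measurable_integrable[OF lim.hyps(4)] borel_measurable_integrable[OF lim.hyps(1)]
    have "(\<lambda>i. LINT z|lborel. \<bar>f z - s i z\<bar>) \<longlonglongrightarrow> (LINT z|lborel. (0 :: real) * f z)"
    proof (rule integral_dominated_convergence[where w="\<lambda>z. 3 * \<bar>f z\<bar>"])
      show "AE z in lborel. (\<lambda>i. \<bar>f z - s i z\<bar>) \<longlonglongrightarrow> 0 * f z"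
      proof (rule AE_I2)
        fix z :: 'a
        have "(\<lambda>i. \<bar>f z - s i z\<bar>) \<longlonglongrightarrow> \<bar>f z - f z\<bar>"
          by (rule tendsto_rabs[OF tendsto_diff[OF tendsto_const lim.hyps(2)]]) simp
        then show "(\<lambda>i. \<bar>f z - s i z\<bar>) \<longlonglongrightarrow> 0 * f z" by simp
      qed
      show "AE z in lborel. norm \<bar>f z - s i z\<bar> \<le> 3 * \<bar>f z\<bar>" for i
      proof (rule AE_I2)
        fix z :: 'a
        show "norm \<bar>f z - s i z\<bar> \<le> 3 * \<bar>f z\<bar>"
          using lim.hyps(3)[of z i] abs_triangle_ineq4[of "f z" "s i z"] by simp
      qed
    qed (use lim.hyps(4) in simp_all)
    then have "eventually (\<lambda>i. (LINT z|lborel. \<bar>f z - s i z\<bar>) < e) sequentially"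
      using \<open>0 < e\<close> by (intro order_tendstoD(2)[of _ 0]) auto
    then obtain i where "(LINT z|lborel. \<bar>f z - s i z\<bar>) < e" by (auto simp: eventually_sequentially)
    then show "\<exists>g. integrable lborel g \<and> (\<lambda>n. translation_dist g (h n)) \<longlonglongrightarrow> 0 \<and> (LINT z|lborel. \<bar>f z - g z\<bar>) < e"
      using lim.hyps(1) lim.IH by blast
  qed
qed

lemma translation_dist_small:
  fixes f :: "'a::euclidean_space \<Rightarrow> real"
  assumes f: "integrable lborel f" and e: "0 < e"
  shows "\<exists>N. \<forall>n\<ge>N. \<forall>u. norm u < 1 / real (Suc n) \<longrightarrow> translation_dist f u < e"
proof (rule ccontr)
  assume "\<not> ?thesis"
  then have *: "\<forall>N. \<exists>n\<ge>N. \<exists>u. norm u < 1 / real (Suc n) \<and> \<not> translation_dist f u < e" by blast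
  have "\<exists>u. norm u < 1 / real (Suc N) \<and> \<not> translation_dist f u < e" for N
  proof -
    obtain n u where n: "N \<le> n" "norm u < 1 / real (Suc n)" "\<not> translation_dist f u < e"
      using * by blast
    have "1 / real (Suc n) \<le> 1 / real (Suc N)" using n(1) by (intro divide_left_mono) auto
    with n(2,3) show ?thesis by (intro exI[of _ u]) auto
  qed
  then obtain u where u: "\<And>N. norm (u N) < 1 / real (Suc N)" "\<And>N. \<not> translation_dist f (u N) < e"
    by metis
  have "u \<longlonglongrightarrow> 0"
  proof (rule Lim_null_comparison[OF _ LIMSEQ_inverse_real_of_nat])
    show "eventually (\<lambda>n. norm (u n) \<le> inverse (real (Suc n))) sequentially"
    proof (intro always_eventually allI)
      fix n
      show "norm (u n) \<le> inverse (real (Suc n))"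
        using u(1)[of n] by (simp only: inverse_eq_divide less_imp_le)
    qed
  qed
  from translation_dist_tendsto[OF f this]
  have "eventually (\<lambda>n. translation_dist f (u n) < e) sequentially"
    using e by (rule order_tendstoD(2))
  then show False using u(2) by (auto simp: eventually_sequentially)
qed

lemma mollifierD:
  assumes "mollifier \<Psi>"
  shows "0 \<le> \<Psi> n z" "\<Psi> n z \<noteq> 0 \<Longrightarrow> norm z < 1 / real (Suc n)" "integrable lborel (\<Psi> n)"
    "(LINT z|lborel. \<Psi> n z) = 1" "continuous_on UNIV (\<Psi> n)" "\<Psi> n \<in> borel_measurable borel"
    "\<exists>B. \<forall>z. \<bar>\<Psi> n z\<bar> \<le> B" "(\<integral>\<^sup>+z. ennreal (\<Psi> n z) \<partial>lborel) = 1"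
proof -
  have *: "\<forall>k. Ck k (\<Psi> n)" "\<forall>z. 0 \<le> \<Psi> n z" "\<forall>z. 1 / real (Suc n) \<le> norm z \<longrightarrow> \<Psi> n z = 0"
     "integrable lborel (\<Psi> n)" "(LINT z|lborel. \<Psi> n z) = 1"
    using assms by (auto simp: mollifier_def)
  then show "0 \<le> \<Psi> n z" "\<Psi> n z \<noteq> 0 \<Longrightarrow> norm z < 1 / real (Suc n)" "integrable lborel (\<Psi> n)"
      "(LINT z|lborel. \<Psi> n z) = 1"
    by (auto simp: not_le[symmetric] simp del: of_nat_Suc)
  show c: "continuous_on UNIV (\<Psi> n)" using *(1)[rule_format, of 0] by simp
  then show "\<Psi> n \<in> borel_measurable borel" by (rule borel_measurable_continuous_onI)
  have "bounded (\<Psi> n ` cball 0 1)"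
    by (intro compact_imp_bounded compact_continuous_image continuous_on_subset[OF c]) auto
  then obtain B where B0: "\<forall>z\<in>cball 0 1. \<bar>\<Psi> n z\<bar> \<le> B" by (auto simp: bounded_iff)
  have B: "\<bar>\<Psi> n z\<bar> \<le> B" if "norm z \<le> 1" for z using B0 that by simp
  have "\<bar>\<Psi> n z\<bar> \<le> max B 0" for z
  proof (cases "norm z \<le> 1")
    case False
    have "1 / real (Suc n) \<le> 1" by simp
    then have "1 / real (Suc n) \<le> norm z" using False by linarith
    then have "\<Psi> n z = 0" using *(3) by blast
    then show ?thesis by simp
  qed (use B in \<open>auto simp: le_max_iff_disj\<close>)
  then show "\<exists>B. \<forall>z. \<bar>\<Psi> n z\<bar> \<le> B" by blast
  show "(\<integral>\<^sup>+z. ennreal (\<Psi> n z) \<partial>lborel) = 1"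
    using * by (subst nn_integral_eq_integral) auto
qed

lemma mollify_L1:
  fixes f :: "'a::euclidean_space \<Rightarrow> real"
  assumes f: "integrable lborel f" and \<Psi>: "mollifier \<Psi>"
  shows "(\<lambda>n. \<integral>\<^sup>+z. ennreal \<bar>(LINT v|lborel. f v * \<Psi> n (z - v)) - f z\<bar> \<partial>lborel) \<longlonglongrightarrow> 0"
  unfolding tendsto_ennreal_0_iff
proof (intro allI impI)
  fix e :: real assume e: "0 < e"
  have [measurable]: "f \<in> borel_measurable borel" using f by auto
  note [measurable] = mollifierD(6)[OF \<Psi>]
  obtain N where N: "\<And>n u. N \<le> n \<Longrightarrow> norm u < 1 / real (Suc n) \<Longrightarrow> translation_dist f u < e / 2"
    using translation_dist_small[OF f, of "e / 2"] e by auto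
  have "(\<integral>\<^sup>+z. ennreal \<bar>(LINT v|lborel. f v * \<Psi> n (z - v)) - f z\<bar> \<partial>lborel) < ennreal e" if n: "N \<le> n" for n
  proof -
    obtain B where B: "\<And>z. \<bar>\<Psi> n z\<bar> \<le> B" using mollifierD(7)[OF \<Psi>] by blast
    have pt: "ennreal \<bar>(LINT v|lborel. f v * \<Psi> n (z - v)) - f z\<bar>
        \<le> (\<integral>\<^sup>+u. ennreal (\<bar>f (z - u) - f z\<bar> * \<Psi> n u) \<partial>lborel)" for z
    proof -
      have i1: "integrable lborel (\<lambda>u. f (z - u) * \<Psi> n u)"
      proof (rule Bochner_Integration.integrable_bound)
        show "integrable lborel (\<lambda>u. B * f (z - u))"
          using f lborel_reflect(2)[of f z] by simp
        show "AE u in lborel. norm (f (z - u) * \<Psi> n u) \<le> norm (B * f (z - u))"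
        proof (rule AE_I2)
          fix u
          have "0 \<le> B" using B[of 0] by linarith
          then show "norm (f (z - u) * \<Psi> n u) \<le> norm (B * f (z - u))"
            using B[of u] by (simp add: abs_mult mult.commute mult_right_mono)
        qed
      qed simp
      have i2: "integrable lborel (\<lambda>u. f z * \<Psi> n u)" using mollifierD(3)[OF \<Psi>] by simp
      have "(LINT v|lborel. f v * \<Psi> n (z - v)) = (LINT u|lborel. f (z - u) * \<Psi> n u)"
        by (subst lborel_reflect(1)[of _ z]) simp_all
      then have "(LINT v|lborel. f v * \<Psi> n (z - v)) - f z = (LINT u|lborel. f (z - u) * \<Psi> n u - f z * \<Psi> n u)"
        using i1 i2 mollifierD(4)[OF \<Psi>] by simp
      then have "\<bar>(LINT v|lborel. f v * \<Psi> n (z - v)) - f z\<bar> \<le> (LINT u|lborel. \<bar>f (z - u) * \<Psi> n u - f z * \<Psi> n u\<bar>)"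
        using integral_abs_bound[of lborel "\<lambda>u. f (z - u) * \<Psi> n u - f z * \<Psi> n u"] by simp
      then have "ennreal \<bar>(LINT v|lborel. f v * \<Psi> n (z - v)) - f z\<bar>
          \<le> ennreal (LINT u|lborel. \<bar>f (z - u) * \<Psi> n u - f z * \<Psi> n u\<bar>)" by (rule ennreal_leI)
      also have "\<dots> = (\<integral>\<^sup>+u. ennreal \<bar>f (z - u) * \<Psi> n u - f z * \<Psi> n u\<bar> \<partial>lborel)"
        using i1 i2 by (intro nn_integral_eq_integral[symmetric]) auto
      also have "\<dots> = (\<integral>\<^sup>+u. ennreal (\<bar>f (z - u) - f z\<bar> * \<Psi> n u) \<partial>lborel)"
        using mollifierD(1)[OF \<Psi>, of n]
        by (intro nn_integral_cong) (simp add: abs_mult left_diff_distrib[symmetric])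
      finally show ?thesis .
    qed
    have "(\<integral>\<^sup>+z. ennreal \<bar>(LINT v|lborel. f v * \<Psi> n (z - v)) - f z\<bar> \<partial>lborel)
        \<le> (\<integral>\<^sup>+z. \<integral>\<^sup>+u. ennreal (\<bar>f (z - u) - f z\<bar> * \<Psi> n u) \<partial>lborel \<partial>lborel)"
      by (intro nn_integral_mono pt)
    also have "\<dots> = (\<integral>\<^sup>+u. \<integral>\<^sup>+z. ennreal (\<bar>f (z - u) - f z\<bar> * \<Psi> n u) \<partial>lborel \<partial>lborel)"
      by (intro lborel_pair.Fubini') measurable
    also have "\<dots> \<le> (\<integral>\<^sup>+u. ennreal (e / 2) * ennreal (\<Psi> n u) \<partial>lborel)"
    proof (intro nn_integral_mono)
      fix u :: 'a
      have "(\<integral>\<^sup>+z. ennreal (\<bar>f (z - u) - f z\<bar> * \<Psi> n u) \<partial>lborel)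
          = ennreal (translation_dist f (- u)) * ennreal (\<Psi> n u)"
        unfolding translation_dist_def using translation_dist_integrable[OF f, of "- u"] mollifierD(1)[OF \<Psi>]
        by (subst nn_integral_eq_integral[symmetric])
           (auto simp: ennreal_mult nn_integral_multc)
      also have "\<dots> \<le> ennreal (e / 2) * ennreal (\<Psi> n u)"
      proof (cases "\<Psi> n u = 0")
        case False
        then have "translation_dist f (- u) < e / 2"
          using mollifierD(2)[OF \<Psi>] by (intro N[OF n]) simp
        then show ?thesis by (intro mult_right_mono ennreal_leI) auto
      qed simp
      finally show "(\<integral>\<^sup>+z. ennreal (\<bar>f (z - u) - f z\<bar> * \<Psi> n u) \<partial>lborel) \<le> ennreal (e / 2) * ennreal (\<Psi> n u)" .
    qed
    also have "\<dots> = ennreal (e / 2)"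
      using mollifierD(8)[OF \<Psi>] by (simp add: nn_integral_cmult)
    also have "\<dots> < ennreal e" using e by (intro ennreal_lessI) auto
    finally show ?thesis .
  qed
  then show "eventually (\<lambda>n. (\<integral>\<^sup>+z. ennreal \<bar>(LINT v|lborel. f v * \<Psi> n (z - v)) - f z\<bar> \<partial>lborel) < ennreal e) sequentially"
    unfolding eventually_sequentially by blast
qed

lemma mollify_L1_local:
  fixes f :: "'a::euclidean_space \<Rightarrow> real"
  assumes f: "set_integrable lborel (cball 0 (R + 1)) f" and \<Psi>: "mollifier \<Psi>"
  shows "(\<lambda>n. \<integral>\<^sup>+z\<in>cball 0 R. ennreal \<bar>(LINT v|lborel. f v * \<Psi> n (z - v)) - f z\<bar> \<partial>lborel) \<longlonglongrightarrow> 0"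
proof -
  define g where "g v = indicator (cball 0 (R + 1)) v * f v" for v
  have g: "integrable lborel g" using f by (simp add: set_integrable_def g_def[abs_def])
  show ?thesis
  proof (rule tendsto_sandwich[OF _ _ tendsto_const mollify_L1[OF g \<Psi>]])
    show "eventually (\<lambda>n. (\<integral>\<^sup>+z\<in>cball 0 R. ennreal \<bar>(LINT v|lborel. f v * \<Psi> n (z - v)) - f z\<bar> \<partial>lborel)
        \<le> (\<integral>\<^sup>+z. ennreal \<bar>(LINT v|lborel. g v * \<Psi> n (z - v)) - g z\<bar> \<partial>lborel)) sequentially"
    proof (intro always_eventually allI nn_integral_mono)
      fix n and z :: 'a
      show "ennreal \<bar>(LINT v|lborel. f v * \<Psi> n (z - v)) - f z\<bar> * indicator (cball 0 R) z
          \<le> ennreal \<bar>(LINT v|lborel. g v * \<Psi> n (z - v)) - g z\<bar>"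
      proof (cases "z \<in> cball 0 R")
        case True
        have "f v * \<Psi> n (z - v) = g v * \<Psi> n (z - v)" for v
        proof (cases "\<Psi> n (z - v) = 0")
          case False
          then have "norm (z - v) < 1 / real (Suc n)" by (rule mollifierD(2)[OF \<Psi>])
          also have "\<dots> \<le> 1" by simp
          finally have "norm v \<le> R + 1"
            using True norm_triangle_sub[of v z] by (simp add: norm_minus_commute)
          then show ?thesis by (simp add: g_def)
        qed simp
        then have "(LINT v|lborel. f v * \<Psi> n (z - v)) = (LINT v|lborel. g v * \<Psi> n (z - v))"
          by (intro Bochner_Integration.integral_cong refl)
        moreover have "g z = f z" using True by (simp add: g_def)
        ultimately show ?thesis using True by simp
      qed simp
    qed
  qed auto
qed

lemma mollify_pointwise:
  fixes g :: "'a::euclidean_space \<Rightarrow> real"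
  assumes \<Psi>: "mollifier \<Psi>" and [measurable]: "g \<in> borel_measurable borel" and cont: "isCont g z"
  shows "(\<lambda>n. LINT v|lborel. g v * \<Psi> n (z - v)) \<longlonglongrightarrow> g z"
proof (rule LIMSEQ_I)
  fix e :: real assume e: "0 < e"
  note [measurable] = mollifierD(6)[OF \<Psi>]
  obtain d where d: "0 < d" "\<And>v. dist v z < d \<Longrightarrow> \<bar>g v - g z\<bar> < e / 2"
    using cont e unfolding continuous_at_eps_delta dist_real_def by (metis half_gt_zero)
  obtain N where N: "1 / real (Suc N) < d" using d(1) nat_approx_posE by blast
  have "norm ((LINT v|lborel. g v * \<Psi> n (z - v)) - g z) < e" if n: "N \<le> n" for n
  proof -
    have i0: "integrable lborel (\<lambda>v. \<Psi> n (z - v))" and I0: "(LINT v|lborel. \<Psi> n (z - v)) = 1"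
      using mollifierD(3,4)[OF \<Psi>, of n] lborel_reflect[of "\<Psi> n" z] by auto
    have bd: "\<bar>g v - g z\<bar> * \<Psi> n (z - v) \<le> e / 2 * \<Psi> n (z - v)" for v
    proof (cases "\<Psi> n (z - v) = 0")
      case False
      then have "norm (z - v) < 1 / real (Suc n)" by (rule mollifierD(2)[OF \<Psi>])
      also have "\<dots> \<le> 1 / real (Suc N)" using n by (intro divide_left_mono) auto
      also have "\<dots> < d" by (rule N)
      finally have "\<bar>g v - g z\<bar> < e / 2" by (intro d(2)) (simp add: dist_norm norm_minus_commute)
      then show ?thesis using mollifierD(1)[OF \<Psi>] by (intro mult_right_mono) auto
    qed simp
    have i1: "integrable lborel (\<lambda>v. (g v - g z) * \<Psi> n (z - v))"
    proof (rule Bochner_Integration.integrable_bound)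
      show "integrable lborel (\<lambda>v. e / 2 * \<Psi> n (z - v))" using i0 by simp
      show "AE v in lborel. norm ((g v - g z) * \<Psi> n (z - v)) \<le> norm (e / 2 * \<Psi> n (z - v))"
        using bd e mollifierD(1)[OF \<Psi>, of n] by (intro AE_I2) (simp add: abs_mult)
    qed simp
    have "(LINT v|lborel. g v * \<Psi> n (z - v)) = (LINT v|lborel. (g v - g z) * \<Psi> n (z - v) + g z * \<Psi> n (z - v))"
      by (simp add: algebra_simps)
    also have "\<dots> = (LINT v|lborel. (g v - g z) * \<Psi> n (z - v)) + g z"
      using i0 i1 I0 by simp
    finally have "norm ((LINT v|lborel. g v * \<Psi> n (z - v)) - g z) = \<bar>LINT v|lborel. (g v - g z) * \<Psi> n (z - v)\<bar>"
      by simp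
    also have "\<dots> \<le> (LINT v|lborel. \<bar>(g v - g z) * \<Psi> n (z - v)\<bar>)" by (rule integral_abs_bound)
    also have "\<dots> \<le> (LINT v|lborel. e / 2 * \<Psi> n (z - v))"
    proof (rule integral_mono)
      show "integrable lborel (\<lambda>v. \<bar>(g v - g z) * \<Psi> n (z - v)\<bar>)"
        using Bochner_Integration.integrable_norm[OF i1] by (simp only: real_norm_def)
      show "integrable lborel (\<lambda>v. e / 2 * \<Psi> n (z - v))" using i0 by simp
      show "\<bar>(g v - g z) * \<Psi> n (z - v)\<bar> \<le> e / 2 * \<Psi> n (z - v)" for v
        using bd[of v] mollifierD(1)[OF \<Psi>, of n] by (simp add: abs_mult)
    qed
    also have "\<dots> = e / 2" using I0 by simp
    also have "\<dots> < e" using e by simp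
    finally show ?thesis .
  qed
  then show "\<exists>no. \<forall>n\<ge>no. norm ((LINT v|lborel. g v * \<Psi> n (z - v)) - g z) < e" by blast
qed

section \<open>Integrals of the heat kernel\<close>

lemma nn_integral_lborel_prod_Basis:
  fixes f :: "real \<Rightarrow> ennreal"
  assumes [measurable]: "f \<in> borel_measurable borel"
  shows "(\<integral>\<^sup>+x. (\<Prod>b\<in>Basis. f (x \<bullet> b)) \<partial>(lborel :: 'a::euclidean_space measure)) = (\<integral>\<^sup>+t. f t \<partial>lborel) ^ DIM('a)"
proof -
  interpret product_sigma_finite "\<lambda>_::'a. lborel :: real measure" ..
  have "(\<integral>\<^sup>+x. (\<Prod>b\<in>Basis. f (x \<bullet> b)) \<partial>(lborel :: 'a measure))
      = (\<integral>\<^sup>+g. (\<Prod>b\<in>Basis. f ((\<Sum>b\<in>Basis. g b *\<^sub>R b) \<bullet> b)) \<partial>(\<Pi>\<^sub>M b\<in>(Basis::'a set). lborel))"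
    by (subst lborel_eq) (simp add: nn_integral_distr)
  also have "\<dots> = (\<integral>\<^sup>+g. (\<Prod>b\<in>Basis. f (g b)) \<partial>(\<Pi>\<^sub>M b\<in>(Basis::'a set). lborel))"
    by (intro nn_integral_cong prod.cong refl) simp
  also have "\<dots> = (\<Prod>b\<in>(Basis::'a set). \<integral>\<^sup>+t. f t \<partial>lborel)"
    by (rule product_nn_integral_prod) auto
  finally show ?thesis by simp
qed

lemma nn_integral_gauss_finite:
  "(\<integral>\<^sup>+x. ennreal (exp (- (norm x)\<^sup>2 / 2)) \<partial>(lborel :: 'a::euclidean_space measure)) < \<infinity>"
proof -
  have "(\<integral>\<^sup>+t. ennreal (exp (- t\<^sup>2 / 2)) \<partial>(lborel :: real measure))
      = (\<integral>\<^sup>+t. ennreal (sqrt (2 * pi)) * ennreal (std_normal_density t) \<partial>lborel)"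
    by (intro nn_integral_cong) (simp add: normal_density_def ennreal_mult[symmetric])
  also have "\<dots> = ennreal (sqrt (2 * pi)) * (\<integral>\<^sup>+t. ennreal (std_normal_density t) \<partial>lborel)"
    by (rule nn_integral_cmult) simp
  also have "(\<integral>\<^sup>+t. ennreal (std_normal_density t) \<partial>lborel) = ennreal 1"
    by (subst nn_integral_eq_integral) (auto intro!: integrable_normal_density simp: integral_normal_density)
  finally have fin: "(\<integral>\<^sup>+t. ennreal (exp (- t\<^sup>2 / 2)) \<partial>(lborel :: real measure)) < \<infinity>" by (simp add: ennreal_mult_less_top)
  have "(\<integral>\<^sup>+x. ennreal (exp (- (norm x)\<^sup>2 / 2)) \<partial>(lborel :: 'a measure))
      = (\<integral>\<^sup>+x. (\<Prod>b\<in>Basis. ennreal (exp (- (x \<bullet> b)\<^sup>2 / 2))) \<partial>(lborel :: 'a measure))"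
  proof (intro nn_integral_cong)
    fix x :: 'a
    have "(norm x)\<^sup>2 = (\<Sum>b\<in>Basis. (x \<bullet> b)\<^sup>2)"
      unfolding power2_norm_eq_inner by (subst euclidean_inner) (simp add: power2_eq_square)
    then have "exp (- (norm x)\<^sup>2 / 2) = (\<Prod>b\<in>Basis. exp (- (x \<bullet> b)\<^sup>2 / 2))"
      by (simp add: exp_sum[symmetric] sum_negf sum_divide_distrib)
    then show "ennreal (exp (- (norm x)\<^sup>2 / 2)) = (\<Prod>b\<in>Basis. ennreal (exp (- (x \<bullet> b)\<^sup>2 / 2)))"
      by (simp add: prod_ennreal)
  qed
  also have "\<dots> = (\<integral>\<^sup>+t. ennreal (exp (- t\<^sup>2 / 2)) \<partial>lborel) ^ DIM('a)"
    by (rule nn_integral_lborel_prod_Basis) simp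
  also have "\<dots> < \<infinity>" using fin by (simp add: power_less_top_ennreal)
  finally show ?thesis .
qed

lemma nn_integral_lborel_scale:
  fixes f :: "'a::euclidean_space \<Rightarrow> ennreal"
  assumes [measurable]: "f \<in> borel_measurable borel" and c: "0 < c"
  shows "(\<integral>\<^sup>+z. f (c *\<^sub>R z) \<partial>lborel) = ennreal ((1 / c) ^ DIM('a)) * (\<integral>\<^sup>+z. f z \<partial>lborel)"
proof -
  have eq: "lborel = density (distr lborel borel (\<lambda>x::'a. 0 + (1 / c) *\<^sub>R x)) (\<lambda>_. ennreal (\<bar>1 / c\<bar> ^ DIM('a)))"
    using c by (intro lborel_affine) auto
  show ?thesis
    by (subst eq, subst nn_integral_density)
       (use c in \<open>auto simp: nn_integral_distr nn_integral_cmult\<close>)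
qed

definition gauss_const :: "'a::euclidean_space itself \<Rightarrow> real" where
  "gauss_const _ = enn2real (\<integral>\<^sup>+x. ennreal (exp (- (norm x)\<^sup>2 / 2)) \<partial>(lborel :: 'a measure))"

lemma gauss_const_pos: "0 < gauss_const TYPE('a::euclidean_space)"
proof -
  have "(\<integral>\<^sup>+x. ennreal (exp (- (norm x)\<^sup>2 / 2)) \<partial>(lborel :: 'a measure)) \<noteq> 0"
  proof
    assume "(\<integral>\<^sup>+x. ennreal (exp (- (norm x)\<^sup>2 / 2)) \<partial>(lborel :: 'a measure)) = 0"
    then have "emeasure lborel {x \<in> space lborel. ennreal (exp (- (norm (x::'a))\<^sup>2 / 2)) \<noteq> 0} = 0"
      by (subst (asm) nn_integral_0_iff) auto
    then show False by simp
  qed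
  then show ?thesis
    unfolding gauss_const_def using nn_integral_gauss_finite[where 'a='a]
    by (simp add: enn2real_positive_iff zero_less_iff_neq_zero less_top)
qed

lemma nn_integral_gauss:
  assumes c: "0 < c"
  shows "(\<integral>\<^sup>+x. ennreal (exp (- c * (norm x)\<^sup>2)) \<partial>(lborel :: 'a::euclidean_space measure))
    = ennreal ((2 * c) powr (- real DIM('a) / 2) * gauss_const TYPE('a))"
proof -
  have "(\<integral>\<^sup>+x. ennreal (exp (- c * (norm x)\<^sup>2)) \<partial>(lborel :: 'a measure))
      = (\<integral>\<^sup>+x. ennreal (exp (- (norm (sqrt (2 * c) *\<^sub>R x))\<^sup>2 / 2)) \<partial>(lborel :: 'a measure))"
    using c by (intro nn_integral_cong) (simp add: power_mult_distrib)
  also have "\<dots> = ennreal ((1 / sqrt (2 * c)) ^ DIM('a)) * (\<integral>\<^sup>+x. ennreal (exp (- (norm x)\<^sup>2 / 2)) \<partial>(lborel :: 'a measure))"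
    by (rule nn_integral_lborel_scale) (use c in auto)
  also have "(1 / sqrt (2 * c)) ^ DIM('a) = (2 * c) powr (- real DIM('a) / 2)"
  proof -
    have eq: "1 / sqrt (2 * c) = (2 * c) powr (- 1 / 2)"
      using c by (simp add: powr_minus_divide powr_half_sqrt)
    show ?thesis
      unfolding eq using c by (subst powr_realpow[symmetric]) (simp_all add: powr_powr)
  qed
  also have "(\<integral>\<^sup>+x. ennreal (exp (- (norm x)\<^sup>2 / 2)) \<partial>(lborel :: 'a measure)) = ennreal (gauss_const TYPE('a))"
    unfolding gauss_const_def using nn_integral_gauss_finite[where 'a='a] by simp
  finally show ?thesis using gauss_const_pos[where 'a='a] by (simp add: ennreal_mult[symmetric])
qed

lemma nn_integral_lborel_translate:
  fixes f :: "'a::euclidean_space \<Rightarrow> ennreal"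
  assumes f: "f \<in> borel_measurable borel"
  shows "(\<integral>\<^sup>+z. f (z - w) \<partial>lborel) = (\<integral>\<^sup>+z. f z \<partial>lborel)"
proof -
  have m: "(+) (- w) \<in> measurable lborel (borel :: 'a measure)" by simp
  show ?thesis using nn_integral_distr[OF m, of f] lborel_distr_plus[of "- w"] f by simp
qed

lemma nn_integral_lborel_reflect:
  fixes f :: "'a::euclidean_space \<Rightarrow> ennreal"
  assumes f: "f \<in> borel_measurable borel"
  shows "(\<integral>\<^sup>+u. f (z - u) \<partial>lborel) = (\<integral>\<^sup>+u. f u \<partial>lborel)"
proof -
  have m: "(\<lambda>u. z - u) \<in> measurable lborel (borel :: 'a measure)" by simp
  show ?thesis using nn_integral_distr[OF m, of f] lborel_reflect_eq[of z] f by simp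
qed

lemma nn_integral_powr_finite:
  fixes T \<gamma> :: real
  assumes "\<gamma> < 1" "0 \<le> T"
  shows "(\<integral>\<^sup>+t. ennreal (t powr (- \<gamma>)) * indicator {0<..T} t \<partial>lborel) < \<infinity>"
proof -
  have "((\<lambda>t. t powr (- \<gamma>)) has_integral (T powr (- \<gamma> + 1) / (- \<gamma> + 1))) {0..T}"
    using assms by (intro has_integral_powr_from_0) auto
  then have "(\<integral>\<^sup>+t. ennreal (indicator {0..T} t * t powr (- \<gamma>)) \<partial>lborel) = ennreal (T powr (- \<gamma> + 1) / (- \<gamma> + 1))"
    by (intro nn_integral_has_integral_lebesgue[unfolded nn_integral_completion]) auto
  moreover have "(\<integral>\<^sup>+t. ennreal (t powr (- \<gamma>)) * indicator {0<..T} t \<partial>lborel)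
      \<le> (\<integral>\<^sup>+t. ennreal (indicator {0..T} t * t powr (- \<gamma>)) \<partial>lborel)"
    by (intro nn_integral_mono) (auto simp: indicator_def)
  ultimately show ?thesis by (auto intro: le_less_trans)
qed

lemma nn_integral_powr_infinite:
  fixes T \<gamma> :: real
  assumes "1 \<le> \<gamma>" "0 < T"
  shows "(\<integral>\<^sup>+t. ennreal (t powr (- \<gamma>)) * indicator {0<..T} t \<partial>lborel) = \<infinity>"
proof (rule ccontr)
  let ?I = "\<integral>\<^sup>+t. ennreal (t powr (- \<gamma>)) * indicator {0<..T} t \<partial>lborel"
  assume "?I \<noteq> \<infinity>"
  then obtain r where r: "?I = ennreal r" "0 \<le> r" by (cases ?I) auto
  define m where "m = min T 1"
  have m: "0 < m" "m \<le> T" "m \<le> 1" using assms by (auto simp: m_def)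
  define e where "e = m * exp (- (r + 1))"
  have e: "0 < e" "e \<le> m" using m r by (auto simp: e_def mult_le_cancel_left1)
  have "(\<integral>\<^sup>+t. ennreal (1 / t) * indicator {e..m} t \<partial>lborel) = ennreal (ln m - ln e)"
    using e by (intro nn_integral_FTC_Icc) (auto intro!: derivative_eq_intros borel_measurable_divide)
  also have "ln m - ln e = r + 1" using m by (simp add: e_def ln_mult)
  finally have "ennreal (r + 1) = (\<integral>\<^sup>+t. ennreal (1 / t) * indicator {e..m} t \<partial>lborel)" by simp
  also have "\<dots> \<le> ?I"
  proof (intro nn_integral_mono)
    fix t :: real
    show "ennreal (1 / t) * indicator {e..m} t \<le> ennreal (t powr (- \<gamma>)) * indicator {0<..T} t"
    proof (cases "t \<in> {e..m}")
      case True
      then have t: "0 < t" "t \<le> 1" "t \<le> T" using e m by auto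
      have "1 / t = t powr (- 1)" using t by (simp add: powr_minus_divide)
      also have "\<dots> \<le> t powr (- \<gamma>)" using t assms by (intro powr_mono') auto
      finally show ?thesis using True t by (simp add: ennreal_leI)
    qed simp
  qed
  also have "\<dots> = ennreal r" by (rule r)
  finally show False using r by simp
qed

lemma borel_measurable_fst_comp [measurable (raw)]:
  fixes f :: "'a \<Rightarrow> 'b::second_countable_topology \<times> 'c::second_countable_topology"
  assumes "f \<in> borel_measurable M"
  shows "(\<lambda>x. fst (f x)) \<in> borel_measurable M" and "(\<lambda>x. snd (f x)) \<in> borel_measurable M"
  by (rule measurable_compose[OF assms], rule borel_measurable_continuous_onI, intro continuous_intros)+

lemma heat_kernel_measurable [measurable]: "heat_kernel \<in> borel_measurable borel"
proof -
  have "(\<lambda>(t, x :: real ^ 'n). if t > 0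
     then 1 / (4 * pi * t) powr (real CARD('n) / 2) * exp (- (norm x)\<^sup>2 / (4 * t))
     else 0) \<in> borel_measurable (borel \<Otimes>\<^sub>M borel)"
    by measurable
  then show ?thesis by (simp add: heat_kernel_def borel_prod)
qed

lemma heat_kernel_nonneg: "0 \<le> heat_kernel z"
  by (cases z) (auto simp: heat_kernel_def)

lemma heat_kernel_powr:
  assumes "0 < \<tau>"
  shows "heat_kernel (\<tau>, x :: real ^ 'n::finite) powr q
    = (4 * pi * \<tau>) powr (- (real CARD('n) * q / 2)) * exp (- (q / (4 * \<tau>)) * (norm x)\<^sup>2)"
proof -
  let ?A = "4 * pi * \<tau>"
  have "heat_kernel (\<tau>, x) = ?A powr (- (real CARD('n) / 2)) * exp (- (norm x)\<^sup>2 / (4 * \<tau>))"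
    using assms by (simp add: heat_kernel_def powr_minus_divide)
  then have "heat_kernel (\<tau>, x) powr q
      = (?A powr (- (real CARD('n) / 2))) powr q * exp (- (norm x)\<^sup>2 / (4 * \<tau>)) powr q"
    by (simp only: powr_mult)
  also have "\<dots> = ?A powr (- (real CARD('n) / 2) * q) * exp (- (norm x)\<^sup>2 / (4 * \<tau>) * q)"
    by (simp only: powr_powr exp_powr_real)
  finally show ?thesis by (simp add: mult_ac)
qed

text \<open>The Gaussian has a free rate \<open>b\<close>, so that the same computation applies to the kernel and
  to the kernel with part of its decay split off.\<close>

lemma nn_integral_parabolic_gauss:
  fixes q b :: real and I :: "real set"
  assumes b: "0 < b" and [measurable]: "I \<in> sets borel" and I: "I \<subseteq> {0<..}"
  shows "(\<integral>\<^sup>+z. ennreal ((4 * pi * fst z) powr (- (real CARD('n) * q / 2)) * exp (- (b / fst z) * (norm (snd z))\<^sup>2))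
      * indicator I (fst z) \<partial>(lborel :: (real \<times> (real ^ 'n::finite)) measure))
    = ennreal ((4 * pi) powr (- (real CARD('n) * q / 2)) * (2 * b) powr (- real CARD('n) / 2) * gauss_const TYPE(real ^ 'n))
      * (\<integral>\<^sup>+\<tau>. ennreal (\<tau> powr (- (real CARD('n) * (q - 1) / 2))) * indicator I \<tau> \<partial>lborel)"
    (is "?L = ennreal ?c * _")
proof -
  let ?f = "\<lambda>\<tau> x. ennreal ((4 * pi * \<tau>) powr (- (real CARD('n) * q / 2)) * exp (- (b / \<tau>) * (norm (x :: real ^ 'n))\<^sup>2))
      * indicator I \<tau>"
  have "?L = (\<integral>\<^sup>+z. ?f (fst z) (snd z) \<partial>(lborel \<Otimes>\<^sub>M lborel))"
    by (simp add: lborel_prod)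
  also have "\<dots> = (\<integral>\<^sup>+\<tau>. \<integral>\<^sup>+x. ?f \<tau> x \<partial>lborel \<partial>lborel)"
    by (subst lborel.nn_integral_fst[symmetric]) simp_all
  also have "\<dots> = (\<integral>\<^sup>+\<tau>. ennreal ?c * (ennreal (\<tau> powr (- (real CARD('n) * (q - 1) / 2))) * indicator I \<tau>) \<partial>lborel)"
  proof (intro nn_integral_cong)
    fix \<tau> :: real
    show "(\<integral>\<^sup>+x. ?f \<tau> x \<partial>lborel) = ennreal ?c * (ennreal (\<tau> powr (- (real CARD('n) * (q - 1) / 2))) * indicator I \<tau>)"
    proof (cases "\<tau> \<in> I")
      case True
      then have \<tau>: "0 < \<tau>" using I by auto
      have "(\<integral>\<^sup>+x. ?f \<tau> x \<partial>lborel)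
          = (\<integral>\<^sup>+x. ennreal ((4 * pi * \<tau>) powr (- (real CARD('n) * q / 2))) *
              ennreal (exp (- (b / \<tau>) * (norm (x :: real ^ 'n))\<^sup>2)) \<partial>lborel)"
        using True by (intro nn_integral_cong) (simp add: ennreal_mult)
      also have "\<dots> = ennreal ((4 * pi * \<tau>) powr (- (real CARD('n) * q / 2))) *
          (\<integral>\<^sup>+x. ennreal (exp (- (b / \<tau>) * (norm (x :: real ^ 'n))\<^sup>2)) \<partial>lborel)"
        by (rule nn_integral_cmult) simp
      also have "(\<integral>\<^sup>+x. ennreal (exp (- (b / \<tau>) * (norm (x :: real ^ 'n))\<^sup>2)) \<partial>lborel)
          = ennreal ((2 * (b / \<tau>)) powr (- real CARD('n) / 2) * gauss_const TYPE(real ^ 'n))"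
        by (subst nn_integral_gauss) (use b \<tau> in auto)
      also have "ennreal ((4 * pi * \<tau>) powr (- (real CARD('n) * q / 2))) * \<dots>
          = ennreal ((4 * pi * \<tau>) powr (- (real CARD('n) * q / 2)) *
              ((2 * (b / \<tau>)) powr (- real CARD('n) / 2) * gauss_const TYPE(real ^ 'n)))"
        by (subst ennreal_mult) (auto simp: gauss_const_pos less_imp_le)
      also have "(4 * pi * \<tau>) powr (- (real CARD('n) * q / 2)) *
              ((2 * (b / \<tau>)) powr (- real CARD('n) / 2) * gauss_const TYPE(real ^ 'n))
          = ?c * \<tau> powr (- (real CARD('n) * (q - 1) / 2))"
      proof -
        have 1: "(4 * pi * \<tau>) powr (- (real CARD('n) * q / 2))
            = (4 * pi) powr (- (real CARD('n) * q / 2)) * \<tau> powr (- (real CARD('n) * q / 2))"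
          using \<tau> by (simp add: powr_mult)
        have 2: "(2 * (b / \<tau>)) powr (- real CARD('n) / 2) = (2 * b) powr (- real CARD('n) / 2) * \<tau> powr (real CARD('n) / 2)"
        proof -
          have "2 * (b / \<tau>) = (2 * b) * \<tau> powr (- 1)" using \<tau> by (simp add: powr_minus_divide)
          then have "(2 * (b / \<tau>)) powr (- real CARD('n) / 2) = ((2 * b) * \<tau> powr (- 1)) powr (- real CARD('n) / 2)"
            by (rule arg_cong)
          also have "\<dots> = (2 * b) powr (- real CARD('n) / 2) * (\<tau> powr (- 1)) powr (- real CARD('n) / 2)"
            by (simp only: powr_mult)
          finally show ?thesis by (simp only: powr_powr) simp
        qed
        have 3: "\<tau> powr (- (real CARD('n) * q / 2)) * \<tau> powr (real CARD('n) / 2) = \<tau> powr (- (real CARD('n) * (q - 1) / 2))"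
          unfolding powr_add[symmetric] by (rule arg_cong[where f="\<lambda>e. \<tau> powr e"]) (simp add: field_simps)
        show ?thesis unfolding 1 2 3[symmetric] by (simp only: mult_ac)
      qed
      finally show ?thesis using True b by (simp add: ennreal_mult gauss_const_pos less_imp_le)
    qed simp
  qed
  also have "\<dots> = ennreal ?c * (\<integral>\<^sup>+\<tau>. ennreal (\<tau> powr (- (real CARD('n) * (q - 1) / 2))) * indicator I \<tau> \<partial>lborel)"
    by (rule nn_integral_cmult) simp
  finally show ?thesis .
qed

lemma half_space_borel [measurable]: "half_space \<in> sets borel"
  unfolding half_space_def by (intro borel_closed closed_Times) auto

lemma L_modular_eq_lborel:
  "L_modular \<alpha> f = (\<integral>\<^sup>+z. ennreal (\<bar>f z\<bar> powr \<alpha>) * indicator half_space z \<partial>lborel)"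
  unfolding L_modular_def by (rule nn_integral_restrict_space) simp

definition heat_shift :: "real \<times> (real ^ 'n::finite) \<Rightarrow> real \<times> (real ^ 'n) \<Rightarrow> real" where
  "heat_shift z w = heat_kernel (z - w)"

lemma heat_shift_eq: "heat_shift (t, x) = (\<lambda>(s, y). heat_kernel (t - s, x - y))"
  by (auto simp: heat_shift_def fun_eq_iff)

lemma heat_shift_measurable [measurable]: "heat_shift z \<in> borel_measurable borel"
  unfolding heat_shift_def by measurable

lemma L_modular_heat_shift:
  assumes "0 < \<alpha>"
  shows "L_modular \<alpha> (heat_shift (t, x :: real ^ 'n::finite))
    = ennreal ((4 * pi) powr (- (real CARD('n) * \<alpha> / 2)) * (\<alpha> / 2) powr (- real CARD('n) / 2) * gauss_const TYPE(real ^ 'n))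
      * (\<integral>\<^sup>+\<tau>. ennreal (\<tau> powr (- (real CARD('n) * (\<alpha> - 1) / 2))) * indicator {0<..t} \<tau> \<partial>lborel)"
proof -
  let ?g = "\<lambda>w :: real \<times> (real ^ 'n). ennreal (heat_kernel w powr \<alpha>) * indicator {0<..t} (fst w)"
  have "L_modular \<alpha> (heat_shift (t, x)) = (\<integral>\<^sup>+w. ?g ((t, x) - w) \<partial>lborel)"
    unfolding L_modular_eq_lborel
  proof (intro nn_integral_cong)
    fix w :: "real \<times> (real ^ 'n)"
    show "ennreal (\<bar>heat_shift (t, x) w\<bar> powr \<alpha>) * indicator half_space w = ?g ((t, x) - w)"
      using heat_kernel_nonneg[of "(t, x) - w"]
      by (cases w) (auto simp: heat_shift_def half_space_def indicator_def heat_kernel_def)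
  qed
  also have "\<dots> = (\<integral>\<^sup>+w. ?g w \<partial>lborel)"
    by (rule nn_integral_lborel_reflect) measurable
  also have "\<dots> = (\<integral>\<^sup>+w. ennreal ((4 * pi * fst w) powr (- (real CARD('n) * \<alpha> / 2)) * exp (- ((\<alpha> / 4) / fst w) * (norm (snd w))\<^sup>2))
      * indicator {0<..t} (fst w) \<partial>(lborel :: (real \<times> (real ^ 'n)) measure))"
  proof (intro nn_integral_cong)
    fix w :: "real \<times> (real ^ 'n)"
    show "?g w = ennreal ((4 * pi * fst w) powr (- (real CARD('n) * \<alpha> / 2)) * exp (- ((\<alpha> / 4) / fst w) * (norm (snd w))\<^sup>2))
      * indicator {0<..t} (fst w)"
      using heat_kernel_powr[of "fst w" "snd w" \<alpha>] by (auto simp: indicator_def)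
  qed
  also have "\<dots> = ennreal ((4 * pi) powr (- (real CARD('n) * \<alpha> / 2)) * (2 * (\<alpha> / 4)) powr (- real CARD('n) / 2) * gauss_const TYPE(real ^ 'n))
      * (\<integral>\<^sup>+\<tau>. ennreal (\<tau> powr (- (real CARD('n) * (\<alpha> - 1) / 2))) * indicator {0<..t} \<tau> \<partial>lborel)"
    by (rule nn_integral_parabolic_gauss) (use assms in auto)
  finally show ?thesis by simp
qed

lemma critical_exponent_iff: "real CARD('n::finite) * (q - 1) / 2 < 1 \<longleftrightarrow> q < 1 + 2 / real CARD('n)"
proof -
  have "0 < real CARD('n)" by simp
  then show ?thesis by (simp add: field_simps)
qed

lemma heat_shift_L_space:
  assumes "0 < \<alpha>" "\<alpha> < 1 + 2 / real CARD('n)"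
  shows "heat_shift (z :: real \<times> (real ^ 'n::finite)) \<in> L_space \<alpha>"
proof -
  obtain t x where z: "z = (t, x)" by (cases z)
  have "(\<integral>\<^sup>+\<tau>. ennreal (\<tau> powr (- (real CARD('n) * (\<alpha> - 1) / 2))) * indicator {0<..t} \<tau> \<partial>lborel)
      \<le> (\<integral>\<^sup>+\<tau>. ennreal (\<tau> powr (- (real CARD('n) * (\<alpha> - 1) / 2))) * indicator {0<..max t 0} \<tau> \<partial>lborel)"
    by (intro nn_integral_mono) (auto simp: indicator_def)
  also have "\<dots> < \<infinity>"
    using critical_exponent_iff[where 'n='n, of \<alpha>] assms(2) by (intro nn_integral_powr_finite) auto
  finally have "L_modular \<alpha> (heat_shift z) < \<infinity>"
    unfolding z by (subst L_modular_heat_shift[OF assms(1)]) (simp add: ennreal_mult_less_top)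
  then show ?thesis unfolding L_space_iff by (auto intro: measurable_restrict_space1)
qed

lemma heat_shift_not_L_space:
  assumes "0 < \<alpha>" "heat_shift (t, x :: real ^ 'n::finite) \<in> L_space \<alpha>" "0 < t"
  shows "\<alpha> < 1 + 2 / real CARD('n)"
proof (rule ccontr)
  assume "\<not> ?thesis"
  then have "1 \<le> real CARD('n) * (\<alpha> - 1) / 2"
    using critical_exponent_iff[where 'n='n, of \<alpha>] by linarith
  then have inf: "(\<integral>\<^sup>+\<tau>. ennreal (\<tau> powr (- (real CARD('n) * (\<alpha> - 1) / 2))) * indicator {0<..t} \<tau> \<partial>lborel) = \<infinity>"
    using assms(3) by (intro nn_integral_powr_infinite)
  have "L_modular \<alpha> (heat_shift (t, x)) = \<infinity>"
    unfolding L_modular_heat_shift[OF assms(1)] inf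
    using assms(1) gauss_const_pos[where 'a="real ^ 'n"] by (auto simp: ennreal_mult_eq_top_iff)
  then show False using assms(2) by (simp add: L_space_iff)
qed

lemma norm_square_ge: "(norm y)\<^sup>2 / 2 - (norm x)\<^sup>2 \<le> (norm (x - y))\<^sup>2"
  for x y :: "'a::real_normed_vector"
proof -
  have "norm y \<le> norm (x - y) + norm x" by (metis norm_minus_commute norm_triangle_sub add.commute)
  then have "(norm y)\<^sup>2 \<le> (norm (x - y) + norm x)\<^sup>2" by (intro power_mono) auto
  also have "\<dots> \<le> 2 * (norm (x - y))\<^sup>2 + 2 * (norm x)\<^sup>2"
    using sum_squares_bound[of "norm (x - y)" "norm x"] by (simp add: power2_sum)
  finally show ?thesis by simp
qed

text \<open>Half of the Gaussian decay of the kernel is used for integrability in \<open>z\<close>, the other half for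
  the decay in the second argument.\<close>

lemma heat_kernel_local_bound:
  assumes q: "0 < q" "q < 1 + 2 / real CARD('n)" and R: "0 < R"
  shows "\<exists>C c. 0 \<le> C \<and> 0 < c \<and> (\<forall>s\<ge>0. \<forall>y :: real ^ 'n::finite.
    (\<integral>\<^sup>+z. ennreal (heat_kernel (z - (s, y)) powr q) * indicator (cball 0 R) z \<partial>lborel)
      \<le> ennreal (C * exp (- c * (norm y)\<^sup>2)) * indicator {0..R} s)"
proof -
  let ?h = "\<lambda>w :: real \<times> (real ^ 'n). ennreal ((4 * pi * fst w) powr (- (real CARD('n) * q / 2)) *
      exp (- ((q / 8) / fst w) * (norm (snd w))\<^sup>2)) * indicator {0<..R} (fst w)"
  define H where "H = enn2real (\<integral>\<^sup>+w. ?h w \<partial>lborel)"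
  have "(\<integral>\<^sup>+w. ?h w \<partial>lborel) < \<infinity>"
  proof -
    have "(\<integral>\<^sup>+\<tau>. ennreal (\<tau> powr (- (real CARD('n) * (q - 1) / 2))) * indicator {0<..R} \<tau> \<partial>lborel) < \<infinity>"
      using critical_exponent_iff[where 'n='n, of q] q(2) R by (intro nn_integral_powr_finite) auto
    then show ?thesis
      by (subst nn_integral_parabolic_gauss) (use q in \<open>auto simp: ennreal_mult_less_top\<close>)
  qed
  then have H: "(\<integral>\<^sup>+w. ?h w \<partial>lborel) = ennreal H" "0 \<le> H" by (auto simp: H_def)
  define a where "a = q / (8 * R)"
  have a: "0 < a" using q R by (simp add: a_def)
  have key: "(\<integral>\<^sup>+z. ennreal (heat_kernel (z - (s, y)) powr q) * indicator (cball 0 R) z \<partial>lborel)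
      \<le> ennreal (H * exp (a * R\<^sup>2) * exp (- (a / 2) * (norm y)\<^sup>2)) * indicator {0..R} s"
    if s: "0 \<le> s" for s and y :: "real ^ 'n"
  proof -
    let ?E = "exp (a * R\<^sup>2) * exp (- (a / 2) * (norm y)\<^sup>2)"
    have pt: "ennreal (heat_kernel (z - (s, y)) powr q) * indicator (cball 0 R) z
        \<le> ennreal ?E * indicator {0..R} s * ?h (z - (s, y))" for z
    proof (cases "z \<in> cball 0 R \<and> s < fst z")
      case False
      then have z0: "ennreal (heat_kernel (z - (s, y)) powr q) * indicator (cball 0 R) z = 0"
        by (cases z) (auto simp: heat_kernel_def)
      show ?thesis unfolding z0 by simp
    next
      case True
      obtain t x where z: "z = (t, x)" by (cases z)
      have "norm t \<le> R" "norm x \<le> R"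
        using True norm_fst_le[of t x] norm_snd_le[of x t] by (auto simp: z)
      then have *: "s \<le> R" "0 < t - s" "t - s \<le> R" "norm x \<le> R" using True s by (auto simp: z)
      have "a * ((norm y)\<^sup>2 / 2 - R\<^sup>2) \<le> a * (norm (x - y))\<^sup>2"
        using a norm_square_ge[of y x] power_mono[OF *(4), of 2] by (intro mult_left_mono) auto
      also have "\<dots> \<le> (q / 8) / (t - s) * (norm (x - y))\<^sup>2"
      proof (rule mult_right_mono)
        have "q / 8 / R \<le> q / 8 / (t - s)" using * q R by (intro divide_left_mono) auto
        then show "a \<le> (q / 8) / (t - s)" by (simp add: a_def)
      qed simp
      finally have "- ((q / 8) / (t - s)) * (norm (x - y))\<^sup>2 \<le> a * R\<^sup>2 + (- (a / 2) * (norm y)\<^sup>2)"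
        by (simp add: algebra_simps)
      then have e: "exp (- ((q / 8) / (t - s)) * (norm (x - y))\<^sup>2) \<le> ?E"
        unfolding exp_add[symmetric] by (rule exp_le_cancel_iff[THEN iffD2])
      have "heat_kernel (z - (s, y)) powr q = (4 * pi * (t - s)) powr (- (real CARD('n) * q / 2)) *
          (exp (- ((q / 8) / (t - s)) * (norm (x - y))\<^sup>2) * exp (- ((q / 8) / (t - s)) * (norm (x - y))\<^sup>2))"
      proof -
        have split: "- (q / (4 * r)) * N = - ((q / 8) / r) * N + - ((q / 8) / r) * N" for r N :: real
          by (simp add: field_simps)
        show ?thesis
          using heat_kernel_powr[OF *(2), of "x - y" q]
          by (simp only: z diff_Pair split exp_add)
      qed
      also have "\<dots> \<le> (4 * pi * (t - s)) powr (- (real CARD('n) * q / 2)) *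
          (?E * exp (- ((q / 8) / (t - s)) * (norm (x - y))\<^sup>2))"
        using e by (intro mult_left_mono mult_right_mono) auto
      finally have "ennreal (heat_kernel (z - (s, y)) powr q) \<le> ennreal (?E * ((4 * pi * (t - s)) powr (- (real CARD('n) * q / 2)) *
          exp (- ((q / 8) / (t - s)) * (norm (x - y))\<^sup>2)))"
        by (intro ennreal_leI) (simp add: mult_ac)
      also have "\<dots> = ennreal ?E * ennreal ((4 * pi * (t - s)) powr (- (real CARD('n) * q / 2)) *
          exp (- ((q / 8) / (t - s)) * (norm (x - y))\<^sup>2))"
        by (rule ennreal_mult) auto
      finally show ?thesis using True * s by (simp add: z)
    qed
    have "(\<integral>\<^sup>+z. ennreal (heat_kernel (z - (s, y)) powr q) * indicator (cball 0 R) z \<partial>lborel)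
        \<le> (\<integral>\<^sup>+z. ennreal ?E * indicator {0..R} s * ?h (z - (s, y)) \<partial>lborel)"
      by (intro nn_integral_mono pt)
    also have "\<dots> = ennreal ?E * indicator {0..R} s * (\<integral>\<^sup>+z. ?h (z - (s, y)) \<partial>lborel)"
      by (rule nn_integral_cmult) measurable
    also have "(\<integral>\<^sup>+z. ?h (z - (s, y)) \<partial>lborel) = (\<integral>\<^sup>+z. ?h z \<partial>lborel)"
      by (rule nn_integral_lborel_translate) measurable
    also have "ennreal ?E * indicator {0..R} s * (\<integral>\<^sup>+z. ?h z \<partial>lborel) = ennreal (H * ?E) * indicator {0..R} s"
      unfolding H(1) using H(2) by (simp add: ennreal_mult mult_ac)
    finally show ?thesis by (simp only: mult.assoc)
  qed
  show ?thesis
    using key a H(2) by (intro exI[of _ "H * exp (a * R\<^sup>2)"] exI[of _ "a / 2"]) auto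
qed

lemma nn_integral_gauss_half_space_finite:
  assumes c: "0 < c"
  shows "(\<integral>\<^sup>+w. ennreal (C * exp (- c * (norm (snd w))\<^sup>2)) * indicator {0..R} (fst w)
    \<partial>(leb_half :: (real \<times> (real ^ 'n::finite)) measure)) < \<infinity>"
proof -
  let ?f = "\<lambda>(s::real) (y :: real ^ 'n). ennreal (C * exp (- c * (norm y)\<^sup>2)) * indicator {0..R} s"
  have "(\<integral>\<^sup>+w. ?f (fst w) (snd w) \<partial>leb_half) = (\<integral>\<^sup>+w. ?f (fst w) (snd w) * indicator half_space w \<partial>lborel)"
    by (rule nn_integral_restrict_space) simp
  also have "\<dots> \<le> (\<integral>\<^sup>+w. ?f (fst w) (snd w) \<partial>lborel)"
    by (intro nn_integral_mono) (auto simp: indicator_def)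
  also have "\<dots> = (\<integral>\<^sup>+w. ?f (fst w) (snd w) \<partial>(lborel \<Otimes>\<^sub>M lborel))"
    by (simp add: lborel_prod)
  also have "\<dots> = (\<integral>\<^sup>+s. \<integral>\<^sup>+y. ?f s y \<partial>lborel \<partial>lborel)"
    by (subst lborel.nn_integral_fst[symmetric]) simp_all
  also have "\<dots> \<le> (\<integral>\<^sup>+s. (ennreal C * ennreal ((2 * c) powr (- real DIM(real ^ 'n) / 2) * gauss_const TYPE(real ^ 'n))) *
      indicator {0..R} s \<partial>lborel)"
  proof (intro nn_integral_mono)
    fix s :: real
    have "(\<integral>\<^sup>+y. ?f s y \<partial>lborel) \<le> (\<integral>\<^sup>+y. (ennreal C * indicator {0..R} s) * ennreal (exp (- c * (norm (y :: real ^ 'n))\<^sup>2)) \<partial>lborel)"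
    proof (intro nn_integral_mono)
      fix y :: "real ^ 'n"
      have "C * exp (- c * (norm y)\<^sup>2) \<le> max C 0 * exp (- c * (norm y)\<^sup>2)" by (intro mult_right_mono) auto
      then have "ennreal (C * exp (- c * (norm y)\<^sup>2)) \<le> ennreal (max C 0) * ennreal (exp (- c * (norm y)\<^sup>2))"
        by (subst ennreal_mult[symmetric]) (auto intro: ennreal_leI)
      also have "ennreal (max C 0) = ennreal C" by (simp add: max_def ennreal_neg)
      finally show "?f s y \<le> (ennreal C * indicator {0..R} s) * ennreal (exp (- c * (norm y)\<^sup>2))"
        by (auto simp: indicator_def)
    qed
    also have "\<dots> = (ennreal C * indicator {0..R} s) * ennreal ((2 * c) powr (- real DIM(real ^ 'n) / 2) * gauss_const TYPE(real ^ 'n))"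
      by (subst nn_integral_cmult) (simp_all only: nn_integral_gauss[OF c], measurable)
    finally show "(\<integral>\<^sup>+y. ?f s y \<partial>lborel) \<le> (ennreal C * ennreal ((2 * c) powr (- real DIM(real ^ 'n) / 2) * gauss_const TYPE(real ^ 'n))) *
      indicator {0..R} s"
      by (simp only: mult_ac)
  qed
  also have "\<dots> < \<infinity>"
    by (subst nn_integral_cmult_indicator) (auto simp: ennreal_mult_less_top emeasure_lborel_Icc_eq)
  finally show ?thesis .
qed

section \<open>The generalized solution and its representations\<close>

lemma heat_kernel_isCont:
  fixes z :: "real \<times> (real ^ 'n::finite)"
  assumes "z \<noteq> 0"
  shows "isCont heat_kernel z"
proof -
  obtain t x where z: "z = (t, x)" by (cases z)
  consider "t < 0" | "0 < t" | "t = 0" "x \<noteq> 0" using assms unfolding z zero_prod_def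
    by (cases t "0 :: real" rule: linorder_cases) auto
  then show ?thesis
  proof cases
    case 1
    have "open {w :: real \<times> (real ^ 'n). fst w < 0}" by (intro open_Collect_less continuous_intros)
    moreover have "continuous_on {w :: real \<times> (real ^ 'n). fst w < 0} heat_kernel"
      by (rule continuous_on_eq[OF continuous_on_const[of _ 0]]) (auto simp: heat_kernel_def split: prod.splits)
    ultimately show ?thesis using 1 by (auto simp: z continuous_on_eq_continuous_at)
  next
    case 2
    have "open {w :: real \<times> (real ^ 'n). 0 < fst w}" by (intro open_Collect_less continuous_intros)
    moreover have "continuous_on {w :: real \<times> (real ^ 'n). 0 < fst w} heat_kernel"
    proof (rule continuous_on_eq)
      show "continuous_on {w :: real \<times> (real ^ 'n). 0 < fst w}
        (\<lambda>w. 1 / (4 * pi * fst w) powr (real CARD('n) / 2) * exp (- (norm (snd w))\<^sup>2 / (4 * fst w)))"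
        by (intro continuous_intros) auto
    qed (auto simp: heat_kernel_def split: prod.splits)
    ultimately show ?thesis using 2 by (auto simp: z continuous_on_eq_continuous_at)
  next
    case 3
    let ?d = "real CARD('n) / 2"
    define r where "r = (norm x)\<^sup>2 / 16"
    have r: "0 < r" using 3 by (simp add: r_def)
    text \<open>Near \<open>(0, x)\<close> with \<open>x \<noteq> 0\<close> the kernel is bounded by a function of time alone that
      vanishes at \<open>0\<close>.\<close>
    define g where "g \<tau> = (if 0 < \<tau> then (4 * pi * \<tau>) powr (- ?d) * exp (- r / \<tau>) else 0)" for \<tau> :: real
    have g0: "(g \<longlongrightarrow> 0) (at_right 0)"
    proof (rule Lim_null_comparison)
      let ?y = "\<lambda>\<tau>. r * inverse \<tau>"
      have "filterlim ?y at_top (at_right 0)"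
        using r by (intro filterlim_tendsto_pos_mult_at_top[OF tendsto_const _ filterlim_inverse_at_top_right])
      from filterlim_compose[OF tendsto_power_div_exp_0[of "CARD('n)"] this]
      have "((\<lambda>\<tau>. (1 / (4 * pi * r)) ^ CARD('n) * (?y \<tau> ^ CARD('n) / exp (?y \<tau>))) \<longlongrightarrow> (1 / (4 * pi * r)) ^ CARD('n) * 0) (at_right 0)"
        by (intro tendsto_mult tendsto_const)
      then show "((\<lambda>\<tau>. (1 / (4 * pi * r)) ^ CARD('n) * (?y \<tau> ^ CARD('n) / exp (?y \<tau>))) \<longlongrightarrow> 0) (at_right 0)"
        by simp
      have "eventually (\<lambda>\<tau>. \<tau> \<in> {0<..<1 / (4 * pi)}) (at_right 0)"
        by (rule eventually_at_right_real) simp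
      then show "eventually (\<lambda>\<tau>. norm (g \<tau>) \<le> (1 / (4 * pi * r)) ^ CARD('n) * (?y \<tau> ^ CARD('n) / exp (?y \<tau>))) (at_right 0)"
      proof eventually_elim
        case (elim \<tau>)
        then have \<tau>: "0 < \<tau>" "4 * pi * \<tau> \<le> 1" by (auto simp: field_simps)
        have "norm (g \<tau>) = (4 * pi * \<tau>) powr (- ?d) * exp (- r / \<tau>)" using \<tau> by (simp add: g_def)
        also have "\<dots> \<le> (4 * pi * \<tau>) powr (- real CARD('n)) * exp (- r / \<tau>)"
          using \<tau> by (intro mult_right_mono powr_mono') auto
        also have "(4 * pi * \<tau>) powr (- real CARD('n)) = (1 / (4 * pi * \<tau>)) ^ CARD('n)"
          using \<tau> by (simp add: powr_minus_divide powr_realpow power_one_over)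
        also have "1 / (4 * pi * \<tau>) = (1 / (4 * pi * r)) * ?y \<tau>" using r \<tau> by (simp add: field_simps)
        also have "exp (- r / \<tau>) = 1 / exp (?y \<tau>)" by (simp add: exp_minus divide_inverse)
        finally show ?case unfolding power_mult_distrib by (simp add: mult.assoc)
      qed
    qed
    have gl: "(g \<longlongrightarrow> 0) (at_left 0)"
      by (rule Lim_transform_eventually[OF tendsto_const]) (auto simp: g_def eventually_at_filter)
    have "(g \<longlongrightarrow> 0) (at 0)" using g0 gl by (simp add: filterlim_at_split)
    then have "isCont g (fst z)" using 3 by (simp add: isCont_def g_def z)
    moreover have "isCont fst z" by (intro continuous_intros)
    ultimately have "isCont (\<lambda>w. g (fst w)) z" by (rule isCont_o2[rotated])
    then have lim: "((\<lambda>w. g (fst w)) \<longlongrightarrow> 0) (at z)" using 3 by (simp add: isCont_def z g_def)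
    have nb: "eventually (\<lambda>w. norm (snd w - x) < norm x / 2) (at z)"
    proof -
      have "((\<lambda>w. norm (snd w - x)) \<longlongrightarrow> norm (snd z - x)) (at z)" by (intro tendsto_intros)
      then show ?thesis using 3 by (intro order_tendstoD(2)) (auto simp: z)
    qed
    have "(heat_kernel \<longlongrightarrow> 0) (at z)"
    proof (rule Lim_null_comparison[OF _ lim])
      show "eventually (\<lambda>w. norm (heat_kernel w) \<le> g (fst w)) (at z)"
        using nb
      proof eventually_elim
        case (elim w)
        show ?case
        proof (cases "0 < fst w")
          case True
          have "norm x / 2 \<le> norm (snd w)"
            using elim norm_triangle_ineq2[of x "snd w"] by (simp add: norm_minus_commute)
          then have "(norm x / 2)\<^sup>2 \<le> (norm (snd w))\<^sup>2" by (intro power_mono) auto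
          then have "4 * r \<le> (norm (snd w))\<^sup>2" by (simp add: r_def power_divide)
          then have "- (norm (snd w))\<^sup>2 / (4 * fst w) \<le> - r / fst w"
            using True by (simp add: field_simps)
          then have "exp (- (norm (snd w))\<^sup>2 / (4 * fst w)) \<le> exp (- r / fst w)" by simp
          then show ?thesis using True
            by (cases w) (auto simp: heat_kernel_def g_def powr_minus_divide intro!: mult_left_mono divide_right_mono)
        next
          case False
          then show ?thesis by (cases w) (auto simp: heat_kernel_def g_def)
        qed
      qed
    qed
    then show ?thesis using 3 by (simp add: isCont_def z heat_kernel_def)
  qed
qed

lemma test_functionD:
  fixes \<phi> :: "'a::euclidean_space \<Rightarrow> real"
  assumes "\<phi> \<in> test_functions"
  shows "continuous_on UNIV \<phi>" "\<phi> \<in> borel_measurable borel"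
    "\<exists>R B. 0 < R \<and> 0 \<le> B \<and> (\<forall>z. \<bar>\<phi> z\<bar> \<le> B * indicator (cball 0 R) z)"
proof -
  show c: "continuous_on UNIV \<phi>" using assms by (simp add: test_functions_def) (metis Ck.simps(1))
  then show "\<phi> \<in> borel_measurable borel" by (rule borel_measurable_continuous_onI)
  have K: "compact (closure {z. \<phi> z \<noteq> 0})" using assms by (simp add: test_functions_def)
  then obtain R0 where R0: "\<And>z. z \<in> closure {z. \<phi> z \<noteq> 0} \<Longrightarrow> norm z \<le> R0"
    using compact_imp_bounded by (meson bounded_iff)
  have "bounded (\<phi> ` closure {z. \<phi> z \<noteq> 0})"
    by (intro compact_imp_bounded compact_continuous_image continuous_on_subset[OF c] K) auto
  then obtain B where B: "\<And>z. z \<in> closure {z. \<phi> z \<noteq> 0} \<Longrightarrow> \<bar>\<phi> z\<bar> \<le> B" by (auto simp: bounded_iff)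
  have "\<bar>\<phi> z\<bar> \<le> max B 0 * indicator (cball 0 (max R0 1)) z" for z
  proof (cases "\<phi> z = 0")
    case False
    then have "z \<in> closure {z. \<phi> z \<noteq> 0}" using closure_subset[of "{z. \<phi> z \<noteq> 0}"] by auto
    with R0[of z] B[of z] show ?thesis by (auto simp: indicator_def)
  qed simp
  then show "\<exists>R B. 0 < R \<and> 0 \<le> B \<and> (\<forall>z. \<bar>\<phi> z\<bar> \<le> B * indicator (cball 0 R) z)"
    by (intro exI[of _ "max R0 1"] exI[of _ "max B 0"]) auto
qed

lemma conv_check_eq:
  fixes \<rho> \<phi> :: "'a::euclidean_space \<Rightarrow> real"
  assumes [measurable]: "\<rho> \<in> borel_measurable borel" "\<phi> \<in> borel_measurable borel"
  shows "conv_check \<phi> \<rho> w = (LINT z|lborel. \<rho> (z - w) * \<phi> z)"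
    and "integrable lborel (\<lambda>z. \<rho> z * \<phi> (w + z)) \<longleftrightarrow> integrable lborel (\<lambda>z. \<rho> (z - w) * \<phi> z)"
proof -
  have m: "(+) (- w) \<in> measurable lborel (borel :: 'a measure)" by simp
  have f: "(\<lambda>z. \<rho> z * \<phi> (w + z)) \<in> borel_measurable borel" by simp
  show "conv_check \<phi> \<rho> w = (LINT z|lborel. \<rho> (z - w) * \<phi> z)"
    using integral_distr[OF m f] lborel_distr_plus[of "- w"]
    by (simp add: conv_check_def pairing_def)
  show "integrable lborel (\<lambda>z. \<rho> z * \<phi> (w + z)) \<longleftrightarrow> integrable lborel (\<lambda>z. \<rho> (z - w) * \<phi> z)"
    using integrable_distr_eq[OF m f] lborel_distr_plus[of "- w"] by simp
qed

lemma conv_check_measurable [measurable]: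
  fixes \<phi> :: "real \<times> (real ^ 'n::finite) \<Rightarrow> real"
  assumes [measurable]: "\<phi> \<in> borel_measurable borel"
  shows "conv_check \<phi> heat_kernel \<in> borel_measurable borel"
  unfolding conv_check_def[abs_def] pairing_def
  by (rule lborel.borel_measurable_lebesgue_integral) measurable

lemma cball_borel [measurable]: "cball z R \<in> sets borel"
  by (rule borel_closed) (rule closed_cball)

lemma heat_kernel_local_integrable:
  assumes q: "0 < q" "q < 1 + 2 / real CARD('n)" and R: "0 < R" and s: "0 \<le> fst w"
  shows "integrable lborel (\<lambda>z :: real \<times> (real ^ 'n::finite). heat_kernel (z - w) powr q * indicator (cball 0 R) z)"
proof (rule integrableI_bounded)
  obtain C c where C: "\<And>s y. 0 \<le> s \<Longrightarrow>
     (\<integral>\<^sup>+z. ennreal (heat_kernel (z - (s, y :: real ^ 'n)) powr q) * indicator (cball 0 R) z \<partial>lborel)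
      \<le> ennreal (C * exp (- c * (norm y)\<^sup>2)) * indicator {0..R} s"
    using heat_kernel_local_bound[OF q R] by blast
  have "(\<integral>\<^sup>+z. ennreal (norm (heat_kernel (z - w) powr q * indicator (cball 0 R) z)) \<partial>lborel)
      = (\<integral>\<^sup>+z. ennreal (heat_kernel (z - w) powr q) * indicator (cball 0 R) z \<partial>lborel)"
    by (intro nn_integral_cong) (auto simp: indicator_def)
  also have "\<dots> \<le> ennreal (C * exp (- c * (norm (snd w))\<^sup>2)) * indicator {0..R} (fst w)"
    using C[OF s, of "snd w"] by simp
  also have "\<dots> < \<infinity>" by (auto simp: indicator_def)
  finally show "(\<integral>\<^sup>+z. ennreal (norm (heat_kernel (z - w) powr q * indicator (cball 0 R) z)) \<partial>lborel) < \<infinity>" .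
qed measurable

lemma conv_check_integrable:
  fixes \<phi> :: "real \<times> (real ^ 'n::finite) \<Rightarrow> real"
  assumes \<phi>: "\<phi> \<in> test_functions" and w: "0 \<le> fst w"
  shows "integrable lborel (\<lambda>z. heat_kernel z * \<phi> (w + z))"
    and "integrable lborel (\<lambda>z. heat_kernel (z - w) * \<phi> z)"
proof -
  note [measurable] = test_functionD(2)[OF \<phi>]
  obtain R B where R: "0 < R" "0 \<le> B" "\<And>z. \<bar>\<phi> z\<bar> \<le> B * indicator (cball 0 R) z"
    using test_functionD(3)[OF \<phi>] by blast
  have i: "integrable lborel (\<lambda>z. heat_kernel (z - w) powr 1 * indicator (cball 0 R) z)"
    by (rule heat_kernel_local_integrable[OF _ _ R(1) w]) auto
  show "integrable lborel (\<lambda>z. heat_kernel (z - w) * \<phi> z)"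
  proof (rule Bochner_Integration.integrable_bound)
    show "integrable lborel (\<lambda>z. B * (heat_kernel (z - w) powr 1 * indicator (cball 0 R) z))" using i by simp
    show "AE z in lborel. norm (heat_kernel (z - w) * \<phi> z) \<le> norm (B * (heat_kernel (z - w) powr 1 * indicator (cball 0 R) z))"
    proof (rule AE_I2)
      fix z
      show "norm (heat_kernel (z - w) * \<phi> z) \<le> norm (B * (heat_kernel (z - w) powr 1 * indicator (cball 0 R) z))"
        using mult_left_mono[OF R(3)[of z] heat_kernel_nonneg[of "z - w"]] R(2) heat_kernel_nonneg[of "z - w"]
        by (simp add: abs_mult mult_ac)
    qed
  qed measurable
  then show "integrable lborel (\<lambda>z. heat_kernel z * \<phi> (w + z))"
    by (subst conv_check_eq(2)) auto
qed

lemma generalized_solution_exists_heat: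
  assumes \<alpha>: "0 < \<alpha>"
  shows "generalized_solution_exists \<alpha> (heat_kernel :: real \<times> (real ^ 'n::finite) \<Rightarrow> real)"
  unfolding generalized_solution_exists_def
proof
  fix \<phi> :: "real \<times> (real ^ 'n) \<Rightarrow> real" assume \<phi>: "\<phi> \<in> test_functions"
  note [measurable] = test_functionD(2)[OF \<phi>]
  obtain R B where R: "0 < R" "0 \<le> B" "\<And>z. \<bar>\<phi> z\<bar> \<le> B * indicator (cball 0 R) z"
    using test_functionD(3)[OF \<phi>] by blast
  obtain C c where C: "0 \<le> C" "0 < c" "\<And>s y. 0 \<le> s \<Longrightarrow>
     (\<integral>\<^sup>+z. ennreal (heat_kernel (z - (s, y :: real ^ 'n)) powr 1) * indicator (cball 0 R) z \<partial>lborel)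
      \<le> ennreal (C * exp (- c * (norm y)\<^sup>2)) * indicator {0..R} s"
    using heat_kernel_local_bound[of 1 R, where 'n='n] R(1) by auto
  have bound: "\<bar>conv_check \<phi> heat_kernel w\<bar> powr \<alpha>
      \<le> (B * C) powr \<alpha> * exp (- (c * \<alpha>) * (norm (snd w))\<^sup>2) * indicator {0..R} (fst w)"
    if w: "0 \<le> fst w" for w
  proof -
    let ?E = "B * (C * exp (- c * (norm (snd w))\<^sup>2)) * indicator {0..R} (fst w)"
    have "ennreal \<bar>conv_check \<phi> heat_kernel w\<bar> \<le> ennreal (LINT z|lborel. \<bar>heat_kernel (z - w) * \<phi> z\<bar>)"
      by (subst conv_check_eq(1)) (auto intro!: ennreal_leI integral_abs_bound)
    also have "\<dots> = (\<integral>\<^sup>+z. ennreal \<bar>heat_kernel (z - w) * \<phi> z\<bar> \<partial>lborel)"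
      using conv_check_integrable(2)[OF \<phi> w] by (intro nn_integral_eq_integral[symmetric]) auto
    also have "\<dots> \<le> (\<integral>\<^sup>+z. ennreal B * (ennreal (heat_kernel (z - w) powr 1) * indicator (cball 0 R) z) \<partial>lborel)"
    proof (intro nn_integral_mono)
      fix z
      have "\<bar>heat_kernel (z - w) * \<phi> z\<bar> \<le> B * (heat_kernel (z - w) * indicator (cball 0 R) z)"
        using mult_left_mono[OF R(3)[of z] heat_kernel_nonneg[of "z - w"]] heat_kernel_nonneg[of "z - w"]
        by (simp add: abs_mult mult_ac)
      then show "ennreal \<bar>heat_kernel (z - w) * \<phi> z\<bar>
          \<le> ennreal B * (ennreal (heat_kernel (z - w) powr 1) * indicator (cball 0 R) z)"
        using R(2) heat_kernel_nonneg[of "z - w"]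
        by (auto simp: ennreal_mult[symmetric] indicator_def intro!: ennreal_leI)
    qed
    also have "\<dots> = ennreal B * (\<integral>\<^sup>+z. ennreal (heat_kernel (z - w) powr 1) * indicator (cball 0 R) z \<partial>lborel)"
      by (rule nn_integral_cmult) measurable
    also have "\<dots> \<le> ennreal B * (ennreal (C * exp (- c * (norm (snd w))\<^sup>2)) * indicator {0..R} (fst w))"
      using C(3)[OF w, of "snd w"] by (intro mult_left_mono) auto
    also have "\<dots> = ennreal ?E"
      using R(2) C(1) by (auto simp: indicator_def ennreal_mult)
    finally have "\<bar>conv_check \<phi> heat_kernel w\<bar> \<le> ?E"
      using R(2) C(1) by (subst (asm) ennreal_le_iff) auto
    then have "\<bar>conv_check \<phi> heat_kernel w\<bar> powr \<alpha> \<le> ?E powr \<alpha>"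
      using \<alpha> by (intro powr_mono2) auto
    also have "\<dots> = (B * C) powr \<alpha> * exp (- (c * \<alpha>) * (norm (snd w))\<^sup>2) * indicator {0..R} (fst w)"
      using \<alpha> by (auto simp: indicator_def powr_mult exp_powr_real mult_ac)
    finally show ?thesis .
  qed
  have "L_modular \<alpha> (conv_check \<phi> heat_kernel)
      \<le> (\<integral>\<^sup>+w. ennreal ((B * C) powr \<alpha> * exp (- (c * \<alpha>) * (norm (snd w))\<^sup>2)) * indicator {0..R} (fst w)
          \<partial>(leb_half :: (real \<times> (real ^ 'n)) measure))"
    unfolding L_modular_def
  proof (intro nn_integral_mono)
    fix w :: "real \<times> (real ^ 'n)" assume "w \<in> space leb_half"
    then have "0 \<le> fst w" by (auto simp: half_space_def space_restrict_space)
    from bound[OF this] show "ennreal (\<bar>conv_check \<phi> heat_kernel w\<bar> powr \<alpha>)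
        \<le> ennreal ((B * C) powr \<alpha> * exp (- (c * \<alpha>) * (norm (snd w))\<^sup>2)) * indicator {0..R} (fst w)"
      by (auto simp: indicator_def intro: ennreal_leI split: if_splits)
  qed
  also have "\<dots> < \<infinity>"
    using C(2) \<alpha> by (intro nn_integral_gauss_half_space_finite) auto
  finally show "conv_check \<phi> heat_kernel \<in> L_space \<alpha>"
    unfolding L_space_iff by (auto intro!: measurable_restrict_space1)
qed

context stable_noise
begin

lemma random_mollify:
  fixes Y :: "'a::euclidean_space \<Rightarrow> 'w \<Rightarrow> real"
  assumes Y[measurable]: "(\<lambda>(z, \<omega>). Y z \<omega>) \<in> borel_measurable (borel \<Otimes>\<^sub>M M)"
    and loc: "AE \<omega> in M. \<forall>K. compact K \<longrightarrow> set_integrable lborel K (\<lambda>z. Y z \<omega>)"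
    and \<Psi>: "mollifier \<Psi>"
  obtains r :: "nat \<Rightarrow> nat" where "\<And>n. n \<le> r n"
    "AE z in lborel. AE \<omega> in M. (\<lambda>n. (LINT v|lborel. Y v \<omega> * \<Psi> (r n) (z - v)) - Y z \<omega>) \<longlonglongrightarrow> 0"
proof -
  note [measurable] = mollifierD(6)[OF \<Psi>]
  define N where "N j = restrict_space lborel (cball (0::'a) (real j)) \<Otimes>\<^sub>M M" for j :: nat
  define D where "D n = (\<lambda>(z, \<omega>). (LINT v|lborel. Y v \<omega> * \<Psi> n (z - v)) - Y z \<omega>)" for n
  have D_meas[measurable]: "D n \<in> borel_measurable (borel \<Otimes>\<^sub>M M)" for n
    unfolding D_def by measurable
  have fmK: "finite_measure (restrict_space lborel (cball (0::'a) (real j)))" for j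
    using emeasure_lborel_cball_finite[of "0::'a" "real j"]
    by (intro finite_measureI) (auto simp: emeasure_restrict_space space_restrict_space)
  have D_meas'[measurable]: "D n \<in> borel_measurable (restrict_space lborel (cball 0 (real j)) \<Otimes>\<^sub>M M)" for n j
  proof -
    have "(\<lambda>z :: 'a. z) \<in> measurable (restrict_space lborel (cball 0 (real j))) borel"
      by (rule measurable_restrict_space1) simp
    then have "(\<lambda>p. (fst p, snd p)) \<in> measurable (restrict_space lborel (cball (0::'a) (real j)) \<Otimes>\<^sub>M M) (borel \<Otimes>\<^sub>M M)"
      by (intro measurable_Pair measurable_compose[OF measurable_fst] measurable_snd)
    from measurable_compose[OF this D_meas] show ?thesis by simp
  qed
  have tend: "(\<lambda>n. prob_dist (N j) (D n)) \<longlonglongrightarrow> 0" for j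
  proof -
    interpret K: finite_measure "restrict_space lborel (cball (0::'a) (real j))" by (rule fmK)
    interpret KM: pair_sigma_finite "restrict_space lborel (cball (0::'a) (real j))" M ..
    have eq: "prob_dist (N j) (D n)
        = (\<integral>\<^sup>+\<omega>. \<integral>\<^sup>+z. ennreal (min 1 \<bar>D n (z, \<omega>)\<bar>) \<partial>restrict_space lborel (cball 0 (real j)) \<partial>M)" for n
      unfolding prob_dist_def N_def by (subst KM.nn_integral_snd[symmetric]) auto
    have "(\<lambda>n. \<integral>\<^sup>+\<omega>. \<integral>\<^sup>+z. ennreal (min 1 \<bar>D n (z, \<omega>)\<bar>) \<partial>restrict_space lborel (cball 0 (real j)) \<partial>M)
        \<longlonglongrightarrow> (\<integral>\<^sup>+\<omega>. 0 \<partial>M)"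
    proof (rule nn_integral_dominated_convergence[where w="\<lambda>_. emeasure lborel (cball (0::'a) (real j))"])
      show "(\<integral>\<^sup>+\<omega>. emeasure lborel (cball (0::'a) (real j)) \<partial>M) < \<infinity>"
        using emeasure_lborel_cball_finite[of "0::'a" "real j"] by (simp add: emeasure_space_1)
      show "AE \<omega> in M. (\<integral>\<^sup>+z. ennreal (min 1 \<bar>D n (z, \<omega>)\<bar>) \<partial>restrict_space lborel (cball 0 (real j)))
          \<le> emeasure lborel (cball (0::'a) (real j))" for n
      proof (rule AE_I2)
        fix \<omega>
        have "(\<integral>\<^sup>+z. ennreal (min 1 \<bar>D n (z, \<omega>)\<bar>) \<partial>restrict_space lborel (cball 0 (real j)))
          \<le> (\<integral>\<^sup>+z. 1 \<partial>restrict_space lborel (cball (0::'a) (real j)))"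
          by (intro nn_integral_mono) (simp add: ennreal_le_1)
        also have "\<dots> = emeasure lborel (cball (0::'a) (real j))"
          by (simp add: emeasure_restrict_space space_restrict_space)
        finally show "(\<integral>\<^sup>+z. ennreal (min 1 \<bar>D n (z, \<omega>)\<bar>) \<partial>restrict_space lborel (cball 0 (real j)))
          \<le> emeasure lborel (cball (0::'a) (real j))" .
      qed
      show "AE \<omega> in M. (\<lambda>n. \<integral>\<^sup>+z. ennreal (min 1 \<bar>D n (z, \<omega>)\<bar>) \<partial>restrict_space lborel (cball 0 (real j))) \<longlonglongrightarrow> 0"
        using loc
      proof eventually_elim
        case (elim \<omega>)
        have "(\<lambda>n. \<integral>\<^sup>+z\<in>cball 0 (real j). ennreal \<bar>(LINT v|lborel. Y v \<omega> * \<Psi> n (z - v)) - Y z \<omega>\<bar> \<partial>lborel) \<longlonglongrightarrow> 0"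
          using elim by (intro mollify_L1_local[OF _ \<Psi>]) auto
        then show ?case
        proof (rule tendsto_sandwich[OF _ _ tendsto_const, rotated 2])
          show "eventually (\<lambda>n. (\<integral>\<^sup>+z. ennreal (min 1 \<bar>D n (z, \<omega>)\<bar>) \<partial>restrict_space lborel (cball 0 (real j)))
            \<le> (\<integral>\<^sup>+z\<in>cball 0 (real j). ennreal \<bar>(LINT v|lborel. Y v \<omega> * \<Psi> n (z - v)) - Y z \<omega>\<bar> \<partial>lborel)) sequentially"
          proof (intro always_eventually allI)
            fix n
            have "(\<integral>\<^sup>+z. ennreal (min 1 \<bar>D n (z, \<omega>)\<bar>) \<partial>restrict_space lborel (cball 0 (real j)))
              = (\<integral>\<^sup>+z\<in>cball 0 (real j). ennreal (min 1 \<bar>D n (z, \<omega>)\<bar>) \<partial>lborel)"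
              by (rule nn_integral_restrict_space) simp
            also have "\<dots> \<le> (\<integral>\<^sup>+z\<in>cball 0 (real j). ennreal \<bar>(LINT v|lborel. Y v \<omega> * \<Psi> n (z - v)) - Y z \<omega>\<bar> \<partial>lborel)"
              by (intro nn_integral_mono mult_right_mono ennreal_leI) (auto simp: D_def)
            finally show "(\<integral>\<^sup>+z. ennreal (min 1 \<bar>D n (z, \<omega>)\<bar>) \<partial>restrict_space lborel (cball 0 (real j))) \<le> \<dots>" .
          qed
        qed auto
      qed
    qed auto
    then show ?thesis by (simp add: eq)
  qed
  have "\<exists>m\<ge>n. prob_dist (N n) (D m) < ennreal ((1/2) ^ n)" for n
  proof -
    have "eventually (\<lambda>m. prob_dist (N n) (D m) < ennreal ((1/2) ^ n)) sequentially"
      using tend[of n] unfolding tendsto_ennreal_0_iff by simp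
    then obtain m where "\<forall>k\<ge>m. prob_dist (N n) (D k) < ennreal ((1/2) ^ n)" unfolding eventually_sequentially by blast
    then show ?thesis by (intro exI[of _ "max m n"]) auto
  qed
  then obtain r where r: "\<And>n. n \<le> r n" "\<And>n. prob_dist (N n) (D (r n)) < ennreal ((1/2) ^ n)" by metis
  have ae_j: "AE z in lborel. norm z \<le> real j \<longrightarrow> (AE \<omega> in M. (\<lambda>n. D (r n) (z, \<omega>)) \<longlonglongrightarrow> 0)" for j
  proof -
    interpret K: finite_measure "restrict_space lborel (cball (0::'a) (real j))" by (rule fmK)
    interpret KM: pair_sigma_finite "restrict_space lborel (cball (0::'a) (real j))" M ..
    have mono: "prob_dist (N j) (D (r (n + j))) \<le> ennreal ((1/2) ^ n)" for n
    proof -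
      interpret K': finite_measure "restrict_space lborel (cball (0::'a) (real (n + j)))" by (rule fmK)
      interpret KM': pair_sigma_finite "restrict_space lborel (cball (0::'a) (real (n + j)))" M ..
      let ?d = "D (r (n + j))"
      have "prob_dist (N j) ?d
          = (\<integral>\<^sup>+z. \<integral>\<^sup>+\<omega>. ennreal (min 1 \<bar>?d (z, \<omega>)\<bar>) \<partial>M \<partial>restrict_space lborel (cball 0 (real j)))"
        unfolding prob_dist_def N_def by (subst nn_integral_fst[symmetric]) auto
      also have "\<dots> = (\<integral>\<^sup>+z\<in>cball 0 (real j). (\<integral>\<^sup>+\<omega>. ennreal (min 1 \<bar>?d (z, \<omega>)\<bar>) \<partial>M) \<partial>lborel)"
        by (rule nn_integral_restrict_space) simp
      also have "\<dots> \<le> (\<integral>\<^sup>+z\<in>cball 0 (real (n + j)). (\<integral>\<^sup>+\<omega>. ennreal (min 1 \<bar>?d (z, \<omega>)\<bar>) \<partial>M) \<partial>lborel)"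
        by (intro nn_integral_mono mult_left_mono) (auto simp: indicator_def)
      also have "\<dots> = (\<integral>\<^sup>+z. \<integral>\<^sup>+\<omega>. ennreal (min 1 \<bar>?d (z, \<omega>)\<bar>) \<partial>M \<partial>restrict_space lborel (cball 0 (real (n + j))))"
        by (rule nn_integral_restrict_space[symmetric]) simp
      also have "\<dots> = prob_dist (N (n + j)) ?d"
        unfolding prob_dist_def N_def by (subst nn_integral_fst[symmetric]) (auto simp del: of_nat_add)
      also have "\<dots> \<le> ennreal ((1/2) ^ (n + j))" using r(2)[of "n + j"] by simp
      also have "\<dots> \<le> ennreal ((1/2) ^ n)" by (intro ennreal_leI power_decreasing) auto
      finally show ?thesis .
    qed
    have "(\<Sum>n. prob_dist (N j) (D (r (n + j)))) \<le> (\<Sum>n. ennreal ((1/2) ^ n))"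
      by (intro suminf_le mono) auto
    also have "\<dots> = ennreal 2"
      using power_half_series geometric_sums[of "1/2 :: real"] by (intro suminf_ennreal_eq) auto
    also have "\<dots> < \<infinity>" by simp
    finally have "AE p in N j. summable (\<lambda>n. \<bar>D (r (n + j)) p\<bar>)"
      unfolding N_def by (intro AE_summable_of_prob_dist) auto
    then have "AE p in N j. (\<lambda>n. D (r n) p) \<longlonglongrightarrow> 0"
    proof eventually_elim
      case (elim p)
      have "(\<lambda>n. \<bar>D (r (n + j)) p\<bar>) \<longlonglongrightarrow> 0" using summable_LIMSEQ_zero[OF elim] .
      then have "(\<lambda>n. D (r (n + j)) p) \<longlonglongrightarrow> 0" by (rule tendsto_rabs_zero_cancel)
      then show ?case by (rule LIMSEQ_offset)
    qed
    then have "AE z in restrict_space lborel (cball 0 (real j)). AE \<omega> in M. (\<lambda>n. D (r n) (z, \<omega>)) \<longlonglongrightarrow> 0"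
      unfolding N_def by (rule KM.AE_pair)
    then show ?thesis by (subst (asm) AE_restrict_space_iff) auto
  qed
  have "AE z in lborel. AE \<omega> in M. (\<lambda>n. D (r n) (z, \<omega>)) \<longlonglongrightarrow> 0"
  proof -
    have "AE z in lborel. \<forall>j. norm z \<le> real j \<longrightarrow> (AE \<omega> in M. (\<lambda>n. D (r n) (z, \<omega>)) \<longlonglongrightarrow> 0)"
      unfolding AE_all_countable using ae_j by blast
    then show ?thesis
    proof eventually_elim
      case (elim z)
      obtain j :: nat where "norm z \<le> real j" using real_arch_simple by blast
      then show ?case using elim by blast
    qed
  qed
  then show thesis using that[of r] r(1) by (simp add: D_def)
qed

lemma generalized_solution_has_integral:
  fixes \<phi> :: "real \<times> (real ^ 'n) \<Rightarrow> real"
  assumes "\<phi> \<in> test_functions"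
  shows "has_stable_integral M \<alpha> W (conv_check \<phi> heat_kernel) (generalized_solution M \<alpha> W heat_kernel \<phi>)"
  unfolding generalized_solution_def
  using generalized_solution_exists_heat[OF \<alpha>_pos, where 'n='n] assms
  by (intro stable_integral) (simp add: generalized_solution_exists_def)

text \<open>A representation is recovered almost everywhere by testing against mollifiers, whose
  convolutions with the reflected kernel converge pointwise to the shifted kernel.\<close>

lemma representation_has_integral:
  assumes Y: "random_field_representation M (generalized_solution M \<alpha> W heat_kernel) Y"
  shows "AE z in lborel. has_stable_integral M \<alpha> W (heat_shift z) (Y z)"
proof -
  have [measurable]: "(\<lambda>(z, \<omega>). Y z \<omega>) \<in> borel_measurable (borel \<Otimes>\<^sub>M M)"
    and loc: "AE \<omega> in M. \<forall>K. compact K \<longrightarrow> set_integrable lborel K (\<lambda>z. Y z \<omega>)"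
    and rep: "\<And>\<phi>. \<phi> \<in> test_functions \<Longrightarrow>
      AE \<omega> in M. generalized_solution M \<alpha> W heat_kernel \<phi> \<omega> = (LINT z|lborel. Y z \<omega> * \<phi> z)"
    using Y by (auto simp: random_field_representation_def)
  obtain \<Psi> :: "nat \<Rightarrow> real \<times> (real ^ 'n) \<Rightarrow> real" where \<Psi>: "mollifier \<Psi>" using mollifier_exists by blast
  note [measurable] = mollifierD(6)[OF \<Psi>]
  obtain r where r: "\<And>n. n \<le> r n"
    "AE z in lborel. AE \<omega> in M. (\<lambda>n. (LINT v|lborel. Y v \<omega> * \<Psi> (r n) (z - v)) - Y z \<omega>) \<longlonglongrightarrow> 0"
    using random_mollify[OF _ loc \<Psi>] by auto
  have r_lim: "filterlim r at_top sequentially"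
    using r(1) by (intro filterlim_at_top_mono[OF filterlim_ident]) auto
  from r(2) show ?thesis
  proof eventually_elim
    case (elim z)
    let ?\<phi> = "\<lambda>n v. \<Psi> (r n) (z - v)"
    have tf: "?\<phi> n \<in> test_functions" for n using \<Psi> by (rule mollifier_test_function)
    note hi = generalized_solution_has_integral[OF tf]
    have Ymeas[measurable]: "Y z \<in> borel_measurable M" by measurable
    have gm[measurable]: "generalized_solution M \<alpha> W heat_kernel (?\<phi> n) \<in> borel_measurable M" for n
      using hi[of n] by (simp add: has_stable_integral_iff)
    show ?case
    proof (rule has_stable_integral_pointwise_limit[OF hi])
      show "heat_shift z \<in> borel_measurable leb_half" by (rule measurable_restrict_space1) measurable
      show "(\<lambda>n. prob_dist M (\<lambda>\<omega>. generalized_solution M \<alpha> W heat_kernel (?\<phi> n) \<omega> - Y z \<omega>)) \<longlonglongrightarrow> 0"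
      proof (rule prob_dist_tendsto_AE)
        have "AE \<omega> in M. \<forall>n. generalized_solution M \<alpha> W heat_kernel (?\<phi> n) \<omega> = (LINT v|lborel. Y v \<omega> * ?\<phi> n v)"
          unfolding AE_all_countable using rep[OF tf] by blast
        with elim show "AE \<omega> in M. (\<lambda>n. generalized_solution M \<alpha> W heat_kernel (?\<phi> n) \<omega> - Y z \<omega>) \<longlonglongrightarrow> 0"
          by eventually_elim simp
      qed (auto intro: prob_space_axioms)
      have "AE w in lborel. (\<lambda>n. conv_check (?\<phi> n) heat_kernel w) \<longlonglongrightarrow> heat_shift z w"
        using AE_lborel_singleton[of z]
      proof eventually_elim
        case (elim w)
        have "(\<lambda>n. LINT v|lborel. heat_kernel v * \<Psi> n ((z - w) - v)) \<longlonglongrightarrow> heat_kernel (z - w)"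
          using elim by (intro mollify_pointwise[OF \<Psi>] heat_kernel_isCont) auto
        from filterlim_compose[OF this r_lim]
        show ?case by (simp add: conv_check_def pairing_def heat_shift_def diff_diff_eq)
      qed
      then show "AE w in leb_half. (\<lambda>n. conv_check (?\<phi> n) heat_kernel w) \<longlonglongrightarrow> heat_shift z w"
        by (subst AE_restrict_space_iff) auto
    qed (rule Ymeas)
  qed
qed

end

section \<open>Random fields built from the noise\<close>

lemma powr_le_tangent:
  fixes t p :: real
  assumes "0 \<le> t" "0 \<le> p" "p \<le> 1"
  shows "t powr p \<le> p * t + (1 - p)"
proof (cases "t = 0")
  case False
  then show ?thesis using Youngs_inequality_0[of p "1 - p" t 1] assms by simp
qed (use assms in simp)

lemma powr_sum_le_concave:
  fixes a b p :: real
  assumes "0 \<le> a" "0 \<le> b" "0 \<le> p" "p \<le> 1"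
  shows "a powr p + b powr p \<le> 2 * ((a + b) / 2) powr p"
proof (cases "a + b = 0")
  case True
  then have "a = 0" "b = 0" using assms by auto
  then show ?thesis by simp
next
  case False
  define m where "m = (a + b) / 2"
  have m: "0 < m" using False assms by (simp add: m_def)
  have "a powr p + b powr p = m powr p * ((a / m) powr p + (b / m) powr p)"
    using m by (simp add: powr_divide distrib_left)
  also have "\<dots> \<le> m powr p * ((p * (a / m) + (1 - p)) + (p * (b / m) + (1 - p)))"
    using assms m by (intro mult_left_mono add_mono powr_le_tangent) auto
  also have "p * (a / m) + (1 - p) + (p * (b / m) + (1 - p)) = p * ((a + b) / m) + 2 * (1 - p)"
    by (simp add: add_divide_distrib distrib_left)
  also have "(a + b) / m = 2"
  proof -
    have "a + b = 2 * m" by (simp add: m_def)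
    then show ?thesis using m by simp
  qed
  finally show ?thesis by (simp add: m_def mult.commute)
qed

lemma powr_subadditive:
  fixes a b p :: real
  assumes "0 \<le> a" "0 \<le> b" "0 \<le> p" "p \<le> 1"
  shows "(a + b) powr p \<le> a powr p + b powr p"
proof (cases "a + b = 0")
  case False
  then have s: "0 < a + b" using assms by auto
  have le: "t \<le> t powr p" if "0 \<le> t" "t \<le> 1" for t
    using that assms powr_mono'[of p 1 t] by (cases "t = 0") auto
  have "(a + b) powr p = (a + b) powr p * (a / (a + b) + b / (a + b))"
    using s by (simp add: add_divide_distrib[symmetric])
  also have "\<dots> \<le> (a + b) powr p * ((a / (a + b)) powr p + (b / (a + b)) powr p)"
    using s assms by (intro mult_left_mono add_mono le) auto
  also have "\<dots> = a powr p + b powr p"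
    using s by (simp add: powr_divide distrib_left)
  finally show ?thesis .
qed simp

lemma clarkson_powr:
  fixes s x q :: real
  assumes "1 \<le> q" "q \<le> 2"
  shows "\<bar>s + x\<bar> powr q + \<bar>s - x\<bar> powr q \<le> 2 * (\<bar>s\<bar> powr q + \<bar>x\<bar> powr q)"
proof -
  have sq: "\<bar>y\<bar> powr q = (y\<^sup>2) powr (q / 2)" for y :: real
  proof (cases "y = 0")
    case False
    then have "y\<^sup>2 = \<bar>y\<bar> powr 2" by (simp add: powr_numeral)
    then have "(y\<^sup>2) powr (q / 2) = (\<bar>y\<bar> powr 2) powr (q / 2)" by (rule arg_cong)
    also have "\<dots> = \<bar>y\<bar> powr q" by (simp only: powr_powr) simp
    finally show ?thesis by simp
  qed simp
  have "\<bar>s + x\<bar> powr q + \<bar>s - x\<bar> powr q \<le> 2 * (((s + x)\<^sup>2 + (s - x)\<^sup>2) / 2) powr (q / 2)"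
    unfolding sq using assms by (intro powr_sum_le_concave) auto
  also have "((s + x)\<^sup>2 + (s - x)\<^sup>2) / 2 = s\<^sup>2 + x\<^sup>2" by (simp add: power2_eq_square algebra_simps)
  also have "(s\<^sup>2 + x\<^sup>2) powr (q / 2) \<le> (s\<^sup>2) powr (q / 2) + (x\<^sup>2) powr (q / 2)"
    using assms by (intro powr_subadditive) auto
  finally show ?thesis by (simp add: sq)
qed

definition symmetric_rv :: "'w measure \<Rightarrow> ('w \<Rightarrow> real) \<Rightarrow> bool" where
  "symmetric_rv M X \<longleftrightarrow> X \<in> borel_measurable M \<and>
    (\<forall>f\<in>borel_measurable borel. (\<integral>\<^sup>+\<omega>. f (X \<omega>) \<partial>M) = (\<integral>\<^sup>+\<omega>. f (- X \<omega>) \<partial>M))"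

lemma symmetric_rv_odd:
  assumes X: "symmetric_rv M X" and h[measurable]: "h \<in> borel_measurable borel" and odd: "\<And>x. h (- x) = - h x"
  shows "symmetric_rv M (\<lambda>\<omega>. h (X \<omega>))"
  unfolding symmetric_rv_def
proof (intro conjI ballI)
  have [measurable]: "X \<in> borel_measurable M" using X by (simp add: symmetric_rv_def)
  show "(\<lambda>\<omega>. h (X \<omega>)) \<in> borel_measurable M" by measurable
  fix f :: "real \<Rightarrow> ennreal" assume [measurable]: "f \<in> borel_measurable borel"
  have fh: "(\<lambda>x. f (h x)) \<in> borel_measurable borel" by measurable
  from X have "\<forall>f\<in>borel_measurable borel. (\<integral>\<^sup>+\<omega>. f (X \<omega>) \<partial>M) = (\<integral>\<^sup>+\<omega>. f (- X \<omega>) \<partial>M)"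
    by (simp add: symmetric_rv_def)
  from bspec[OF this fh] show "(\<integral>\<^sup>+\<omega>. f (h (X \<omega>)) \<partial>M) = (\<integral>\<^sup>+\<omega>. f (- h (X \<omega>)) \<partial>M)"
    by (simp add: odd)
qed

lemma symmetric_rv_char:
  assumes "prob_space M" and X[measurable]: "X \<in> borel_measurable M"
    and ch: "\<And>u. char (distr M borel X) (- u) = char (distr M borel X) u"
  shows "symmetric_rv M X"
proof -
  interpret prob_space M by fact
  have "distr M borel (\<lambda>\<omega>. - X \<omega>) = distr M borel X"
  proof (rule Levy_uniqueness)
    show "real_distribution (distr M borel (\<lambda>\<omega>. - X \<omega>))" "real_distribution (distr M borel X)"
      by (auto intro: real_distribution_distr)
    show "char (distr M borel (\<lambda>\<omega>. - X \<omega>)) = char (distr M borel X)"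
    proof
      fix u
      have "char (distr M borel (\<lambda>\<omega>. - X \<omega>)) u = char (distr M borel X) (- u)"
        by (simp add: char_def integral_distr)
      then show "char (distr M borel (\<lambda>\<omega>. - X \<omega>)) u = char (distr M borel X) u" by (simp add: ch)
    qed
  qed
  then have "(\<integral>\<^sup>+\<omega>. f (X \<omega>) \<partial>M) = (\<integral>\<^sup>+\<omega>. f (- X \<omega>) \<partial>M)" if "f \<in> borel_measurable borel" for f
    using nn_integral_distr[of X M borel f] nn_integral_distr[of "\<lambda>\<omega>. - X \<omega>" M borel f] that by simp
  then show ?thesis by (simp add: symmetric_rv_def)
qed

lemma (in prob_space) nn_expectation_powr_add:
  assumes ind: "indep_var borel X borel S" and sym: "symmetric_rv M X" and q: "1 \<le> q" "q \<le> 2"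
  shows "(\<integral>\<^sup>+\<omega>. ennreal (\<bar>S \<omega> + X \<omega>\<bar> powr q) \<partial>M)
    \<le> (\<integral>\<^sup>+\<omega>. ennreal (\<bar>S \<omega>\<bar> powr q) \<partial>M) + (\<integral>\<^sup>+\<omega>. ennreal (\<bar>X \<omega>\<bar> powr q) \<partial>M)"
proof -
  have [measurable]: "S \<in> borel_measurable M" "X \<in> borel_measurable M"
    using ind by (auto elim: indep_var_rv1 indep_var_rv2)
  interpret DS: prob_space "distr M borel S" by (rule prob_space_distr) simp
  interpret DX: prob_space "distr M borel X" by (rule prob_space_distr) simp
  interpret P: pair_prob_space "distr M borel X" "distr M borel S" ..
  have joint: "distr M borel X \<Otimes>\<^sub>M distr M borel S = distr M (borel \<Otimes>\<^sub>M borel) (\<lambda>\<omega>. (X \<omega>, S \<omega>))"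
    using ind unfolding indep_var_distribution_eq by simp
  have inner: "(\<integral>\<^sup>+\<omega>. ennreal (\<bar>s + X \<omega>\<bar> powr q) \<partial>M)
      \<le> ennreal (\<bar>s\<bar> powr q) + (\<integral>\<^sup>+\<omega>. ennreal (\<bar>X \<omega>\<bar> powr q) \<partial>M)" for s
  proof -
    have "(\<lambda>x. ennreal (\<bar>s + x\<bar> powr q)) \<in> borel_measurable borel" by measurable
    then have eq: "(\<integral>\<^sup>+\<omega>. ennreal (\<bar>s + X \<omega>\<bar> powr q) \<partial>M) = (\<integral>\<^sup>+\<omega>. ennreal (\<bar>s - X \<omega>\<bar> powr q) \<partial>M)"
      using sym unfolding symmetric_rv_def by (metis (no_types, lifting) add_uminus_conv_diff nn_integral_cong)
    have "2 * (\<integral>\<^sup>+\<omega>. ennreal (\<bar>s + X \<omega>\<bar> powr q) \<partial>M)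
        = (\<integral>\<^sup>+\<omega>. ennreal (\<bar>s + X \<omega>\<bar> powr q) + ennreal (\<bar>s - X \<omega>\<bar> powr q) \<partial>M)"
      by (subst nn_integral_add) (auto simp: eq[symmetric] mult_2)
    also have "\<dots> \<le> (\<integral>\<^sup>+\<omega>. 2 * (ennreal (\<bar>s\<bar> powr q) + ennreal (\<bar>X \<omega>\<bar> powr q)) \<partial>M)"
    proof (intro nn_integral_mono)
      fix \<omega>
      have "ennreal (\<bar>s + X \<omega>\<bar> powr q + \<bar>s - X \<omega>\<bar> powr q) \<le> ennreal (2 * (\<bar>s\<bar> powr q + \<bar>X \<omega>\<bar> powr q))"
        by (intro ennreal_leI clarkson_powr q)
      then show "ennreal (\<bar>s + X \<omega>\<bar> powr q) + ennreal (\<bar>s - X \<omega>\<bar> powr q)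
          \<le> 2 * (ennreal (\<bar>s\<bar> powr q) + ennreal (\<bar>X \<omega>\<bar> powr q))"
        by (simp add: ennreal_mult)
    qed
    also have "\<dots> = 2 * (ennreal (\<bar>s\<bar> powr q) + (\<integral>\<^sup>+\<omega>. ennreal (\<bar>X \<omega>\<bar> powr q) \<partial>M))"
      by (simp add: nn_integral_cmult nn_integral_add emeasure_space_1)
    finally show ?thesis by (subst (asm) ennreal_mult_le_mult_iff) auto
  qed
  have "(\<integral>\<^sup>+\<omega>. ennreal (\<bar>S \<omega> + X \<omega>\<bar> powr q) \<partial>M)
      = (\<integral>\<^sup>+p. ennreal (\<bar>snd p + fst p\<bar> powr q) \<partial>(distr M borel X \<Otimes>\<^sub>M distr M borel S))"
    unfolding joint by (subst nn_integral_distr) auto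
  also have "\<dots> = (\<integral>\<^sup>+s. \<integral>\<^sup>+x. ennreal (\<bar>s + x\<bar> powr q) \<partial>distr M borel X \<partial>distr M borel S)"
    by (subst P.nn_integral_snd[symmetric]) (auto simp: split_beta)
  also have "\<dots> = (\<integral>\<^sup>+\<omega>'. \<integral>\<^sup>+\<omega>. ennreal (\<bar>S \<omega>' + X \<omega>\<bar> powr q) \<partial>M \<partial>M)"
    by (subst nn_integral_distr; (subst nn_integral_distr)?) auto
  also have "\<dots> \<le> (\<integral>\<^sup>+\<omega>'. ennreal (\<bar>S \<omega>'\<bar> powr q) + (\<integral>\<^sup>+\<omega>. ennreal (\<bar>X \<omega>\<bar> powr q) \<partial>M) \<partial>M)"
    by (intro nn_integral_mono inner)
  also have "\<dots> = (\<integral>\<^sup>+\<omega>. ennreal (\<bar>S \<omega>\<bar> powr q) \<partial>M) + (\<integral>\<^sup>+\<omega>. ennreal (\<bar>X \<omega>\<bar> powr q) \<partial>M)"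
    by (simp add: nn_integral_add emeasure_space_1)
  finally show ?thesis .
qed

lemma (in prob_space) nn_expectation_powr_sum:
  fixes X :: "nat \<Rightarrow> 'a \<Rightarrow> real"
  assumes ind: "indep_vars (\<lambda>_. borel) X UNIV" and sym: "\<And>i. symmetric_rv M (X i)" and q: "1 \<le> q" "q \<le> 2"
  shows "(\<integral>\<^sup>+\<omega>. ennreal (\<bar>\<Sum>i<n. X i \<omega>\<bar> powr q) \<partial>M) \<le> (\<Sum>i<n. \<integral>\<^sup>+\<omega>. ennreal (\<bar>X i \<omega>\<bar> powr q) \<partial>M)"
proof (induction n)
  case (Suc n)
  have "indep_vars (\<lambda>_. borel) X (insert n {..<n})"
    using ind by (rule indep_vars_subset) auto
  then have iv: "indep_var borel (X n) borel (\<lambda>\<omega>. \<Sum>i<n. X i \<omega>)"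
    by (intro indep_vars_sum) auto
  have "(\<integral>\<^sup>+\<omega>. ennreal (\<bar>\<Sum>i<Suc n. X i \<omega>\<bar> powr q) \<partial>M)
      \<le> (\<integral>\<^sup>+\<omega>. ennreal (\<bar>\<Sum>i<n. X i \<omega>\<bar> powr q) \<partial>M) + (\<integral>\<^sup>+\<omega>. ennreal (\<bar>X n \<omega>\<bar> powr q) \<partial>M)"
    using nn_expectation_powr_add[OF iv sym q] by simp
  also have "\<dots> \<le> (\<Sum>i<Suc n. \<integral>\<^sup>+\<omega>. ennreal (\<bar>X i \<omega>\<bar> powr q) \<partial>M)"
    using Suc by (simp add: add_right_mono)
  finally show ?case .
qed (use q in simp)

text \<open>Elementary fields: a list of pairs \<open>(g, A)\<close> encodes the kernel \<open>\<Sum> g(z) 1\<^sub>A(w)\<close> and the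
  random field \<open>\<Sum> g(z) W(A)\<close>.\<close>

definition field_kernel :: "(('z \<Rightarrow> real) \<times> 'b set) list \<Rightarrow> 'z \<Rightarrow> 'b \<Rightarrow> real" where
  "field_kernel L z = simple_fun (map (\<lambda>(g, A). (g z, A)) L)"

definition simple_field :: "('b set \<Rightarrow> 'w \<Rightarrow> real) \<Rightarrow> (('z \<Rightarrow> real) \<times> 'b set) list \<Rightarrow> 'z \<Rightarrow> 'w \<Rightarrow> real" where
  "simple_field W L z = simple_integral W (map (\<lambda>(g, A). (g z, A)) L)"

definition admissible :: "'z measure \<Rightarrow> (('z \<Rightarrow> real) \<times> (real \<times> (real ^ 'n::finite)) set) list \<Rightarrow> bool" where
  "admissible \<mu> L \<longleftrightarrow> snd ` set L \<subseteq> finite_sets \<and>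
    (\<forall>g\<in>fst ` set L. g \<in> borel_measurable \<mu> \<and> (\<exists>B. \<forall>z. \<bar>g z\<bar> \<le> B))"

definition mixed_modular ::
  "'z measure \<Rightarrow> real \<Rightarrow> real \<Rightarrow> ('z \<Rightarrow> real \<times> (real ^ 'n::finite) \<Rightarrow> real) \<Rightarrow> ennreal" where
  "mixed_modular \<mu> \<alpha> q k = (\<integral>\<^sup>+w. ennreal ((LINT z|\<mu>. \<bar>k z w\<bar> powr q) powr (\<alpha> / q)) \<partial>leb_half)"

lemma bounded_sum_list_coeff:
  assumes "\<forall>g\<in>fst ` set L. g \<in> borel_measurable \<mu> \<and> (\<exists>B. \<forall>z. \<bar>g z\<bar> \<le> B)"
  shows "(\<lambda>z. \<Sum>(g, A)\<leftarrow>L. g z * c A) \<in> borel_measurable \<mu> \<and> (\<exists>B. \<forall>z. \<bar>\<Sum>(g, A)\<leftarrow>L. g z * c A\<bar> \<le> (B :: real))"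
  using assms
proof (induction L)
  case (Cons p L)
  obtain g A where p: "p = (g, A)" by (cases p)
  obtain B where B: "\<And>z. \<bar>\<Sum>(g, A)\<leftarrow>L. g z * c A\<bar> \<le> B" using Cons by auto
  obtain B' where B': "\<And>z. \<bar>g z\<bar> \<le> B'" using Cons.prems by (auto simp: p)
  have [measurable]: "g \<in> borel_measurable \<mu>" "(\<lambda>z. \<Sum>(g, A)\<leftarrow>L. g z * c A) \<in> borel_measurable \<mu>"
    using Cons by (auto simp: p)
  have "\<bar>g z * c A + (\<Sum>(g, A)\<leftarrow>L. g z * c A)\<bar> \<le> B' * \<bar>c A\<bar> + B" for z
  proof -
    have "\<bar>g z * c A + (\<Sum>(g, A)\<leftarrow>L. g z * c A)\<bar> \<le> \<bar>g z * c A\<bar> + \<bar>\<Sum>(g, A)\<leftarrow>L. g z * c A\<bar>" by (rule abs_triangle_ineq)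
    also have "\<dots> \<le> B' * \<bar>c A\<bar> + B" unfolding abs_mult by (intro add_mono mult_right_mono B B') auto
    finally show ?thesis .
  qed
  then show ?case by (auto simp: p)
qed (auto intro: exI[of _ 0])

lemma admissible_coeff:
  assumes "admissible \<mu> L"
  shows "(\<lambda>z. \<Sum>(g, A)\<leftarrow>L. g z * c A) \<in> borel_measurable \<mu>"
    and "\<exists>B. \<forall>z. \<bar>\<Sum>(g, A)\<leftarrow>L. g z * c A\<bar> \<le> (B :: real)"
  using bounded_sum_list_coeff[of L \<mu> c] assms by (auto simp: admissible_def)

lemma integrable_bounded_powr:
  fixes f :: "'z \<Rightarrow> real"
  assumes "finite_measure \<mu>" "f \<in> borel_measurable \<mu>" "\<exists>B. \<forall>z. \<bar>f z\<bar> \<le> B" "0 \<le> q"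
  shows "integrable \<mu> (\<lambda>z. \<bar>f z\<bar> powr q)"
proof -
  interpret finite_measure \<mu> by fact
  note [measurable] = assms(2)
  obtain B where B: "\<And>z. \<bar>f z\<bar> \<le> B" using assms(3) by blast
  have "0 \<le> B" using B[of undefined] by linarith
  show ?thesis
    by (rule integrable_const_bound[where B="B powr q"]) (use B assms(4) in \<open>auto intro!: powr_mono2\<close>)
qed

lemma field_kernel_eq: "field_kernel L z w = (\<Sum>(g, A)\<leftarrow>L. g z * indicator A w)"
  by (induction L) (auto simp: field_kernel_def simple_fun_def)

lemma simple_field_eq: "simple_field W L z \<omega> = (\<Sum>(g, A)\<leftarrow>L. g z * W A \<omega>)"
  by (induction L) (auto simp: simple_field_def simple_integral_def)

context stable_noise
begin

lemma W_symmetric: "A \<in> finite_sets \<Longrightarrow> symmetric_rv M (W A)"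
  by (rule symmetric_rv_char) (auto simp: W_char W_measurable prob_space_axioms)

lemma disjoint_field_bound:
  fixes \<mu> :: "'z measure" and g :: "nat \<Rightarrow> 'z \<Rightarrow> real"
  assumes \<mu>: "finite_measure \<mu>" and B: "range B \<subseteq> finite_sets" "disjoint_family B"
    and g[measurable]: "\<And>i. g i \<in> borel_measurable \<mu>" and b: "\<And>i. 0 \<le> b i"
    and gb: "\<And>i. (\<integral>\<^sup>+z. ennreal (\<bar>g i z\<bar> powr q) \<partial>\<mu>) = ennreal (b i powr q)"
    and q: "1 \<le> q" "\<alpha> < q" "q \<le> 2" and \<delta>: "0 < \<delta>"
  shows "(\<integral>\<^sup>+\<omega>. min 1 (\<integral>\<^sup>+z. ennreal \<bar>\<Sum>i<n. g i z * W (B i) \<omega>\<bar> \<partial>\<mu>) \<partial>M)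
    \<le> ennreal \<delta> * emeasure \<mu> (space \<mu>) + ennreal (stable_tail_const \<alpha> q * (1 + \<delta> powr (1 - q))) *
      ennreal (\<Sum>i<n. measure leb_half (B i) * b i powr \<alpha>)"
proof -
  interpret finite_measure \<mu> by fact
  interpret P: pair_sigma_finite M \<mu> ..
  define C where "C = stable_tail_const \<alpha> q"
  have C: "0 \<le> C" unfolding C_def using q by (intro stable_tail_const_nonneg)
  have Bf: "B i \<in> finite_sets" for i using B by auto
  define X where "X i = W (B i)" for i
  have [measurable]: "X i \<in> borel_measurable M" for i unfolding X_def by (rule W_measurable[OF Bf])
  define h where "h i x = (if \<bar>b i * x\<bar> \<le> 1 then x else 0)" for i and x :: real
  have [measurable]: "h i \<in> borel_measurable borel" for i unfolding h_def by measurable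
  define X' where "X' i \<omega> = h i (X i \<omega>)" for i \<omega>
  have [measurable]: "X' i \<in> borel_measurable M" for i unfolding X'_def by measurable
  define m where "m i = (\<integral>\<^sup>+\<omega>. ennreal (min 1 (\<bar>b i * X i \<omega>\<bar> powr q)) \<partial>M)" for i
  have m: "m i \<le> ennreal (C * (measure leb_half (B i) * b i powr \<alpha>))" for i
  proof -
    have "m i \<le> ennreal (stable_tail_const \<alpha> q * measure leb_half (B i) * \<bar>b i\<bar> powr \<alpha>)"
      unfolding m_def X_def
      by (rule stable_tail[OF prob_space_axioms W_measurable[OF Bf] W_char[OF Bf]])
         (use q \<alpha>_pos in auto)
    then show ?thesis using b[of i] by (simp add: C_def mult.assoc)
  qed
  have sym: "symmetric_rv M (\<lambda>\<omega>. g i z * X' i \<omega>)" for i z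
    unfolding X'_def X_def
    by (rule symmetric_rv_odd[OF W_symmetric[OF Bf]]) (auto simp: h_def)
  have ind: "indep_vars (\<lambda>_. borel) (\<lambda>i \<omega>. g i z * X' i \<omega>) UNIV" for z
    using indep_vars_compose2[OF W_indep[OF B], of "\<lambda>i x. g i z * h i x" "\<lambda>_. borel"]
    by (simp add: X'_def X_def)
  have mom: "ennreal (b i powr q) * (\<integral>\<^sup>+\<omega>. ennreal (\<bar>X' i \<omega>\<bar> powr q) \<partial>M) \<le> m i" for i
  proof -
    have "ennreal (b i powr q) * (\<integral>\<^sup>+\<omega>. ennreal (\<bar>X' i \<omega>\<bar> powr q) \<partial>M)
        = (\<integral>\<^sup>+\<omega>. ennreal (\<bar>b i * X' i \<omega>\<bar> powr q) \<partial>M)"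
      using b[of i] by (subst nn_integral_cmult[symmetric]) (auto simp: abs_powr_mult ennreal_mult)
    also have "\<dots> \<le> m i"
      unfolding m_def
    proof (intro nn_integral_mono ennreal_leI)
      fix \<omega>
      show "\<bar>b i * X' i \<omega>\<bar> powr q \<le> min 1 (\<bar>b i * X i \<omega>\<bar> powr q)"
        using q by (auto simp: X'_def h_def intro: powr_le1)
    qed
    finally show ?thesis .
  qed
  have meanE: "(\<integral>\<^sup>+\<omega>. ennreal \<bar>\<Sum>i<n. g i z * X' i \<omega>\<bar> \<partial>M)
      \<le> ennreal \<delta> + ennreal (\<delta> powr (1 - q)) * (\<Sum>i<n. ennreal (\<bar>g i z\<bar> powr q) * (\<integral>\<^sup>+\<omega>. ennreal (\<bar>X' i \<omega>\<bar> powr q) \<partial>M))" for z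
  proof -
    have "(\<integral>\<^sup>+\<omega>. ennreal \<bar>\<Sum>i<n. g i z * X' i \<omega>\<bar> \<partial>M)
        \<le> (\<integral>\<^sup>+\<omega>. ennreal \<delta> + ennreal (\<delta> powr (1 - q)) * ennreal (\<bar>\<Sum>i<n. g i z * X' i \<omega>\<bar> powr q) \<partial>M)"
    proof (intro nn_integral_mono)
      fix \<omega>
      show "ennreal \<bar>\<Sum>i<n. g i z * X' i \<omega>\<bar>
          \<le> ennreal \<delta> + ennreal (\<delta> powr (1 - q)) * ennreal (\<bar>\<Sum>i<n. g i z * X' i \<omega>\<bar> powr q)"
        using abs_le_delta_powr[OF q(1) \<delta>, of "\<Sum>i<n. g i z * X' i \<omega>"] \<delta>
        by (simp add: ennreal_mult[symmetric] ennreal_plus[symmetric] ennreal_leI del: ennreal_plus)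
    qed
    also have "\<dots> = ennreal \<delta> + ennreal (\<delta> powr (1 - q)) * (\<integral>\<^sup>+\<omega>. ennreal (\<bar>\<Sum>i<n. g i z * X' i \<omega>\<bar> powr q) \<partial>M)"
      by (simp add: nn_integral_add nn_integral_cmult emeasure_space_1)
    also have "\<dots> \<le> ennreal \<delta> + ennreal (\<delta> powr (1 - q)) * (\<Sum>i<n. \<integral>\<^sup>+\<omega>. ennreal (\<bar>g i z * X' i \<omega>\<bar> powr q) \<partial>M)"
      by (intro add_left_mono mult_left_mono nn_expectation_powr_sum ind sym q) auto
    also have "(\<Sum>i<n. \<integral>\<^sup>+\<omega>. ennreal (\<bar>g i z * X' i \<omega>\<bar> powr q) \<partial>M)
        = (\<Sum>i<n. ennreal (\<bar>g i z\<bar> powr q) * (\<integral>\<^sup>+\<omega>. ennreal (\<bar>X' i \<omega>\<bar> powr q) \<partial>M))"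
      by (intro sum.cong refl, subst nn_integral_cmult[symmetric]) (auto simp: abs_powr_mult ennreal_mult)
    finally show ?thesis .
  qed
  have "(\<integral>\<^sup>+\<omega>. min 1 (\<integral>\<^sup>+z. ennreal \<bar>\<Sum>i<n. g i z * W (B i) \<omega>\<bar> \<partial>\<mu>) \<partial>M)
      \<le> (\<integral>\<^sup>+\<omega>. (\<Sum>i<n. ennreal (min 1 (\<bar>b i * X i \<omega>\<bar> powr q))) + (\<integral>\<^sup>+z. ennreal \<bar>\<Sum>i<n. g i z * X' i \<omega>\<bar> \<partial>\<mu>) \<partial>M)"
  proof (intro nn_integral_mono)
    fix \<omega>
    show "min 1 (\<integral>\<^sup>+z. ennreal \<bar>\<Sum>i<n. g i z * W (B i) \<omega>\<bar> \<partial>\<mu>)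
      \<le> (\<Sum>i<n. ennreal (min 1 (\<bar>b i * X i \<omega>\<bar> powr q))) + (\<integral>\<^sup>+z. ennreal \<bar>\<Sum>i<n. g i z * X' i \<omega>\<bar> \<partial>\<mu>)"
    proof (cases "\<forall>i<n. \<bar>b i * X i \<omega>\<bar> \<le> 1")
      case True
      then have "(\<Sum>i<n. g i z * X' i \<omega>) = (\<Sum>i<n. g i z * W (B i) \<omega>)" for z
        by (intro sum.cong) (auto simp: X'_def h_def X_def)
      then show ?thesis by (simp add: min.coboundedI2 add_increasing)
    next
      case False
      then obtain i where i: "i < n" "1 < \<bar>b i * X i \<omega>\<bar>" by (auto simp: not_le)
      then have "1 \<le> \<bar>b i * X i \<omega>\<bar> powr q" using q by (intro ge_one_powr_ge_zero) auto
      then have "1 = ennreal (min 1 (\<bar>b i * X i \<omega>\<bar> powr q))" by simp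
      also have "\<dots> \<le> (\<Sum>i<n. ennreal (min 1 (\<bar>b i * X i \<omega>\<bar> powr q)))"
        using i by (intro member_le_sum) auto
      finally show ?thesis by (intro min.coboundedI1 add_increasing2) auto
    qed
  qed
  also have "\<dots> = (\<Sum>i<n. m i) + (\<integral>\<^sup>+\<omega>. \<integral>\<^sup>+z. ennreal \<bar>\<Sum>i<n. g i z * X' i \<omega>\<bar> \<partial>\<mu> \<partial>M)"
    unfolding m_def by (simp del: sum_ennreal add: nn_integral_add nn_integral_sum)
  also have "(\<integral>\<^sup>+\<omega>. \<integral>\<^sup>+z. ennreal \<bar>\<Sum>i<n. g i z * X' i \<omega>\<bar> \<partial>\<mu> \<partial>M)
      = (\<integral>\<^sup>+z. \<integral>\<^sup>+\<omega>. ennreal \<bar>\<Sum>i<n. g i z * X' i \<omega>\<bar> \<partial>M \<partial>\<mu>)"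
    by (rule P.Fubini'[symmetric]) measurable
  also have "\<dots> \<le> (\<integral>\<^sup>+z. ennreal \<delta> + ennreal (\<delta> powr (1 - q)) *
      (\<Sum>i<n. ennreal (\<bar>g i z\<bar> powr q) * (\<integral>\<^sup>+\<omega>. ennreal (\<bar>X' i \<omega>\<bar> powr q) \<partial>M)) \<partial>\<mu>)"
    by (intro nn_integral_mono meanE)
  also have "\<dots> = ennreal \<delta> * emeasure \<mu> (space \<mu>) + ennreal (\<delta> powr (1 - q)) *
      (\<Sum>i<n. ennreal (b i powr q) * (\<integral>\<^sup>+\<omega>. ennreal (\<bar>X' i \<omega>\<bar> powr q) \<partial>M))"
    by (simp add: nn_integral_add nn_integral_cmult nn_integral_sum nn_integral_multc gb)
  also have "\<dots> \<le> ennreal \<delta> * emeasure \<mu> (space \<mu>) + ennreal (\<delta> powr (1 - q)) * (\<Sum>i<n. m i)"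
    by (intro add_left_mono mult_left_mono sum_mono mom) auto
  finally have 1: "(\<integral>\<^sup>+\<omega>. min 1 (\<integral>\<^sup>+z. ennreal \<bar>\<Sum>i<n. g i z * W (B i) \<omega>\<bar> \<partial>\<mu>) \<partial>M)
      \<le> (\<Sum>i<n. m i) + (ennreal \<delta> * emeasure \<mu> (space \<mu>) + ennreal (\<delta> powr (1 - q)) * (\<Sum>i<n. m i))"
    by (simp add: add_left_mono)
  let ?S = "\<Sum>i<n. measure leb_half (B i) * b i powr \<alpha>"
  have S: "0 \<le> ?S" by (intro sum_nonneg) auto
  have "(\<Sum>i<n. m i) \<le> (\<Sum>i<n. ennreal (C * (measure leb_half (B i) * b i powr \<alpha>)))"
    by (intro sum_mono m)
  also have "\<dots> = ennreal (C * ?S)" using C by (simp add: sum_ennreal sum_distrib_left)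
  finally have 2: "(\<Sum>i<n. m i) \<le> ennreal (C * ?S)" .
  have "(\<Sum>i<n. m i) + (ennreal \<delta> * emeasure \<mu> (space \<mu>) + ennreal (\<delta> powr (1 - q)) * (\<Sum>i<n. m i))
      \<le> ennreal (C * ?S) + (ennreal \<delta> * emeasure \<mu> (space \<mu>) + ennreal (\<delta> powr (1 - q)) * ennreal (C * ?S))"
    by (intro add_mono mult_left_mono order_refl 2) auto
  also have "\<dots> = ennreal \<delta> * emeasure \<mu> (space \<mu>) + (ennreal (C * ?S) + ennreal (\<delta> powr (1 - q)) * ennreal (C * ?S))"
    by (simp only: add_ac)
  also have "ennreal (C * ?S) + ennreal (\<delta> powr (1 - q)) * ennreal (C * ?S) = ennreal (C * (1 + \<delta> powr (1 - q))) * ennreal ?S"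
    using C S by (simp add: ennreal_mult[symmetric] ennreal_plus[symmetric] algebra_simps del: ennreal_plus)
  finally have 3: "(\<Sum>i<n. m i) + (ennreal \<delta> * emeasure \<mu> (space \<mu>) + ennreal (\<delta> powr (1 - q)) * (\<Sum>i<n. m i))
      \<le> ennreal \<delta> * emeasure \<mu> (space \<mu>) + ennreal (C * (1 + \<delta> powr (1 - q))) * ennreal ?S" .
  show ?thesis using order.trans[OF 1 3] by (simp only: C_def)
qed

lemma simple_field_bound:
  fixes \<mu> :: "'z measure"
  assumes \<mu>: "finite_measure \<mu>" and L: "admissible \<mu> L"
    and q: "1 \<le> q" "\<alpha> < q" "q \<le> 2" and \<delta>: "0 < \<delta>"
  shows "(\<integral>\<^sup>+\<omega>. min 1 (\<integral>\<^sup>+z. ennreal \<bar>simple_field W L z \<omega>\<bar> \<partial>\<mu>) \<partial>M)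
    \<le> ennreal \<delta> * emeasure \<mu> (space \<mu>) + ennreal (stable_tail_const \<alpha> q * (1 + \<delta> powr (1 - q))) *
      mixed_modular \<mu> \<alpha> q (field_kernel L)"
proof -
  let ?\<A> = "snd ` set L"
  have fs: "?\<A> \<subseteq> finite_sets" using L by (simp add: admissible_def)
  obtain B :: "nat \<Rightarrow> _" and n and I where B: "range B \<subseteq> finite_sets" "disjoint_family B"
    and IA: "\<forall>A\<in>?\<A>. I A \<subseteq> {..<n} \<and> A = (\<Union>i\<in>I A. B i)"
    and ae: "AE \<omega> in M. \<forall>A\<in>?\<A>. W A \<omega> = (\<Sum>i\<in>I A. W (B i) \<omega>)"
    by (rule refinement[OF finite_imageI[OF finite_set] fs]) (erule (3) that)
  have I: "I A \<subseteq> {..<n}" "A = (\<Union>i\<in>I A. B i)" if "A \<in> ?\<A>" for A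
    by (rule conjunct1[OF bspec[OF IA that]], rule conjunct2[OF bspec[OF IA that]])
  define g where "g i z = (\<Sum>(g, A)\<leftarrow>L. g z * (if i \<in> I A then 1 else 0))" for i z
  have g[measurable]: "g i \<in> borel_measurable \<mu>" for i
    unfolding g_def by (rule admissible_coeff(1)[OF L])
  have gi: "integrable \<mu> (\<lambda>z. \<bar>g i z\<bar> powr q)" for i
    unfolding g_def using admissible_coeff[OF L] q by (intro integrable_bounded_powr[OF \<mu>]) auto
  have coeff: "(\<Sum>(c, A)\<leftarrow>map (\<lambda>(g, A). (g z, A)) L. if i \<in> I A then c else 0) = g i z" for i z
    unfolding g_def by (induction L) auto
  have ind: "indicator A w = (\<Sum>i\<in>I A. indicator (B i) w :: real)" if A: "A \<in> ?\<A>" for A w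
  proof -
    have "finite (I A)" using I(1)[OF A] finite_subset by blast
    moreover have "disjoint_family_on B (I A)" using B(2) by (auto simp: disjoint_family_on_def)
    ultimately have "indicator (\<Union>i\<in>I A. B i) w = (\<Sum>i\<in>I A. indicator (B i) w :: real)"
      by (rule indicator_UN_disjoint)
    then show ?thesis by (simp only: I(2)[OF A, symmetric])
  qed
  have kern: "field_kernel L z w = (\<Sum>i<n. g i z * indicator (B i) w)" for z w
    unfolding field_kernel_def simple_fun_def coeff[symmetric]
  proof (rule sum_list_index_swap, intro ballI, unfold split_beta)
    fix p assume "p \<in> set (map (\<lambda>p. (fst p z, snd p)) L)"
    then have "snd p \<in> ?\<A>" by force
    then show "I (snd p) \<subseteq> {..<n} \<and> indicator (snd p) w = (\<Sum>i\<in>I (snd p). indicator (B i) w :: real)"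
      by (intro conjI I(1) ind)
  qed
  have fld: "AE \<omega> in M. \<forall>z. simple_field W L z \<omega> = (\<Sum>i<n. g i z * W (B i) \<omega>)"
    using ae
  proof eventually_elim
    case (elim \<omega>)
    show ?case
    proof
      fix z
      show "simple_field W L z \<omega> = (\<Sum>i<n. g i z * W (B i) \<omega>)"
        unfolding simple_field_def simple_integral_def coeff[symmetric]
      proof (rule sum_list_index_swap, intro ballI, unfold split_beta)
        fix p assume "p \<in> set (map (\<lambda>p. (fst p z, snd p)) L)"
        then have "snd p \<in> ?\<A>" by force
        then show "I (snd p) \<subseteq> {..<n} \<and> W (snd p) \<omega> = (\<Sum>i\<in>I (snd p). W (B i) \<omega>)"
          by (intro conjI I(1) bspec[OF elim])
      qed
    qed
  qed
  define b where "b i = (LINT z|\<mu>. \<bar>g i z\<bar> powr q) powr (1 / q)" for i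
  have b: "0 \<le> b i" "b i powr q = (LINT z|\<mu>. \<bar>g i z\<bar> powr q)"
    "b i powr \<alpha> = (LINT z|\<mu>. \<bar>g i z\<bar> powr q) powr (\<alpha> / q)" for i
  proof -
    have "0 \<le> (LINT z|\<mu>. \<bar>g i z\<bar> powr q)" by (intro integral_nonneg_AE) auto
    then show "0 \<le> b i" "b i powr q = (LINT z|\<mu>. \<bar>g i z\<bar> powr q)"
      "b i powr \<alpha> = (LINT z|\<mu>. \<bar>g i z\<bar> powr q) powr (\<alpha> / q)"
      using q by (auto simp: b_def powr_powr)
  qed
  have [measurable]: "B i \<in> sets leb_half" for i using B finite_sets_measurable by blast
  have mm: "mixed_modular \<mu> \<alpha> q (field_kernel L) = ennreal (\<Sum>i<n. measure leb_half (B i) * b i powr \<alpha>)"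
  proof -
    have "(LINT z|\<mu>. \<bar>field_kernel L z w\<bar> powr q) powr (\<alpha> / q) = \<bar>\<Sum>i<n. b i * indicator (B i) w\<bar> powr \<alpha>" for w
    proof -
      have "(LINT z|\<mu>. \<bar>field_kernel L z w\<bar> powr q) = (LINT z|\<mu>. (\<Sum>i<n. \<bar>g i z\<bar> powr q * indicator (B i) w))"
        unfolding kern
        by (subst disjoint_family_sum_indicator[OF B(2), of "\<lambda>x. \<bar>x\<bar> powr q"]) auto
      also have "\<dots> = (\<Sum>i<n. (LINT z|\<mu>. \<bar>g i z\<bar> powr q) * indicator (B i) w)"
        using gi by (subst Bochner_Integration.integral_sum) auto
      also have "(\<dots>) powr (\<alpha> / q) = (\<Sum>i<n. (LINT z|\<mu>. \<bar>g i z\<bar> powr q) powr (\<alpha> / q) * indicator (B i) w)"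
        by (rule disjoint_family_sum_indicator[OF B(2), of "\<lambda>x. x powr (\<alpha> / q)"]) simp
      also have "\<dots> = (\<Sum>i<n. \<bar>b i\<bar> powr \<alpha> * indicator (B i) w)"
        using b(1,3) by (intro sum.cong refl) simp
      also have "\<dots> = \<bar>\<Sum>i<n. b i * indicator (B i) w\<bar> powr \<alpha>"
        by (rule disjoint_family_sum_indicator[OF B(2), of "\<lambda>x. \<bar>x\<bar> powr \<alpha>", symmetric]) simp
      finally show ?thesis .
    qed
    then have "mixed_modular \<mu> \<alpha> q (field_kernel L) = L_modular \<alpha> (\<lambda>w. \<Sum>i<n. b i * indicator (B i) w)"
      by (simp add: mixed_modular_def L_modular_def)
    also have "\<dots> = ennreal (\<Sum>i<n. measure leb_half (B i) * \<bar>b i\<bar> powr \<alpha>)"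
      by (rule L_modular_disjoint_sum[OF B])
    finally show ?thesis using b(1) by simp
  qed
  have "(\<integral>\<^sup>+\<omega>. min 1 (\<integral>\<^sup>+z. ennreal \<bar>simple_field W L z \<omega>\<bar> \<partial>\<mu>) \<partial>M)
      = (\<integral>\<^sup>+\<omega>. min 1 (\<integral>\<^sup>+z. ennreal \<bar>\<Sum>i<n. g i z * W (B i) \<omega>\<bar> \<partial>\<mu>) \<partial>M)"
    by (rule nn_integral_cong_AE) (use fld in eventually_elim, simp)
  also have "\<dots> \<le> ennreal \<delta> * emeasure \<mu> (space \<mu>) + ennreal (stable_tail_const \<alpha> q * (1 + \<delta> powr (1 - q))) *
      ennreal (\<Sum>i<n. measure leb_half (B i) * b i powr \<alpha>)"
  proof (rule disjoint_field_bound[OF \<mu> B g b(1) _ q \<delta>])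
    show "(\<integral>\<^sup>+z. ennreal (\<bar>g i z\<bar> powr q) \<partial>\<mu>) = ennreal (b i powr q)" for i
      unfolding b(2) using gi by (intro nn_integral_eq_integral) auto
  qed
  finally show ?thesis unfolding mm .
qed

definition field_norm :: "'z measure \<Rightarrow> (('z \<Rightarrow> real) \<times> (real \<times> (real ^ 'n)) set) list \<Rightarrow> 'w \<Rightarrow> real" where
  "field_norm \<mu> L \<omega> = (LINT z|\<mu>. \<bar>simple_field W L z \<omega>\<bar>)"

lemma simple_field_integrable:
  assumes \<mu>: "finite_measure \<mu>" and L: "admissible \<mu> L"
  shows "integrable \<mu> (\<lambda>z. \<bar>simple_field W L z \<omega>\<bar>)" "integrable \<mu> (\<lambda>z. simple_field W L z \<omega>)"
proof -
  have "integrable \<mu> (\<lambda>z. \<bar>simple_field W L z \<omega>\<bar> powr 1)"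
    unfolding simple_field_eq using admissible_coeff[OF L] by (intro integrable_bounded_powr[OF \<mu>]) auto
  then show 1: "integrable \<mu> (\<lambda>z. \<bar>simple_field W L z \<omega>\<bar>)" by simp
  have "(\<lambda>z. simple_field W L z \<omega>) \<in> borel_measurable \<mu>"
    unfolding simple_field_eq by (rule admissible_coeff(1)[OF L])
  then show "integrable \<mu> (\<lambda>z. simple_field W L z \<omega>)"
    using 1 by (subst (asm) integrable_abs_iff) auto
qed

lemma simple_field_measurable:
  assumes L: "admissible \<mu> L"
  shows "(\<lambda>(z, \<omega>). simple_field W L z \<omega>) \<in> borel_measurable (\<mu> \<Otimes>\<^sub>M M)"
  using L
proof (induction L)
  case (Cons p L)
  obtain g A where p: "p = (g, A)" by (cases p)
  have [measurable]: "g \<in> borel_measurable \<mu>" "W A \<in> borel_measurable M"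
    "(\<lambda>(z, \<omega>). simple_field W L z \<omega>) \<in> borel_measurable (\<mu> \<Otimes>\<^sub>M M)"
    using Cons by (auto simp: p admissible_def W_measurable)
  have "(\<lambda>(z, \<omega>). simple_field W (p # L) z \<omega>)
      = (\<lambda>(z, \<omega>). g z * W A \<omega> + (case (z, \<omega>) of (z, \<omega>) \<Rightarrow> simple_field W L z \<omega>))"
    by (auto simp: simple_field_eq p)
  also have "\<dots> \<in> borel_measurable (\<mu> \<Otimes>\<^sub>M M)" by measurable
  finally show ?case .
qed (simp add: simple_field_def[abs_def] simple_integral_def[abs_def])

lemma field_norm_measurable:
  assumes \<mu>: "finite_measure \<mu>" and L: "admissible \<mu> L"
  shows "field_norm \<mu> L \<in> borel_measurable M"
proof -
  interpret finite_measure \<mu> by fact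
  interpret P: pair_sigma_finite M \<mu> ..
  have [measurable]: "(\<lambda>(z, \<omega>). simple_field W L z \<omega>) \<in> borel_measurable (\<mu> \<Otimes>\<^sub>M M)"
    by (rule simple_field_measurable[OF L])
  have "(\<lambda>p. (snd p, fst p)) \<in> measurable (M \<Otimes>\<^sub>M \<mu>) (\<mu> \<Otimes>\<^sub>M M)" by measurable
  from measurable_compose[OF this simple_field_measurable[OF L]]
  have [measurable]: "(\<lambda>(\<omega>, z). simple_field W L z \<omega>) \<in> borel_measurable (M \<Otimes>\<^sub>M \<mu>)"
    by (simp add: split_beta')
  show ?thesis
    unfolding field_norm_def[abs_def] by (rule borel_measurable_lebesgue_integral) measurable
qed

lemma field_norm_small:
  assumes \<mu>: "finite_measure \<mu>" and q: "1 \<le> q" "\<alpha> < q" "q \<le> 2" and e: "0 < e"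
  shows "\<exists>\<eta>>0. \<forall>L. admissible \<mu> L \<longrightarrow> mixed_modular \<mu> \<alpha> q (field_kernel L) < ennreal \<eta> \<longrightarrow>
    prob_dist M (field_norm \<mu> L) < ennreal e"
proof -
  interpret finite_measure \<mu> by fact
  define V where "V = measure \<mu> (space \<mu>)"
  have V: "emeasure \<mu> (space \<mu>) = ennreal V" "0 \<le> V" by (auto simp: V_def emeasure_eq_measure)
  define \<delta> where "\<delta> = e / (3 * (V + 1))"
  have \<delta>: "0 < \<delta>" using e V by (simp add: \<delta>_def)
  define K where "K = stable_tail_const \<alpha> q * (1 + \<delta> powr (1 - q))"
  have K: "0 \<le> K" unfolding K_def using stable_tail_const_nonneg[OF q(2)] by simp
  define \<eta> where "\<eta> = e / (3 * (K + 1))"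
  have \<eta>: "0 < \<eta>" using e K by (simp add: \<eta>_def)
  show ?thesis
  proof (intro exI[of _ \<eta>] conjI \<eta> allI impI)
    fix L :: "(('a \<Rightarrow> real) \<times> (real \<times> (real ^ 'n)) set) list"
    assume L: "admissible \<mu> L" and small: "mixed_modular \<mu> \<alpha> q (field_kernel L) < ennreal \<eta>"
    have "prob_dist M (field_norm \<mu> L) = (\<integral>\<^sup>+\<omega>. min 1 (\<integral>\<^sup>+z. ennreal \<bar>simple_field W L z \<omega>\<bar> \<partial>\<mu>) \<partial>M)"
      unfolding prob_dist_def
    proof (intro nn_integral_cong)
      fix \<omega>
      have "0 \<le> field_norm \<mu> L \<omega>" unfolding field_norm_def by (intro integral_nonneg_AE) auto
      moreover have "(\<integral>\<^sup>+z. ennreal \<bar>simple_field W L z \<omega>\<bar> \<partial>\<mu>) = ennreal (field_norm \<mu> L \<omega>)"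
        unfolding field_norm_def using simple_field_integrable(1)[OF \<mu> L]
        by (intro nn_integral_eq_integral) auto
      ultimately show "ennreal (min 1 \<bar>field_norm \<mu> L \<omega>\<bar>) = min 1 (\<integral>\<^sup>+z. ennreal \<bar>simple_field W L z \<omega>\<bar> \<partial>\<mu>)"
        by (simp add: min_ennreal[symmetric])
    qed
    also have "\<dots> \<le> ennreal \<delta> * ennreal V + ennreal K * mixed_modular \<mu> \<alpha> q (field_kernel L)"
      using simple_field_bound[OF \<mu> L q \<delta>] by (simp add: V(1) K_def)
    also have "\<dots> \<le> ennreal \<delta> * ennreal V + ennreal K * ennreal \<eta>"
      using small by (intro add_left_mono mult_left_mono) auto
    also have "\<dots> = ennreal (\<delta> * V + K * \<eta>)"
      using \<delta> V K \<eta> by (simp add: ennreal_mult[symmetric] ennreal_plus[symmetric] del: ennreal_plus)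
    also have "\<dots> < ennreal e"
    proof (rule ennreal_lessI[OF e])
      have "\<delta> * V \<le> e / 3" using V(2) e by (simp add: \<delta>_def field_simps)
      moreover have "K * \<eta> \<le> e / 3" using K e by (simp add: \<eta>_def field_simps)
      ultimately show "\<delta> * V + K * \<eta> < e" using e by linarith
    qed
    finally show "prob_dist M (field_norm \<mu> L) < ennreal e" .
  qed
qed

end

section \<open>Approximation of the shifted heat kernel\<close>

definition ball_measure :: "real \<Rightarrow> 'a::euclidean_space measure" where
  "ball_measure R = restrict_space lborel (cball 0 R)"

lemma finite_measure_ball_measure: "finite_measure (ball_measure R :: 'a::euclidean_space measure)"
  unfolding ball_measure_def using emeasure_lborel_cball_finite[of "0::'a" R]
  by (intro finite_measureI) (auto simp: emeasure_restrict_space space_restrict_space)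

lemma measurable_ball_measure: "f \<in> measurable borel N \<Longrightarrow> f \<in> measurable (ball_measure R) N"
  unfolding ball_measure_def by (rule measurable_restrict_space1) simp

lemma integrable_ball_measure:
  "integrable (ball_measure R) f \<longleftrightarrow> integrable lborel (\<lambda>z. indicator (cball 0 R) z * f z)" for f :: "_ \<Rightarrow> real"
  unfolding ball_measure_def by (subst integrable_restrict_space) auto

lemma integral_ball_measure:
  "(LINT z|ball_measure R. f z) = (LINT z|lborel. indicator (cball 0 R) z * f z)" for f :: "_ \<Rightarrow> real"
  unfolding ball_measure_def by (subst integral_restrict_space) auto

lemma nn_integral_ball_measure:
  "(\<integral>\<^sup>+z. f z \<partial>ball_measure R) = (\<integral>\<^sup>+z. f z * indicator (cball 0 R) z \<partial>lborel)"
  unfolding ball_measure_def by (rule nn_integral_restrict_space) simp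

lemma ball_measure_mono:
  fixes f :: "'a::euclidean_space \<Rightarrow> real"
  assumes f: "integrable (ball_measure R') f" and R: "R \<le> R'" and [measurable]: "f \<in> borel_measurable borel"
  shows "integrable (ball_measure R) f"
    and "(\<And>z. 0 \<le> f z) \<Longrightarrow> (LINT z|ball_measure R. f z) \<le> (LINT z|ball_measure R'. f z)"
proof -
  have i': "integrable lborel (\<lambda>z. indicator (cball 0 R') z * f z)" using f by (simp add: integrable_ball_measure)
  show i: "integrable (ball_measure R) f"
    unfolding integrable_ball_measure
    by (rule Bochner_Integration.integrable_bound[OF i']) (use R in \<open>auto simp: indicator_def\<close>)
  show "(LINT z|ball_measure R. f z) \<le> (LINT z|ball_measure R'. f z)" if "\<And>z. 0 \<le> f z"
    unfolding integral_ball_measure using i i' R that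
    by (intro integral_mono) (auto simp: integrable_ball_measure indicator_def)
qed

lemma leb_half_ident [measurable]: "(\<lambda>w. w) \<in> measurable leb_half borel"
  by (rule measurable_restrict_space1) simp

lemma ball_measure_ident [measurable]: "(\<lambda>z. z) \<in> measurable (ball_measure R) borel"
  by (rule measurable_ball_measure) simp

lemma heat_kernel_ball_integrable:
  assumes "0 < q" "q < 1 + 2 / real CARD('n)" "0 < R" "0 \<le> fst w"
  shows "integrable (ball_measure R) (\<lambda>z :: real \<times> (real ^ 'n::finite). heat_kernel (z - w) powr q)"
  using heat_kernel_local_integrable[OF assms] by (simp add: integrable_ball_measure mult.commute)

lemma heat_kernel_ball_integral_bound:
  assumes q: "0 < q" "q < 1 + 2 / real CARD('n)" and R: "0 < R"
  shows "\<exists>C c. 0 \<le> C \<and> 0 < c \<and> (\<forall>w :: real \<times> (real ^ 'n::finite). 0 \<le> fst w \<longrightarrow>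
    (LINT z|ball_measure R. heat_kernel (z - w) powr q) \<le> C * exp (- c * (norm (snd w))\<^sup>2) * indicator {0..R} (fst w))"
proof -
  obtain C c where C: "0 \<le> C" "0 < c" "\<And>s y. 0 \<le> s \<Longrightarrow>
     (\<integral>\<^sup>+z. ennreal (heat_kernel (z - (s, y :: real ^ 'n)) powr q) * indicator (cball 0 R) z \<partial>lborel)
      \<le> ennreal (C * exp (- c * (norm y)\<^sup>2)) * indicator {0..R} s"
    using heat_kernel_local_bound[OF q R] by blast
  have "(LINT z|ball_measure R. heat_kernel (z - w) powr q) \<le> C * exp (- c * (norm (snd w))\<^sup>2) * indicator {0..R} (fst w)"
    if w: "0 \<le> fst w" for w :: "real \<times> (real ^ 'n)"
  proof -
    have "ennreal (LINT z|ball_measure R. heat_kernel (z - w) powr q)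
        = (\<integral>\<^sup>+z. ennreal (heat_kernel (z - w) powr q) \<partial>ball_measure R)"
      using heat_kernel_ball_integrable[OF q R w] by (intro nn_integral_eq_integral[symmetric]) auto
    also have "\<dots> \<le> ennreal (C * exp (- c * (norm (snd w))\<^sup>2)) * indicator {0..R} (fst w)"
      unfolding nn_integral_ball_measure using C(3)[OF w, of "snd w"] by simp
    also have "\<dots> = ennreal (C * exp (- c * (norm (snd w))\<^sup>2) * indicator {0..R} (fst w))"
      by (auto simp: indicator_def)
    finally show ?thesis using C(1) by (subst (asm) ennreal_le_iff) auto
  qed
  then show ?thesis using C(1,2) by blast
qed

lemma L1_le_Lq:
  fixes f :: "'z \<Rightarrow> real"
  assumes \<mu>: "finite_measure \<mu>" and f[measurable]: "f \<in> borel_measurable \<mu>"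
    and i: "integrable \<mu> (\<lambda>z. \<bar>f z\<bar> powr q)" and q: "1 \<le> q"
  shows "integrable \<mu> f"
    and "(LINT z|\<mu>. \<bar>f z\<bar>) \<le> (measure \<mu> (space \<mu>) + 1) * (LINT z|\<mu>. \<bar>f z\<bar> powr q) powr (1 / q)"
proof -
  interpret finite_measure \<mu> by fact
  show int: "integrable \<mu> f"
  proof (rule Bochner_Integration.integrable_bound)
    show "integrable \<mu> (\<lambda>z. 1 + 1 powr (1 - q) * \<bar>f z\<bar> powr q)" using i by simp
    show "AE z in \<mu>. norm (f z) \<le> norm (1 + 1 powr (1 - q) * \<bar>f z\<bar> powr q)"
      using abs_le_delta_powr[OF q, of 1] by (intro AE_I2) simp
  qed simp
  define H where "H = (LINT z|\<mu>. \<bar>f z\<bar> powr q)"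
  have H: "0 \<le> H" unfolding H_def by (intro integral_nonneg_AE) auto
  show "(LINT z|\<mu>. \<bar>f z\<bar>) \<le> (measure \<mu> (space \<mu>) + 1) * (LINT z|\<mu>. \<bar>f z\<bar> powr q) powr (1 / q)"
  proof (cases "H = 0")
    case True
    then have "AE z in \<mu>. \<bar>f z\<bar> powr q = 0"
      using integral_nonneg_eq_0_iff_AE[OF i] by (auto simp: H_def)
    then have "AE z in \<mu>. \<bar>f z\<bar> = 0" by eventually_elim simp
    then have "(LINT z|\<mu>. \<bar>f z\<bar>) = 0" by (rule integral_eq_zero_AE)
    then show ?thesis by simp
  next
    case False
    then have H0: "0 < H" using H by simp
    define \<delta> where "\<delta> = H powr (1 / q)"
    have \<delta>: "0 < \<delta>" using H0 by (simp add: \<delta>_def)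
    have "(LINT z|\<mu>. \<bar>f z\<bar>) \<le> (LINT z|\<mu>. \<delta> + \<delta> powr (1 - q) * \<bar>f z\<bar> powr q)"
      using int i abs_le_delta_powr[OF q \<delta>] by (intro integral_mono) auto
    also have "\<dots> = \<delta> * measure \<mu> (space \<mu>) + \<delta> powr (1 - q) * H"
      using i by (simp add: H_def mult.commute)
    also have "\<delta> powr (1 - q) * H = \<delta>"
    proof -
      have "H = \<delta> powr q" using q H0 by (simp add: \<delta>_def powr_powr)
      then have "\<delta> powr (1 - q) * H = \<delta> powr (1 - q) * \<delta> powr q" by simp
      also have "\<dots> = \<delta>" using \<delta> by (simp flip: powr_add)
      finally show ?thesis .
    qed
    finally show ?thesis by (simp add: \<delta>_def H_def algebra_simps)
  qed
qed

definition mixed_const :: "real \<Rightarrow> real \<Rightarrow> real" where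
  "mixed_const \<alpha> q = (2 powr q) powr (\<alpha> / q) * 2 powr (\<alpha> / q)"

lemma mixed_const_pos: "0 < mixed_const \<alpha> q"
  by (simp add: mixed_const_def)

lemma mixed_modular_diff_triangle:
  fixes f g h :: "'z \<Rightarrow> real \<times> (real ^ 'n::finite) \<Rightarrow> real"
  assumes q: "0 < q" and \<alpha>: "0 < \<alpha>"
    and f: "\<And>w. w \<in> half_space \<Longrightarrow> integrable \<mu> (\<lambda>z. \<bar>f z w - g z w\<bar> powr q)"
    and h: "\<And>w. w \<in> half_space \<Longrightarrow> integrable \<mu> (\<lambda>z. \<bar>h z w - g z w\<bar> powr q)"
    and [measurable]: "(\<lambda>w. LINT z|\<mu>. \<bar>f z w - g z w\<bar> powr q) \<in> borel_measurable leb_half"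
      "(\<lambda>w. LINT z|\<mu>. \<bar>h z w - g z w\<bar> powr q) \<in> borel_measurable leb_half"
  shows "mixed_modular \<mu> \<alpha> q (\<lambda>z w. f z w - h z w) \<le> ennreal (mixed_const \<alpha> q) *
    (mixed_modular \<mu> \<alpha> q (\<lambda>z w. f z w - g z w) + mixed_modular \<mu> \<alpha> q (\<lambda>z w. h z w - g z w))"
proof -
  let ?F = "\<lambda>w. LINT z|\<mu>. \<bar>f z w - g z w\<bar> powr q" and ?H = "\<lambda>w. LINT z|\<mu>. \<bar>h z w - g z w\<bar> powr q"
  have nn: "0 \<le> ?F w" "0 \<le> ?H w" for w by (auto intro!: integral_nonneg_AE)
  have pt: "(LINT z|\<mu>. \<bar>f z w - h z w\<bar> powr q) powr (\<alpha> / q)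
      \<le> mixed_const \<alpha> q * (?F w powr (\<alpha> / q) + ?H w powr (\<alpha> / q))" if w: "w \<in> half_space" for w
  proof -
    have "(LINT z|\<mu>. \<bar>f z w - h z w\<bar> powr q) \<le> (LINT z|\<mu>. 2 powr q * (\<bar>f z w - g z w\<bar> powr q + \<bar>h z w - g z w\<bar> powr q))"
    proof (rule integral_mono')
      show "integrable \<mu> (\<lambda>z. 2 powr q * (\<bar>f z w - g z w\<bar> powr q + \<bar>h z w - g z w\<bar> powr q))"
        using f[OF w] h[OF w] by simp
      show "\<bar>f z w - h z w\<bar> powr q \<le> 2 powr q * (\<bar>f z w - g z w\<bar> powr q + \<bar>h z w - g z w\<bar> powr q)" for z
        using abs_add_powr_le[OF q, of "f z w - g z w" "g z w - h z w"]
        by (simp add: abs_minus_commute[of "g z w"])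
    qed auto
    also have "\<dots> = 2 powr q * (?F w + ?H w)" using f[OF w] h[OF w] by simp
    finally have "(LINT z|\<mu>. \<bar>f z w - h z w\<bar> powr q) powr (\<alpha> / q) \<le> (2 powr q * (?F w + ?H w)) powr (\<alpha> / q)"
      using q \<alpha> by (intro powr_mono2) (auto intro!: integral_nonneg_AE)
    also have "\<dots> = (2 powr q) powr (\<alpha> / q) * (?F w + ?H w) powr (\<alpha> / q)" by (simp only: powr_mult)
    also have "\<dots> \<le> (2 powr q) powr (\<alpha> / q) * (2 powr (\<alpha> / q) * (?F w powr (\<alpha> / q) + ?H w powr (\<alpha> / q)))"
      using nn q \<alpha> by (intro mult_left_mono powr_add_le) auto
    finally show ?thesis by (simp only: mixed_const_def mult.assoc)
  qed
  have "mixed_modular \<mu> \<alpha> q (\<lambda>z w. f z w - h z w)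
      \<le> (\<integral>\<^sup>+w. ennreal (mixed_const \<alpha> q) * (ennreal (?F w powr (\<alpha> / q)) + ennreal (?H w powr (\<alpha> / q))) \<partial>leb_half)"
    unfolding mixed_modular_def
  proof (intro nn_integral_mono)
    fix w :: "real \<times> (real ^ 'n)" assume "w \<in> space leb_half"
    then have "w \<in> half_space" by (simp add: space_restrict_space)
    from ennreal_leI[OF pt[OF this]]
    show "ennreal ((LINT z|\<mu>. \<bar>f z w - h z w\<bar> powr q) powr (\<alpha> / q))
        \<le> ennreal (mixed_const \<alpha> q) * (ennreal (?F w powr (\<alpha> / q)) + ennreal (?H w powr (\<alpha> / q)))"
      using mixed_const_pos[of \<alpha> q] by (simp add: ennreal_mult less_imp_le)
  qed
  also have "\<dots> = ennreal (mixed_const \<alpha> q) *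
    (mixed_modular \<mu> \<alpha> q (\<lambda>z w. f z w - g z w) + mixed_modular \<mu> \<alpha> q (\<lambda>z w. h z w - g z w))"
    unfolding mixed_modular_def by (simp add: nn_integral_cmult nn_integral_add)
  finally show ?thesis .
qed

lemma mixed_modular_minus_commute:
  "mixed_modular \<mu> \<alpha> q (\<lambda>z w. f z w - h z w) = mixed_modular \<mu> \<alpha> q (\<lambda>z w. h z w - f z w)"
  by (simp add: mixed_modular_def abs_minus_commute)

lemma min_heat_measurable:
  fixes \<sigma> :: "real \<times> (real ^ 'n::finite) \<Rightarrow> real \<times> (real ^ 'n)"
  assumes [measurable]: "\<sigma> \<in> measurable leb_half borel"
  shows "(\<lambda>(w, z). min (heat_kernel (z - \<sigma> w)) k * indicator (cball 0 k) w)
      \<in> borel_measurable (leb_half \<Otimes>\<^sub>M ball_measure R)"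
    and "(\<lambda>(w, z). heat_kernel (z - \<sigma> w)) \<in> borel_measurable (leb_half \<Otimes>\<^sub>M ball_measure R)"
proof -
  have [measurable]: "(\<lambda>p. fst p) \<in> measurable (leb_half \<Otimes>\<^sub>M ball_measure R) leb_half"
    "(\<lambda>p. snd p :: real \<times> (real ^ 'n)) \<in> measurable (leb_half \<Otimes>\<^sub>M ball_measure R) borel"
    "(\<lambda>p. fst p :: real \<times> (real ^ 'n)) \<in> measurable (leb_half \<Otimes>\<^sub>M ball_measure R) borel"
    using measurable_compose[OF measurable_snd ball_measure_ident, of leb_half]
      measurable_compose[OF measurable_fst leb_half_ident, of "ball_measure R"] by auto
  have [measurable]: "(\<lambda>p. \<sigma> (fst p)) \<in> measurable (leb_half \<Otimes>\<^sub>M ball_measure R) borel" by measurable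
  show "(\<lambda>(w, z). heat_kernel (z - \<sigma> w)) \<in> borel_measurable (leb_half \<Otimes>\<^sub>M ball_measure R)"
    unfolding split_beta' by measurable
  show "(\<lambda>(w, z). min (heat_kernel (z - \<sigma> w)) k * indicator (cball 0 k) w)
      \<in> borel_measurable (leb_half \<Otimes>\<^sub>M ball_measure R)"
    unfolding split_beta' by measurable
qed

lemma ball_integral_measurable:
  fixes f :: "'a::euclidean_space \<Rightarrow> real \<times> (real ^ 'n::finite) \<Rightarrow> real"
  assumes "(\<lambda>(w, z). f z w) \<in> borel_measurable (leb_half \<Otimes>\<^sub>M ball_measure R)"
  shows "(\<lambda>w. LINT z|ball_measure R. \<bar>f z w\<bar> powr q) \<in> borel_measurable leb_half"
proof -
  interpret finite_measure "ball_measure R :: 'a measure" by (rule finite_measure_ball_measure)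
  note [measurable] = assms
  show ?thesis by (rule borel_measurable_lebesgue_integral) measurable
qed

lemma mixed_modular_tendsto_0:
  fixes f :: "nat \<Rightarrow> 'a::euclidean_space \<Rightarrow> real \<times> (real ^ 'n::finite) \<Rightarrow> real"
  assumes q: "0 < q" and \<alpha>: "0 < \<alpha>"
    and f: "\<And>n. (\<lambda>(w, z). f n z w) \<in> borel_measurable (leb_half \<Otimes>\<^sub>M ball_measure R)"
    and lim: "\<And>w. w \<in> half_space \<Longrightarrow> AE z in lborel. (\<lambda>n. f n z w) \<longlonglongrightarrow> 0"
    and d: "\<And>w. w \<in> half_space \<Longrightarrow> integrable (ball_measure R) (d w)"
    and bd: "\<And>n z w. w \<in> half_space \<Longrightarrow> \<bar>f n z w\<bar> powr q \<le> d w z"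
    and e: "\<And>w. w \<in> half_space \<Longrightarrow> (LINT z|ball_measure R. d w z) powr (\<alpha> / q) \<le> e w"
    and fin: "(\<integral>\<^sup>+w. ennreal (e w) \<partial>leb_half) < \<infinity>" and [measurable]: "e \<in> borel_measurable leb_half"
  shows "(\<lambda>n. mixed_modular (ball_measure R) \<alpha> q (f n)) \<longlonglongrightarrow> 0"
proof -
  let ?I = "\<lambda>n w. LINT z|ball_measure R. \<bar>f n z w\<bar> powr q"
  have [measurable]: "?I n \<in> borel_measurable leb_half" for n by (rule ball_integral_measurable[OF f])
  have meas_z: "(\<lambda>z. f n z w) \<in> borel_measurable (ball_measure R)" if "w \<in> half_space" for n w
    using measurable_compose[OF measurable_Pair1', of w leb_half "\<lambda>(w, z). f n z w" borel "ball_measure R"] that f[of n]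
    by (simp add: space_restrict_space)
  have "(\<lambda>n. \<integral>\<^sup>+w. ennreal (?I n w powr (\<alpha> / q)) \<partial>leb_half) \<longlonglongrightarrow> (\<integral>\<^sup>+w. 0 \<partial>(leb_half :: (real \<times> (real ^ 'n)) measure))"
  proof (rule nn_integral_dominated_convergence[where w="\<lambda>w. ennreal (e w)"])
    show "AE w in leb_half. ennreal (?I n w powr (\<alpha> / q)) \<le> ennreal (e w)" for n
    proof (rule AE_I2)
      fix w :: "real \<times> (real ^ 'n)" assume "w \<in> space leb_half"
      then have w: "w \<in> half_space" by (simp add: space_restrict_space)
      have "?I n w \<le> (LINT z|ball_measure R. d w z)"
        using bd[OF w] order.trans[OF powr_ge_zero bd[OF w]] by (intro integral_mono' d[OF w]) auto
      then have "?I n w powr (\<alpha> / q) \<le> (LINT z|ball_measure R. d w z) powr (\<alpha> / q)"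
        using q \<alpha> by (intro powr_mono2) (auto intro!: integral_nonneg_AE)
      also have "\<dots> \<le> e w" by (rule e[OF w])
      finally show "ennreal (?I n w powr (\<alpha> / q)) \<le> ennreal (e w)" by (rule ennreal_leI)
    qed
    show "AE w in leb_half. (\<lambda>n. ennreal (?I n w powr (\<alpha> / q))) \<longlonglongrightarrow> 0"
    proof (rule AE_I2)
      fix w :: "real \<times> (real ^ 'n)" assume "w \<in> space leb_half"
      then have w: "w \<in> half_space" by (simp add: space_restrict_space)
      note [measurable] = meas_z[OF w]
      have "(\<lambda>n. ?I n w) \<longlonglongrightarrow> (LINT z|(ball_measure R :: 'a measure). (0 :: real))"
      proof (rule integral_dominated_convergence[where w="d w"])
        show "AE z in ball_measure R. (\<lambda>n. \<bar>f n z w\<bar> powr q) \<longlonglongrightarrow> 0"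
        proof -
          have "AE z in lborel. z \<in> cball 0 R \<longrightarrow> (\<lambda>n. \<bar>f n z w\<bar> powr q) \<longlonglongrightarrow> 0"
            using lim[OF w]
          proof eventually_elim
            case (elim z)
            then have "(\<lambda>n. \<bar>f n z w\<bar> powr q) \<longlonglongrightarrow> 0 powr q"
              using q by (intro tendsto_powr' tendsto_rabs_zero tendsto_const) auto
            then show ?case by simp
          qed
          then show ?thesis unfolding ball_measure_def by (subst AE_restrict_space_iff) auto
        qed
      qed (use d[OF w] bd[OF w] in auto)
      then have "(\<lambda>n. ?I n w powr (\<alpha> / q)) \<longlonglongrightarrow> 0 powr (\<alpha> / q)"
        using q \<alpha> by (intro tendsto_powr' tendsto_const) (auto intro!: always_eventually integral_nonneg_AE)
      then show "(\<lambda>n. ennreal (?I n w powr (\<alpha> / q))) \<longlonglongrightarrow> 0"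
        by (simp add: tendsto_ennrealI[where x=0, simplified])
    qed
  qed (use fin in auto)
  then show ?thesis by (simp add: mixed_modular_def)
qed

lemma field_kernel_measurable:
  assumes L: "admissible lborel L"
  shows "(\<lambda>(w, z). field_kernel L z w) \<in> borel_measurable (leb_half \<Otimes>\<^sub>M ball_measure R)"
  using L
proof (induction L)
  case (Cons p L)
  obtain g A where p: "p = (g, A)" by (cases p)
  have "g \<in> borel_measurable (ball_measure R)"
    using Cons.prems by (intro measurable_ball_measure) (auto simp: p admissible_def)
  moreover have "A \<in> sets leb_half" "(\<lambda>(w, z). field_kernel L z w) \<in> borel_measurable (leb_half \<Otimes>\<^sub>M ball_measure R)"
    using Cons by (auto simp: p admissible_def finite_sets_measurable)
  ultimately have [measurable]: "g \<in> borel_measurable (ball_measure R)" "A \<in> sets leb_half"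
    "(\<lambda>(w, z). field_kernel L z w) \<in> borel_measurable (leb_half \<Otimes>\<^sub>M ball_measure R)" by auto
  have "(\<lambda>(w, z). field_kernel (p # L) z w)
      = (\<lambda>(w, z). g z * indicator A w + (case (w, z) of (w, z) \<Rightarrow> field_kernel L z w))"
    by (auto simp: field_kernel_eq p)
  also have "\<dots> \<in> borel_measurable (leb_half \<Otimes>\<^sub>M ball_measure R)" by measurable
  finally show ?case .
qed (simp add: field_kernel_def[abs_def] simple_fun_def[abs_def])

lemma admissible_ball_measure: "admissible lborel L \<Longrightarrow> admissible (ball_measure R) L"
  unfolding admissible_def by (auto intro: measurable_ball_measure)

lemma kernel_difference:
  fixes L :: "((real \<times> (real ^ 'n::finite) \<Rightarrow> real) \<times> (real \<times> (real ^ 'n)) set) list"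
  assumes L: "admissible lborel L" and q: "1 \<le> q" "q < 1 + 2 / real CARD('n)" and R: "0 < R"
  shows "(\<lambda>w. LINT z|ball_measure R. \<bar>field_kernel L z w - heat_kernel (z - w)\<bar> powr q) \<in> borel_measurable leb_half"
    and "w \<in> half_space \<Longrightarrow> integrable (ball_measure R) (\<lambda>z. \<bar>field_kernel L z w - heat_kernel (z - w)\<bar> powr q)"
    and "(\<lambda>z. field_kernel L z w - heat_kernel (z - w)) \<in> borel_measurable (ball_measure R)"
proof -
  note [measurable] = field_kernel_measurable[OF L] min_heat_measurable(2)[OF leb_half_ident]
  show "(\<lambda>w. LINT z|ball_measure R. \<bar>field_kernel L z w - heat_kernel (z - w)\<bar> powr q) \<in> borel_measurable leb_half"
    by (rule ball_integral_measurable) measurable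
  have fk: "(\<lambda>z. field_kernel L z w) \<in> borel_measurable (ball_measure R)" "\<exists>B. \<forall>z. \<bar>field_kernel L z w\<bar> \<le> B" for w
    unfolding field_kernel_eq using admissible_coeff[OF admissible_ball_measure[OF L]] by auto
  have hk: "(\<lambda>z. heat_kernel (z - w)) \<in> borel_measurable (ball_measure R)" for w :: "real \<times> (real ^ 'n)"
    by (rule measurable_ball_measure) measurable
  show m: "(\<lambda>z. field_kernel L z w - heat_kernel (z - w)) \<in> borel_measurable (ball_measure R)" for w
    using fk(1) hk by measurable
  show "integrable (ball_measure R) (\<lambda>z. \<bar>field_kernel L z w - heat_kernel (z - w)\<bar> powr q)" if "w \<in> half_space"
  proof (rule Bochner_Integration.integrable_bound)
    have "integrable (ball_measure R) (\<lambda>z. \<bar>field_kernel L z w\<bar> powr q)"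
      using fk q by (intro integrable_bounded_powr finite_measure_ball_measure) auto
    moreover have "integrable (ball_measure R) (\<lambda>z. heat_kernel (z - w) powr q)"
      using q R that by (intro heat_kernel_ball_integrable) (auto simp: half_space_def)
    ultimately show "integrable (ball_measure R) (\<lambda>z. 2 powr q * (\<bar>field_kernel L z w\<bar> powr q + heat_kernel (z - w) powr q))"
      by simp
    show "AE z in ball_measure R. norm (\<bar>field_kernel L z w - heat_kernel (z - w)\<bar> powr q)
        \<le> norm (2 powr q * (\<bar>field_kernel L z w\<bar> powr q + heat_kernel (z - w) powr q))"
    proof (rule AE_I2)
      fix z
      show "norm (\<bar>field_kernel L z w - heat_kernel (z - w)\<bar> powr q)
        \<le> norm (2 powr q * (\<bar>field_kernel L z w\<bar> powr q + heat_kernel (z - w) powr q))"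
        using abs_add_powr_le[of q "field_kernel L z w" "- heat_kernel (z - w)"] q heat_kernel_nonneg[of "z - w"]
        by simp
    qed
    show "(\<lambda>z. \<bar>field_kernel L z w - heat_kernel (z - w)\<bar> powr q) \<in> borel_measurable (ball_measure R)"
      using m[of w] by measurable
  qed
qed

lemma gauss_weight_measurable:
  "(\<lambda>w :: real \<times> (real ^ 'n::finite). a * exp (- b * (norm (snd w))\<^sup>2) * indicator {0..R} (fst w))
    \<in> borel_measurable leb_half"
proof (rule measurable_restrict_space1)
  have f: "(\<lambda>w :: real \<times> (real ^ 'n). fst w) \<in> borel_measurable lborel"
    and [measurable]: "(\<lambda>w :: real \<times> (real ^ 'n). snd w) \<in> borel_measurable lborel"
    by (rule borel_measurable_fst_comp, simp)+
  have [measurable]: "(\<lambda>w :: real \<times> (real ^ 'n). indicator {0..R} (fst w) :: real) \<in> borel_measurable lborel"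
    by (rule measurable_compose[OF f]) simp
  show "(\<lambda>w :: real \<times> (real ^ 'n). a * exp (- b * (norm (snd w))\<^sup>2) * indicator {0..R} (fst w)) \<in> borel_measurable lborel"
    by measurable
qed

lemma cball_weight_measurable:
  "(\<lambda>w :: real \<times> (real ^ 'n::finite). (a :: real) * indicator (cball 0 k) w) \<in> borel_measurable leb_half"
  by (rule measurable_restrict_space1) measurable

lemma heat_kernel_approx:
  fixes R :: real
  assumes q: "1 \<le> q" "q < 1 + 2 / real CARD('n)" and \<alpha>: "0 < \<alpha>" and R: "0 < R" and e: "0 < e"
  shows "\<exists>L. admissible lborel L \<and>
    mixed_modular (ball_measure R) \<alpha> q (\<lambda>z (w :: real \<times> (real ^ 'n::finite)). field_kernel L z w - heat_kernel (z - w)) < ennreal e"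
proof -
  have q0: "0 < q" using q by simp
  define c where "c = mixed_const \<alpha> q"
  have c: "0 < c" unfolding c_def by (rule mixed_const_pos)
  define r where "r = e / (2 * c)"
  have r: "0 < r" using e c by (simp add: r_def)
  define h where "h k z w = min (heat_kernel (z - w)) k * indicator (cball 0 k) w" for k and z w :: "real \<times> (real ^ 'n)"
  have h_meas: "(\<lambda>(w, z). h k z w) \<in> borel_measurable (leb_half \<Otimes>\<^sub>M ball_measure R)" for k
    unfolding h_def using min_heat_measurable(1)[OF leb_half_ident] .
  note hk_meas = min_heat_measurable(2)[OF leb_half_ident, where 'n='n, of R]
  note [measurable] = h_meas hk_meas
  obtain C b where C: "0 \<le> C" "0 < b" "\<And>w :: real \<times> (real ^ 'n). 0 \<le> fst w \<Longrightarrow>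
      (LINT z|ball_measure R. heat_kernel (z - w) powr q) \<le> C * exp (- b * (norm (snd w))\<^sup>2) * indicator {0..R} (fst w)"
    using heat_kernel_ball_integral_bound[OF q0 q(2) R] by blast
  have h_diff: "\<bar>h (real k) z w - heat_kernel (z - w)\<bar> powr q \<le> heat_kernel (z - w) powr q" for k z w
    using q0 heat_kernel_nonneg[of "z - w"]
    by (intro powr_mono2) (auto simp: h_def indicator_def min_def)
  have "(\<lambda>k. mixed_modular (ball_measure R) \<alpha> q (\<lambda>z w. h (real k) z w - heat_kernel (z - w))) \<longlonglongrightarrow> 0"
  proof (rule mixed_modular_tendsto_0[OF q0 \<alpha>, where d="\<lambda>w z. heat_kernel (z - w) powr q"
        and e="\<lambda>w. C powr (\<alpha> / q) * exp (- (b * (\<alpha> / q)) * (norm (snd w))\<^sup>2) * indicator {0..R} (fst w)"])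
    show "(\<lambda>(w, z). h (real k) z w - heat_kernel (z - w)) \<in> borel_measurable (leb_half \<Otimes>\<^sub>M ball_measure R)" for k
      by measurable
    show "AE z in lborel. (\<lambda>k. h (real k) z w - heat_kernel (z - w)) \<longlonglongrightarrow> 0" for w :: "real \<times> (real ^ 'n)"
    proof (rule AE_I2)
      fix z
      obtain N :: nat where N: "max (norm w) (heat_kernel (z - w)) \<le> real N" using real_arch_simple by blast
      have "eventually (\<lambda>k. h (real k) z w - heat_kernel (z - w) = 0) sequentially"
        unfolding eventually_sequentially
      proof (intro exI[of _ N] allI impI)
        fix k assume "N \<le> k"
        then have "max (norm w) (heat_kernel (z - w)) \<le> real k" using N by linarith
        then show "h (real k) z w - heat_kernel (z - w) = 0" by (simp add: h_def)
      qed
      then show "(\<lambda>k. h (real k) z w - heat_kernel (z - w)) \<longlonglongrightarrow> 0" by (rule tendsto_eventually)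
    qed
    show "integrable (ball_measure R) (\<lambda>z. heat_kernel (z - w) powr q)" if "w \<in> half_space" for w :: "real \<times> (real ^ 'n)"
      using that by (intro heat_kernel_ball_integrable[OF q0 q(2) R]) (auto simp: half_space_def)
    show "\<bar>h (real k) z w - heat_kernel (z - w)\<bar> powr q \<le> heat_kernel (z - w) powr q" for k z w by (rule h_diff)
    show "(LINT z|ball_measure R. heat_kernel (z - w) powr q) powr (\<alpha> / q)
        \<le> C powr (\<alpha> / q) * exp (- (b * (\<alpha> / q)) * (norm (snd w))\<^sup>2) * indicator {0..R} (fst w)" if "w \<in> half_space" for w :: "real \<times> (real ^ 'n)"
    proof -
      have "0 \<le> fst w" using that by (auto simp: half_space_def)
      then have "(LINT z|ball_measure R. heat_kernel (z - w) powr q) powr (\<alpha> / q)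
          \<le> (C * exp (- b * (norm (snd w))\<^sup>2) * indicator {0..R} (fst w)) powr (\<alpha> / q)"
        using C(3)[of w] q0 \<alpha> by (intro powr_mono2) (auto intro!: integral_nonneg_AE)
      also have "\<dots> = C powr (\<alpha> / q) * exp (- (b * (\<alpha> / q)) * (norm (snd w))\<^sup>2) * indicator {0..R} (fst w)"
        by (auto simp: indicator_def powr_mult exp_powr_real mult_ac)
      finally show ?thesis .
    qed
    show "(\<integral>\<^sup>+w. ennreal (C powr (\<alpha> / q) * exp (- (b * (\<alpha> / q)) * (norm (snd w))\<^sup>2) * indicator {0..R} (fst w))
        \<partial>(leb_half :: (real \<times> (real ^ 'n)) measure)) < \<infinity>"
    proof -
      have "(\<integral>\<^sup>+w. ennreal (C powr (\<alpha> / q) * exp (- (b * (\<alpha> / q)) * (norm (snd w))\<^sup>2)) * indicator {0..R} (fst w)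
          \<partial>(leb_half :: (real \<times> (real ^ 'n)) measure)) < \<infinity>"
        using C(2) q0 \<alpha> by (intro nn_integral_gauss_half_space_finite) auto
      also have "(\<integral>\<^sup>+w. ennreal (C powr (\<alpha> / q) * exp (- (b * (\<alpha> / q)) * (norm (snd w))\<^sup>2)) * indicator {0..R} (fst w)
          \<partial>(leb_half :: (real \<times> (real ^ 'n)) measure))
        = (\<integral>\<^sup>+w. ennreal (C powr (\<alpha> / q) * exp (- (b * (\<alpha> / q)) * (norm (snd w))\<^sup>2) * indicator {0..R} (fst w))
          \<partial>(leb_half :: (real \<times> (real ^ 'n)) measure))"
        by (intro nn_integral_cong) (auto simp: indicator_def)
      finally show ?thesis .
    qed
    show "(\<lambda>w :: real \<times> (real ^ 'n). C powr (\<alpha> / q) * exp (- (b * (\<alpha> / q)) * (norm (snd w))\<^sup>2) * indicator {0..R} (fst w))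
        \<in> borel_measurable leb_half"
      by (rule gauss_weight_measurable)
  qed
  then have "eventually (\<lambda>k. mixed_modular (ball_measure R) \<alpha> q (\<lambda>z w. h (real k) z w - heat_kernel (z - w)) < ennreal r) sequentially"
    using r unfolding tendsto_ennreal_0_iff by blast
  then obtain k :: nat where k: "mixed_modular (ball_measure R) \<alpha> q (\<lambda>z w. h (real k) z w - heat_kernel (z - w)) < ennreal r"
    by (auto simp: eventually_sequentially)
  obtain \<sigma> where \<sigma>: "\<And>i::nat. simple_function leb_half (\<sigma> i)"
    "\<And>w :: real \<times> (real ^ 'n). w \<in> space leb_half \<Longrightarrow> (\<lambda>i. \<sigma> i w) \<longlonglongrightarrow> w"
    using borel_measurable_implies_sequence_metric[OF leb_half_ident, of 0] by metis
  have \<sigma>_meas: "\<sigma> i \<in> measurable leb_half borel" for i using \<sigma>(1) by (rule borel_measurable_simple_function)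
  define h' where "h' i z w = min (heat_kernel (z - \<sigma> i w)) (real k) * indicator (cball 0 (real k)) w" for i z w
  have h'_meas: "(\<lambda>(w, z). h' i z w) \<in> borel_measurable (leb_half \<Otimes>\<^sub>M ball_measure R)" for i
    unfolding h'_def using min_heat_measurable(1)[OF \<sigma>_meas] .
  note [measurable] = h'_meas
  have bounds: "0 \<le> h' i z w" "h' i z w \<le> real k * indicator (cball 0 (real k)) w"
    for i z w
    using heat_kernel_nonneg[of "z - \<sigma> i w"] by (simp_all add: h'_def indicator_def)
  have bounds': "0 \<le> h (real k) z w" "h (real k) z w \<le> real k * indicator (cball 0 (real k)) w" for z w
    using heat_kernel_nonneg[of "z - w"] by (simp_all add: h_def indicator_def)
  let ?V = "measure (ball_measure R :: (real \<times> (real ^ 'n)) measure) (space (ball_measure R))"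
  interpret K: finite_measure "ball_measure R :: (real \<times> (real ^ 'n)) measure" by (rule finite_measure_ball_measure)
  have "(\<lambda>i. mixed_modular (ball_measure R) \<alpha> q (\<lambda>z w. h' i z w - h (real k) z w)) \<longlonglongrightarrow> 0"
  proof (rule mixed_modular_tendsto_0[OF q0 \<alpha>, where d="\<lambda>w z. (real k * indicator (cball 0 (real k)) w) powr q"
        and e="\<lambda>w. (?V * real k powr q) powr (\<alpha> / q) * indicator (cball 0 (real k)) w"])
    show "(\<lambda>(w, z). h' i z w - h (real k) z w) \<in> borel_measurable (leb_half \<Otimes>\<^sub>M ball_measure R)" for i
      by measurable
    show "AE z in lborel. (\<lambda>i. h' i z w - h (real k) z w) \<longlonglongrightarrow> 0" if w: "w \<in> half_space" for w :: "real \<times> (real ^ 'n)"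
      using AE_lborel_singleton[of w]
    proof eventually_elim
      case (elim z)
      have "(\<lambda>i. z - \<sigma> i w) \<longlonglongrightarrow> z - w"
        using \<sigma>(2)[of w] w by (intro tendsto_diff tendsto_const) (auto simp: space_restrict_space)
      moreover have "isCont heat_kernel (z - w)" using elim by (intro heat_kernel_isCont) simp
      ultimately have "(\<lambda>i. heat_kernel (z - \<sigma> i w)) \<longlonglongrightarrow> heat_kernel (z - w)"
        by (rule isCont_tendsto_compose[rotated])
      then have "(\<lambda>i. h' i z w - h (real k) z w) \<longlonglongrightarrow> h (real k) z w - h (real k) z w"
        unfolding h'_def h_def by (intro tendsto_intros)
      then show ?case by simp
    qed
    show "integrable (ball_measure R) (\<lambda>z :: real \<times> (real ^ 'n). (real k * indicator (cball 0 (real k)) w) powr q)" for w :: "real \<times> (real ^ 'n)" by simp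
    show "\<bar>h' i z w - h (real k) z w\<bar> powr q \<le> (real k * indicator (cball 0 (real k)) w) powr q" for i z w
      using bounds[of i z w] bounds'[of z w] q0 by (intro powr_mono2) (auto simp: abs_le_iff)
    show "(LINT z|(ball_measure R :: (real \<times> (real ^ 'n)) measure). (real k * indicator (cball 0 (real k)) w) powr q) powr (\<alpha> / q)
        \<le> (?V * real k powr q) powr (\<alpha> / q) * indicator (cball 0 (real k)) w" for w :: "real \<times> (real ^ 'n)"
      by (auto simp: indicator_def)
    show "(\<integral>\<^sup>+w. ennreal ((?V * real k powr q) powr (\<alpha> / q) * indicator (cball 0 (real k)) w)
        \<partial>(leb_half :: (real \<times> (real ^ 'n)) measure)) < \<infinity>"
    proof -
      have "(\<integral>\<^sup>+w. ennreal ((?V * real k powr q) powr (\<alpha> / q) * indicator (cball 0 (real k)) w)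
          \<partial>(leb_half :: (real \<times> (real ^ 'n)) measure))
        \<le> (\<integral>\<^sup>+w. ennreal ((?V * real k powr q) powr (\<alpha> / q)) * indicator (cball 0 (real k)) w
          \<partial>(lborel :: (real \<times> (real ^ 'n)) measure))"
        by (subst nn_integral_restrict_space) (auto intro!: nn_integral_mono simp: indicator_def)
      also have "\<dots> < \<infinity>"
        using emeasure_lborel_cball_finite[of "0 :: real \<times> (real ^ 'n)" "real k"]
        by (subst nn_integral_cmult_indicator) (auto simp: ennreal_mult_less_top)
      finally show ?thesis .
    qed
    show "(\<lambda>w :: real \<times> (real ^ 'n). (?V * real k powr q) powr (\<alpha> / q) * indicator (cball 0 (real k)) w) \<in> borel_measurable leb_half"
      by (rule cball_weight_measurable)
  qed
  then have "eventually (\<lambda>i. mixed_modular (ball_measure R) \<alpha> q (\<lambda>z w. h' i z w - h (real k) z w) < ennreal r) sequentially"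
    using r unfolding tendsto_ennreal_0_iff by blast
  then obtain i where i: "mixed_modular (ball_measure R) \<alpha> q (\<lambda>z w. h' i z w - h (real k) z w) < ennreal r"
    by (auto simp: eventually_sequentially)
  have finV: "finite (\<sigma> i ` space leb_half)" using \<sigma>(1)[of i] by (rule simple_functionD(1))
  then obtain vs where vs: "set vs = \<sigma> i ` space leb_half" "distinct vs" using finite_distinct_list by blast
  define A where "A v = \<sigma> i -` {v} \<inter> space leb_half \<inter> cball 0 (real k)" for v
  define L where "L = map (\<lambda>v. (\<lambda>z. min (heat_kernel (z - v)) (real k), A v)) vs"
  have cb: "cball 0 (real k) \<inter> space leb_half \<in> sets (leb_half :: (real \<times> (real ^ 'n)) measure)"
    using measurable_sets[OF leb_half_ident cball_borel[of 0 "real k"]] by simp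
  have A: "A v \<in> finite_sets" for v
  proof -
    have "\<sigma> i -` {v} \<inter> space leb_half \<in> sets leb_half" using \<sigma>(1)[of i] by (rule simple_functionD(2))
    then have "(\<sigma> i -` {v} \<inter> space leb_half) \<inter> (cball 0 (real k) \<inter> space leb_half) \<in> sets leb_half"
      using cb by (rule sets.Int)
    also have "(\<sigma> i -` {v} \<inter> space leb_half) \<inter> (cball 0 (real k) \<inter> space leb_half) = A v" by (auto simp: A_def)
    finally have m: "A v \<in> sets leb_half" .
    have "emeasure leb_half (A v) = emeasure lborel (A v)"
      using m by (subst emeasure_restrict_space) (auto simp: sets_restrict_space A_def space_restrict_space)
    also have "\<dots> \<le> emeasure lborel (cball (0 :: real \<times> (real ^ 'n)) (real k))" by (intro emeasure_mono) (auto simp: A_def)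
    also have "\<dots> < \<infinity>" using emeasure_lborel_cball_finite[of "0 :: real \<times> (real ^ 'n)" "real k"] by simp
    finally show ?thesis using m by (simp add: finite_sets_def)
  qed
  have adm: "admissible lborel L"
  proof -
    have "\<bar>min (heat_kernel (z - v)) (real k)\<bar> \<le> real k" for z v :: "real \<times> (real ^ 'n)"
      using heat_kernel_nonneg[of "z - v"] by auto
    then show ?thesis using A unfolding admissible_def L_def by (auto intro!: exI[of _ "real k"])
  qed
  have kern: "field_kernel L z w = h' i z w" if w: "w \<in> half_space" for z w
  proof -
    have "field_kernel L z w = (\<Sum>v\<in>\<sigma> i ` space leb_half. min (heat_kernel (z - v)) (real k) * indicator (A v) w)"
      unfolding field_kernel_eq L_def using vs
      by (simp add: comp_def sum_list_distinct_conv_sum_set)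
    also have "\<dots> = (\<Sum>v\<in>\<sigma> i ` space leb_half. if v = \<sigma> i w then h' i z w else 0)"
      using w by (intro sum.cong) (auto simp: A_def h'_def indicator_def space_restrict_space)
    also have "\<dots> = h' i z w" using finV w by (auto simp: sum.delta' space_restrict_space)
    finally show ?thesis .
  qed
  have inth': "integrable (ball_measure R) (\<lambda>z. \<bar>h' i z w - h (real k) z w\<bar> powr q)" if w: "w \<in> half_space" for w :: "real \<times> (real ^ 'n)"
  proof (rule Bochner_Integration.integrable_bound)
    show "integrable (ball_measure R) (\<lambda>z :: real \<times> (real ^ 'n). real k powr q)" by simp
    have m1: "(\<lambda>z. min (heat_kernel (z - v)) (real k)) \<in> borel_measurable (ball_measure R)" for v :: "real \<times> (real ^ 'n)"
      by (rule measurable_ball_measure) measurable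
    show "(\<lambda>z. \<bar>h' i z w - h (real k) z w\<bar> powr q) \<in> borel_measurable (ball_measure R)"
      unfolding h'_def h_def using m1[of "\<sigma> i w"] m1[of w] by measurable
    have "\<bar>h' i z w - h (real k) z w\<bar> \<le> real k" for z
      using bounds[of i z w] bounds'[of z w] by (cases "w \<in> cball 0 (real k)") (auto simp: abs_le_iff)
    then show "AE z in ball_measure R. norm (\<bar>h' i z w - h (real k) z w\<bar> powr q) \<le> norm (real k powr q)"
      using q0 by (intro AE_I2) (auto intro!: powr_mono2)
  qed
  have inth: "integrable (ball_measure R) (\<lambda>z. \<bar>heat_kernel (z - w) - h (real k) z w\<bar> powr q)" if w: "w \<in> half_space" for w :: "real \<times> (real ^ 'n)"
  proof (rule Bochner_Integration.integrable_bound)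
    show "integrable (ball_measure R) (\<lambda>z. heat_kernel (z - w) powr q)"
      using w by (intro heat_kernel_ball_integrable[OF q0 q(2) R]) (auto simp: half_space_def)
    have m1: "(\<lambda>z. min (heat_kernel (z - v)) (real k)) \<in> borel_measurable (ball_measure R)"
      "(\<lambda>z. heat_kernel (z - v)) \<in> borel_measurable (ball_measure R)" for v :: "real \<times> (real ^ 'n)"
      by (rule measurable_ball_measure, measurable)+
    show "(\<lambda>z. \<bar>heat_kernel (z - w) - h (real k) z w\<bar> powr q) \<in> borel_measurable (ball_measure R)"
      unfolding h_def using m1[of w] by measurable
    show "AE z in ball_measure R. norm (\<bar>heat_kernel (z - w) - h (real k) z w\<bar> powr q) \<le> norm (heat_kernel (z - w) powr q)"
      using h_diff[of k _ w] by (intro AE_I2) (simp add: abs_minus_commute)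
  qed
  have "mixed_modular (ball_measure R) \<alpha> q (\<lambda>z w. field_kernel L z w - heat_kernel (z - w))
      = mixed_modular (ball_measure R) \<alpha> q (\<lambda>z w. h' i z w - heat_kernel (z - w))"
    unfolding mixed_modular_def by (intro nn_integral_cong) (simp add: kern space_restrict_space)
  also have "\<dots> \<le> ennreal c * (mixed_modular (ball_measure R) \<alpha> q (\<lambda>z w. h' i z w - h (real k) z w)
      + mixed_modular (ball_measure R) \<alpha> q (\<lambda>z w. heat_kernel (z - w) - h (real k) z w))"
    unfolding c_def
    by (rule mixed_modular_diff_triangle[OF q0 \<alpha> inth' inth]; (rule ball_integral_measurable)?) measurable
  also have "\<dots> < ennreal c * (ennreal r + ennreal r)"
    using c i k unfolding mixed_modular_minus_commute[of _ _ _ "\<lambda>z w. heat_kernel (z - w)"]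
    by (intro ennreal_mult_strict_left_mono add_strict_mono) auto
  also have "\<dots> = ennreal e"
    using c r e by (simp add: ennreal_mult[symmetric] ennreal_plus[symmetric] r_def del: ennreal_plus)
  finally show ?thesis using adm by blast
qed

section \<open>Existence of a random field representation\<close>

lemma telescoping_sums:
  fixes x :: "nat \<Rightarrow> real"
  assumes "x \<longlonglongrightarrow> y"
  shows "(\<lambda>i. x (Suc (n + i)) - x (n + i)) sums (y - x n)"
proof -
  have "(\<lambda>m. x (n + m) - x n) \<longlonglongrightarrow> y - x n"
    using LIMSEQ_ignore_initial_segment[OF assms, of n] by (intro tendsto_diff tendsto_const) (simp add: add.commute)
  moreover have "(\<Sum>i<m. x (Suc (n + i)) - x (n + i)) = x (n + m) - x n" for m
    using sum_lessThan_telescope[of "\<lambda>i. x (n + i)" m] by simp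
  ultimately show ?thesis by (simp add: sums_def)
qed

lemma L1_telescope_limit:
  fixes U :: "nat \<Rightarrow> 'z \<Rightarrow> real"
  assumes U: "\<And>n. integrable \<mu> (U n)" and D: "summable D"
    and le: "\<And>n. j \<le> n \<Longrightarrow> (LINT z|\<mu>. \<bar>U (Suc n) z - U n z\<bar>) \<le> D n"
    and Y: "\<And>z. Y z = lim (\<lambda>n. U n z)"
  shows "integrable \<mu> Y" and "(\<lambda>n. LINT z|\<mu>. \<bar>U n z - Y z\<bar>) \<longlonglongrightarrow> 0"
proof -
  have [measurable]: "U n \<in> borel_measurable \<mu>" for n using U by auto
  have [measurable]: "Y \<in> borel_measurable \<mu>"
    unfolding Y[abs_def] by (rule borel_measurable_lim_metric) simp
  define V where "V n i z = U (Suc (n + i)) z - U (n + i) z" for n i z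
  have V: "integrable \<mu> (V n i)" for n i unfolding V_def[abs_def] by (intro Bochner_Integration.integrable_diff U)
  have Dn: "summable (\<lambda>i. D (n + i))" for n using D by (subst add.commute) (rule summable_ignore_initial_segment)
  have VD: "(LINT z|\<mu>. \<bar>V n i z\<bar>) \<le> D (n + i)" if "j \<le> n" for n i
    unfolding V_def using le[of "n + i"] that by simp
  have sumV: "summable (\<lambda>i. LINT z|\<mu>. \<bar>V n i z\<bar>)" if "j \<le> n" for n
    by (rule summable_comparison_test'[OF Dn, of 0]) (use VD[OF that] in \<open>auto intro!: integral_nonneg_AE simp: abs_of_nonneg\<close>)
  have aesum: "AE z in \<mu>. summable (\<lambda>i. \<bar>V n i z\<bar>)" if n: "j \<le> n" for n
  proof -
    have "(\<integral>\<^sup>+z. (\<Sum>i. ennreal \<bar>V n i z\<bar>) \<partial>\<mu>) = (\<Sum>i. \<integral>\<^sup>+z. ennreal \<bar>V n i z\<bar> \<partial>\<mu>)"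
      using V by (intro nn_integral_suminf) auto
    also have "\<dots> = (\<Sum>i. ennreal (LINT z|\<mu>. \<bar>V n i z\<bar>))"
      using V by (intro suminf_cong nn_integral_eq_integral) auto
    also have "\<dots> = ennreal (\<Sum>i. LINT z|\<mu>. \<bar>V n i z\<bar>)"
      by (rule suminf_ennreal2[OF _ sumV[OF n]]) (intro integral_nonneg_AE AE_I2 abs_ge_zero)
    also have "\<dots> < \<infinity>" by simp
    finally have fin: "(\<integral>\<^sup>+z. (\<Sum>i. ennreal \<bar>V n i z\<bar>) \<partial>\<mu>) \<noteq> \<infinity>" by (rule less_imp_neq)
    note [measurable] = borel_measurable_integrable[OF V]
    have "AE z in \<mu>. (\<Sum>i. ennreal \<bar>V n i z\<bar>) \<noteq> \<infinity>"
      by (rule nn_integral_PInf_AE[OF _ fin]) measurable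
    then show ?thesis by eventually_elim (auto intro: summable_suminf_not_top)
  qed
  have conv: "AE z in \<mu>. (\<lambda>n. U n z) \<longlonglongrightarrow> Y z"
    using aesum[OF order_refl]
  proof eventually_elim
    case (elim z)
    then have "convergent (\<lambda>i. U (j + i) z)"
      by (intro convergent_of_summable_increments) (simp add: V_def)
    then have "convergent (\<lambda>i. U (i + j) z)" by (simp add: add.commute)
    then have "convergent (\<lambda>i. U i z)" by (rule convergent_ignore_initial_segment[THEN iffD1])
    then show ?case unfolding Y convergent_LIMSEQ_iff .
  qed
  have key: "AE z in \<mu>. (\<Sum>i. V n i z) = Y z - U n z" for n
    using conv by eventually_elim (auto simp: V_def intro!: sums_unique[symmetric] telescoping_sums)
  have i1: "integrable \<mu> (\<lambda>z. \<Sum>i. V n i z)" if n: "j \<le> n" for n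
    using V aesum[OF n] sumV[OF n] by (intro integrable_suminf) auto
  have "integrable \<mu> (\<lambda>z. (\<Sum>i. V j i z) + U j z)" using i1 U by (intro Bochner_Integration.integrable_add) auto
  moreover have "AE z in \<mu>. (\<Sum>i. V j i z) + U j z = Y z" using key[of j] by eventually_elim simp
  ultimately show "integrable \<mu> Y" by (rule integrable_cong_AE_imp[OF _ \<open>Y \<in> borel_measurable \<mu>\<close>])
  have bound: "(LINT z|\<mu>. \<bar>U n z - Y z\<bar>) \<le> (\<Sum>i. D (n + i))" if n: "j \<le> n" for n
  proof -
    have Va: "integrable \<mu> (\<lambda>z. \<bar>V n i z\<bar>)" for i using V by auto
    have ia: "integrable \<mu> (\<lambda>z. \<Sum>i. \<bar>V n i z\<bar>)"
      using Va aesum[OF n] sumV[OF n] by (intro integrable_suminf) auto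
    have "(LINT z|\<mu>. \<bar>U n z - Y z\<bar>) \<le> (LINT z|\<mu>. (\<Sum>i. \<bar>V n i z\<bar>))"
    proof (rule integral_mono_AE)
      show "integrable \<mu> (\<lambda>z. \<bar>U n z - Y z\<bar>)"
        using \<open>integrable \<mu> Y\<close> U by auto
      show "AE z in \<mu>. \<bar>U n z - Y z\<bar> \<le> (\<Sum>i. \<bar>V n i z\<bar>)"
        using key[of n] aesum[OF n]
      proof eventually_elim
        case (elim z)
        then have "\<bar>\<Sum>i. V n i z\<bar> \<le> (\<Sum>i. \<bar>V n i z\<bar>)" by (intro summable_rabs)
        then show ?case using elim(1) by (simp add: abs_minus_commute)
      qed
    qed (rule ia)
    also have "\<dots> = (\<Sum>i. LINT z|\<mu>. \<bar>V n i z\<bar>)"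
      using Va aesum[OF n] sumV[OF n] by (intro integral_suminf) auto
    also have "\<dots> \<le> (\<Sum>i. D (n + i))" by (intro suminf_le VD n sumV Dn)
    finally show ?thesis .
  qed
  have tail: "(\<lambda>n. \<Sum>i. D (n + i)) \<longlonglongrightarrow> 0"
  proof -
    have "(\<lambda>n. suminf D - (\<Sum>i<n. D i)) \<longlonglongrightarrow> suminf D - suminf D"
      by (intro tendsto_diff tendsto_const summable_LIMSEQ D)
    moreover have "suminf D - (\<Sum>i<n. D i) = (\<Sum>i. D (n + i))" for n
      using suminf_minus_initial_segment[OF D, of n] by (simp add: add.commute)
    ultimately show ?thesis by simp
  qed
  show "(\<lambda>n. LINT z|\<mu>. \<bar>U n z - Y z\<bar>) \<longlonglongrightarrow> 0"
  proof (rule tendsto_sandwich[OF _ _ tendsto_const tail])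
    show "eventually (\<lambda>n. (LINT z|\<mu>. \<bar>U n z - Y z\<bar>) \<le> (\<Sum>i. D (n + i))) sequentially"
      unfolding eventually_sequentially using bound by blast
  qed (auto intro!: always_eventually integral_nonneg_AE)
qed

definition negate_field :: "(('z \<Rightarrow> real) \<times> 'b) list \<Rightarrow> (('z \<Rightarrow> real) \<times> 'b) list" where
  "negate_field L = map (\<lambda>(g, A). (\<lambda>z. - g z, A)) L"

lemma admissible_append_negate:
  assumes "admissible \<mu> L" "admissible \<mu> L'"
  shows "admissible \<mu> (L @ negate_field L')"
proof -
  have s: "snd ` set (negate_field L') = snd ` set L'" by (force simp: negate_field_def)
  have ng: "g \<in> borel_measurable \<mu> \<and> (\<exists>B. \<forall>z. \<bar>g z\<bar> \<le> B)" if g: "g \<in> fst ` set (negate_field L')" for g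
  proof -
    obtain g' where "g' \<in> fst ` set L'" "g = (\<lambda>z. - g' z)" using g by (force simp: negate_field_def)
    then show ?thesis using assms(2) by (auto simp: admissible_def)
  qed
  show ?thesis
    unfolding admissible_def set_append image_Un ball_Un
    using assms ng by (simp add: s admissible_def ball_Un)
qed

lemma field_kernel_append_negate:
  "field_kernel (L @ negate_field L') z w = field_kernel L z w - field_kernel L' z w"
proof -
  have "field_kernel (negate_field L') z w = - field_kernel L' z w"
    by (induction L') (auto simp: field_kernel_eq negate_field_def)
  then show ?thesis by (simp add: field_kernel_eq)
qed

lemma simple_field_append_negate:
  "simple_field W (L @ negate_field L') z \<omega> = simple_field W L z \<omega> - simple_field W L' z \<omega>"
proof -
  have "simple_field W (negate_field L') z \<omega> = - simple_field W L' z \<omega>"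
    by (induction L') (auto simp: simple_field_eq negate_field_def)
  then show ?thesis by (simp add: simple_field_eq)
qed

definition test_field ::
  "(('a::euclidean_space \<Rightarrow> real) \<times> 'b) list \<Rightarrow> ('a \<Rightarrow> real) \<Rightarrow> (real \<times> 'b) list" where
  "test_field L \<phi> = map (\<lambda>(g, A). (LINT z|lborel. g z * \<phi> z, A)) L"

lemma test_function_integrable:
  fixes \<phi> :: "'a::euclidean_space \<Rightarrow> real"
  assumes \<phi>: "\<phi> \<in> test_functions" and [measurable]: "g \<in> borel_measurable borel" and g: "\<exists>B. \<forall>z. \<bar>g z\<bar> \<le> (B :: real)"
  shows "integrable lborel (\<lambda>z. g z * \<phi> z)"
proof -
  note [measurable] = test_functionD(2)[OF \<phi>]
  obtain R C where R: "0 < R" "0 \<le> C" "\<And>z. \<bar>\<phi> z\<bar> \<le> C * indicator (cball 0 R) z"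
    using test_functionD(3)[OF \<phi>] by blast
  obtain B where B: "\<And>z. \<bar>g z\<bar> \<le> B" using g by blast
  show ?thesis
  proof (rule Bochner_Integration.integrable_bound)
    show "integrable lborel (\<lambda>z. (B * C) * indicator (cball (0::'a) R) z :: real)"
      using emeasure_lborel_cball_finite[of "0::'a" R]
      by (intro integrable_mult_right) (auto simp: integrable_indicator_iff)
    show "AE z in lborel. norm (g z * \<phi> z) \<le> norm ((B * C) * indicator (cball 0 R) z :: real)"
    proof (rule AE_I2)
      fix z
      have "0 \<le> B" using B[of z] by linarith
      have "\<bar>g z\<bar> * \<bar>\<phi> z\<bar> \<le> B * (C * indicator (cball 0 R) z)"
        using B R(3) \<open>0 \<le> B\<close> by (intro mult_mono) auto
      then show "norm (g z * \<phi> z) \<le> norm ((B * C) * indicator (cball 0 R) z :: real)"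
        using \<open>0 \<le> B\<close> R(2) by (simp add: abs_mult mult.assoc)
    qed
  qed simp
qed

lemma test_field_sum:
  fixes \<phi> :: "'a::euclidean_space \<Rightarrow> real"
  assumes \<phi>: "\<phi> \<in> test_functions" and L: "\<forall>g\<in>fst ` set L. g \<in> borel_measurable lborel \<and> (\<exists>B. \<forall>z. \<bar>g z\<bar> \<le> B)"
  shows "(\<Sum>(c, A)\<leftarrow>test_field L \<phi>. c * y A) = (LINT z|lborel. (\<Sum>(g, A)\<leftarrow>L. g z * y A) * \<phi> z)"
  using L
proof (induction L)
  case (Cons p L)
  obtain g A where p: "p = (g, A)" by (cases p)
  have g: "g \<in> borel_measurable borel" "\<exists>B. \<forall>z. \<bar>g z\<bar> \<le> B" using Cons.prems by (auto simp: p)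
  have i1: "integrable lborel (\<lambda>z. g z * \<phi> z)" by (rule test_function_integrable[OF \<phi> g])
  have i2: "integrable lborel (\<lambda>z. (\<Sum>(g, A)\<leftarrow>L. g z * y A) * \<phi> z)"
    using bounded_sum_list_coeff[of L lborel y] Cons.prems
    by (intro test_function_integrable[OF \<phi>]) auto
  have "(LINT z|lborel. (\<Sum>(g, A)\<leftarrow>p # L. g z * y A) * \<phi> z)
      = (LINT z|lborel. y A * (g z * \<phi> z) + (\<Sum>(g, A)\<leftarrow>L. g z * y A) * \<phi> z)"
    by (simp add: p algebra_simps)
  also have "\<dots> = y A * (LINT z|lborel. g z * \<phi> z) + (LINT z|lborel. (\<Sum>(g, A)\<leftarrow>L. g z * y A) * \<phi> z)"
    using i1 i2 by simp
  finally show ?case using Cons by (simp add: p test_field_def mult.commute)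
qed (simp add: test_field_def)

lemma integral_test_function_ball_bound:
  fixes f \<phi> :: "'a::euclidean_space \<Rightarrow> real"
  assumes f: "integrable (ball_measure R') f" and R: "R \<le> R'"
    and \<phi>m[measurable]: "\<phi> \<in> borel_measurable borel" and fm[measurable]: "f \<in> borel_measurable borel"
    and \<phi>: "\<And>z. \<bar>\<phi> z\<bar> \<le> B * indicator (cball 0 R) z" and B: "0 \<le> B"
  shows "integrable lborel (\<lambda>z. f z * \<phi> z)"
    and "\<bar>LINT z|lborel. f z * \<phi> z\<bar> \<le> B * (LINT z|ball_measure R'. \<bar>f z\<bar>)"
proof -
  have i: "integrable lborel (\<lambda>z. indicator (cball 0 R') z * \<bar>f z\<bar>)"
    using f by (simp add: integrable_ball_measure[symmetric])
  have pt: "\<bar>f z * \<phi> z\<bar> \<le> B * (indicator (cball 0 R') z * \<bar>f z\<bar>)" for z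
  proof -
    have "\<bar>f z * \<phi> z\<bar> \<le> \<bar>f z\<bar> * (B * indicator (cball 0 R) z)"
      unfolding abs_mult by (intro mult_left_mono \<phi>) auto
    also have "\<dots> \<le> \<bar>f z\<bar> * (B * indicator (cball 0 R') z)"
      using R B by (intro mult_left_mono) (auto simp: indicator_def)
    finally show ?thesis by (simp add: mult_ac)
  qed
  show i': "integrable lborel (\<lambda>z. f z * \<phi> z)"
    by (rule Bochner_Integration.integrable_bound[OF integrable_mult_right[OF i, of B]])
       (use pt B in \<open>auto simp: abs_mult\<close>)
  have "\<bar>LINT z|lborel. f z * \<phi> z\<bar> \<le> (LINT z|lborel. \<bar>f z * \<phi> z\<bar>)" by (rule integral_abs_bound)
  also have "\<dots> \<le> (LINT z|lborel. B * (indicator (cball 0 R') z * \<bar>f z\<bar>))"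
    using i i' pt by (intro integral_mono integrable_mult_right integrable_abs) auto
  also have "\<dots> = B * (LINT z|ball_measure R'. \<bar>f z\<bar>)" by (simp add: integral_ball_measure)
  finally show "\<bar>LINT z|lborel. f z * \<phi> z\<bar> \<le> B * (LINT z|ball_measure R'. \<bar>f z\<bar>)" .
qed

context stable_noise
begin

lemma has_stable_integral_cong:
  assumes "\<And>w. w \<in> half_space \<Longrightarrow> f w = g w"
  shows "has_stable_integral M \<alpha> W f X \<longleftrightarrow> has_stable_integral M \<alpha> W g X"
proof -
  have "f \<in> borel_measurable leb_half \<longleftrightarrow> g \<in> borel_measurable leb_half"
    using assms by (intro measurable_cong) (simp add: space_restrict_space)
  moreover have "L_modular \<alpha> f = L_modular \<alpha> g"
    "\<And>cs. L_modular \<alpha> (\<lambda>z. simple_fun cs z - f z) = L_modular \<alpha> (\<lambda>z. simple_fun cs z - g z)"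
    unfolding L_modular_def using assms by (auto intro!: nn_integral_cong simp: space_restrict_space)
  ultimately show ?thesis by (simp add: has_stable_integral_iff L_space_iff)
qed

lemma generalized_process_heat:
  "generalized_process M (generalized_solution M \<alpha> W (heat_kernel :: real \<times> (real ^ 'n) \<Rightarrow> real))"
  unfolding generalized_process_def
proof (intro conjI ballI allI)
  fix \<phi> :: "real \<times> (real ^ 'n) \<Rightarrow> real" assume \<phi>: "\<phi> \<in> test_functions"
  show "generalized_solution M \<alpha> W heat_kernel \<phi> \<in> borel_measurable M"
    using generalized_solution_has_integral[OF \<phi>] by (simp add: has_stable_integral_iff)
  fix \<psi> :: "real \<times> (real ^ 'n) \<Rightarrow> real" and a b assume \<psi>: "\<psi> \<in> test_functions"
  note [measurable] = test_functionD(2)[OF \<phi>] test_functionD(2)[OF \<psi>]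
  let ?\<chi> = "\<lambda>z. a * \<phi> z + b * \<psi> z"
  let ?X = "\<lambda>\<omega>. a * generalized_solution M \<alpha> W heat_kernel \<phi> \<omega> + b * generalized_solution M \<alpha> W heat_kernel \<psi> \<omega>"
  have lin: "a * conv_check \<phi> heat_kernel w + b * conv_check \<psi> heat_kernel w = conv_check ?\<chi> heat_kernel w"
    if "w \<in> half_space" for w
  proof -
    have w: "0 \<le> fst w" using that by (auto simp: half_space_def)
    have "conv_check ?\<chi> heat_kernel w
        = (LINT z|lborel. a * (heat_kernel z * \<phi> (w + z)) + b * (heat_kernel z * \<psi> (w + z)))"
      by (simp add: conv_check_def pairing_def algebra_simps)
    also have "\<dots> = a * conv_check \<phi> heat_kernel w + b * conv_check \<psi> heat_kernel w"
      using conv_check_integrable(1)[OF \<phi> w] conv_check_integrable(1)[OF \<psi> w]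
      by (simp add: conv_check_def pairing_def)
    finally show ?thesis by simp
  qed
  have X: "has_stable_integral M \<alpha> W (conv_check ?\<chi> heat_kernel) ?X"
    using has_stable_integral_linear[OF generalized_solution_has_integral[OF \<phi>] generalized_solution_has_integral[OF \<psi>], of a b]
      has_stable_integral_cong[of "\<lambda>w. a * conv_check \<phi> heat_kernel w + b * conv_check \<psi> heat_kernel w"
        "conv_check ?\<chi> heat_kernel" ?X, OF lin] by simp
  have "has_stable_integral M \<alpha> W (conv_check ?\<chi> heat_kernel) (generalized_solution M \<alpha> W heat_kernel ?\<chi>)"
    unfolding generalized_solution_def[of M \<alpha> W heat_kernel ?\<chi>] stable_integral_def[of M \<alpha> W "conv_check ?\<chi> heat_kernel"]
    by (rule someI[where P="has_stable_integral M \<alpha> W (conv_check ?\<chi> heat_kernel)", OF X])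
  then show "AE \<omega> in M. generalized_solution M \<alpha> W heat_kernel ?\<chi> \<omega> = ?X \<omega>"
    using X by (rule has_stable_integral_unique)
qed

lemma simple_integral_test_field:
  fixes \<phi> :: "real \<times> (real ^ 'n) \<Rightarrow> real"
  assumes \<phi>: "\<phi> \<in> test_functions" and L: "admissible lborel L"
  shows "snd ` set (test_field L \<phi>) \<subseteq> finite_sets"
    and "simple_integral W (test_field L \<phi>) \<omega> = (LINT z|lborel. simple_field W L z \<omega> * \<phi> z)"
    and "simple_fun (test_field L \<phi>) w = (LINT z|lborel. field_kernel L z w * \<phi> z)"
proof -
  have L': "\<forall>g\<in>fst ` set L. g \<in> borel_measurable lborel \<and> (\<exists>B. \<forall>z. \<bar>g z\<bar> \<le> B)"
    using L by (simp add: admissible_def)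
  have "snd ` set (test_field L \<phi>) = snd ` set L" by (force simp: test_field_def)
  then show "snd ` set (test_field L \<phi>) \<subseteq> finite_sets" using L by (simp add: admissible_def)
  show "simple_integral W (test_field L \<phi>) \<omega> = (LINT z|lborel. simple_field W L z \<omega> * \<phi> z)"
    unfolding simple_integral_def simple_field_eq by (rule test_field_sum[OF \<phi> L'])
  show "simple_fun (test_field L \<phi>) w = (LINT z|lborel. field_kernel L z w * \<phi> z)"
    unfolding simple_fun_def field_kernel_eq by (rule test_field_sum[OF \<phi> L'])
qed

lemma test_field_L_modular:
  fixes \<phi> :: "real \<times> (real ^ 'n) \<Rightarrow> real"
  assumes \<phi>: "\<phi> \<in> test_functions" and L: "admissible lborel L"
    and q: "1 \<le> q" "q < 1 + 2 / real CARD('n)" and R: "0 < R" "R \<le> R'" and B: "0 \<le> B"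
    and supp: "\<And>z. \<bar>\<phi> z\<bar> \<le> B * indicator (cball 0 R) z"
  shows "L_modular \<alpha> (\<lambda>w. simple_fun (test_field L \<phi>) w - conv_check \<phi> heat_kernel w)
    \<le> ennreal ((B * (measure (ball_measure R :: (real \<times> (real ^ 'n)) measure) (space (ball_measure R)) + 1)) powr \<alpha>) *
      mixed_modular (ball_measure R') \<alpha> q (\<lambda>z w. field_kernel L z w - heat_kernel (z - w))"
proof -
  note [measurable] = test_functionD(2)[OF \<phi>]
  have R': "0 < R'" using R by simp
  define V where "V = measure (ball_measure R :: (real \<times> (real ^ 'n)) measure) (space (ball_measure R))"
  have V: "0 \<le> V" by (simp add: V_def)
  let ?I = "\<lambda>R w. LINT z|ball_measure R. \<bar>field_kernel L z w - heat_kernel (z - w)\<bar> powr q"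
  have fk: "(\<lambda>z. field_kernel L z w) \<in> borel_measurable borel" "\<exists>B. \<forall>z. \<bar>field_kernel L z w\<bar> \<le> B" for w
    unfolding field_kernel_eq using admissible_coeff[OF L] by auto
  have pt: "\<bar>simple_fun (test_field L \<phi>) w - conv_check \<phi> heat_kernel w\<bar> powr \<alpha> \<le> (B * (V + 1)) powr \<alpha> * ?I R' w powr (\<alpha> / q)"
    if w: "w \<in> half_space" for w
  proof -
    have w0: "0 \<le> fst w" using w by (auto simp: half_space_def)
    note [measurable] = fk(1)[of w]
    let ?f = "\<lambda>z. field_kernel L z w - heat_kernel (z - w)"
    have "simple_fun (test_field L \<phi>) w - conv_check \<phi> heat_kernel w
        = (LINT z|lborel. field_kernel L z w * \<phi> z) - (LINT z|lborel. heat_kernel (z - w) * \<phi> z)"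
      by (simp add: simple_integral_test_field(3)[OF \<phi> L] conv_check_eq(1))
    also have "\<dots> = (LINT z|lborel. ?f z * \<phi> z)"
      using test_function_integrable[OF \<phi> fk] conv_check_integrable(2)[OF \<phi> w0]
      by (subst Bochner_Integration.integral_diff[symmetric]) (auto simp: left_diff_distrib)
    finally have eq: "simple_fun (test_field L \<phi>) w - conv_check \<phi> heat_kernel w = (LINT z|lborel. ?f z * \<phi> z)" .
    note iq = kernel_difference(2)[OF L q R(1) w]
    note L1 = L1_le_Lq[OF finite_measure_ball_measure kernel_difference(3)[OF L q R(1)] iq q(1)]
    have "\<bar>LINT z|lborel. ?f z * \<phi> z\<bar> \<le> B * (LINT z|ball_measure R. \<bar>?f z\<bar>)"
      by (rule integral_test_function_ball_bound(2)[OF L1(1) order_refl _ _ supp B]) measurable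
    also have "\<dots> \<le> B * ((V + 1) * ?I R w powr (1 / q))"
      using L1(2) B by (intro mult_left_mono) (auto simp: V_def)
    also have "\<dots> \<le> B * ((V + 1) * ?I R' w powr (1 / q))"
    proof -
      have "?I R w \<le> ?I R' w"
        using kernel_difference(2)[OF L q R' w] R(2) by (intro ball_measure_mono(2)) auto
      then show ?thesis using B V q by (intro mult_left_mono powr_mono2) (auto intro!: integral_nonneg_AE)
    qed
    finally have "\<bar>simple_fun (test_field L \<phi>) w - conv_check \<phi> heat_kernel w\<bar> powr \<alpha>
        \<le> (B * ((V + 1) * ?I R' w powr (1 / q))) powr \<alpha>"
      unfolding eq using \<alpha>_pos by (intro powr_mono2) auto
    also have "\<dots> = ((B * (V + 1)) * ?I R' w powr (1 / q)) powr \<alpha>" by (simp only: mult.assoc)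
    also have "\<dots> = (B * (V + 1)) powr \<alpha> * (?I R' w powr (1 / q)) powr \<alpha>" by (simp only: powr_mult)
    also have "(?I R' w powr (1 / q)) powr \<alpha> = ?I R' w powr (\<alpha> / q)" by (simp add: powr_powr)
    finally show ?thesis .
  qed
  have [measurable]: "?I R' \<in> borel_measurable leb_half" by (rule kernel_difference(1)[OF L q R'])
  have "L_modular \<alpha> (\<lambda>w. simple_fun (test_field L \<phi>) w - conv_check \<phi> heat_kernel w)
      \<le> (\<integral>\<^sup>+w. ennreal ((B * (V + 1)) powr \<alpha>) * ennreal (?I R' w powr (\<alpha> / q)) \<partial>leb_half)"
    unfolding L_modular_def
  proof (intro nn_integral_mono)
    fix w :: "real \<times> (real ^ 'n)" assume "w \<in> space leb_half"
    then have "w \<in> half_space" by (simp add: space_restrict_space)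
    from ennreal_leI[OF pt[OF this]]
    show "ennreal (\<bar>simple_fun (test_field L \<phi>) w - conv_check \<phi> heat_kernel w\<bar> powr \<alpha>)
        \<le> ennreal ((B * (V + 1)) powr \<alpha>) * ennreal (?I R' w powr (\<alpha> / q))"
      by (simp add: ennreal_mult)
  qed
  also have "\<dots> = ennreal ((B * (V + 1)) powr \<alpha>) * mixed_modular (ball_measure R') \<alpha> q (\<lambda>z w. field_kernel L z w - heat_kernel (z - w))"
    unfolding mixed_modular_def by (rule nn_integral_cmult) measurable
  finally show ?thesis by (simp add: V_def)
qed

lemma mixed_modular_ball_mono:
  fixes L :: "((real \<times> (real ^ 'n) \<Rightarrow> real) \<times> (real \<times> (real ^ 'n)) set) list"
  assumes L: "admissible lborel L" and q: "1 \<le> q" "q < 1 + 2 / real CARD('n)" and R: "0 < R" "R \<le> R'"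
  shows "mixed_modular (ball_measure R) \<alpha> q (\<lambda>z w. field_kernel L z w - heat_kernel (z - w))
    \<le> mixed_modular (ball_measure R') \<alpha> q (\<lambda>z w. field_kernel L z w - heat_kernel (z - w))"
  unfolding mixed_modular_def
proof (intro nn_integral_mono ennreal_leI)
  fix w :: "real \<times> (real ^ 'n)" assume "w \<in> space leb_half"
  then have w: "w \<in> half_space" by (simp add: space_restrict_space)
  have [measurable]: "(\<lambda>z. field_kernel L z w) \<in> borel_measurable borel"
    unfolding field_kernel_eq using admissible_coeff(1)[OF L] by simp
  have "(LINT z|ball_measure R. \<bar>field_kernel L z w - heat_kernel (z - w)\<bar> powr q)
      \<le> (LINT z|ball_measure R'. \<bar>field_kernel L z w - heat_kernel (z - w)\<bar> powr q)"
    using R by (intro ball_measure_mono(2) kernel_difference(2)[OF L q _ w]) auto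
  then show "(LINT z|ball_measure R. \<bar>field_kernel L z w - heat_kernel (z - w)\<bar> powr q) powr (\<alpha> / q)
      \<le> (LINT z|ball_measure R'. \<bar>field_kernel L z w - heat_kernel (z - w)\<bar> powr q) powr (\<alpha> / q)"
    using \<alpha>_pos q by (intro powr_mono2) (auto intro!: integral_nonneg_AE)
qed

lemma representation_exists:
  assumes sub: "\<alpha> < 1 + 2 / real CARD('n)"
  shows "\<exists>Y. random_field_representation M
    (generalized_solution M \<alpha> W (heat_kernel :: real \<times> (real ^ 'n) \<Rightarrow> real)) Y"
proof -
  have "max 1 \<alpha> < min 2 (1 + 2 / real CARD('n))" using sub \<alpha>_less by simp
  then obtain q where "max 1 \<alpha> < q" "q < min 2 (1 + 2 / real CARD('n))" using dense by blast
  then have q: "1 \<le> q" "q < 1 + 2 / real CARD('n)" "\<alpha> < q" "q \<le> 2" and q0: "0 < q" by auto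
  define \<mu> where "\<mu> n = (ball_measure (real (Suc n)) :: (real \<times> (real ^ 'n)) measure)" for n
  have fin: "finite_measure (\<mu> n)" for n unfolding \<mu>_def by (rule finite_measure_ball_measure)
  define mm where "mm n L = mixed_modular (\<mu> n) \<alpha> q (\<lambda>z w. field_kernel L z w - heat_kernel (z - w))"
    for n and L :: "((real \<times> (real ^ 'n) \<Rightarrow> real) \<times> (real \<times> (real ^ 'n)) set) list"
  have "\<exists>\<eta>>0. \<forall>L. admissible (\<mu> n) L \<longrightarrow> mixed_modular (\<mu> n) \<alpha> q (field_kernel L) < ennreal \<eta> \<longrightarrow>
    prob_dist M (field_norm (\<mu> n) L) < ennreal ((1/2) ^ n)" for n
    by (rule field_norm_small[OF fin q(1,3,4)]) simp
  then obtain \<eta> where \<eta>: "\<And>n. 0 < \<eta> n" "\<And>n L. admissible (\<mu> n) L \<Longrightarrow>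
      mixed_modular (\<mu> n) \<alpha> q (field_kernel L) < ennreal (\<eta> n) \<Longrightarrow> prob_dist M (field_norm (\<mu> n) L) < ennreal ((1/2) ^ n)"
    by metis
  define c where "c = mixed_const \<alpha> q"
  have c: "0 < c" unfolding c_def by (rule mixed_const_pos)
  obtain \<epsilon> where \<epsilon>: "\<And>n. 0 < \<epsilon> n" "\<And>n. \<epsilon> n \<le> \<eta> n / (2 * c)" "decseq \<epsilon>" "\<epsilon> \<longlonglongrightarrow> 0"
    using decreasing_null_sequence[of "\<lambda>n. \<eta> n / (2 * c)"] \<eta>(1) c by auto
  have "\<exists>L. admissible lborel L \<and> mm n L < ennreal (\<epsilon> n)" for n
    unfolding mm_def \<mu>_def by (rule heat_kernel_approx[OF q(1,2) \<alpha>_pos _ \<epsilon>(1)]) simp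
  then obtain L where L: "\<And>n. admissible lborel (L n)" "\<And>n. mm n (L n) < ennreal (\<epsilon> n)" by metis
  have mm_mono: "mm j (L n) \<le> mm k (L n)" if "j \<le> k" for j k n
    unfolding mm_def \<mu>_def using that by (intro mixed_modular_ball_mono[OF L(1) q(1,2)]) auto
  define E where "E n = L (Suc n) @ negate_field (L n)" for n
  have E: "admissible lborel (E n)" for n unfolding E_def by (intro admissible_append_negate L(1))
  have E\<mu>: "admissible (\<mu> n) (E k)" for n k unfolding \<mu>_def by (intro admissible_ball_measure E)
  define D where "D n = field_norm (\<mu> n) (E n)" for n
  have D_meas[measurable]: "D n \<in> borel_measurable M" for n
    unfolding D_def by (rule field_norm_measurable[OF fin E\<mu>])
  have D_small: "prob_dist M (D n) \<le> ennreal ((1/2) ^ n)" for n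
  proof -
    have pos: "(0::real) < real (Suc n)" by simp
    have "mixed_modular (\<mu> n) \<alpha> q (field_kernel (E n))
        = mixed_modular (\<mu> n) \<alpha> q (\<lambda>z w. field_kernel (L (Suc n)) z w - field_kernel (L n) z w)"
      by (simp add: mixed_modular_def E_def field_kernel_append_negate)
    also have "\<dots> \<le> ennreal c * (mm n (L (Suc n)) + mm n (L n))"
      unfolding mm_def c_def \<mu>_def
      by (rule mixed_modular_diff_triangle[OF q0 \<alpha>_pos kernel_difference(2)[OF L(1) q(1,2) pos]
          kernel_difference(2)[OF L(1) q(1,2) pos] kernel_difference(1)[OF L(1) q(1,2) pos]
          kernel_difference(1)[OF L(1) q(1,2) pos]])
    also have "\<dots> < ennreal c * (ennreal (\<epsilon> n) + ennreal (\<epsilon> n))"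
    proof -
      have "mm n (L (Suc n)) \<le> mm (Suc n) (L (Suc n))" by (rule mm_mono) simp
      also have "\<dots> < ennreal (\<epsilon> (Suc n))" by (rule L(2))
      also have "\<dots> \<le> ennreal (\<epsilon> n)" using \<epsilon>(3) by (intro ennreal_leI) (simp add: decseq_Suc_iff)
      finally show ?thesis
        using c L(2)[of n] by (intro ennreal_mult_strict_left_mono add_strict_mono) auto
    qed
    also have "\<dots> \<le> ennreal (\<eta> n)"
    proof -
      have "c * (\<epsilon> n + \<epsilon> n) \<le> \<eta> n" using \<epsilon>(2)[of n] c by (simp add: field_simps)
      then show ?thesis using c \<epsilon>(1)[of n]
        by (simp add: ennreal_mult[symmetric] ennreal_plus[symmetric] ennreal_leI less_imp_le del: ennreal_plus)
    qed
    finally show ?thesis unfolding D_def using \<eta>(2)[OF E\<mu>, of n n] by simp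
  qed
  have "(\<Sum>n. prob_dist M (D n)) \<le> (\<Sum>n. ennreal ((1/2) ^ n))"
    by (intro suminf_le D_small) auto
  also have "\<dots> = ennreal 2"
    using power_half_series geometric_sums[of "1/2 :: real"] by (intro suminf_ennreal_eq) auto
  also have "\<dots> < \<infinity>" by simp
  finally have ae_sum: "AE \<omega> in M. summable (\<lambda>n. \<bar>D n \<omega>\<bar>)"
    by (intro AE_summable_of_prob_dist) auto
  define U where "U n z = simple_field W (L n) z" for n z
  have U_meas[measurable]: "(\<lambda>(z, \<omega>). U n z \<omega>) \<in> borel_measurable (borel \<Otimes>\<^sub>M M)" for n
    unfolding U_def using simple_field_measurable[OF L(1)[of n]] by (simp cong: measurable_cong_sets)
  define Y where "Y z \<omega> = lim (\<lambda>n. U n z \<omega>)" for z \<omega>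
  have Y_meas[measurable]: "(\<lambda>(z, \<omega>). Y z \<omega>) \<in> borel_measurable (borel \<Otimes>\<^sub>M M)"
    unfolding Y_def split_beta' by (rule borel_measurable_lim_metric) (use U_meas in \<open>simp add: split_beta'\<close>)
  have U_z: "(\<lambda>z. U n z \<omega>) \<in> borel_measurable borel" for n \<omega>
    unfolding U_def simple_field_eq using admissible_coeff(1)[OF L(1)] by simp
  have Y_z: "(\<lambda>z. Y z \<omega>) \<in> borel_measurable borel" for \<omega>
    unfolding Y_def by (rule borel_measurable_lim_metric) (rule U_z)
  have U_int: "integrable (\<mu> j) (\<lambda>z. U n z \<omega>)" for j n \<omega>
    unfolding U_def \<mu>_def by (intro simple_field_integrable(2) finite_measure_ball_measure admissible_ball_measure L(1))
  have lim: "integrable (\<mu> j) (\<lambda>z. Y z \<omega>) \<and> (\<lambda>n. LINT z|\<mu> j. \<bar>U n z \<omega> - Y z \<omega>\<bar>) \<longlonglongrightarrow> 0"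
    if s: "summable (\<lambda>n. \<bar>D n \<omega>\<bar>)" for \<omega> j
  proof -
    have le: "(LINT z|\<mu> j. \<bar>U (Suc n) z \<omega> - U n z \<omega>\<bar>) \<le> \<bar>D n \<omega>\<bar>" if "j \<le> n" for n
    proof -
      have "integrable (\<mu> n) (\<lambda>z. \<bar>U (Suc n) z \<omega> - U n z \<omega>\<bar>)"
        using U_int by (intro integrable_abs Bochner_Integration.integrable_diff) auto
      then have "(LINT z|\<mu> j. \<bar>U (Suc n) z \<omega> - U n z \<omega>\<bar>) \<le> (LINT z|\<mu> n. \<bar>U (Suc n) z \<omega> - U n z \<omega>\<bar>)"
        unfolding \<mu>_def using that U_z by (intro ball_measure_mono(2)) auto
      also have "\<dots> = D n \<omega>"
        by (simp add: D_def field_norm_def E_def simple_field_append_negate U_def)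
      finally show ?thesis by simp
    qed
    show ?thesis
      using L1_telescope_limit[of "\<mu> j" "\<lambda>n z. U n z \<omega>" "\<lambda>n. \<bar>D n \<omega>\<bar>" j "\<lambda>z. Y z \<omega>"] U_int s le
      by (simp add: Y_def)
  qed
  have loc: "AE \<omega> in M. \<forall>K. compact K \<longrightarrow> set_integrable lborel K (\<lambda>z. Y z \<omega>)"
    using ae_sum
  proof eventually_elim
    case (elim \<omega>)
    show ?case
    proof (intro allI impI)
      fix K :: "(real \<times> (real ^ 'n)) set" assume K: "compact K"
      then obtain R where R: "\<And>z. z \<in> K \<Longrightarrow> norm z \<le> R" using compact_imp_bounded by (meson bounded_iff)
      obtain j :: nat where j: "R \<le> real j" using real_arch_simple by blast
      have "integrable lborel (\<lambda>z. indicator (cball 0 (real (Suc j))) z * Y z \<omega>)"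
        using lim[OF elim, of j] by (simp add: \<mu>_def integrable_ball_measure)
      then have "set_integrable lborel (cball 0 (real (Suc j))) (\<lambda>z. Y z \<omega>)" by (simp add: set_integrable_def)
      moreover have "K \<subseteq> cball 0 (real (Suc j))"
      proof
        fix z assume "z \<in> K"
        with R[of z] j show "z \<in> cball 0 (real (Suc j))" by simp
      qed
      moreover have "K \<in> sets lborel" using borel_closed[OF compact_imp_closed[OF K]] by simp
      ultimately show "set_integrable lborel K (\<lambda>z. Y z \<omega>)" by (metis set_integrable_subset)
    qed
  qed
  have rep: "AE \<omega> in M. generalized_solution M \<alpha> W heat_kernel \<phi> \<omega> = (LINT z|lborel. Y z \<omega> * \<phi> z)"
    if \<phi>: "\<phi> \<in> test_functions" for \<phi> :: "real \<times> (real ^ 'n) \<Rightarrow> real"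
  proof -
    note \<phi>m[measurable] = test_functionD(2)[OF \<phi>]
    obtain R B where R: "0 < R" "0 \<le> B" "\<And>z. \<bar>\<phi> z\<bar> \<le> B * indicator (cball 0 R) z"
      using test_functionD(3)[OF \<phi>] by blast
    obtain j :: nat where j: "R \<le> real j" using real_arch_simple by blast
    define X where "X \<omega> = (LINT z|lborel. Y z \<omega> * \<phi> z)" for \<omega>
    have X_meas[measurable]: "X \<in> borel_measurable M"
    proof -
      have "(\<lambda>p. (snd p, fst p)) \<in> measurable (M \<Otimes>\<^sub>M borel) (borel \<Otimes>\<^sub>M M)" by measurable
      from measurable_compose[OF this Y_meas]
      have [measurable]: "(\<lambda>(\<omega>, z). Y z \<omega>) \<in> borel_measurable (M \<Otimes>\<^sub>M borel)" by (simp add: split_beta')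
      have "(\<lambda>(\<omega>, z). Y z \<omega> * \<phi> z) \<in> borel_measurable (M \<Otimes>\<^sub>M borel)" by measurable
      then have "(\<lambda>(\<omega>, z). Y z \<omega> * \<phi> z) \<in> borel_measurable (M \<Otimes>\<^sub>M lborel)" by (simp cong: measurable_cong_sets)
      then show ?thesis unfolding X_def[abs_def] by (rule lborel.borel_measurable_lebesgue_integral)
    qed
    have "has_stable_integral M \<alpha> W (conv_check \<phi> heat_kernel) X"
      unfolding has_stable_integral_iff
    proof (intro conjI exI[of _ "\<lambda>n. test_field (L n) \<phi>"] allI)
      show "conv_check \<phi> heat_kernel \<in> L_space \<alpha>"
        using generalized_solution_exists_heat[OF \<alpha>_pos, where 'n='n] \<phi> by (simp add: generalized_solution_exists_def)
      show "snd ` set (test_field (L n) \<phi>) \<subseteq> finite_sets" for n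
        by (rule simple_integral_test_field(1)[OF \<phi> L(1)])
      show "(\<lambda>n. prob_dist M (\<lambda>\<omega>. simple_integral W (test_field (L n) \<phi>) \<omega> - X \<omega>)) \<longlonglongrightarrow> 0"
      proof (rule prob_dist_tendsto_AE)
        show "(\<lambda>\<omega>. simple_integral W (test_field (L n) \<phi>) \<omega> - X \<omega>) \<in> borel_measurable M" for n
          using simple_integral_measurable[OF simple_integral_test_field(1)[OF \<phi> L(1)], of n] by measurable
        show "AE \<omega> in M. (\<lambda>n. simple_integral W (test_field (L n) \<phi>) \<omega> - X \<omega>) \<longlonglongrightarrow> 0"
          using ae_sum
        proof eventually_elim
          case (elim \<omega>)
          have Yi: "integrable (\<mu> j) (\<lambda>z. Y z \<omega>)" and t: "(\<lambda>n. LINT z|\<mu> j. \<bar>U n z \<omega> - Y z \<omega>\<bar>) \<longlonglongrightarrow> 0"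
            using lim[OF elim] by auto
          have Rj: "R \<le> real (Suc j)" using j by simp
          have bound: "\<bar>simple_integral W (test_field (L n) \<phi>) \<omega> - X \<omega>\<bar> \<le> B * (LINT z|\<mu> j. \<bar>U n z \<omega> - Y z \<omega>\<bar>)" for n
          proof -
            have iU: "integrable lborel (\<lambda>z. U n z \<omega> * \<phi> z)"
              by (rule integral_test_function_ball_bound(1)[OF U_int[unfolded \<mu>_def] Rj \<phi>m U_z R(3) R(2)])
            have iY: "integrable lborel (\<lambda>z. Y z \<omega> * \<phi> z)"
              by (rule integral_test_function_ball_bound(1)[OF Yi[unfolded \<mu>_def] Rj \<phi>m Y_z R(3) R(2)])
            have iD: "integrable (\<mu> j) (\<lambda>z. U n z \<omega> - Y z \<omega>)"
              using U_int Yi by (intro Bochner_Integration.integrable_diff)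
            have mD: "(\<lambda>z. U n z \<omega> - Y z \<omega>) \<in> borel_measurable borel"
              using U_z Y_z by (intro borel_measurable_diff)
            have "simple_integral W (test_field (L n) \<phi>) \<omega> - X \<omega> = (LINT z|lborel. (U n z \<omega> - Y z \<omega>) * \<phi> z)"
              using iU iY by (simp add: X_def simple_integral_test_field(2)[OF \<phi> L(1)] U_def left_diff_distrib)
            then show ?thesis
              using integral_test_function_ball_bound(2)[OF iD[unfolded \<mu>_def] Rj \<phi>m mD R(3) R(2)] by (simp add: \<mu>_def)
          qed
          have t0: "(\<lambda>n. B * (LINT z|\<mu> j. \<bar>U n z \<omega> - Y z \<omega>\<bar>)) \<longlonglongrightarrow> 0"
            using tendsto_mult_left[OF t, of B] by simp
          show ?case
            by (rule Lim_null_comparison[OF _ t0]) (use bound in simp)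
        qed
      qed (rule prob_space_axioms)
      define K where "K = (B * (measure (ball_measure R :: (real \<times> (real ^ 'n)) measure) (space (ball_measure R)) + 1)) powr \<alpha>"
      show "(\<lambda>n. L_modular \<alpha> (\<lambda>w. simple_fun (test_field (L n) \<phi>) w - conv_check \<phi> heat_kernel w)) \<longlonglongrightarrow> 0"
      proof (rule tendsto_sandwich[OF _ _ tendsto_const])
        show "eventually (\<lambda>n. L_modular \<alpha> (\<lambda>w. simple_fun (test_field (L n) \<phi>) w - conv_check \<phi> heat_kernel w)
            \<le> ennreal K * ennreal (\<epsilon> n)) sequentially"
          unfolding eventually_sequentially
        proof (intro exI[of _ j] allI impI)
          fix n assume "j \<le> n"
          then have Rn: "R \<le> real (Suc n)" using j by simp
          have "L_modular \<alpha> (\<lambda>w. simple_fun (test_field (L n) \<phi>) w - conv_check \<phi> heat_kernel w) \<le> ennreal K * mm n (L n)"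
            unfolding K_def mm_def \<mu>_def
            by (rule test_field_L_modular[OF \<phi> L(1) q(1,2) R(1) Rn R(2) R(3)])
          also have "\<dots> \<le> ennreal K * ennreal (\<epsilon> n)" using L(2)[of n] by (intro mult_left_mono) auto
          finally show "L_modular \<alpha> (\<lambda>w. simple_fun (test_field (L n) \<phi>) w - conv_check \<phi> heat_kernel w)
            \<le> ennreal K * ennreal (\<epsilon> n)" .
        qed
        have "(\<lambda>n. ennreal (\<epsilon> n)) \<longlonglongrightarrow> 0" using tendsto_ennrealI[OF \<epsilon>(4)] by simp
        then have "(\<lambda>n. ennreal K * ennreal (\<epsilon> n)) \<longlonglongrightarrow> ennreal K * 0"
          by (intro ennreal_tendsto_cmult) auto
        then show "(\<lambda>n. ennreal K * ennreal (\<epsilon> n)) \<longlonglongrightarrow> 0" by simp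
      qed auto
    qed (rule X_meas)
    from has_stable_integral_unique[OF generalized_solution_has_integral[OF \<phi>] this]
    show ?thesis by (simp add: X_def)
  qed
  show ?thesis
    unfolding random_field_representation_def using generalized_process_heat Y_meas loc rep by blast
qed

lemma representation_subcritical:
  assumes Y: "random_field_representation M
    (generalized_solution M \<alpha> W (heat_kernel :: real \<times> (real ^ 'n) \<Rightarrow> real)) Y"
  shows "\<alpha> < 1 + 2 / real CARD('n)"
proof -
  have ae: "AE z in (lborel :: (real \<times> (real ^ 'n)) measure). heat_shift z \<in> L_space \<alpha>"
    using representation_has_integral[OF Y] by eventually_elim (simp add: has_stable_integral_iff)
  have "\<exists>z :: real \<times> (real ^ 'n). 0 < fst z \<and> heat_shift z \<in> L_space \<alpha>"
  proof (rule ccontr)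
    assume "\<not> ?thesis"
    then have "AE z in lborel. z \<notin> {z :: real \<times> (real ^ 'n). 0 < fst z}"
      using ae by auto
    moreover have op: "open {z :: real \<times> (real ^ 'n). 0 < fst z}" by (intro open_Collect_less continuous_intros)
    ultimately have "{z :: real \<times> (real ^ 'n). 0 < fst z} \<in> null_sets lborel"
      by (subst AE_iff_null_sets) auto
    then have "negligible {z :: real \<times> (real ^ 'n). 0 < fst z}"
      by (simp add: negligible_iff_null_sets null_sets_completionI)
    moreover have "(1, 0) \<in> {z :: real \<times> (real ^ 'n). 0 < fst z}" by simp
    ultimately show False using open_not_negligible[OF op] by blast
  qed
  then obtain t and x :: "real ^ 'n" where "0 < t" "heat_shift (t, x) \<in> L_space \<alpha>" by auto
  then show ?thesis using heat_shift_not_L_space[OF \<alpha>_pos] by blast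
qed

end

lemma mild_solution_exists_heat_iff:
  assumes "0 < \<alpha>"
  shows "mild_solution_exists \<alpha> (heat_kernel :: real \<times> (real ^ 'n::finite) \<Rightarrow> real) \<longleftrightarrow> \<alpha> < 1 + 2 / real CARD('n)"
proof
  assume "mild_solution_exists \<alpha> (heat_kernel :: real \<times> (real ^ 'n) \<Rightarrow> real)"
  then have "heat_shift (1, 0 :: real ^ 'n) \<in> L_space \<alpha>"
    unfolding mild_solution_exists_def heat_shift_eq by blast
  from heat_shift_not_L_space[OF assms this] show "\<alpha> < 1 + 2 / real CARD('n)" by simp
next
  assume "\<alpha> < 1 + 2 / real CARD('n)"
  then show "mild_solution_exists \<alpha> (heat_kernel :: real \<times> (real ^ 'n) \<Rightarrow> real)"
    unfolding mild_solution_exists_def heat_shift_eq[symmetric] using heat_shift_L_space[OF assms] by blast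
qed

theorem theorem6p6:
  fixes M :: "'w measure"
    and W :: "(real \<times> (real ^ 'n::finite)) set \<Rightarrow> 'w \<Rightarrow> real"
    and \<alpha> :: real
  assumes "0 < \<alpha>" and "\<alpha> < 2"
    and "stable_white_noise M \<alpha> W"
  shows "generalized_solution_exists \<alpha> (heat_kernel :: real \<times> (real ^ 'n) \<Rightarrow> real)
    \<and> (mild_solution_exists \<alpha> (heat_kernel :: real \<times> (real ^ 'n) \<Rightarrow> real)
         \<longleftrightarrow> \<alpha> < 1 + 2 / real CARD('n))
    \<and> ((\<exists>Y. random_field_representation M (generalized_solution M \<alpha> W heat_kernel) Y)
         \<longleftrightarrow> \<alpha> < 1 + 2 / real CARD('n))
    \<and> (\<alpha> < 1 + 2 / real CARD('n) \<longrightarrow>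
        (\<forall>Y. random_field_representation M (generalized_solution M \<alpha> W heat_kernel) Y \<longrightarrow>
          (AE (t, x) in leb_half. AE \<omega> in M.
             Y (t, x) \<omega> = stable_integral M \<alpha> W (\<lambda>(s, y). heat_kernel (t - s, x - y)) \<omega> \<and>
             Y (t, x) \<omega> = mild_solution M \<alpha> W heat_kernel (t, x) \<omega>)))"
proof -
  interpret stable_noise M \<alpha> W using assms by unfold_locales
  have "AE (t, x) in leb_half. AE \<omega> in M.
      Y (t, x) \<omega> = stable_integral M \<alpha> W (\<lambda>(s, y). heat_kernel (t - s, x - y)) \<omega> \<and>
      Y (t, x) \<omega> = mild_solution M \<alpha> W heat_kernel (t, x) \<omega>"
    if Y: "random_field_representation M (generalized_solution M \<alpha> W heat_kernel) Y" for Y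
  proof -
    have "AE z in lborel. AE \<omega> in M. Y z \<omega> = stable_integral M \<alpha> W (heat_shift z) \<omega>"
      using representation_has_integral[OF Y]
    proof eventually_elim
      case (elim z)
      then have "has_stable_integral M \<alpha> W (heat_shift z) (stable_integral M \<alpha> W (heat_shift z))"
        by (intro stable_integral) (simp add: has_stable_integral_iff)
      with elim show ?case by (rule has_stable_integral_unique)
    qed
    then have "AE z in leb_half. AE \<omega> in M. Y z \<omega> = stable_integral M \<alpha> W (heat_shift z) \<omega>"
      by (subst AE_restrict_space_iff) auto
    then show ?thesis
      by eventually_elim (auto simp: heat_shift_eq mild_solution_def)
  qed
  then show ?thesis
    using generalized_solution_exists_heat[OF assms(1), where 'n='n] mild_solution_exists_heat_iff[OF assms(1), where 'n='n]
      representation_exists representation_subcritical by blast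
qed

end
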